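(* A function between list types is a quantifier-free interpretation if and only if it can be derived from the following prime functions (each a family ranging over all list types $\Gamma,\Sigma,\Delta,\Gamma_1,\Gamma_2$) $\Gamma\times\Sigma \leftrightarrow \Sigma\times\Gamma$ (commutativity of $\times$), $\Gamma+\Sigma \leftrightarrow \Sigma+\Gamma$ (commutativity of $+$), $\Gamma\times(\Sigma\times\Delta)\leftrightarrow(\Gamma\times\Sigma)\times\Delta$, $\Gamma+(\Sigma+\Delta)\leftrightarrow(\Gamma+\Sigma)+\Delta$ (associativity), $\Gamma\times(\Sigma+\Delta)\leftrightarrow(\Gamma\times\Sigma)+(\Gamma\times\Delta)$ (distributivity), projections $\Gamma_1\times\Gamma_2\to\Gamma_i$, co-projections $\Gamma_i\to\Gamma_1+\Gamma_2$, co-diagonal $\Gamma+\Gamma\to\Gamma$, append $\Sigma^*\times\Sigma\to\Sigma^*$ ($([a_1,\ldots,a_n],a)\mapsto[a_1,\ldots,a_n,a]$), reverse $\Sigma^*\to\Sigma^*$, concat $\Sigma^{**}\to\Sigma^*$ (flattening a list of lists), create empty $\Sigma\to\Sigma\times\Gamma^*$ ($x\mapsto(x,[\,])$), list distribute $(\Sigma\times\Gamma)^*\to\Sigma^*\times\Gamma^*$ ($[(a_1,b_1),\ldots,(a_n,b_n)]\mapsto([a_1,\ldots,a_n],[b_1,\ldots,b_n])$), by applying the combinators: function composition (from $\Gamma\to\Sigma$ and $\Sigma\to\Delta$ obtain $\Gamma\to\Delta$), functoriality of $\times$ (from $f_1:\Gamma_1\to\Sigma_1$, $f_2:\Gamma_2\to\Sigma_2$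 obtain $f_1\times f_2 : \Gamma_1\times\Gamma_2\to\Sigma_1\times\Sigma_2$), functoriality of $+$ (from $f_1,f_2$ as before obtain $f_1+f_2:\Gamma_1+\Gamma_2\to\Sigma_1+\Sigma_2$), and functoriality of $*$ (from $f:\Gamma\to\Sigma$ obtain $\Gamma^*\to\Sigma^*$, applying $f$ to every list element).
   Context: List types are the types generated by: $1$ (a one-element type), $\Sigma_1\times\Sigma_2$ (pairs), $\Sigma_1+\Sigma_2$ (tagged disjoint union), and $\Sigma^*$ (lists). Each list type is identified with a class of structures: $1$ is the class with one structure, having one element and no relations; $\Sigma_1+\Sigma_2$ has as vocabulary the disjoint union of the vocabularies plus a new nullary relation; a structure is a structure of $\Sigma_1$ or of $\Sigma_2$, with the other vocabulary interpreted as empty, and the nullary relation true or false according to which side is used; $\Sigma_1\times\Sigma_2$ has the disjoint union of the vocabularies plus a new unary relation; a structure is the disjoint union of a structure of $\Sigma_1$ and one of $\Sigma_2$, the unary relation selecting the elements from the first; $\Sigma^*$ consists of structures obtained from a list $[A_1,\ldots,A_n]$ of nonempty structures of $\Sigma$ by taking their disjoint union, adding a binary relation $x\le y$ holding iff the list item of $x$ appears no later than that of $y$, and replacing every nullary relation $R()$ of $\Sigma$ by a unary relation $R(x)$ selecting elements whose item satisfies $R()$. A quantifier-free interpretation $f:\Sigma\to\Gamma$ is given by: a quantifier-free formula $\varphi(x)$ over the input vocabulary such that the universe of $f(A)$ is the set of elements of $A$ satisfying $\varphi$, and, for each output relation name of arity $m$, a quantifier-free formula with $m$ free variables over the input vocabulary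 defining that relation on the output universe. *)

theory Defs
  imports Main "HOL-Library.Infinite_Typeclass"
begin

section \<open>List types and their vocabularies\<close>

datatype list_type =
    Unit
  | Prod list_type list_type  (infixr "\<otimes>" 70)
  | Sum list_type list_type   (infixr "\<oplus>" 65)
  | Lists list_type

text \<open>
  Relation names. A name of a composite type is a name of a component type tagged by the position
  of that component (so that vocabularies of components become disjoint), or one of the new names:
  \<open>InFirst\<close> (unary, products), \<open>IsLeft\<close> (nullary, sums) and \<open>Leq\<close> (binary, lists).
\<close>

datatype rel_name =
    ProdL rel_name | ProdR rel_name | InFirst
  | SumL rel_name | SumR rel_name | IsLeft
  | Item rel_name | Leq

fun arity :: "rel_name \<Rightarrow> nat" where
  "arity (ProdL R) = arity R"
| "arity (ProdR R) = arity R"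
| "arity InFirst = 1"
| "arity (SumL R) = arity R"
| "arity (SumR R) = arity R"
| "arity IsLeft = 0"
| "arity (Item R) = (if arity R = 0 then 1 else arity R)"
| "arity Leq = 2"

fun vocabulary :: "list_type \<Rightarrow> rel_name set" where
  "vocabulary Unit = {}"
| "vocabulary (\<Gamma> \<otimes> \<Sigma>) = insert InFirst (ProdL ` vocabulary \<Gamma> \<union> ProdR ` vocabulary \<Sigma>)"
| "vocabulary (\<Gamma> \<oplus> \<Sigma>) = insert IsLeft (SumL ` vocabulary \<Gamma> \<union> SumR ` vocabulary \<Sigma>)"
| "vocabulary (Lists \<Sigma>) = insert Leq (Item ` vocabulary \<Sigma>)"


section \<open>Structures\<close>

text \<open>
  Relations are sets of tuples, given as lists; a nullary relation is \<open>{[]}\<close> (true) or \<open>{}\<close> (false).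
  A structure interprets names outside its vocabulary as \<open>{}\<close>.
\<close>

record 'a rel_struct =
  universe :: "'a set"
  rel :: "rel_name \<Rightarrow> 'a list set"

abbreviation disj :: "'a rel_struct \<Rightarrow> 'a rel_struct \<Rightarrow> bool" where
  "disj A B \<equiv> universe A \<inter> universe B = {}"

definition unit_struct :: "'a \<Rightarrow> 'a rel_struct" where
  "unit_struct a = \<lparr>universe = {a}, rel = (\<lambda>_. {})\<rparr>"

definition prod_struct :: "'a rel_struct \<Rightarrow> 'a rel_struct \<Rightarrow> 'a rel_struct" where
  "prod_struct A B = \<lparr>universe = universe A \<union> universe B,
     rel = (\<lambda>R. case R of
         ProdL R' \<Rightarrow> rel A R'
       | ProdR R' \<Rightarrow> rel B R'
       | InFirst \<Rightarrow> {[a] | a. a \<in> universe A}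
       | _ \<Rightarrow> {})\<rparr>"

definition inl_struct :: "'a rel_struct \<Rightarrow> 'a rel_struct" where
  "inl_struct A = \<lparr>universe = universe A,
     rel = (\<lambda>R. case R of SumL R' \<Rightarrow> rel A R' | IsLeft \<Rightarrow> {[]} | _ \<Rightarrow> {})\<rparr>"

definition inr_struct :: "'a rel_struct \<Rightarrow> 'a rel_struct" where
  "inr_struct A = \<lparr>universe = universe A,
     rel = (\<lambda>R. case R of SumR R' \<Rightarrow> rel A R' | _ \<Rightarrow> {})\<rparr>"

definition list_struct :: "'a rel_struct list \<Rightarrow> 'a rel_struct" where
  "list_struct As = \<lparr>universe = (\<Union>A\<in>set As. universe A),
     rel = (\<lambda>R. case R of
         Item R' \<Rightarrow>
           (if arity R' = 0 then {[a] | a A. A \<in> set As \<and> a \<in> universe A \<and> [] \<in> rel A R'}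
            else (\<Union>A\<in>set As. rel A R'))
       | Leq \<Rightarrow> {[x, y] | x y i j. i \<le> j \<and> j < length As \<and> x \<in> universe (As ! i) \<and> y \<in> universe (As ! j)}
       | _ \<Rightarrow> {})\<rparr>"

definition items :: "'a rel_struct set \<Rightarrow> 'a rel_struct list \<Rightarrow> bool" where
  "items \<C> As \<longleftrightarrow> (\<forall>A\<in>set As. A \<in> \<C> \<and> universe A \<noteq> {}) \<and> sorted_wrt disj As"

text \<open>
  The class of structures of a list type. All of them are finite, so taking elements from a fixed
  infinite type loses no structure up to isomorphism. Disjoint union is union of structures with
  disjoint universes; hence every class is closed under renaming of elements.
\<close>

primrec structs :: "list_type \<Rightarrow> 'a rel_struct set" where
  "structs Unit = range unit_struct"
| "structs (\<Gamma> \<otimes> \<Sigma>) = {prod_struct A B | A B. A \<in> structs \<Gamma> \<and> B \<in> structs \<Sigma> \<and> disj A B}"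
| "structs (\<Gamma> \<oplus> \<Sigma>) = inl_struct ` structs \<Gamma> \<union> inr_struct ` structs \<Sigma>"
| "structs (Lists \<Sigma>) = {list_struct As | As. items (structs \<Sigma>) As}"


section \<open>Quantifier-free interpretations\<close>

text \<open>A variable is an index into the tuple at which the formula is evaluated.\<close>

datatype qf_formula =
    Truth
  | Equal nat nat
  | Atom rel_name "nat list"
  | Neg qf_formula
  | Conj qf_formula qf_formula

fun qf_over :: "rel_name set \<Rightarrow> nat \<Rightarrow> qf_formula \<Rightarrow> bool" where
  "qf_over V m Truth = True"
| "qf_over V m (Equal i j) = (i < m \<and> j < m)"
| "qf_over V m (Atom R ks) = (R \<in> V \<and> length ks = arity R \<and> (\<forall>k\<in>set ks. k < m))"
| "qf_over V m (Neg \<phi>) = qf_over V m \<phi>"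
| "qf_over V m (Conj \<phi> \<psi>) = (qf_over V m \<phi> \<and> qf_over V m \<psi>)"

fun sat :: "'a rel_struct \<Rightarrow> 'a list \<Rightarrow> qf_formula \<Rightarrow> bool" where
  "sat A xs Truth = True"
| "sat A xs (Equal i j) = (xs ! i = xs ! j)"
| "sat A xs (Atom R ks) = (map ((!) xs) ks \<in> rel A R)"
| "sat A xs (Neg \<phi>) = (\<not> sat A xs \<phi>)"
| "sat A xs (Conj \<phi> \<psi>) = (sat A xs \<phi> \<and> sat A xs \<psi>)"

definition qf_apply ::
  "list_type \<Rightarrow> qf_formula \<Rightarrow> (rel_name \<Rightarrow> qf_formula) \<Rightarrow> 'a rel_struct \<Rightarrow> 'a rel_struct" where
  "qf_apply \<Gamma> \<phi> \<psi> A = (let U = {a \<in> universe A. sat A [a] \<phi>} in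
     \<lparr>universe = U,
      rel = (\<lambda>R. if R \<in> vocabulary \<Gamma>
                 then {xs. length xs = arity R \<and> set xs \<subseteq> U \<and> sat A xs (\<psi> R)}
                 else {})\<rparr>)"

definition qf_interpretation ::
  "list_type \<Rightarrow> list_type \<Rightarrow> ('a rel_struct \<Rightarrow> 'a rel_struct) \<Rightarrow> bool" where
  "qf_interpretation \<Sigma> \<Gamma> f \<longleftrightarrow>
     (\<exists>\<phi> \<psi>. qf_over (vocabulary \<Sigma>) 1 \<phi> \<and>
            (\<forall>R\<in>vocabulary \<Gamma>. qf_over (vocabulary \<Sigma>) (arity R) (\<psi> R)) \<and>
            (\<forall>A\<in>structs \<Sigma>. f A = qf_apply \<Gamma> \<phi> \<psi> A))"


section \<open>Prime functions and derivable functions\<close>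

text \<open>
  Functions on structures are specified by their values on the structures of the input type, which
  decompose uniquely (see the injectivity lemmas below); values outside that class are irrelevant.
  Where an output list acquires an item with empty universe (in append, list distribute and map),
  that item leaves no trace in \<open>list_struct\<close>, i.e. it is dropped (lemma \<open>list_struct_nonempty\<close>).
\<close>

inductive prime :: "list_type \<Rightarrow> list_type \<Rightarrow> ('a rel_struct \<Rightarrow> 'a rel_struct) \<Rightarrow> bool" where
  prod_comm:
    "(\<And>A B. A \<in> structs \<Gamma> \<Longrightarrow> B \<in> structs \<Sigma> \<Longrightarrow> disj A B \<Longrightarrow>
        f (prod_struct A B) = prod_struct B A)
     \<Longrightarrow> prime (\<Gamma> \<otimes> \<Sigma>) (\<Sigma> \<otimes> \<Gamma>) f"
| sum_comm:
    "(\<And>A. A \<in> structs \<Gamma> \<Longrightarrow> f (inl_struct A) = inr_struct A) \<Longrightarrow>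
     (\<And>B. B \<in> structs \<Sigma> \<Longrightarrow> f (inr_struct B) = inl_struct B)
     \<Longrightarrow> prime (\<Gamma> \<oplus> \<Sigma>) (\<Sigma> \<oplus> \<Gamma>) f"
| prod_assoc_right_to_left:
    "(\<And>A B C. A \<in> structs \<Gamma> \<Longrightarrow> B \<in> structs \<Sigma> \<Longrightarrow> C \<in> structs \<Delta> \<Longrightarrow>
        disj A B \<Longrightarrow> disj A C \<Longrightarrow> disj B C \<Longrightarrow>
        f (prod_struct A (prod_struct B C)) = prod_struct (prod_struct A B) C)
     \<Longrightarrow> prime (\<Gamma> \<otimes> (\<Sigma> \<otimes> \<Delta>)) ((\<Gamma> \<otimes> \<Sigma>) \<otimes> \<Delta>) f"
| prod_assoc_left_to_right:
    "(\<And>A B C. A \<in> structs \<Gamma> \<Longrightarrow> B \<in> structs \<Sigma> \<Longrightarrow> C \<in> structs \<Delta> \<Longrightarrow>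
        disj A B \<Longrightarrow> disj A C \<Longrightarrow> disj B C \<Longrightarrow>
        f (prod_struct (prod_struct A B) C) = prod_struct A (prod_struct B C))
     \<Longrightarrow> prime ((\<Gamma> \<otimes> \<Sigma>) \<otimes> \<Delta>) (\<Gamma> \<otimes> (\<Sigma> \<otimes> \<Delta>)) f"
| sum_assoc_right_to_left:
    "(\<And>A. A \<in> structs \<Gamma> \<Longrightarrow> f (inl_struct A) = inl_struct (inl_struct A)) \<Longrightarrow>
     (\<And>B. B \<in> structs \<Sigma> \<Longrightarrow> f (inr_struct (inl_struct B)) = inl_struct (inr_struct B)) \<Longrightarrow>
     (\<And>C. C \<in> structs \<Delta> \<Longrightarrow> f (inr_struct (inr_struct C)) = inr_struct C)
     \<Longrightarrow> prime (\<Gamma> \<oplus> (\<Sigma> \<oplus> \<Delta>)) ((\<Gamma> \<oplus> \<Sigma>) \<oplus> \<Delta>) f"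
| sum_assoc_left_to_right:
    "(\<And>A. A \<in> structs \<Gamma> \<Longrightarrow> f (inl_struct (inl_struct A)) = inl_struct A) \<Longrightarrow>
     (\<And>B. B \<in> structs \<Sigma> \<Longrightarrow> f (inl_struct (inr_struct B)) = inr_struct (inl_struct B)) \<Longrightarrow>
     (\<And>C. C \<in> structs \<Delta> \<Longrightarrow> f (inr_struct C) = inr_struct (inr_struct C))
     \<Longrightarrow> prime ((\<Gamma> \<oplus> \<Sigma>) \<oplus> \<Delta>) (\<Gamma> \<oplus> (\<Sigma> \<oplus> \<Delta>)) f"
| distribute:
    "(\<And>A B. A \<in> structs \<Gamma> \<Longrightarrow> B \<in> structs \<Sigma> \<Longrightarrow> disj A B \<Longrightarrow>
        f (prod_struct A (inl_struct B)) = inl_struct (prod_struct A B)) \<Longrightarrow>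
     (\<And>A C. A \<in> structs \<Gamma> \<Longrightarrow> C \<in> structs \<Delta> \<Longrightarrow> disj A C \<Longrightarrow>
        f (prod_struct A (inr_struct C)) = inr_struct (prod_struct A C))
     \<Longrightarrow> prime (\<Gamma> \<otimes> (\<Sigma> \<oplus> \<Delta>)) ((\<Gamma> \<otimes> \<Sigma>) \<oplus> (\<Gamma> \<otimes> \<Delta>)) f"
| undistribute:
    "(\<And>A B. A \<in> structs \<Gamma> \<Longrightarrow> B \<in> structs \<Sigma> \<Longrightarrow> disj A B \<Longrightarrow>
        f (inl_struct (prod_struct A B)) = prod_struct A (inl_struct B)) \<Longrightarrow>
     (\<And>A C. A \<in> structs \<Gamma> \<Longrightarrow> C \<in> structs \<Delta> \<Longrightarrow> disj A C \<Longrightarrow>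
        f (inr_struct (prod_struct A C)) = prod_struct A (inr_struct C))
     \<Longrightarrow> prime ((\<Gamma> \<otimes> \<Sigma>) \<oplus> (\<Gamma> \<otimes> \<Delta>)) (\<Gamma> \<otimes> (\<Sigma> \<oplus> \<Delta>)) f"
| project_first:
    "(\<And>A B. A \<in> structs \<Gamma>\<^sub>1 \<Longrightarrow> B \<in> structs \<Gamma>\<^sub>2 \<Longrightarrow> disj A B \<Longrightarrow> f (prod_struct A B) = A)
     \<Longrightarrow> prime (\<Gamma>\<^sub>1 \<otimes> \<Gamma>\<^sub>2) \<Gamma>\<^sub>1 f"
| project_second:
    "(\<And>A B. A \<in> structs \<Gamma>\<^sub>1 \<Longrightarrow> B \<in> structs \<Gamma>\<^sub>2 \<Longrightarrow> disj A B \<Longrightarrow> f (prod_struct A B) = B)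
     \<Longrightarrow> prime (\<Gamma>\<^sub>1 \<otimes> \<Gamma>\<^sub>2) \<Gamma>\<^sub>2 f"
| coproject_first:
    "(\<And>A. A \<in> structs \<Gamma>\<^sub>1 \<Longrightarrow> f A = inl_struct A) \<Longrightarrow> prime \<Gamma>\<^sub>1 (\<Gamma>\<^sub>1 \<oplus> \<Gamma>\<^sub>2) f"
| coproject_second:
    "(\<And>A. A \<in> structs \<Gamma>\<^sub>2 \<Longrightarrow> f A = inr_struct A) \<Longrightarrow> prime \<Gamma>\<^sub>2 (\<Gamma>\<^sub>1 \<oplus> \<Gamma>\<^sub>2) f"
| codiagonal:
    "(\<And>A. A \<in> structs \<Gamma> \<Longrightarrow> f (inl_struct A) = A) \<Longrightarrow>
     (\<And>A. A \<in> structs \<Gamma> \<Longrightarrow> f (inr_struct A) = A)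
     \<Longrightarrow> prime (\<Gamma> \<oplus> \<Gamma>) \<Gamma> f"
| append:
    "(\<And>As B. items (structs \<Sigma>) As \<Longrightarrow> B \<in> structs \<Sigma> \<Longrightarrow> disj (list_struct As) B \<Longrightarrow>
        f (prod_struct (list_struct As) B) = list_struct (As @ [B]))
     \<Longrightarrow> prime (Lists \<Sigma> \<otimes> \<Sigma>) (Lists \<Sigma>) f"
| reverse:
    "(\<And>As. items (structs \<Sigma>) As \<Longrightarrow> f (list_struct As) = list_struct (rev As))
     \<Longrightarrow> prime (Lists \<Sigma>) (Lists \<Sigma>) f"
| concat:
    "(\<And>Ass. (\<forall>As\<in>set Ass. items (structs \<Sigma>) As) \<Longrightarrow>
        items (structs (Lists \<Sigma>)) (map list_struct Ass) \<Longrightarrow>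
        f (list_struct (map list_struct Ass)) = list_struct (concat Ass))
     \<Longrightarrow> prime (Lists (Lists \<Sigma>)) (Lists \<Sigma>) f"
| create_empty:
    "(\<And>A. A \<in> structs \<Sigma> \<Longrightarrow> f A = prod_struct A (list_struct []))
     \<Longrightarrow> prime \<Sigma> (\<Sigma> \<otimes> Lists \<Gamma>) f"
| list_distribute:
    "(\<And>ABs. (\<forall>(A, B)\<in>set ABs. A \<in> structs \<Sigma> \<and> B \<in> structs \<Gamma> \<and> disj A B) \<Longrightarrow>
        items (structs (\<Sigma> \<otimes> \<Gamma>)) (map (\<lambda>(A, B). prod_struct A B) ABs) \<Longrightarrow>
        f (list_struct (map (\<lambda>(A, B). prod_struct A B) ABs)) =
          prod_struct (list_struct (map fst ABs)) (list_struct (map snd ABs)))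
     \<Longrightarrow> prime (Lists (\<Sigma> \<otimes> \<Gamma>)) (Lists \<Sigma> \<otimes> Lists \<Gamma>) f"

inductive derivable :: "list_type \<Rightarrow> list_type \<Rightarrow> ('a rel_struct \<Rightarrow> 'a rel_struct) \<Rightarrow> bool" where
  prime: "prime \<Sigma> \<Gamma> f \<Longrightarrow> derivable \<Sigma> \<Gamma> f"
| compose: "derivable \<Gamma> \<Sigma> f \<Longrightarrow> derivable \<Sigma> \<Delta> g \<Longrightarrow> derivable \<Gamma> \<Delta> (g \<circ> f)"
| prod_functor:
    "derivable \<Gamma>\<^sub>1 \<Sigma>\<^sub>1 f\<^sub>1 \<Longrightarrow> derivable \<Gamma>\<^sub>2 \<Sigma>\<^sub>2 f\<^sub>2 \<Longrightarrow>
     (\<And>A B. A \<in> structs \<Gamma>\<^sub>1 \<Longrightarrow> B \<in> structs \<Gamma>\<^sub>2 \<Longrightarrow> disj A B \<Longrightarrow>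
        g (prod_struct A B) = prod_struct (f\<^sub>1 A) (f\<^sub>2 B))
     \<Longrightarrow> derivable (\<Gamma>\<^sub>1 \<otimes> \<Gamma>\<^sub>2) (\<Sigma>\<^sub>1 \<otimes> \<Sigma>\<^sub>2) g"
| sum_functor:
    "derivable \<Gamma>\<^sub>1 \<Sigma>\<^sub>1 f\<^sub>1 \<Longrightarrow> derivable \<Gamma>\<^sub>2 \<Sigma>\<^sub>2 f\<^sub>2 \<Longrightarrow>
     (\<And>A. A \<in> structs \<Gamma>\<^sub>1 \<Longrightarrow> g (inl_struct A) = inl_struct (f\<^sub>1 A)) \<Longrightarrow>
     (\<And>B. B \<in> structs \<Gamma>\<^sub>2 \<Longrightarrow> g (inr_struct B) = inr_struct (f\<^sub>2 B))
     \<Longrightarrow> derivable (\<Gamma>\<^sub>1 \<oplus> \<Gamma>\<^sub>2) (\<Sigma>\<^sub>1 \<oplus> \<Sigma>\<^sub>2) g"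
| list_functor:
    "derivable \<Gamma> \<Sigma> f \<Longrightarrow>
     (\<And>As. items (structs \<Gamma>) As \<Longrightarrow> g (list_struct As) = list_struct (map f As))
     \<Longrightarrow> derivable (Lists \<Gamma>) (Lists \<Sigma>) g"


section \<open>Unique decomposition\<close>

lemma inl_struct_inject:
  assumes "inl_struct A = inl_struct B"
  shows "A = B"
proof -
  have "rel (inl_struct A) (SumL R) = rel (inl_struct B) (SumL R)" for R
    using assms by simp
  then have "rel A = rel B"
    by (auto simp: inl_struct_def)
  then show ?thesis
    using assms by (simp add: inl_struct_def)
qed

lemma inr_struct_inject:
  assumes "inr_struct A = inr_struct B"
  shows "A = B"
proof -
  have "rel (inr_struct A) (SumR R) = rel (inr_struct B) (SumR R)" for R
    using assms by simp
  then have "rel A = rel B"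
    by (auto simp: inr_struct_def)
  then show ?thesis
    using assms by (simp add: inr_struct_def)
qed

lemma inl_struct_neq_inr_struct: "inl_struct A \<noteq> inr_struct B"
  unfolding inl_struct_def inr_struct_def
  by (auto dest: fun_cong[where x = IsLeft])

lemma prod_struct_inject:
  assumes eq: "prod_struct A B = prod_struct A' B'" and "disj A B" "disj A' B'"
  shows "A = A' \<and> B = B'"
proof -
  have r: "rel (prod_struct A B) R = rel (prod_struct A' B') R" for R
    using eq by simp
  have "rel A = rel A'" "rel B = rel B'"
    using r[of "ProdL _"] r[of "ProdR _"] by (auto simp: prod_struct_def)
  moreover have "universe A = universe A'"
    using r[of InFirst] by (auto simp: prod_struct_def)
  moreover have "universe A \<union> universe B = universe A' \<union> universe B'"
    using eq by (simp add: prod_struct_def)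
  ultimately show ?thesis
    using assms(2,3) by (auto intro!: rel_struct.equality)
qed

text \<open>Tuples have the right length, range over the universe, and use names of the vocabulary only.\<close>

lemma rel_of_structs:
  "A \<in> structs \<Sigma> \<Longrightarrow> xs \<in> rel A R \<Longrightarrow>
     R \<in> vocabulary \<Sigma> \<and> length xs = arity R \<and> set xs \<subseteq> universe A"
proof (induction \<Sigma> arbitrary: A xs R)
  case Unit
  then show ?case by (auto simp: unit_struct_def)
next
  case (Prod \<Gamma> \<Sigma>)
  then show ?case by (cases R) (fastforce simp: prod_struct_def)+
next
  case (Sum \<Gamma> \<Sigma>)
  then show ?case by (cases R) (fastforce simp: inl_struct_def inr_struct_def)+
next
  case (Lists \<Sigma>)
  then show ?case
    by (cases R) (fastforce simp: list_struct_def items_def split: if_splits)+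
qed

lemma universe_list_struct [simp]: "universe (list_struct As) = (\<Union>A\<in>set As. universe A)"
  by (simp add: list_struct_def)

lemma rel_list_struct_Nil: "rel (list_struct []) R = {}"
  by (cases R) (auto simp: list_struct_def)

lemma rel_list_struct_Cons:
  "rel (list_struct (A # As)) R = (case R of
      Item R' \<Rightarrow> (if arity R' = 0 then {[a] | a. a \<in> universe A \<and> [] \<in> rel A R'} else rel A R')
    | Leq \<Rightarrow> {[x, y] | x y. x \<in> universe A \<and> y \<in> universe (list_struct (A # As))}
    | _ \<Rightarrow> {}) \<union> rel (list_struct As) R"
proof (cases R)
  case Leq
  have "(\<exists>i j. i \<le> j \<and> j < length (A # As) \<and> x \<in> universe ((A # As) ! i) \<and> y \<in> universe ((A # As) ! j)) \<longleftrightarrow>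
      x \<in> universe A \<and> (\<exists>B\<in>set (A # As). y \<in> universe B) \<or>
      (\<exists>i j. i \<le> j \<and> j < length As \<and> x \<in> universe (As ! i) \<and> y \<in> universe (As ! j))"
    (is "?l \<longleftrightarrow> ?r1 \<or> ?r2") for x y
  proof
    assume ?l
    then obtain i j where ij: "i \<le> j" "j < length (A # As)"
        "x \<in> universe ((A # As) ! i)" "y \<in> universe ((A # As) ! j)"
      by blast
    show "?r1 \<or> ?r2"
    proof (cases i)
      case 0
      then show ?thesis using ij nth_mem[OF ij(2)] by auto
    next
      case (Suc i')
      with ij obtain j' where "j = Suc j'" by (cases j) auto
      with Suc ij have ?r2 by auto
      then show ?thesis ..
    qed
  next
    assume "?r1 \<or> ?r2"
    then show ?l
    proof
      assume ?r1
      then obtain j where "j < length (A # As)" "y \<in> universe ((A # As) ! j)"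
        by (metis in_set_conv_nth)
      with \<open>?r1\<close> show ?l by (intro exI[of _ 0] exI[of _ j]) simp
    next
      assume ?r2
      then obtain i j where "i \<le> j \<and> j < length As \<and> x \<in> universe (As ! i) \<and> y \<in> universe (As ! j)"
        by blast
      then show ?l by (intro exI[of _ "Suc i"] exI[of _ "Suc j"]) simp
    qed
  qed
  then show ?thesis
    unfolding Leq by (auto simp: list_struct_def)
qed (auto simp: list_struct_def)

lemma list_struct_nonempty:
  assumes "\<forall>A\<in>set As. A \<in> structs \<Sigma>"
  shows "list_struct As = list_struct (filter (\<lambda>A. universe A \<noteq> {}) As)"
proof (rule rel_struct.equality)
  let ?Bs = "\<lambda>As. filter (\<lambda>A. universe A \<noteq> {}) As"
  show "universe (list_struct As) = universe (list_struct (?Bs As))"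
    by auto
  have "rel (list_struct As) R = rel (list_struct (?Bs As)) R" for R
    using assms
  proof (induction As)
    case (Cons A As)
    show ?case
    proof (cases "universe A = {}")
      case True
      have "rel A R' = {}" if "arity R' \<noteq> 0" for R'
        using rel_of_structs[of A \<Sigma> _ R'] Cons.prems True that by fastforce
      with True Cons show ?thesis
        by (auto simp: rel_list_struct_Cons split: rel_name.split)
    next
      case False
      with Cons show ?thesis
        by (auto simp: rel_list_struct_Cons split: rel_name.split)
    qed
  qed simp
  then show "rel (list_struct As) = rel (list_struct (?Bs As))"
    by blast
qed simp

lemma items_Cons:
  "items \<C> (A # As) \<longleftrightarrow>
     A \<in> \<C> \<and> universe A \<noteq> {} \<and> disj A (list_struct As) \<and> items \<C> As"
  by (auto simp: items_def)

lemma list_struct_Cons_split: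
  assumes "items (structs \<Sigma>) (A # As)"
  defines "L \<equiv> list_struct (A # As)"
  shows "universe A = {x \<in> universe L. \<forall>y\<in>universe L. [x, y] \<in> rel L Leq}" (is ?univ)
    and "rel A R = (if arity R = 0 then {[] | a. a \<in> universe A \<and> [a] \<in> rel L (Item R)}
                    else {xs \<in> rel L (Item R). set xs \<subseteq> universe A})" (is ?head)
    and "rel (list_struct As) R = {xs \<in> rel L R. set xs \<inter> universe A = {}}" (is ?tail)
proof -
  have A: "A \<in> structs \<Sigma>" "universe A \<noteq> {}" "disj A (list_struct As)" "items (structs \<Sigma>) As"
    using assms by (auto simp: items_Cons)
  then have T: "list_struct As \<in> structs (Lists \<Sigma>)"
    by auto
  have in_T: "xs \<noteq> [] \<and> set xs \<subseteq> universe (list_struct As)" if "xs \<in> rel (list_struct As) R" for xs R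
  proof -
    have "R \<in> vocabulary (Lists \<Sigma>)" "length xs = arity R" "set xs \<subseteq> universe (list_struct As)"
      using rel_of_structs[OF T that] by blast+
    then show ?thesis by (auto split: if_splits)
  qed
  have in_A: "length xs = arity R \<and> set xs \<subseteq> universe A" if "xs \<in> rel A R" for xs R
    using rel_of_structs[OF A(1) that] by blast
  have T_A: False if "xs \<in> rel (list_struct As) R" "set xs \<subseteq> universe A" for xs R
    using in_T[OF that(1)] that(2) A(3) by (cases xs) auto
  show ?univ
  proof (intro equalityI subsetI CollectI conjI ballI)
    fix x assume x: "x \<in> {x \<in> universe L. \<forall>y\<in>universe L. [x, y] \<in> rel L Leq}"
    obtain a where a: "a \<in> universe A" using A(2) by blast
    with x have "[x, a] \<in> rel L Leq" by (auto simp: L_def)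
    moreover have "[x, a] \<notin> rel (list_struct As) Leq"
      using in_T[of "[x, a]" Leq] a A(3) by auto
    ultimately show "x \<in> universe A"
      by (auto simp: L_def rel_list_struct_Cons)
  qed (auto simp: L_def rel_list_struct_Cons)
  show ?head
  proof (cases "arity R = 0")
    case True
    have "xs \<in> rel A R \<longleftrightarrow> xs = [] \<and> [] \<in> rel A R" for xs
      using in_A[of xs R] True by auto
    moreover have "[a] \<in> rel L (Item R) \<longleftrightarrow> [] \<in> rel A R" if "a \<in> universe A" for a
      using T_A[of "[a]" "Item R"] that True by (auto simp: L_def rel_list_struct_Cons)
    ultimately have "rel A R = {[] | a. a \<in> universe A \<and> [a] \<in> rel L (Item R)}"
      using A(2) by blast
    with True show ?thesis
      by (simp only: simp_thms if_True)
  next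
    case False
    have L: "rel L (Item R) = rel A R \<union> rel (list_struct As) (Item R)"
      using False by (simp add: L_def rel_list_struct_Cons)
    have "rel A R = {xs \<in> rel L (Item R). set xs \<subseteq> universe A}"
      unfolding L using in_A T_A by blast
    with False show ?thesis
      by (simp only: if_False)
  qed
  have "xs \<in> rel L R \<and> set xs \<inter> universe A = {}" if "xs \<in> rel (list_struct As) R" for xs
  proof
    show "xs \<in> rel L R"
      unfolding L_def rel_list_struct_Cons using that by blast
    show "set xs \<inter> universe A = {}"
      using in_T[OF that] A(3) by blast
  qed
  moreover have "xs \<in> rel (list_struct As) R" if "xs \<in> rel L R" "set xs \<inter> universe A = {}" for xs
  proof (cases R)
    case (Item R')
    have "xs \<notin> rel A R'" if "arity R' \<noteq> 0"
    proof
      assume "xs \<in> rel A R'"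
      then have "length xs \<noteq> 0" "set xs \<subseteq> universe A"
        using in_A that by auto
      with \<open>set xs \<inter> universe A = {}\<close> show False
        by (cases xs) auto
    qed
    with that Item show ?thesis
      by (auto simp: L_def rel_list_struct_Cons split: if_splits)
  qed (use that in \<open>auto simp: L_def rel_list_struct_Cons\<close>)
  ultimately show ?tail
    by blast
qed

lemma list_struct_inject:
  assumes "items (structs \<Sigma>) As" "items (structs \<Sigma>) Bs" "list_struct As = list_struct Bs"
  shows "As = Bs"
  using assms
proof (induction As arbitrary: Bs)
  case Nil
  have "universe (list_struct Bs) = {}"
    using Nil.prems(3)[symmetric] by simp
  with Nil.prems(2) show ?case
    by (cases Bs) (auto simp: items_Cons)
next
  case (Cons A As)
  have "universe (list_struct Bs) \<noteq> {}"
    using Cons.prems(1) unfolding Cons.prems(3)[symmetric] by (auto simp: items_Cons)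
  then obtain B Bs' where Bs: "Bs = B # Bs'"
    by (cases Bs) auto
  note A = list_struct_Cons_split[OF Cons.prems(1)]
  note B = list_struct_Cons_split[OF Cons.prems(2)[unfolded Bs]]
  have eq: "list_struct (A # As) = list_struct (B # Bs')"
    using Cons.prems(3) Bs by simp
  have u: "universe A = universe B"
    by (rule trans[OF A(1)[unfolded eq] B(1)[symmetric]])
  have "rel A R = rel B R" for R
    by (rule trans[OF A(2)[unfolded eq u] B(2)[symmetric]])
  then have "rel A = rel B"
    by blast
  with u have "A = B"
    by (intro rel_struct.equality) simp_all
  have uA: "universe (list_struct As) = universe (list_struct (A # As)) - universe A"
    using Cons.prems(1) by (auto simp: items_Cons)
  have uB: "universe (list_struct Bs') = universe (list_struct (B # Bs')) - universe B"
    using Cons.prems(2) by (auto simp: items_Cons Bs)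
  have "universe (list_struct As) = universe (list_struct Bs')"
    by (rule trans[OF uA[unfolded eq u] uB[symmetric]])
  moreover have "rel (list_struct As) R = rel (list_struct Bs') R" for R
    by (rule trans[OF A(3)[unfolded eq u] B(3)[symmetric]])
  then have "rel (list_struct As) = rel (list_struct Bs')"
    by blast
  ultimately have "list_struct As = list_struct Bs'"
    by (rule rel_struct.equality) simp
  moreover have "items (structs \<Sigma>) As" "items (structs \<Sigma>) Bs'"
    using Cons.prems(1,2) unfolding Bs items_Cons by blast+
  ultimately have "As = Bs'"
    using Cons.IH by blast
  with \<open>A = B\<close> Bs show ?case by simp
qed

end

theory Submission
  imports Defs
begin

text \<open>
  A function whose universe shrinks is a quantifier-free interpretation iff it is compatible with
  local embeddings, that is, with injections of subsets that preserve and reflect all relations.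
  Derivable functions have this property by induction.

  For the converse, distributing products over sums makes the input a sum of types built from \<open>1\<close>,
  products and lists. Finite structures over such a type amalgamate, so whether an input element occurs
  in the output depends only on its unary type, and a property of unary types splits an input into two
  inputs of types of the same shape. One then argues by induction on the nesting depth of lists in the
  input and on the output type. For an output list, consider the unary types of the input elements
  that occur in it. If some type never precedes or equals some other type, the output is a concatenation
  of two lists with fewer types. Otherwise, if all elements always lie in a single item, the output
  reduces to that item. In the remaining case the two sides of a product could be interleaved
  arbitrarily, which is incompatible with a linear preorder unless only one side is used; this leaves
  an input list, whose items must appear in the output in ascending or in descending order, so that the
  output is obtained by mapping a function of smaller depth, possibly after reversal, and flattening.
\<close>

section \<open>Local embeddings\<close>

text \<open>Formulas do not decompose along the type constructors: a formula over a product or a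
  list may mix all parts of the input. Local embeddings do decompose, with one criterion per
  constructor, and finiteness of the vocabularies turns invariance back into a formula. Three
  obstacles shape the rest. Nullary relations are visible even to an embedding of the empty set; so
  sums have to leave products, whereas below a list they are harmless because a list makes nullary
  names unary. A split may leave one part empty although no list type has the empty structure as its
  only inhabitant; so normal forms contain a zero, whose class of models is smaller than that of the
  list type representing it. Finally, a list output with at most one item may be empty for some
  inputs, where there is no item to return; the item type must then be shown to have an empty
  structure with the right nullary relations. Amalgamation over one shared point makes the order in
  which unary types can occur in outputs a transitive relation, and this is what allows list outputs
  to be cut.\<close>

definition wf_struct :: "'a rel_struct \<Rightarrow> bool" where
  "wf_struct A \<longleftrightarrow> (\<forall>R xs. xs \<in> rel A R \<longrightarrow> length xs = arity R \<and> set xs \<subseteq> universe A)"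

text \<open>A partial isomorphism with domain \<open>X\<close>. All names and all tuple lengths are
  tested, so no vocabulary has to be carried along. The empty tuple lies over every
  \<open>X\<close>; hence even for \<open>X = {}\<close> the nullary relations are compared.\<close>

definition local_emb :: "'a rel_struct \<Rightarrow> 'a rel_struct \<Rightarrow> 'a set \<Rightarrow> ('a \<Rightarrow> 'a) \<Rightarrow> bool" where
  "local_emb A B X h \<longleftrightarrow> X \<subseteq> universe A \<and> h ` X \<subseteq> universe B \<and> inj_on h X \<and>
     (\<forall>R xs. set xs \<subseteq> X \<longrightarrow> (xs \<in> rel A R \<longleftrightarrow> map h xs \<in> rel B R))"

lemma wf_structs: "A \<in> structs \<Sigma> \<Longrightarrow> wf_struct A"
  unfolding wf_struct_def using rel_of_structs by blast

lemma wf_structD: "wf_struct A \<Longrightarrow> xs \<in> rel A R \<Longrightarrow> length xs = arity R \<and> set xs \<subseteq> universe A"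
  unfolding wf_struct_def by blast

lemma local_embD:
  assumes "local_emb A B X h"
  shows "X \<subseteq> universe A" "h ` X \<subseteq> universe B" "inj_on h X"
    and "\<And>x. x \<in> X \<Longrightarrow> x \<in> universe A" "\<And>x. x \<in> X \<Longrightarrow> h x \<in> universe B"
    and "\<And>xs R. set xs \<subseteq> X \<Longrightarrow> xs \<in> rel A R \<longleftrightarrow> map h xs \<in> rel B R"
  using assms unfolding local_emb_def by blast+

lemma local_embI:
  assumes "X \<subseteq> universe A" "\<And>x. x \<in> X \<Longrightarrow> h x \<in> universe B" "inj_on h X"
    "\<And>xs R. set xs \<subseteq> X \<Longrightarrow> xs \<in> rel A R \<longleftrightarrow> map h xs \<in> rel B R"
  shows "local_emb A B X h"
  using assms unfolding local_emb_def by blast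

lemma local_emb_mono: "local_emb A B X h \<Longrightarrow> Y \<subseteq> X \<Longrightarrow> local_emb A B Y h"
  unfolding local_emb_def by (meson image_mono inj_on_subset order_trans)

lemma local_emb_cong:
  assumes "\<And>x. x \<in> X \<Longrightarrow> h x = h' x"
  shows "local_emb A B X h \<longleftrightarrow> local_emb A B X h'"
proof -
  have "map h xs = map h' xs" if "set xs \<subseteq> X" for xs
    using that assms by auto
  moreover have "h ` X = h' ` X" "inj_on h X = inj_on h' X"
    using assms by (auto cong: inj_on_cong)
  ultimately show ?thesis
    unfolding local_emb_def by metis
qed

lemma local_emb_comp:
  assumes "local_emb A B X h" "local_emb B C (h ` X) g"
  shows "local_emb A C X (\<lambda>x. g (h x))"
proof (rule local_embI)
  fix xs R assume "set xs \<subseteq> X"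
  then show "xs \<in> rel A R \<longleftrightarrow> map (\<lambda>x. g (h x)) xs \<in> rel C R"
    using local_embD(6)[OF assms(1), of xs R] local_embD(6)[OF assms(2), of "map h xs" R]
    by (auto simp: comp_def)
next
  show "inj_on (\<lambda>x. g (h x)) X"
    using assms comp_inj_on[of h X g] by (auto simp: local_emb_def comp_def)
qed (use assms in \<open>auto simp: local_emb_def\<close>)

lemma local_emb_inv:
  assumes "local_emb A B X h"
  shows "local_emb B A (h ` X) (inv_into X h)"
proof (rule local_embI)
  fix ys R assume ys: "set ys \<subseteq> h ` X"
  let ?xs = "map (inv_into X h) ys"
  have "set ?xs \<subseteq> X"
    using ys by (auto intro: inv_into_into)
  moreover have "map h ?xs = ys"
    using ys by (simp add: map_idI f_inv_into_f subset_iff)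
  ultimately show "ys \<in> rel B R \<longleftrightarrow> ?xs \<in> rel A R"
    using local_embD(6)[OF assms] by metis
qed (use assms in \<open>auto simp: local_emb_def inj_on_inv_into\<close>)

lemma local_emb_id: "X \<subseteq> universe A \<Longrightarrow> local_emb A A X (\<lambda>x. x)"
  by (rule local_embI) auto

section \<open>Local embeddings and the type constructors\<close>

lemma wf_unit [simp]: "wf_struct (unit_struct a)"
  by (simp add: wf_struct_def unit_struct_def)

lemma wf_inl [simp]: "wf_struct (inl_struct A) \<longleftrightarrow> wf_struct A"
  by (auto simp: wf_struct_def inl_struct_def split: rel_name.splits dest!: spec[of _ "SumL _"])

lemma wf_inr [simp]: "wf_struct (inr_struct A) \<longleftrightarrow> wf_struct A"
  by (auto simp: wf_struct_def inr_struct_def split: rel_name.splits dest!: spec[of _ "SumR _"])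

lemma wf_prod [simp]: "wf_struct A \<Longrightarrow> wf_struct B \<Longrightarrow> wf_struct (prod_struct A B)"
  by (fastforce simp: wf_struct_def prod_struct_def split: rel_name.splits)

lemma universe_simps [simp]:
  "universe (unit_struct a) = {a}"
  "universe (prod_struct A B) = universe A \<union> universe B"
  "universe (inl_struct A) = universe A"
  "universe (inr_struct A) = universe A"
  by (simp_all add: unit_struct_def prod_struct_def inl_struct_def inr_struct_def)

lemma rel_unit [simp]: "rel (unit_struct a) R = {}"
  by (simp add: unit_struct_def)

lemma rel_prod [simp]:
  "rel (prod_struct A B) (ProdL R) = rel A R"
  "rel (prod_struct A B) (ProdR R) = rel B R"
  "rel (prod_struct A B) InFirst = {[a] | a. a \<in> universe A}"
  "rel (prod_struct A B) (SumL R) = {}"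
  "rel (prod_struct A B) (SumR R) = {}"
  "rel (prod_struct A B) IsLeft = {}"
  "rel (prod_struct A B) (Item R) = {}"
  "rel (prod_struct A B) Leq = {}"
  by (simp_all add: prod_struct_def)

lemma rel_inl [simp]:
  "rel (inl_struct A) (ProdL R) = {}"
  "rel (inl_struct A) (ProdR R) = {}"
  "rel (inl_struct A) InFirst = {}"
  "rel (inl_struct A) (SumL R) = rel A R"
  "rel (inl_struct A) (SumR R) = {}"
  "rel (inl_struct A) IsLeft = {[]}"
  "rel (inl_struct A) (Item R) = {}"
  "rel (inl_struct A) Leq = {}"
  by (simp_all add: inl_struct_def)

lemma rel_inr [simp]:
  "rel (inr_struct A) (ProdL R) = {}"
  "rel (inr_struct A) (ProdR R) = {}"
  "rel (inr_struct A) InFirst = {}"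
  "rel (inr_struct A) (SumL R) = {}"
  "rel (inr_struct A) (SumR R) = rel A R"
  "rel (inr_struct A) IsLeft = {}"
  "rel (inr_struct A) (Item R) = {}"
  "rel (inr_struct A) Leq = {}"
  by (simp_all add: inr_struct_def)

lemma local_emb_unit [simp]:
  "local_emb (unit_struct a) (unit_struct b) X h \<longleftrightarrow> X \<subseteq> {a} \<and> h ` X \<subseteq> {b}"
  by (auto simp: local_emb_def inj_on_def)

lemma local_emb_inl [simp]: "local_emb (inl_struct A) (inl_struct B) X h \<longleftrightarrow> local_emb A B X h"
proof
  assume "local_emb (inl_struct A) (inl_struct B) X h"
  then show "local_emb A B X h"
    unfolding local_emb_def by simp (metis rel_inl(4))
next
  assume h: "local_emb A B X h"
  show "local_emb (inl_struct A) (inl_struct B) X h"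
  proof (rule local_embI)
    fix xs R assume "set xs \<subseteq> X"
    then show "xs \<in> rel (inl_struct A) R \<longleftrightarrow> map h xs \<in> rel (inl_struct B) R"
      using local_embD(6)[OF h] by (cases R) auto
  qed (use h in \<open>auto simp: local_emb_def\<close>)
qed

lemma local_emb_inr [simp]: "local_emb (inr_struct A) (inr_struct B) X h \<longleftrightarrow> local_emb A B X h"
proof
  assume "local_emb (inr_struct A) (inr_struct B) X h"
  then show "local_emb A B X h"
    unfolding local_emb_def by simp (metis rel_inr(5))
next
  assume h: "local_emb A B X h"
  show "local_emb (inr_struct A) (inr_struct B) X h"
  proof (rule local_embI)
    fix xs R assume "set xs \<subseteq> X"
    then show "xs \<in> rel (inr_struct A) R \<longleftrightarrow> map h xs \<in> rel (inr_struct B) R"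
      using local_embD(6)[OF h] by (cases R) auto
  qed (use h in \<open>auto simp: local_emb_def\<close>)
qed

text \<open>The empty tuple is tested whatever \<open>X\<close> is, and \<open>IsLeft\<close>
  contains it on one side only.\<close>

lemma local_emb_inl_inr [simp]:
  "\<not> local_emb (inl_struct A) (inr_struct B) X h"
  "\<not> local_emb (inr_struct A) (inl_struct B) X h"
proof -
  have "[] \<in> rel A IsLeft \<longleftrightarrow> [] \<in> rel B IsLeft" if "local_emb A B X h" for A B :: "'a rel_struct"
    using local_embD(6)[OF that, of "[]" IsLeft] by simp
  then show "\<not> local_emb (inl_struct A) (inr_struct B) X h" "\<not> local_emb (inr_struct A) (inl_struct B) X h"
    by fastforce+
qed

text \<open>\<open>InFirst\<close> forces \<open>h\<close> to respect the two sides. Conversely, by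
  well-formedness every tuple of a relation lies within one factor, so the tuples of each factor can
  be tested separately.\<close>

lemma local_emb_prod:
  assumes wf: "wf_struct A" "wf_struct B" "wf_struct A'" "wf_struct B'"
    and dis: "disj A B" "disj A' B'"
  shows "local_emb (prod_struct A B) (prod_struct A' B') X h \<longleftrightarrow>
    X \<subseteq> universe A \<union> universe B \<and>
    local_emb A A' (X \<inter> universe A) h \<and> local_emb B B' (X \<inter> universe B) h" (is "?l \<longleftrightarrow> ?r")
proof
  assume l: ?l
  note D = local_embD[OF l]
  have in1: "x \<in> universe A \<longleftrightarrow> h x \<in> universe A'" if "x \<in> X" for x
    using D(6)[of "[x]" InFirst] that by simp
  have "local_emb A A' (X \<inter> universe A) h"
  proof (rule local_embI)
    fix xs R assume "set xs \<subseteq> X \<inter> universe A"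
    then show "xs \<in> rel A R \<longleftrightarrow> map h xs \<in> rel A' R"
      using D(6)[of xs "ProdL R"] by simp
  qed (use in1 D(3) in \<open>auto simp: inj_on_def\<close>)
  moreover have "local_emb B B' (X \<inter> universe B) h"
  proof (rule local_embI)
    fix x assume "x \<in> X \<inter> universe B"
    then show "h x \<in> universe B'"
      using D(5)[of x] in1[of x] dis by auto
  next
    fix xs R assume "set xs \<subseteq> X \<inter> universe B"
    then show "xs \<in> rel B R \<longleftrightarrow> map h xs \<in> rel B' R"
      using D(6)[of xs "ProdR R"] by simp
  qed (use D(3) in \<open>auto simp: inj_on_def\<close>)
  ultimately show ?r using D(1) by simp
next
  assume r: ?r
  then have a: "local_emb A A' (X \<inter> universe A) h" and b: "local_emb B B' (X \<inter> universe B) h"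
    and X: "X \<subseteq> universe A \<union> universe B"
    by blast+
  have in1: "x \<in> universe A \<longleftrightarrow> h x \<in> universe A'" if "x \<in> X" for x
    using local_embD(5)[OF a, of x] local_embD(5)[OF b, of x] X that dis by auto
  have in2: "x \<in> universe B \<longleftrightarrow> h x \<in> universe B'" if "x \<in> X" for x
    using local_embD(5)[OF a, of x] local_embD(5)[OF b, of x] X that dis by auto
  show ?l
  proof (rule local_embI)
    show "inj_on h X"
    proof (rule inj_onI)
      fix x y assume xy: "x \<in> X" "y \<in> X" "h x = h y"
      then have "x \<in> universe A \<longleftrightarrow> y \<in> universe A" "x \<in> universe B \<longleftrightarrow> y \<in> universe B"
        using in1[OF xy(1)] in1[OF xy(2)] in2[OF xy(1)] in2[OF xy(2)] by simp_all
      then show "x = y"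
        using xy X local_embD(3)[OF a] local_embD(3)[OF b] by (auto simp: inj_on_def)
    qed
  next
    fix xs R assume xs: "set xs \<subseteq> X"
    show "xs \<in> rel (prod_struct A B) R \<longleftrightarrow> map h xs \<in> rel (prod_struct A' B') R"
    proof (cases R)
      case (ProdL R')
      have "set xs \<subseteq> universe A" if "map h xs \<in> rel A' R'"
        using wf_structD[OF wf(3) that] in1 xs by auto
      then show ?thesis
        using local_embD(6)[OF a, of xs R'] wf_structD[OF wf(1), of xs R'] ProdL xs by auto
    next
      case (ProdR R')
      have "set xs \<subseteq> universe B" if "map h xs \<in> rel B' R'"
        using wf_structD[OF wf(4) that] in2 xs by auto
      then show ?thesis
        using local_embD(6)[OF b, of xs R'] wf_structD[OF wf(2), of xs R'] ProdR xs by auto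
    next
      case InFirst
      then show ?thesis using xs in1 by (auto simp: map_eq_Cons_conv)
    qed auto
  qed (use X in1 in2 in auto)
qed


section \<open>Positions in lists\<close>

definition wf_list :: "'a rel_struct list \<Rightarrow> bool" where
  "wf_list As \<longleftrightarrow> (\<forall>A\<in>set As. wf_struct A) \<and> sorted_wrt disj As"

text \<open>For disjoint items the index is unique; \<open>LEAST\<close> only makes
  \<open>pos\<close> a total function.\<close>

definition pos :: "'a rel_struct list \<Rightarrow> 'a \<Rightarrow> nat" where
  "pos As x = (LEAST i. i < length As \<and> x \<in> universe (As ! i))"

definition item :: "'a rel_struct list \<Rightarrow> 'a \<Rightarrow> 'a rel_struct" where
  "item As x = As ! pos As x"

lemma items_wf_list: "items (structs \<Sigma>) As \<Longrightarrow> wf_list As"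
  by (auto simp: items_def wf_list_def intro: wf_structs)

lemma disj_nth:
  assumes "sorted_wrt disj As" "i < length As" "j < length As" "i \<noteq> j"
  shows "universe (As ! i) \<inter> universe (As ! j) = {}"
  using assms sorted_wrt_nth_less[of disj As i j] sorted_wrt_nth_less[of disj As j i]
  by (cases "i < j") auto

lemma pos_eq:
  assumes "wf_list As" "i < length As" "x \<in> universe (As ! i)"
  shows "pos As x = i"
  unfolding pos_def
proof (rule Least_equality)
  fix j assume "j < length As \<and> x \<in> universe (As ! j)"
  then show "i \<le> j"
    using disj_nth[of As i j] assms by (fastforce simp: wf_list_def)
qed (use assms in simp)

lemma item_eq:
  assumes "wf_list As" "A \<in> set As" "x \<in> universe A"
  shows "item As x = A"
  using assms pos_eq[OF assms(1)] by (auto simp: in_set_conv_nth item_def)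

lemma pos_less:
  assumes "wf_list As" "x \<in> universe (list_struct As)"
  shows "pos As x < length As" "x \<in> universe (item As x)" "item As x \<in> set As"
proof -
  obtain i where "i < length As" "x \<in> universe (As ! i)"
    using assms(2) by (auto simp: in_set_conv_nth)
  with pos_eq[OF assms(1) this]
  show "pos As x < length As" "x \<in> universe (item As x)" "item As x \<in> set As"
    by (simp_all add: item_def)
qed

lemma mem_item:
  assumes "wf_list As" "x \<in> universe (list_struct As)"
  shows "y \<in> universe (item As x) \<longleftrightarrow> y \<in> universe (list_struct As) \<and> pos As y = pos As x"
proof
  assume "y \<in> universe (item As x)"
  then show "y \<in> universe (list_struct As) \<and> pos As y = pos As x"
    using pos_less[OF assms] pos_eq[OF assms(1), of "pos As x" y] by (auto simp: item_def)
next
  assume "y \<in> universe (list_struct As) \<and> pos As y = pos As x"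
  then show "y \<in> universe (item As x)"
    using pos_less(2)[OF assms(1), of y] by (simp add: item_def)
qed

lemma rel_list [simp]:
  "rel (list_struct As) (ProdL R) = {}"
  "rel (list_struct As) (ProdR R) = {}"
  "rel (list_struct As) InFirst = {}"
  "rel (list_struct As) (SumL R) = {}"
  "rel (list_struct As) (SumR R) = {}"
  "rel (list_struct As) IsLeft = {}"
  by (simp_all add: list_struct_def)

lemma rel_list_Leq:
  assumes "wf_list As"
  shows "xs \<in> rel (list_struct As) Leq \<longleftrightarrow> (\<exists>x y. xs = [x, y] \<and> x \<in> universe (list_struct As) \<and>
    y \<in> universe (list_struct As) \<and> pos As x \<le> pos As y)" (is "?l \<longleftrightarrow> ?r")
proof
  assume ?l
  then obtain x y i j where "xs = [x, y]" "i \<le> j" "j < length As"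
      "x \<in> universe (As ! i)" "y \<in> universe (As ! j)"
    by (auto simp: list_struct_def)
  moreover from this have "pos As x = i" "pos As y = j"
    using pos_eq[OF assms] by auto
  ultimately show ?r by auto
next
  assume ?r
  then obtain x y where "xs = [x, y]" "x \<in> universe (list_struct As)"
    "y \<in> universe (list_struct As)" "pos As x \<le> pos As y"
    by blast
  with pos_less[OF assms this(2)] pos_less[OF assms this(3)] show ?l
    by (auto simp: list_struct_def item_def)
qed

lemma rel_list_Item_nullary:
  assumes "wf_list As" "arity R = 0"
  shows "xs \<in> rel (list_struct As) (Item R) \<longleftrightarrow>
    (\<exists>x. xs = [x] \<and> x \<in> universe (list_struct As) \<and> [] \<in> rel (item As x) R)"
  using assms item_eq[OF assms(1)] by (auto simp: list_struct_def)

lemma rel_list_Item: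
  assumes "wf_list As" "arity R \<noteq> 0"
  shows "xs \<in> rel (list_struct As) (Item R) \<longleftrightarrow>
    (\<exists>x. x \<in> set xs \<and> x \<in> universe (list_struct As) \<and> xs \<in> rel (item As x) R)"
proof
  assume "xs \<in> rel (list_struct As) (Item R)"
  then obtain A where A: "A \<in> set As" "xs \<in> rel A R"
    using assms by (auto simp: list_struct_def)
  then have "length xs = arity R" "set xs \<subseteq> universe A"
    using assms(1) wf_structD unfolding wf_list_def by blast+
  moreover from this obtain x where "x \<in> set xs"
    using assms(2) by (cases xs) auto
  ultimately show "\<exists>x. x \<in> set xs \<and> x \<in> universe (list_struct As) \<and> xs \<in> rel (item As x) R"
    using A item_eq[OF assms(1) A(1)] by auto
next
  assume "\<exists>x. x \<in> set xs \<and> x \<in> universe (list_struct As) \<and> xs \<in> rel (item As x) R"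
  with pos_less(3)[OF assms(1)] show "xs \<in> rel (list_struct As) (Item R)"
    using assms(2) by (auto simp: list_struct_def)
qed

lemma wf_list_struct [simp]:
  assumes "wf_list As"
  shows "wf_struct (list_struct As)"
  unfolding wf_struct_def
proof (intro allI impI)
  fix R xs assume xs: "xs \<in> rel (list_struct As) R"
  show "length xs = arity R \<and> set xs \<subseteq> universe (list_struct As)"
  proof (cases R)
    case (Item R')
    show ?thesis
    proof (cases "arity R' = 0")
      case False
      then obtain x where x: "x \<in> universe (list_struct As)" "xs \<in> rel (item As x) R'"
        using xs Item rel_list_Item[OF assms] by auto
      moreover from this have "wf_struct (item As x)"
        using pos_less(3)[OF assms] assms by (auto simp: wf_list_def)
      ultimately show ?thesis
        using wf_structD[of "item As x" xs R'] pos_less(3)[OF assms x(1)] Item False by auto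
    qed (use xs Item assms in \<open>auto simp: rel_list_Item_nullary simp del: universe_list_struct\<close>)
  qed (use xs assms in \<open>auto simp: rel_list_Leq simp del: universe_list_struct\<close>)
qed

text \<open>\<open>Leq\<close> compares positions, and two comparisons detect equality of positions;
  within an item the relations are those tagged by \<open>Item\<close>. A nullary relation of an
  item is recovered from the unary one at any element \<open>x\<close> of that item, which is why
  the criterion is silent about items that \<open>X\<close> misses.\<close>

lemma local_emb_list:
  assumes wfA: "wf_list As" and wfB: "wf_list Bs"
  shows "local_emb (list_struct As) (list_struct Bs) X h \<longleftrightarrow>
    X \<subseteq> universe (list_struct As) \<and> h ` X \<subseteq> universe (list_struct Bs) \<and>
    (\<forall>x\<in>X. local_emb (item As x) (item Bs (h x)) (X \<inter> universe (item As x)) h) \<and>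
    (\<forall>x\<in>X. \<forall>y\<in>X. pos As x \<le> pos As y \<longleftrightarrow> pos Bs (h x) \<le> pos Bs (h y))" (is "?l \<longleftrightarrow> ?r")
proof
  assume l: ?l
  note D = local_embD[OF l]
  have le: "pos As x \<le> pos As y \<longleftrightarrow> pos Bs (h x) \<le> pos Bs (h y)" if "x \<in> X" "y \<in> X" for x y
    using D(6)[of "[x, y]" Leq] D(4,5) that rel_list_Leq[OF wfA] rel_list_Leq[OF wfB] by auto
  then have eq: "pos As x = pos As y \<longleftrightarrow> pos Bs (h x) = pos Bs (h y)" if "x \<in> X" "y \<in> X" for x y
    using that by (metis order_antisym order_refl)
  have "local_emb (item As x) (item Bs (h x)) (X \<inter> universe (item As x)) h" if x: "x \<in> X" for x
  proof (rule local_embI)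
    fix y assume "y \<in> X \<inter> universe (item As x)"
    then show "h y \<in> universe (item Bs (h x))"
      using mem_item[OF wfA D(4)[OF x]] mem_item[OF wfB D(5)[OF x]] D(5) eq x by auto
  next
    fix xs R assume xs: "set xs \<subseteq> X \<inter> universe (item As x)"
    have wfs: "wf_struct (item As x)" "wf_struct (item Bs (h x))"
      using pos_less(3)[OF wfA D(4)[OF x]] pos_less(3)[OF wfB D(5)[OF x]] wfA wfB
      by (auto simp: wf_list_def)
    show "xs \<in> rel (item As x) R \<longleftrightarrow> map h xs \<in> rel (item Bs (h x)) R"
    proof (cases "arity R = 0")
      case True
      then have "xs = []" if "xs \<in> rel (item As x) R \<or> map h xs \<in> rel (item Bs (h x)) R"
        using that wfs wf_structD by fastforce
      then show ?thesis
        using D(6)[of "[x]" "Item R"] x D(4,5) True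
        by (auto simp: rel_list_Item_nullary[OF wfA] rel_list_Item_nullary[OF wfB]
            simp del: universe_list_struct)
    next
      case False
      have a: "item As y = item As x" if "y \<in> set xs" for y
        using that xs mem_item[OF wfA D(4)[OF x]] by (auto simp: item_def)
      have b: "item Bs (h y) = item Bs (h x)" if "y \<in> set xs" for y
        using that xs mem_item[OF wfA D(4)[OF x], of y] eq[of y x] x unfolding item_def by auto
      have c: "\<exists>y. y \<in> set xs" if "xs \<in> rel (item As x) R \<or> map h xs \<in> rel (item Bs (h x)) R"
      proof -
        have "xs \<noteq> []"
          using that wfs wf_structD False by fastforce
        then show ?thesis by (cases xs) auto
      qed
      have d: "y \<in> universe (list_struct As)" "h y \<in> universe (list_struct Bs)" if "y \<in> set xs" for y
        using that xs D(4,5) by blast+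
      have "xs \<in> rel (list_struct As) (Item R) \<longleftrightarrow> xs \<in> rel (item As x) R"
      proof
        assume l: "xs \<in> rel (item As x) R"
        then obtain y where "y \<in> set xs" using c by blast
        then show "xs \<in> rel (list_struct As) (Item R)"
          unfolding rel_list_Item[OF wfA False] using l a d(1) by (intro exI[of _ y]) simp
      qed (use a in \<open>auto simp: rel_list_Item[OF wfA False]\<close>)
      moreover have "map h xs \<in> rel (list_struct Bs) (Item R) \<longleftrightarrow> map h xs \<in> rel (item Bs (h x)) R"
      proof
        assume l: "map h xs \<in> rel (item Bs (h x)) R"
        then obtain y where "y \<in> set xs" using c by blast
        then show "map h xs \<in> rel (list_struct Bs) (Item R)"
          unfolding rel_list_Item[OF wfB False] using l b d(2) by (intro exI[of _ "h y"]) simp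
      qed (use b in \<open>auto simp: rel_list_Item[OF wfB False]\<close>)
      ultimately show ?thesis
        using D(6)[of xs "Item R"] xs by blast
    qed
  qed (use D(3) in \<open>auto simp: inj_on_def\<close>)
  with le D show ?r by blast
next
  assume r: ?r
  then have X: "\<And>x. x \<in> X \<Longrightarrow> x \<in> universe (list_struct As)"
      "\<And>x. x \<in> X \<Longrightarrow> h x \<in> universe (list_struct Bs)"
    and it: "\<And>x. x \<in> X \<Longrightarrow> local_emb (item As x) (item Bs (h x)) (X \<inter> universe (item As x)) h"
    and le: "\<And>x y. x \<in> X \<Longrightarrow> y \<in> X \<Longrightarrow> pos As x \<le> pos As y \<longleftrightarrow> pos Bs (h x) \<le> pos Bs (h y)"
    by blast+
  have eq: "pos As x = pos As y \<longleftrightarrow> pos Bs (h x) = pos Bs (h y)" if "x \<in> X" "y \<in> X" for x y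
    using that le by (metis order_antisym order_refl)
  have inj: "inj_on h X"
  proof (rule inj_onI)
    fix x y assume xy: "x \<in> X" "y \<in> X" "h x = h y"
    then have "y \<in> universe (item As x)" "x \<in> universe (item As x)"
      using eq[of x y] mem_item[OF wfA X(1)[of x]] X(1) by auto
    then show "x = y"
      using local_embD(3)[OF it[OF xy(1)]] xy by (auto simp: inj_on_def)
  qed
  show ?l
  proof (rule local_embI)
    fix xs R assume xs: "set xs \<subseteq> X"
    show "xs \<in> rel (list_struct As) R \<longleftrightarrow> map h xs \<in> rel (list_struct Bs) R"
    proof (cases R)
      case (Item R')
      show ?thesis
      proof (cases "arity R' = 0")
        case True
        have "[] \<in> rel (item As x) R' \<longleftrightarrow> [] \<in> rel (item Bs (h x)) R'" if "x \<in> X" for x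
          using local_embD(6)[OF it[OF that], of "[]"] by simp
        then show ?thesis
          unfolding Item rel_list_Item_nullary[OF wfA True] rel_list_Item_nullary[OF wfB True]
          using xs X by auto
      next
        case False
        have "xs \<in> rel (item As x) R' \<longleftrightarrow> map h xs \<in> rel (item Bs (h x)) R'" if x: "x \<in> set xs" for x
        proof -
          have xX: "x \<in> X" using x xs by auto
          have wfs: "wf_struct (item As x)" "wf_struct (item Bs (h x))"
            using pos_less(3)[OF wfA X(1)[OF xX]] pos_less(3)[OF wfB X(2)[OF xX]] wfA wfB
            by (auto simp: wf_list_def)
          have "set xs \<subseteq> universe (item As x)" if m: "map h xs \<in> rel (item Bs (h x)) R'"
          proof
            fix y assume y: "y \<in> set xs"
            then have "h y \<in> universe (item Bs (h x))" "y \<in> X"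
              using wf_structD[OF wfs(2) m] xs by auto
            then show "y \<in> universe (item As x)"
              using mem_item[OF wfA X(1)[OF xX], of y] mem_item[OF wfB X(2)[OF xX], of "h y"]
                eq[of y x] X(1) xX by blast
          qed
          moreover have "set xs \<subseteq> universe (item As x)" if "xs \<in> rel (item As x) R'"
            using wf_structD[OF wfs(1) that] by blast
          ultimately show ?thesis
            using local_embD(6)[OF it[OF xX], of xs R'] xs by blast
        qed
        then show ?thesis
          unfolding Item rel_list_Item[OF wfA False] rel_list_Item[OF wfB False] set_map
          using xs X by blast
      qed
    next
      case Leq
      show ?thesis
        unfolding Leq rel_list_Leq[OF wfA] rel_list_Leq[OF wfB]
        using xs X le by (auto simp del: universe_list_struct simp: map_eq_Cons_conv)
    qed auto
  qed (use X inj in blast)+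
qed

section \<open>Lists under concatenation, reversal, mapping and flattening\<close>

lemma wf_list_append:
  "wf_list (As @ Bs) \<longleftrightarrow> wf_list As \<and> wf_list Bs \<and> disj (list_struct As) (list_struct Bs)"
  by (auto simp: wf_list_def sorted_wrt_append)

lemma pos_append:
  assumes wf: "wf_list (As @ Bs)" and x: "x \<in> universe (list_struct (As @ Bs))"
  shows "pos (As @ Bs) x =
    (if x \<in> universe (list_struct As) then pos As x else length As + pos Bs x)"
proof (cases "x \<in> universe (list_struct As)")
  case True
  note p = pos_less[OF _ True]
  have "pos (As @ Bs) x = pos As x"
    using p wf by (intro pos_eq[OF wf]) (auto simp: wf_list_append nth_append item_def)
  with True show ?thesis by simp
next
  case False
  then have "x \<in> universe (list_struct Bs)"
    using x by auto
  note p = pos_less[OF _ this]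
  have "pos (As @ Bs) x = length As + pos Bs x"
    using p wf by (intro pos_eq[OF wf]) (auto simp: wf_list_append nth_append item_def)
  with False show ?thesis by simp
qed

lemma item_append:
  assumes wf: "wf_list (As @ Bs)" and x: "x \<in> universe (list_struct (As @ Bs))"
  shows "item (As @ Bs) x = (if x \<in> universe (list_struct As) then item As x else item Bs x)"
  using pos_append[OF assms] pos_less(1)[of As x] wf
  by (auto simp: item_def nth_append wf_list_append)

text \<open>\<open>h\<close> preserves membership in either half, and everything in the first half
  precedes everything in the second; positions within one half are compared by the given
  embeddings.\<close>

lemma local_emb_append:
  assumes wf: "wf_list (As @ Bs)" "wf_list (As' @ Bs')"
    and X: "X \<subseteq> universe (list_struct (As @ Bs))"
    and a: "local_emb (list_struct As) (list_struct As') (X \<inter> universe (list_struct As)) h"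
    and b: "local_emb (list_struct Bs) (list_struct Bs') (X \<inter> universe (list_struct Bs)) h"
  shows "local_emb (list_struct (As @ Bs)) (list_struct (As' @ Bs')) X h"
proof -
  have wfs: "wf_list As" "wf_list Bs" "wf_list As'" "wf_list Bs'"
    and dis: "disj (list_struct As) (list_struct Bs)" "disj (list_struct As') (list_struct Bs')"
    using wf by (auto simp: wf_list_append)
  note a' = a[unfolded local_emb_list[OF wfs(1,3)]] and b' = b[unfolded local_emb_list[OF wfs(2,4)]]
  have X': "x \<in> universe (list_struct As) \<or> x \<in> universe (list_struct Bs)" if "x \<in> X" for x
    using X that by auto
  have hX: "(x \<in> universe (list_struct As) \<longleftrightarrow> h x \<in> universe (list_struct As')) \<and>
     (x \<in> universe (list_struct Bs) \<longleftrightarrow> h x \<in> universe (list_struct Bs'))" if "x \<in> X" for x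
    using X'[OF that] local_embD(5)[OF a, of x] local_embD(5)[OF b, of x] dis that by blast
  have U: "universe (list_struct (As @ Bs)) = universe (list_struct As) \<union> universe (list_struct Bs)"
    "universe (list_struct (As' @ Bs')) = universe (list_struct As') \<union> universe (list_struct Bs')"
    by auto
  have hXU: "h x \<in> universe (list_struct (As' @ Bs'))" if "x \<in> X" for x
    using hX[OF that] X'[OF that] U by blast
  have XU: "x \<in> universe (list_struct (As @ Bs))" if "x \<in> X" for x
    using X that by blast
  show ?thesis
    unfolding local_emb_list[OF wf]
  proof (intro conjI ballI)
    fix x assume x: "x \<in> X"
    note I = item_append[OF wf(1) XU[OF x]] item_append[OF wf(2) hXU[OF x]]
    show "local_emb (item (As @ Bs) x) (item (As' @ Bs') (h x)) (X \<inter> universe (item (As @ Bs) x)) h"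
    proof (cases "x \<in> universe (list_struct As)")
      case True
      moreover have "X \<inter> universe (item As x) \<subseteq> X \<inter> universe (list_struct As) \<inter> universe (item As x)"
        using mem_item[OF wfs(1) True] by blast
      moreover have "local_emb (item As x) (item As' (h x))
          (X \<inter> universe (list_struct As) \<inter> universe (item As x)) h"
        using a' x True by blast
      ultimately show ?thesis
        using hX[OF x] I by (simp add: local_emb_mono del: universe_list_struct)
    next
      case False
      then have xB: "x \<in> universe (list_struct Bs)" using X'[OF x] by blast
      have "X \<inter> universe (item Bs x) \<subseteq> X \<inter> universe (list_struct Bs) \<inter> universe (item Bs x)"
        using mem_item[OF wfs(2) xB] by blast
      moreover have "local_emb (item Bs x) (item Bs' (h x))
          (X \<inter> universe (list_struct Bs) \<inter> universe (item Bs x)) h"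
        using b' x xB by blast
      ultimately show ?thesis
        using hX[OF x] I False by (simp add: local_emb_mono del: universe_list_struct)
    qed
  next
    fix x y assume x: "x \<in> X" and y: "y \<in> X"
    note p = pos_append[OF wf(1) XU[OF x]] pos_append[OF wf(2) hXU[OF x]]
      pos_append[OF wf(1) XU[OF y]] pos_append[OF wf(2) hXU[OF y]]
    have le: "x \<in> universe (list_struct As) \<Longrightarrow> y \<in> universe (list_struct As) \<Longrightarrow>
        pos As x \<le> pos As y \<longleftrightarrow> pos As' (h x) \<le> pos As' (h y)"
      "x \<in> universe (list_struct Bs) \<Longrightarrow> y \<in> universe (list_struct Bs) \<Longrightarrow>
        pos Bs x \<le> pos Bs y \<longleftrightarrow> pos Bs' (h x) \<le> pos Bs' (h y)"
      using a' b' x y by blast+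
    show "pos (As @ Bs) x \<le> pos (As @ Bs) y \<longleftrightarrow> pos (As' @ Bs') (h x) \<le> pos (As' @ Bs') (h y)"
    proof (cases "x \<in> universe (list_struct As)"; cases "y \<in> universe (list_struct As)")
      assume "x \<in> universe (list_struct As)" "y \<notin> universe (list_struct As)"
      then show ?thesis
        using p hX[OF x] hX[OF y] pos_less(1)[OF wfs(1), of x] pos_less(1)[OF wfs(3), of "h x"] by simp
    next
      assume "x \<notin> universe (list_struct As)" "y \<in> universe (list_struct As)"
      then show ?thesis
        using p hX[OF x] hX[OF y] pos_less(1)[OF wfs(1), of y] pos_less(1)[OF wfs(3), of "h y"] by simp
    qed (use p hX[OF x] hX[OF y] le X'[OF x] X'[OF y] in simp_all)
  qed (use X hXU in blast)+
qed

lemma wf_list_singleton [simp]: "wf_list [A] \<longleftrightarrow> wf_struct A"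
  by (simp add: wf_list_def)

lemma pos_singleton: "x \<in> universe A \<Longrightarrow> pos [A] x = 0"
  unfolding pos_def by (rule Least_equality) auto

lemma local_emb_singleton:
  assumes "wf_struct A" "wf_struct B" "local_emb A B X h"
  shows "local_emb (list_struct [A]) (list_struct [B]) X h"
  unfolding local_emb_list[of "[A]" "[B]", simplified, OF assms(1,2)]
  using local_embD(4,5)[OF assms(3)] local_emb_mono[OF assms(3)]
  by (auto simp: pos_singleton item_def)

text \<open>An element must be present: a list shows the nullary relations of an item only at its
  elements, so nothing about them follows for \<open>X = {}\<close>.\<close>

lemma local_emb_singletonD:
  assumes "wf_struct A" "wf_struct B" "local_emb (list_struct [A]) (list_struct [B]) X h" "X \<noteq> {}"
  shows "local_emb A B X h"
proof -
  obtain x where "x \<in> X" using assms(4) by blast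
  moreover have "X \<subseteq> universe A" "h ` X \<subseteq> universe B"
    using local_embD[OF assms(3)] by auto
  ultimately show ?thesis
    using assms(3) unfolding local_emb_list[of "[A]" "[B]", simplified, OF assms(1,2)]
    by (auto simp: pos_singleton item_def inf.absorb1 subset_iff dest!: bspec)
qed

lemma pos_rev:
  assumes wf: "wf_list As" and x: "x \<in> universe (list_struct As)"
  shows "pos (rev As) x = length As - Suc (pos As x)" "item (rev As) x = item As x"
proof -
  have "sorted_wrt disj (rev As)"
    using wf by (auto simp: wf_list_def sorted_wrt_rev Int_commute)
  then have "wf_list (rev As)"
    using wf by (auto simp: wf_list_def)
  then show p: "pos (rev As) x = length As - Suc (pos As x)"
    using pos_less[OF assms] by (intro pos_eq) (auto simp: rev_nth item_def)
  show "item (rev As) x = item As x"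
    using pos_less[OF assms] by (auto simp: item_def p rev_nth)
qed

lemma wf_list_rev [simp]: "wf_list (rev As) \<longleftrightarrow> wf_list As"
  by (auto simp: wf_list_def sorted_wrt_rev Int_commute)

text \<open>Reversal sends position \<open>i\<close> to \<open>length - Suc i\<close> in both lists,
  which flips both sides of every comparison.\<close>

lemma local_emb_rev:
  assumes "wf_list As" "wf_list Bs" "local_emb (list_struct As) (list_struct Bs) X h"
  shows "local_emb (list_struct (rev As)) (list_struct (rev Bs)) X h"
proof -
  have eq: "pos (rev As) x = length As - Suc (pos As x) \<and> item (rev As) x = item As x \<and>
    pos (rev Bs) (h x) = length Bs - Suc (pos Bs (h x)) \<and> item (rev Bs) (h x) = item Bs (h x) \<and>
    pos As x < length As \<and> pos Bs (h x) < length Bs"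
    if "x \<in> X" for x
    using pos_rev[OF assms(1)] pos_rev[OF assms(2)] pos_less(1)[OF assms(1)] pos_less(1)[OF assms(2)]
      local_embD(4,5)[OF assms(3) that] by simp
  have le: "pos (rev As) x \<le> pos (rev As) y \<longleftrightarrow> pos As y \<le> pos As x"
    "pos (rev Bs) (h x) \<le> pos (rev Bs) (h y) \<longleftrightarrow> pos Bs (h y) \<le> pos Bs (h x)"
    if "x \<in> X" "y \<in> X" for x y
    using eq[OF that(1)] eq[OF that(2)] by auto
  show ?thesis
    using assms(3) eq le
    by (simp add: local_emb_list assms(1,2) del: universe_list_struct) (simp add: subset_iff)
qed

text \<open>Both lists of items are images of the same \<open>Cs\<close>, so an element of
  \<open>Y\<close> has the same position in \<open>map f Cs\<close> as in \<open>map g Cs\<close>,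
  and comparisons carry over. With \<open>f\<close> below \<open>g\<close> this transports
  embeddings to shrunken items; with \<open>f\<close> the identity it recovers embeddings of whole
  items from embeddings of their parts.\<close>

lemma local_emb_map_transfer:
  assumes wf: "wf_list (map f Cs)" "wf_list (map f Cs')" "wf_list (map g Cs)" "wf_list (map g Cs')"
    and e: "local_emb (list_struct (map g Cs)) (list_struct (map g Cs')) X h"
    and Y: "Y \<subseteq> X" "\<And>C. C \<in> set Cs \<Longrightarrow> Y \<inter> universe (g C) \<subseteq> universe (f C)"
    and C: "\<And>C C' Z. C \<in> set Cs \<Longrightarrow> C' \<in> set Cs' \<Longrightarrow> Z \<subseteq> Y \<Longrightarrow> Z \<noteq> {} \<Longrightarrow> Z \<subseteq> universe (f C) \<Longrightarrow>
      local_emb (g C) (g C') Z h \<Longrightarrow> local_emb (f C) (f C') Z h"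
  shows "local_emb (list_struct (map f Cs)) (list_struct (map f Cs')) Y h"
proof -
  note e' = e[unfolded local_emb_list[OF wf(3,4)]]
  have main: "\<exists>i j. pos (map f Cs) x = i \<and> pos (map g Cs) x = i \<and> i < length Cs \<and> x \<in> universe (f (Cs ! i)) \<and>
      pos (map f Cs') (h x) = j \<and> pos (map g Cs') (h x) = j \<and> j < length Cs' \<and> h x \<in> universe (f (Cs' ! j)) \<and>
      local_emb (f (Cs ! i)) (f (Cs' ! j)) (Y \<inter> universe (f (Cs ! i))) h" if x: "x \<in> Y" for x
  proof -
    have xg: "x \<in> universe (list_struct (map g Cs))" "h x \<in> universe (list_struct (map g Cs'))"
      using local_embD(4,5)[OF e] x Y(1) by blast+
    define i j where "i = pos (map g Cs) x" and "j = pos (map g Cs') (h x)"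
    note ij = i_def[symmetric] j_def[symmetric]
    have i: "i < length Cs" "x \<in> universe (g (Cs ! i))"
      using pos_less[OF wf(3) xg(1)] by (auto simp: item_def ij)
    have j: "j < length Cs'" "h x \<in> universe (g (Cs' ! j))"
      using pos_less[OF wf(4) xg(2)] by (auto simp: item_def ij)
    have xf: "x \<in> universe (f (Cs ! i))"
      using Y(2)[OF nth_mem[OF i(1)]] i(2) x by blast
    then have pf: "pos (map f Cs) x = i"
      using i by (intro pos_eq[OF wf(1)]) auto
    \<comment> \<open>An element of \<open>f (Cs ! i)\<close> might a priori sit in another item of
      \<open>map g Cs\<close>; disjointness of the items of \<open>map f Cs\<close> excludes
      this.\<close>
    have sub: "Y \<inter> universe (f (Cs ! i)) \<subseteq> X \<inter> universe (g (Cs ! i))"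
    proof
      fix y assume y: "y \<in> Y \<inter> universe (f (Cs ! i))"
      then have "y \<in> universe (list_struct (map g Cs))"
        using local_embD(4)[OF e] Y(1) by blast
      then obtain k where k: "k < length Cs" "y \<in> universe (g (Cs ! k))"
        by (auto simp: in_set_conv_nth)
      with y Y(2)[of "Cs ! k"] have "y \<in> universe (f (Cs ! k))"
        by auto
      then have "pos (map f Cs) y = k" "pos (map f Cs) y = i"
        using y k i by (intro pos_eq[OF wf(1)]; auto)+
      with y k Y(1) show "y \<in> X \<inter> universe (g (Cs ! i))" by auto
    qed
    have "local_emb (g (Cs ! i)) (g (Cs' ! j)) (X \<inter> universe (g (Cs ! i))) h"
      using e' x Y(1) i j by (auto simp: item_def ij simp del: universe_list_struct dest!: bspec)
    then have "local_emb (g (Cs ! i)) (g (Cs' ! j)) (Y \<inter> universe (f (Cs ! i))) h"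
      using sub by (rule local_emb_mono)
    then have fe: "local_emb (f (Cs ! i)) (f (Cs' ! j)) (Y \<inter> universe (f (Cs ! i))) h"
      using i j x xf by (intro C) auto
    then have xf': "h x \<in> universe (f (Cs' ! j))"
      using local_embD(5)[OF fe] x xf by blast
    then have "pos (map f Cs') (h x) = j"
      using j by (intro pos_eq[OF wf(2)]) auto
    with pf i j xf xf' fe show ?thesis
      by (auto simp: ij)
  qed
  show ?thesis
    unfolding local_emb_list[OF wf(1,2)]
  proof (intro conjI ballI)
    show "Y \<subseteq> universe (list_struct (map f Cs))"
      using main by fastforce
    show "h ` Y \<subseteq> universe (list_struct (map f Cs'))"
      using main by fastforce
    fix x assume x: "x \<in> Y"
    show "local_emb (item (map f Cs) x) (item (map f Cs') (h x)) (Y \<inter> universe (item (map f Cs) x)) h"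
      using main[OF x] by (auto simp: item_def)
    fix y assume y: "y \<in> Y"
    have "pos (map g Cs) x \<le> pos (map g Cs) y \<longleftrightarrow> pos (map g Cs') (h x) \<le> pos (map g Cs') (h y)"
      using e' x y Y(1) by blast
    then show "pos (map f Cs) x \<le> pos (map f Cs) y \<longleftrightarrow> pos (map f Cs') (h x) \<le> pos (map f Cs') (h y)"
      using main[OF x] main[OF y] by metis
  qed
qed

lemma local_emb_map:
  assumes wf: "wf_list (map f Cs)" "wf_list (map f Cs')" "wf_list (map g Cs)" "wf_list (map g Cs')"
    and e: "local_emb (list_struct (map g Cs)) (list_struct (map g Cs')) X h"
    and sub: "\<And>C. C \<in> set Cs \<Longrightarrow> universe (f C) \<subseteq> universe (g C)"
    and C: "\<And>C C' Z. C \<in> set Cs \<Longrightarrow> C' \<in> set Cs' \<Longrightarrow> Z \<noteq> {} \<Longrightarrow> Z \<subseteq> universe (f C) \<Longrightarrow>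
      local_emb (g C) (g C') Z h \<Longrightarrow> local_emb (f C) (f C') Z h"
  shows "local_emb (list_struct (map f Cs)) (list_struct (map f Cs'))
    (X \<inter> universe (list_struct (map f Cs))) h"
proof (rule local_emb_map_transfer[OF wf e])
  fix C assume C: "C \<in> set Cs"
  show "X \<inter> universe (list_struct (map f Cs)) \<inter> universe (g C) \<subseteq> universe (f C)"
  proof
    fix x assume x: "x \<in> X \<inter> universe (list_struct (map f Cs)) \<inter> universe (g C)"
    then obtain D where D: "D \<in> set Cs" "x \<in> universe (f D)"
      by auto
    from C D(1) obtain i j where ij: "i < length Cs" "j < length Cs" "C = Cs ! i" "D = Cs ! j"
      by (auto simp: in_set_conv_nth)
    have "x \<in> universe (g D)"
      using D sub by blast
    then have "pos (map g Cs) x = i" "pos (map g Cs) x = j"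
      using ij x by (intro pos_eq[OF wf(3)]; simp)+
    with D ij show "x \<in> universe (f C)" by simp
  qed
qed (use C in auto)

lemma concat_split:
  assumes "n < length Ass"
  shows "concat Ass = concat (take n Ass) @ Ass ! n @ concat (drop (Suc n) Ass)"
  by (subst id_take_nth_drop[OF assms]) simp

lemma wf_list_concat:
  assumes "wf_list (map list_struct Ass)" "\<forall>As\<in>set Ass. wf_list As"
  shows "wf_list (concat Ass)"
  using assms
proof (induction Ass)
  case (Cons As Ass)
  have "disj (list_struct As) (list_struct (concat Ass))"
    using Cons.prems(1) by (auto simp: wf_list_def)
  moreover have "wf_list (concat Ass)"
    using Cons by (auto simp: wf_list_def)
  ultimately show ?case
    using Cons.prems(2) by (simp add: wf_list_append)
qed (simp add: wf_list_def)

lemma pos_concat: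
  assumes wf: "wf_list (map list_struct Ass)" "\<forall>As\<in>set Ass. wf_list As"
    and x: "x \<in> universe (list_struct (map list_struct Ass))"
  defines "n \<equiv> pos (map list_struct Ass) x"
  shows "n < length Ass" "x \<in> universe (list_struct (Ass ! n))"
    "pos (concat Ass) x = length (concat (take n Ass)) + pos (Ass ! n) x"
    "item (concat Ass) x = item (Ass ! n) x"
proof -
  show n: "n < length Ass" and xn: "x \<in> universe (list_struct (Ass ! n))"
    using pos_less[OF wf(1) x] by (auto simp: item_def n_def)
  have wfn: "wf_list (Ass ! n)"
    using wf(2) n by simp
  note p = pos_less[OF wfn xn]
  have nth: "concat Ass ! (length (concat (take n Ass)) + pos (Ass ! n) x) = item (Ass ! n) x"
    using p n by (subst concat_split[OF n]) (simp add: nth_append item_def)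
  have len: "length (concat (take n Ass)) + pos (Ass ! n) x < length (concat Ass)"
    using p arg_cong[OF concat_split[OF n], of length] by simp
  show eq: "pos (concat Ass) x = length (concat (take n Ass)) + pos (Ass ! n) x"
    by (rule pos_eq[OF wf_list_concat[OF wf] len]) (use nth p in auto)
  show "item (concat Ass) x = item (Ass ! n) x"
    using nth eq by (simp add: item_def)
qed

text \<open>Blocks are laid end to end, so the order of the flattened list is lexicographic: block
  number before position within the block.\<close>

lemma pos_concat_le:
  assumes wf: "wf_list (map list_struct Ass)" "\<forall>As\<in>set Ass. wf_list As"
    and x: "x \<in> universe (list_struct (map list_struct Ass))"
    and y: "y \<in> universe (list_struct (map list_struct Ass))"
  defines "n \<equiv> pos (map list_struct Ass)"
  shows "pos (concat Ass) x \<le> pos (concat Ass) y \<longleftrightarrow>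
    n x < n y \<or> n x = n y \<and> pos (Ass ! n x) x \<le> pos (Ass ! n x) y"
proof -
  have less: "pos (concat Ass) x < pos (concat Ass) y" if "n x < n y"
    "x \<in> universe (list_struct (map list_struct Ass))"
    "y \<in> universe (list_struct (map list_struct Ass))" for x y
  proof -
    note px = pos_concat[OF wf that(2), folded n_def] and py = pos_concat[OF wf that(3), folded n_def]
    have "wf_list (Ass ! n x)" using wf(2) px(1) by simp
    from pos_less(1)[OF this px(2)] have "pos (concat Ass) x < length (concat (take (Suc (n x)) Ass))"
      using px by (simp add: take_Suc_conv_app_nth)
    also have "take (n y) Ass = take (Suc (n x)) Ass @ take (n y - Suc (n x)) (drop (Suc (n x)) Ass)"
      using that(1) by (metis Suc_leI le_add_diff_inverse take_add)
    then have "length (concat (take (Suc (n x)) Ass)) \<le> length (concat (take (n y) Ass))"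
      by simp
    also have "\<dots> \<le> pos (concat Ass) y"
      using py by simp
    finally show ?thesis .
  qed
  show ?thesis
    using less[OF _ x y] less[OF _ y x] pos_concat(3)[OF wf x] pos_concat(3)[OF wf y]
    by (cases "n x" "n y" rule: linorder_cases) (auto simp: n_def)
qed

lemma local_emb_concat:
  assumes wf: "wf_list (map list_struct Ass)" "\<forall>As\<in>set Ass. wf_list As"
    and wf': "wf_list (map list_struct Bss)" "\<forall>As\<in>set Bss. wf_list As"
    and e: "local_emb (list_struct (map list_struct Ass)) (list_struct (map list_struct Bss)) X h"
  shows "local_emb (list_struct (concat Ass)) (list_struct (concat Bss)) X h"
proof -
  note e' = e[unfolded local_emb_list[OF wf(1) wf'(1)]]
  let ?n = "pos (map list_struct Ass)" and ?m = "pos (map list_struct Bss)"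
  have le: "?n x \<le> ?n y \<longleftrightarrow> ?m (h x) \<le> ?m (h y)" if "x \<in> X" "y \<in> X" for x y
    using e' that by blast
  have mem: "x \<in> universe (list_struct (map list_struct Ass))"
    "h x \<in> universe (list_struct (map list_struct Bss))" if "x \<in> X" for x
    using local_embD(4,5)[OF e that] by blast+
  have inner: "local_emb (list_struct (Ass ! ?n x)) (list_struct (Bss ! ?m (h x)))
      (X \<inter> universe (list_struct (Ass ! ?n x))) h" if x: "x \<in> X" for x
    using e' x pos_concat(1)[OF wf mem(1)[OF x]] pos_concat(1)[OF wf' mem(2)[OF x]]
    by (auto simp: item_def simp del: universe_list_struct dest!: bspec)
  have wfx: "wf_list (Ass ! ?n x)" "wf_list (Bss ! ?m (h x))" if x: "x \<in> X" for x
    using wf(2) wf'(2) pos_concat(1)[OF wf mem(1)[OF x]] pos_concat(1)[OF wf' mem(2)[OF x]] by simp_all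
  have same: "y \<in> universe (list_struct (Ass ! ?n x))" if "x \<in> X" "y \<in> X" "?n y = ?n x" for x y
    using pos_concat(2)[OF wf mem(1)[OF that(2)]] that(3) by simp
  show ?thesis
    unfolding local_emb_list[OF wf_list_concat[OF wf] wf_list_concat[OF wf']]
  proof (intro conjI ballI)
    fix x assume x: "x \<in> X"
    note px = pos_concat[OF wf mem(1)[OF x]] and px' = pos_concat[OF wf' mem(2)[OF x]]
    have "X \<inter> universe (item (Ass ! ?n x) x) \<subseteq>
        X \<inter> universe (list_struct (Ass ! ?n x)) \<inter> universe (item (Ass ! ?n x) x)"
      using pos_less(3)[OF wfx(1)[OF x] px(2)] by auto
    moreover have "local_emb (item (Ass ! ?n x) x) (item (Bss ! ?m (h x)) (h x))
       (X \<inter> universe (list_struct (Ass ! ?n x)) \<inter> universe (item (Ass ! ?n x) x)) h"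
      using inner[OF x, unfolded local_emb_list[OF wfx[OF x]]] x px(2) by blast
    ultimately show "local_emb (item (concat Ass) x) (item (concat Bss) (h x))
        (X \<inter> universe (item (concat Ass) x)) h"
      by (simp only: px(4) px'(4) local_emb_mono)
    fix y assume y: "y \<in> X"
    have eq: "?n x = ?n y \<longleftrightarrow> ?m (h x) = ?m (h y)"
      using le[OF x y] le[OF y x] by (metis order_antisym order_refl)
    have "pos (Ass ! ?n x) x \<le> pos (Ass ! ?n x) y \<longleftrightarrow>
      pos (Bss ! ?m (h x)) (h x) \<le> pos (Bss ! ?m (h x)) (h y)" if "?n y = ?n x"
      using inner[OF x, unfolded local_emb_list[OF wfx[OF x]]] same[OF x y that] same[OF x x] x y by blast
    then show "pos (concat Ass) x \<le> pos (concat Ass) y \<longleftrightarrow>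
        pos (concat Bss) (h x) \<le> pos (concat Bss) (h y)"
      using le[OF x y] le[OF y x] eq
      unfolding pos_concat_le[OF wf mem(1)[OF x] mem(1)[OF y]] pos_concat_le[OF wf' mem(2)[OF x] mem(2)[OF y]]
      by auto
  next
    show "X \<subseteq> universe (list_struct (concat Ass))" "h ` X \<subseteq> universe (list_struct (concat Bss))"
      using mem by auto
  qed
qed


section \<open>Interpretations as functions compatible with local embeddings\<close>

text \<open>The semantic counterpart of a quantifier-free interpretation. The classes are arbitrary
  sets of structures, since the models of a normal form can be a proper part of the class of a list
  type.\<close>

definition interp :: "'a rel_struct set \<Rightarrow> 'a rel_struct set \<Rightarrow> ('a rel_struct \<Rightarrow> 'a rel_struct) \<Rightarrow> bool" where
  "interp \<C> \<D> f \<longleftrightarrow> (\<forall>A\<in>\<C>. f A \<in> \<D> \<and> universe (f A) \<subseteq> universe A) \<and>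
     (\<forall>A\<in>\<C>. \<forall>B\<in>\<C>. \<forall>X h. local_emb A B X h \<longrightarrow> local_emb (f A) (f B) (X \<inter> universe (f A)) h)"

lemma interpI:
  assumes "\<And>A. A \<in> \<C> \<Longrightarrow> f A \<in> \<D> \<and> universe (f A) \<subseteq> universe A"
    "\<And>A B X h. A \<in> \<C> \<Longrightarrow> B \<in> \<C> \<Longrightarrow> local_emb A B X h \<Longrightarrow> local_emb (f A) (f B) (X \<inter> universe (f A)) h"
  shows "interp \<C> \<D> f"
  using assms unfolding interp_def by blast

lemma interpD:
  assumes "interp \<C> \<D> f"
  shows "\<And>A. A \<in> \<C> \<Longrightarrow> f A \<in> \<D>" "\<And>A. A \<in> \<C> \<Longrightarrow> universe (f A) \<subseteq> universe A"
    "\<And>A B X h. A \<in> \<C> \<Longrightarrow> B \<in> \<C> \<Longrightarrow> local_emb A B X h \<Longrightarrow> local_emb (f A) (f B) (X \<inter> universe (f A)) h"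
  using assms unfolding interp_def by blast+

text \<open>The backward direction is the forward one for the inverse embedding.\<close>

lemma interp_iff:
  assumes "interp \<C> \<D> f" "A \<in> \<C>" "B \<in> \<C>" "local_emb A B X h" "x \<in> X"
  shows "x \<in> universe (f A) \<longleftrightarrow> h x \<in> universe (f B)"
proof
  assume "x \<in> universe (f A)"
  then show "h x \<in> universe (f B)"
    using local_embD(5)[OF interpD(3)[OF assms(1-4)], of x] assms(5) by blast
next
  assume "h x \<in> universe (f B)"
  then show "x \<in> universe (f A)"
    using local_embD(5)[OF interpD(3)[OF assms(1,3,2) local_emb_inv[OF assms(4)]], of "h x"] assms(5)
      local_embD(3)[OF assms(4)] by simp
qed

lemma interp_cong:
  assumes "\<C> = \<C>'" "\<D> = \<D>'" "\<And>A. A \<in> \<C>' \<Longrightarrow> f A = g A"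
  shows "interp \<C> \<D> f \<longleftrightarrow> interp \<C>' \<D>' g"
  using assms unfolding interp_def by simp

lemma interp_subset: "interp \<C> \<D> f \<Longrightarrow> \<C>' \<subseteq> \<C> \<Longrightarrow> \<D> \<subseteq> \<D>' \<Longrightarrow> interp \<C>' \<D>' f"
  unfolding interp_def by blast

lemma interp_comp:
  assumes f: "interp \<C> \<D> f" and g: "interp \<D> \<E> g"
  shows "interp \<C> \<E> (g \<circ> f)"
proof (rule interpI)
  fix A assume "A \<in> \<C>"
  then show "(g \<circ> f) A \<in> \<E> \<and> universe ((g \<circ> f) A) \<subseteq> universe A"
    using interpD(1,2)[OF f, of A] interpD(1,2)[OF g, of "f A"] by auto
next
  fix A B X h assume "A \<in> \<C>" "B \<in> \<C>" "local_emb A B X h"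
  then have "local_emb (g (f A)) (g (f B)) (X \<inter> universe (f A) \<inter> universe (g (f A))) h"
    using f g by (blast intro: interpD)
  moreover have "X \<inter> universe (g (f A)) \<subseteq> X \<inter> universe (f A) \<inter> universe (g (f A))"
    using interpD(1,2)[OF f \<open>A \<in> \<C>\<close>] interpD(2)[OF g] by blast
  ultimately show "local_emb ((g \<circ> f) A) ((g \<circ> f) B) (X \<inter> universe ((g \<circ> f) A)) h"
    unfolding comp_def by (rule local_emb_mono)
qed

lemma interp_prodI:
  assumes wf: "\<And>A. A \<in> \<C> \<Longrightarrow> wf_struct A" "\<And>A. A \<in> \<D> \<Longrightarrow> wf_struct A"
    and 1: "\<And>A B. A \<in> \<C> \<Longrightarrow> B \<in> \<D> \<Longrightarrow> disj A B \<Longrightarrow>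
      f (prod_struct A B) \<in> \<E> \<and> universe (f (prod_struct A B)) \<subseteq> universe A \<union> universe B"
    and 2: "\<And>A B A' B' X h. A \<in> \<C> \<Longrightarrow> B \<in> \<D> \<Longrightarrow> disj A B \<Longrightarrow> A' \<in> \<C> \<Longrightarrow> B' \<in> \<D> \<Longrightarrow> disj A' B' \<Longrightarrow>
      X \<subseteq> universe A \<union> universe B \<Longrightarrow>
      local_emb A A' (X \<inter> universe A) h \<Longrightarrow> local_emb B B' (X \<inter> universe B) h \<Longrightarrow>
      local_emb (f (prod_struct A B)) (f (prod_struct A' B')) (X \<inter> universe (f (prod_struct A B))) h"
  shows "interp {prod_struct A B | A B. A \<in> \<C> \<and> B \<in> \<D> \<and> disj A B} \<E> f"
proof (rule interpI)
  fix A assume "A \<in> {prod_struct A B | A B. A \<in> \<C> \<and> B \<in> \<D> \<and> disj A B}"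
  with 1 show "f A \<in> \<E> \<and> universe (f A) \<subseteq> universe A"
    by fastforce
next
  fix P Q X h
  assume "P \<in> {prod_struct A B | A B. A \<in> \<C> \<and> B \<in> \<D> \<and> disj A B}"
    "Q \<in> {prod_struct A B | A B. A \<in> \<C> \<and> B \<in> \<D> \<and> disj A B}" and e: "local_emb P Q X h"
  then obtain A B A' B' where *: "A \<in> \<C>" "B \<in> \<D>" "disj A B" "A' \<in> \<C>" "B' \<in> \<D>" "disj A' B'"
    and P: "P = prod_struct A B" "Q = prod_struct A' B'"
    by blast
  have "X \<subseteq> universe A \<union> universe B \<and> local_emb A A' (X \<inter> universe A) h \<and> local_emb B B' (X \<inter> universe B) h"
    using e * wf unfolding P by (subst (asm) local_emb_prod) simp_all
  then show "local_emb (f P) (f Q) (X \<inter> universe (f P)) h"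
    unfolding P using 2 * by blast
qed

text \<open>No embedding leads from one side of a sum to the other, so compatibility is tested
  within each side only.\<close>

lemma interp_sum:
  "interp (inl_struct ` \<C> \<union> inr_struct ` \<D>) \<E> f \<longleftrightarrow>
    interp \<C> \<E> (\<lambda>A. f (inl_struct A)) \<and> interp \<D> \<E> (\<lambda>A. f (inr_struct A))"
  unfolding interp_def by (simp add: ball_Un) blast

lemma interp_id: "interp \<C> \<D> (\<lambda>A. A) \<longleftrightarrow> \<C> \<subseteq> \<D>"
  unfolding interp_def using local_emb_mono by blast

lemma interp_inl:
  "interp \<C> \<E> (\<lambda>A. inl_struct (f A)) \<longleftrightarrow> interp \<C> {B. inl_struct B \<in> \<E>} f"
  "interp \<C> \<E> inl_struct \<longleftrightarrow> inl_struct ` \<C> \<subseteq> \<E>"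
  using interp_id[of \<C> "{B. inl_struct B \<in> \<E>}"] by (auto simp: interp_def)

lemma interp_inr:
  "interp \<C> \<E> (\<lambda>A. inr_struct (f A)) \<longleftrightarrow> interp \<C> {B. inr_struct B \<in> \<E>} f"
  "interp \<C> \<E> inr_struct \<longleftrightarrow> inr_struct ` \<C> \<subseteq> \<E>"
  using interp_id[of \<C> "{B. inr_struct B \<in> \<E>}"] by (auto simp: interp_def)

lemma list_struct_in_structs:
  assumes "\<And>A. A \<in> set As \<Longrightarrow> A \<in> structs \<Sigma>" "sorted_wrt disj As"
  shows "list_struct As \<in> structs (Lists \<Sigma>)"
proof -
  have "items (structs \<Sigma>) (filter (\<lambda>A. universe A \<noteq> {}) As)"
    using assms by (auto simp: items_def sorted_wrt_filter)
  moreover have "list_struct As = list_struct (filter (\<lambda>A. universe A \<noteq> {}) As)"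
    using assms list_struct_nonempty by blast
  ultimately show ?thesis by auto
qed

section \<open>Derivable functions are interpretations\<close>

lemma structs_Prod: "structs (\<Gamma> \<otimes> \<Sigma>) = {prod_struct A B | A B. A \<in> structs \<Gamma> \<and> B \<in> structs \<Sigma> \<and> disj A B}"
  by simp

lemma prod_in_structs [intro]:
  "A \<in> structs \<Gamma> \<Longrightarrow> B \<in> structs \<Sigma> \<Longrightarrow> disj A B \<Longrightarrow> prod_struct A B \<in> structs (\<Gamma> \<otimes> \<Sigma>)"
  by auto

lemma interp_structs_prodI:
  assumes "\<And>A B. A \<in> structs \<Gamma> \<Longrightarrow> B \<in> structs \<Sigma> \<Longrightarrow> wf_struct A \<Longrightarrow> wf_struct B \<Longrightarrow> disj A B \<Longrightarrow>
      f (prod_struct A B) \<in> \<E> \<and> universe (f (prod_struct A B)) \<subseteq> universe A \<union> universe B"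
    and "\<And>A B A' B' X h. A \<in> structs \<Gamma> \<Longrightarrow> B \<in> structs \<Sigma> \<Longrightarrow> wf_struct A \<Longrightarrow> wf_struct B \<Longrightarrow> disj A B \<Longrightarrow>
      A' \<in> structs \<Gamma> \<Longrightarrow> B' \<in> structs \<Sigma> \<Longrightarrow> wf_struct A' \<Longrightarrow> wf_struct B' \<Longrightarrow> disj A' B' \<Longrightarrow>
      X \<subseteq> universe A \<union> universe B \<Longrightarrow>
      local_emb A A' (X \<inter> universe A) h \<Longrightarrow> local_emb B B' (X \<inter> universe B) h \<Longrightarrow>
      local_emb (f (prod_struct A B)) (f (prod_struct A' B')) (X \<inter> universe (f (prod_struct A B))) h"
  shows "interp (structs (\<Gamma> \<otimes> \<Sigma>)) \<E> f"
  unfolding structs_Prod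
proof (rule interp_prodI, goal_cases)
  case (3 A B)
  then show ?case by (intro assms(1)) (auto intro: wf_structs)
next
  case (4 A B A' B' X h)
  then show ?case by (intro assms(2)) (auto intro: wf_structs)
qed (auto intro: wf_structs)

lemma interp_structs_sum:
  "interp (structs (\<Gamma> \<oplus> \<Sigma>)) \<E> f \<longleftrightarrow>
    interp (structs \<Gamma>) \<E> (\<lambda>A. f (inl_struct A)) \<and> interp (structs \<Sigma>) \<E> (\<lambda>A. f (inr_struct A))"
  by (simp add: interp_sum)

lemma interp_structs_listI:
  fixes f :: "'a rel_struct \<Rightarrow> 'a rel_struct"
  assumes "\<And>As. items (structs \<Sigma>) As \<Longrightarrow> wf_list As \<Longrightarrow>
      f (list_struct As) \<in> \<E> \<and> universe (f (list_struct As)) \<subseteq> universe (list_struct As)"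
    and "\<And>As Bs X h. items (structs \<Sigma>) As \<Longrightarrow> wf_list As \<Longrightarrow> items (structs \<Sigma>) Bs \<Longrightarrow> wf_list Bs \<Longrightarrow>
      local_emb (list_struct As) (list_struct Bs) X h \<Longrightarrow>
      local_emb (f (list_struct As)) (f (list_struct Bs)) (X \<inter> universe (f (list_struct As))) h"
  shows "interp (structs (Lists \<Sigma>)) \<E> f"
proof (rule interpI)
  fix A :: "'a rel_struct" assume "A \<in> structs (Lists \<Sigma>)"
  then show "f A \<in> \<E> \<and> universe (f A) \<subseteq> universe A"
    using assms(1) items_wf_list by (auto simp del: universe_list_struct)
next
  fix A B :: "'a rel_struct" and X h
  assume "A \<in> structs (Lists \<Sigma>)" "B \<in> structs (Lists \<Sigma>)" and e: "local_emb A B X h"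
  then obtain As Bs where "A = list_struct As" "B = list_struct Bs"
      "items (structs \<Sigma>) As" "items (structs \<Sigma>) Bs"
    by auto
  with assms(2)[of As Bs X h] e show "local_emb (f A) (f B) (X \<inter> universe (f A)) h"
    by (simp add: items_wf_list)
qed

lemma items_rev [simp]: "items \<C> (rev As) \<longleftrightarrow> items \<C> As"
  by (auto simp: items_def sorted_wrt_rev Int_commute)

lemma items_append:
  "items \<C> (As @ Bs) \<longleftrightarrow> items \<C> As \<and> items \<C> Bs \<and> disj (list_struct As) (list_struct Bs)"
  by (auto simp: items_def sorted_wrt_append)

lemma items_disjD: "items \<C> As \<Longrightarrow> sorted_wrt disj As"
  by (auto simp: items_def)

lemma items_concat:
  assumes "\<And>As. As \<in> set Ass \<Longrightarrow> items \<C> As" "sorted_wrt disj (map list_struct Ass)"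
  shows "items \<C> (concat Ass)"
  using assms
proof (induction Ass)
  case (Cons As Ass)
  then have "disj (list_struct As) (list_struct (concat Ass))"
    by auto
  then show ?case
    using Cons by (simp add: items_append)
qed (simp add: items_def)

text \<open>A prime function only rearranges, tags or discards parts of its input. An embedding of
  inputs is therefore cut along the input constructors and glued along the output constructors by
  the criteria above.\<close>

lemma prime_interp:
  assumes "prime \<Sigma> \<Gamma> f"
  shows "interp (structs \<Sigma>) (structs \<Gamma>) f"
  using assms
proof cases
  case (prod_comm \<Gamma> \<Sigma>)
  show ?thesis
    unfolding prod_comm(1,2)
  proof (rule interp_structs_prodI, goal_cases)
    case (1 A B)
    then have "prod_struct B A \<in> structs (\<Sigma> \<otimes> \<Gamma>)"
      by (intro prod_in_structs) auto
    then show ?case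
      using prod_comm(3)[of A B] 1 by auto
  next
    case (2 A B A' B' X h)
    then show ?case
      using prod_comm(3)[of A B] prod_comm(3)[of A' B']
      by (auto simp: local_emb_prod Int_commute elim!: local_emb_mono)
  qed
next
  case (sum_comm \<Gamma> \<Sigma>)
  then show ?thesis
    by (auto simp add: interp_sum interp_inl interp_inr interp_id cong: interp_cong)
next
  case (prod_assoc_right_to_left \<Gamma> \<Sigma> \<Delta>)
  show ?thesis
    unfolding prod_assoc_right_to_left(1,2)
  proof (rule interp_structs_prodI, goal_cases)
    case (1 A B)
    then obtain B1 B2 where "B = prod_struct B1 B2" "B1 \<in> structs \<Sigma>" "B2 \<in> structs \<Delta>" "disj B1 B2"
      by auto
    with 1 prod_assoc_right_to_left(3)[of A B1 B2] show ?case
      by (fastforce simp: Int_Un_distrib Int_Un_distrib2)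
  next
    case (2 A B A' B' X h)
    then obtain B1 B2 where B: "B = prod_struct B1 B2" "B1 \<in> structs \<Sigma>" "B2 \<in> structs \<Delta>" "disj B1 B2"
      by auto
    from 2 obtain B1' B2' where B': "B' = prod_struct B1' B2'" "B1' \<in> structs \<Sigma>" "B2' \<in> structs \<Delta>" "disj B1' B2'"
      by auto
    note wf = B(2,3)[THEN wf_structs] B'(2,3)[THEN wf_structs]
    show ?case
      using 2 B B' wf prod_assoc_right_to_left(3)[of A B1 B2] prod_assoc_right_to_left(3)[of A' B1' B2']
      by (auto simp: local_emb_prod Int_Un_distrib Int_Un_distrib2 elim!: local_emb_mono)
  qed
next
  case (prod_assoc_left_to_right \<Gamma> \<Sigma> \<Delta>)
  show ?thesis
    unfolding prod_assoc_left_to_right(1,2)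
  proof (rule interp_structs_prodI, goal_cases)
    case (1 A B)
    then obtain A1 A2 where "A = prod_struct A1 A2" "A1 \<in> structs \<Gamma>" "A2 \<in> structs \<Sigma>" "disj A1 A2"
      by auto
    with 1 prod_assoc_left_to_right(3)[of A1 A2 B] show ?case
      by (fastforce simp: Int_Un_distrib Int_Un_distrib2)
  next
    case (2 A B A' B' X h)
    then obtain A1 A2 where A: "A = prod_struct A1 A2" "A1 \<in> structs \<Gamma>" "A2 \<in> structs \<Sigma>" "disj A1 A2"
      by auto
    from 2 obtain A1' A2' where A': "A' = prod_struct A1' A2'" "A1' \<in> structs \<Gamma>" "A2' \<in> structs \<Sigma>" "disj A1' A2'"
      by auto
    note wf = A(2,3)[THEN wf_structs] A'(2,3)[THEN wf_structs]
    show ?case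
      using 2 A A' wf prod_assoc_left_to_right(3)[of A1 A2 B] prod_assoc_left_to_right(3)[of A1' A2' B']
      by (auto simp: local_emb_prod Int_Un_distrib Int_Un_distrib2 elim!: local_emb_mono)
  qed
next
  case (sum_assoc_right_to_left \<Gamma> \<Sigma> \<Delta>)
  then show ?thesis
    by (auto simp add: interp_sum interp_inl interp_inr interp_id cong: interp_cong)
next
  case (sum_assoc_left_to_right \<Gamma> \<Sigma> \<Delta>)
  then show ?thesis
    by (auto simp add: interp_sum interp_inl interp_inr interp_id cong: interp_cong)
next
  case (distribute \<Gamma> \<Sigma> \<Delta>)
  show ?thesis
    unfolding distribute(1,2)
  proof (rule interp_structs_prodI, goal_cases)
    case (1 A B)
    then show ?case
      using distribute(3,4) by fastforce
  next
    case (2 A B A' B' X h)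
    note d = distribute(3)[OF 2(1) _ ] distribute(4)[OF 2(1)] distribute(3)[OF 2(6) _ ] distribute(4)[OF 2(6)]
    from 2 show ?case
      using d by (auto simp: local_emb_prod elim!: local_emb_mono)
  qed
next
  case (undistribute \<Gamma> \<Sigma> \<Delta>)
  show ?thesis
    unfolding undistribute(1,2) interp_structs_sum
  proof ((intro conjI; rule interp_structs_prodI), goal_cases)
    case (1 A B)
    then show ?case using undistribute(3)[of A B] by fastforce
  next
    case (2 A B A' B' X h)
    then show ?case
      using undistribute(3)[of A B] undistribute(3)[of A' B']
      by (auto simp: local_emb_prod elim!: local_emb_mono)
  next
    case (3 A B)
    then show ?case using undistribute(4)[of A B] by fastforce
  next
    case (4 A B A' B' X h)
    then show ?case
      using undistribute(4)[of A B] undistribute(4)[of A' B']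
      by (auto simp: local_emb_prod elim!: local_emb_mono)
  qed
next
  case (project_first \<Gamma>\<^sub>2)
  then show ?thesis
    by (simp only:) (rule interp_structs_prodI; auto)
next
  case (project_second \<Gamma>\<^sub>1)
  then show ?thesis
    by (simp only:) (rule interp_structs_prodI; auto)
next
  case (coproject_first \<Gamma>\<^sub>2)
  then show ?thesis
    by (auto simp add: interp_inl interp_id cong: interp_cong)
next
  case (coproject_second \<Gamma>\<^sub>1)
  then show ?thesis
    by (auto simp add: interp_inr interp_id cong: interp_cong)
next
  case codiagonal
  then show ?thesis
    by (auto simp add: interp_sum interp_id cong: interp_cong)
next
  case (append \<Sigma>)
  show ?thesis
    unfolding append(1,2)
  proof (rule interp_structs_prodI, goal_cases)
    case (1 A B)
    then obtain As where As: "A = list_struct As" "items (structs \<Sigma>) As" by auto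
    have "list_struct (As @ [B]) \<in> structs (Lists \<Sigma>)"
      using 1 As by (intro list_struct_in_structs) (auto simp: sorted_wrt_append items_def)
    then show ?case
      using append(3)[OF As(2), of B] 1 As by auto
  next
    case (2 A B A' B' X h)
    then obtain As As' where As: "A = list_struct As" "items (structs \<Sigma>) As"
      "A' = list_struct As'" "items (structs \<Sigma>) As'" by auto
    have "wf_list (As @ [B])" "wf_list (As' @ [B'])"
      using 2 As by (auto simp: wf_list_append items_wf_list)
    moreover have "local_emb (list_struct [B]) (list_struct [B']) (X \<inter> universe B) h"
      using 2 by (intro local_emb_singleton) auto
    ultimately have "local_emb (list_struct (As @ [B])) (list_struct (As' @ [B'])) X h"
      using 2 As by (intro local_emb_append) auto
    then have "local_emb (f (prod_struct A B)) (f (prod_struct A' B')) X h"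
      using append(3)[OF As(2), of B] append(3)[OF As(4), of B'] 2 As by auto
    then show ?case
      by (rule local_emb_mono) blast
  qed
next
  case (reverse \<Sigma>)
  show ?thesis
    unfolding reverse(1,2)
    by (rule interp_structs_listI)
      (auto simp: reverse(3) simp del: universe_list_struct intro!: local_emb_rev elim!: local_emb_mono,
       auto)
next
  case (concat \<Sigma>)
  \<comment> \<open>Every item is itself a list structure; choosing its items yields the list of
    lists that the defining equation of \<open>concat\<close> speaks about.\<close>
  have ex: "\<exists>Ass. As = map list_struct Ass \<and> (\<forall>As\<in>set Ass. items (structs \<Sigma>) As)"
    if "items (structs (Lists \<Sigma>)) As" for As
  proof -
    have "\<forall>A\<in>set As. \<exists>L. A = list_struct L \<and> items (structs \<Sigma>) L"
      using that by (auto simp: items_def)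
    then obtain g where "\<forall>A\<in>set As. A = list_struct (g A) \<and> items (structs \<Sigma>) (g A)"
      by metis
    then show ?thesis
      by (intro exI[of _ "map g As"]) (auto simp: map_idI)
  qed
  show ?thesis
    unfolding concat(1,2)
  proof (rule interp_structs_listI, goal_cases)
    case (1 As)
    from ex[OF 1(1)] obtain Ass where Ass: "As = map list_struct Ass" "\<forall>As\<in>set Ass. items (structs \<Sigma>) As"
      by blast
    have "items (structs \<Sigma>) (List.concat Ass)"
      using Ass 1(1) by (intro items_concat) (auto intro: items_disjD)
    then show ?case
      using concat(3)[of Ass] Ass 1 by auto
  next
    case (2 As Bs X h)
    from ex[OF 2(1)] obtain Ass where Ass: "As = map list_struct Ass" "\<forall>As\<in>set Ass. items (structs \<Sigma>) As"
      by blast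
    from ex[OF 2(3)] obtain Bss where Bss: "Bs = map list_struct Bss" "\<forall>As\<in>set Bss. items (structs \<Sigma>) As"
      by blast
    have "local_emb (list_struct (List.concat Ass)) (list_struct (List.concat Bss)) X h"
      using Ass Bss 2 by (intro local_emb_concat) (auto intro: items_wf_list)
    then have "local_emb (f (list_struct As)) (f (list_struct Bs)) X h"
      using concat(3)[of Ass] concat(3)[of Bss] 2 Ass Bss by auto
    then show ?case by (rule local_emb_mono) blast
  qed
next
  case (create_empty \<Gamma>)
  have "list_struct [] \<in> structs (Lists \<Gamma>)"
    by (rule list_struct_in_structs) auto
  moreover have wf: "wf_struct (list_struct [] :: 'a rel_struct)"
    by (simp add: wf_list_def)
  moreover have "local_emb (list_struct []) (list_struct [] :: 'a rel_struct) {} h" for h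
    by (simp add: local_emb_list wf_list_def)
  ultimately show ?thesis
    unfolding create_empty(1) using create_empty(2)
    by (intro interpI) (auto simp: local_emb_prod wf_structs simp del: structs.simps
        elim!: local_emb_mono dest: local_embD(1))
next
  case (list_distribute \<Sigma> \<Gamma>)
  have ex: "\<exists>ABs. As = map (\<lambda>(A, B). prod_struct A B) ABs \<and>
      (\<forall>(A, B)\<in>set ABs. A \<in> structs \<Sigma> \<and> B \<in> structs \<Gamma> \<and> disj A B)"
    if "items (structs (\<Sigma> \<otimes> \<Gamma>)) As" for As
  proof -
    have "\<forall>P\<in>set As. \<exists>AB. P = (\<lambda>(A, B). prod_struct A B) AB \<and> fst AB \<in> structs \<Sigma> \<and> snd AB \<in> structs \<Gamma> \<and>
        disj (fst AB) (snd AB)"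
      using that by (force simp: items_def)
    then obtain g where g: "\<forall>P\<in>set As. P = (\<lambda>(A, B). prod_struct A B) (g P) \<and> fst (g P) \<in> structs \<Sigma> \<and>
        snd (g P) \<in> structs \<Gamma> \<and> disj (fst (g P)) (snd (g P))"
      by metis
    then have "map (\<lambda>(A, B). prod_struct A B) (map g As) = As"
      by (auto intro!: map_idI)
    with g show ?thesis
      by (intro exI[of _ "map g As"]) (simp add: case_prod_beta)
  qed
  \<comment> \<open>Different pairs are disjoint and so are the two components of one pair; hence
    the unzipped lists are disjoint. Their items may be empty, which
    \<open>list_struct_in_structs\<close> tolerates.\<close>
  have facts: "wf_list (map fst ABs) \<and> wf_list (map snd ABs) \<and>
      disj (list_struct (map fst ABs)) (list_struct (map snd ABs)) \<and>
      list_struct (map fst ABs) \<in> structs (Lists \<Sigma>) \<and> list_struct (map snd ABs) \<in> structs (Lists \<Gamma>)"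
    if "wf_list (map (\<lambda>(A, B). prod_struct A B) ABs)"
      "\<forall>(A, B)\<in>set ABs. A \<in> structs \<Sigma> \<and> B \<in> structs \<Gamma> \<and> disj A B" for ABs
  proof -
    have "sorted_wrt disj (map fst ABs)" "sorted_wrt disj (map snd ABs)"
      using that(1) by (auto simp: wf_list_def sorted_wrt_map elim!: sorted_wrt_mono_rel[rotated])
    moreover from this have "wf_list (map fst ABs)" "wf_list (map snd ABs)"
      using that(2) wf_structs[of _ \<Sigma>] wf_structs[of _ \<Gamma>] by (fastforce simp: wf_list_def)+
    moreover have "disj (list_struct (map fst ABs)) (list_struct (map snd ABs))"
      using that
    proof (induction ABs)
      case (Cons AB ABs)
      then show ?case by (cases AB) (fastforce simp: wf_list_def)
    qed simp
    moreover have "list_struct (map fst ABs) \<in> structs (Lists \<Sigma>)" "list_struct (map snd ABs) \<in> structs (Lists \<Gamma>)"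
      using that(2) calculation(1,2) by (intro list_struct_in_structs; auto)+
    ultimately show ?thesis by blast
  qed
  show ?thesis
    unfolding list_distribute(1,2)
  proof (rule interp_structs_listI, goal_cases)
    case (1 As)
    from ex[OF 1(1)] obtain ABs where ABs: "As = map (\<lambda>(A, B). prod_struct A B) ABs"
      "\<forall>(A, B)\<in>set ABs. A \<in> structs \<Sigma> \<and> B \<in> structs \<Gamma> \<and> disj A B" by blast
    have "f (list_struct As) = prod_struct (list_struct (map fst ABs)) (list_struct (map snd ABs))"
      using list_distribute(3)[of ABs] ABs 1 by simp
    moreover have "universe (list_struct (map fst ABs)) \<union> universe (list_struct (map snd ABs)) \<subseteq> universe (list_struct As)"
      using ABs(1) by force
    ultimately show ?case
      using facts[of ABs] ABs 1 by (auto simp del: structs.simps universe_list_struct)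
  next
    case (2 As Bs X h)
    from ex[OF 2(1)] obtain ABs where ABs: "As = map (\<lambda>(A, B). prod_struct A B) ABs"
      "\<forall>(A, B)\<in>set ABs. A \<in> structs \<Sigma> \<and> B \<in> structs \<Gamma> \<and> disj A B" by blast
    from ex[OF 2(3)] obtain CDs where CDs: "Bs = map (\<lambda>(A, B). prod_struct A B) CDs"
      "\<forall>(A, B)\<in>set CDs. A \<in> structs \<Sigma> \<and> B \<in> structs \<Gamma> \<and> disj A B" by blast
    note F = facts[OF 2(2)[unfolded ABs(1)] ABs(2)] and F' = facts[OF 2(4)[unfolded CDs(1)] CDs(2)]
    have e: "local_emb (fst AB) (fst CD) (Z \<inter> universe (fst AB)) h \<and> local_emb (snd AB) (snd CD) (Z \<inter> universe (snd AB)) h"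
      if "AB \<in> set ABs" "CD \<in> set CDs"
        "local_emb ((\<lambda>(A, B). prod_struct A B) AB) ((\<lambda>(A, B). prod_struct A B) CD) Z h" for AB CD Z
    proof -
      obtain A B C D where AB: "AB = (A, B)" "CD = (C, D)"
        by (cases AB; cases CD) auto
      then have *: "A \<in> structs \<Sigma>" "B \<in> structs \<Gamma>" "disj A B" "C \<in> structs \<Sigma>" "D \<in> structs \<Gamma>" "disj C D"
        using that(1,2) ABs(2) CDs(2) by auto
      note wf = *(1,2,4,5)[THEN wf_structs]
      show ?thesis
        using that(3) local_emb_prod[OF wf *(3,6)] by (simp add: AB)
    qed
    have "local_emb (list_struct (map fst ABs)) (list_struct (map fst CDs)) (X \<inter> universe (list_struct (map fst ABs))) h"
    proof (rule local_emb_map[where g = "\<lambda>(A, B). prod_struct A B"])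
      fix C C' Z assume *: "C \<in> set ABs" "C' \<in> set CDs" "Z \<subseteq> universe (fst C)"
        "local_emb ((\<lambda>(A, B). prod_struct A B) C) ((\<lambda>(A, B). prod_struct A B) C') Z h"
      show "local_emb (fst C) (fst C') Z h"
        using e[OF *(1,2,4)] *(3) by (simp add: inf.absorb1)
    qed (use 2 F F' ABs(1) CDs(1) in auto)
    moreover have "local_emb (list_struct (map snd ABs)) (list_struct (map snd CDs)) (X \<inter> universe (list_struct (map snd ABs))) h"
    proof (rule local_emb_map[where g = "\<lambda>(A, B). prod_struct A B"])
      fix C C' Z assume *: "C \<in> set ABs" "C' \<in> set CDs" "Z \<subseteq> universe (snd C)"
        "local_emb ((\<lambda>(A, B). prod_struct A B) C) ((\<lambda>(A, B). prod_struct A B) C') Z h"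
      show "local_emb (snd C) (snd C') Z h"
        using e[OF *(1,2,4)] *(3) by (simp add: inf.absorb1)
    qed (use 2 F F' ABs(1) CDs(1) in auto)
    ultimately have "local_emb (prod_struct (list_struct (map fst ABs)) (list_struct (map snd ABs)))
       (prod_struct (list_struct (map fst CDs)) (list_struct (map snd CDs)))
       (X \<inter> universe (prod_struct (list_struct (map fst ABs)) (list_struct (map snd ABs)))) h"
      using F F' by (subst local_emb_prod) (auto elim!: local_emb_mono simp del: universe_list_struct)
    then show ?case
      using list_distribute(3)[of ABs] list_distribute(3)[of CDs] ABs CDs 2 by simp
  qed
qed

lemma derivable_interp:
  assumes "derivable \<Sigma> \<Gamma> f"
  shows "interp (structs \<Sigma>) (structs \<Gamma>) f"
  using assms
proof induction
  case (prime \<Sigma> \<Gamma> f)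
  then show ?case by (rule prime_interp)
next
  case (compose \<Gamma> \<Sigma> f \<Delta> g)
  then show ?case by (blast intro: interp_comp)
next
  case (prod_functor \<Gamma>\<^sub>1 \<Sigma>\<^sub>1 f\<^sub>1 \<Gamma>\<^sub>2 \<Sigma>\<^sub>2 f\<^sub>2 g)
  note f1 = prod_functor.IH(1) and f2 = prod_functor.IH(2) and g = prod_functor.hyps(3)
  show ?case
  proof (rule interp_structs_prodI, goal_cases)
    case (1 A B)
    then have "f\<^sub>1 A \<in> structs \<Sigma>\<^sub>1" "f\<^sub>2 B \<in> structs \<Sigma>\<^sub>2" "universe (f\<^sub>1 A) \<subseteq> universe A" "universe (f\<^sub>2 B) \<subseteq> universe B"
      using interpD(1,2)[OF f1] interpD(1,2)[OF f2] by blast+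
    then show ?case
      using 1 g[of A B] by fastforce
  next
    case (2 A B A' B' X h)
    have *: "f\<^sub>1 C \<in> structs \<Sigma>\<^sub>1" "wf_struct (f\<^sub>1 C)" "universe (f\<^sub>1 C) \<subseteq> universe C" if "C \<in> structs \<Gamma>\<^sub>1" for C
      using interpD(1,2)[OF f1 that] by (auto intro: wf_structs)
    have **: "f\<^sub>2 C \<in> structs \<Sigma>\<^sub>2" "wf_struct (f\<^sub>2 C)" "universe (f\<^sub>2 C) \<subseteq> universe C" if "C \<in> structs \<Gamma>\<^sub>2" for C
      using interpD(1,2)[OF f2 that] by (auto intro: wf_structs)
    have "disj (f\<^sub>1 A) (f\<^sub>2 B)" "disj (f\<^sub>1 A') (f\<^sub>2 B')"
      using 2 *(3) **(3) by blast+
    moreover have "local_emb (f\<^sub>1 A) (f\<^sub>1 A') (X \<inter> universe (f\<^sub>1 A)) h"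
      using interpD(3)[OF f1 2(1,6,12)] *(3)[OF 2(1)] by (elim local_emb_mono) blast
    moreover have "local_emb (f\<^sub>2 B) (f\<^sub>2 B') (X \<inter> universe (f\<^sub>2 B)) h"
      using interpD(3)[OF f2 2(2,7,13)] **(3)[OF 2(2)] by (elim local_emb_mono) blast
    ultimately show ?case
      using 2 * ** g[of A B] g[of A' B']
      by (auto simp: local_emb_prod elim!: local_emb_mono)
  qed
next
  case (sum_functor \<Gamma>\<^sub>1 \<Sigma>\<^sub>1 f\<^sub>1 \<Gamma>\<^sub>2 \<Sigma>\<^sub>2 f\<^sub>2 g)
  have "interp (structs \<Gamma>\<^sub>1) (structs (\<Sigma>\<^sub>1 \<oplus> \<Sigma>\<^sub>2)) (\<lambda>A. inl_struct (f\<^sub>1 A))"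
    unfolding interp_inl by (rule interp_subset[OF sum_functor.IH(1)]) auto
  moreover have "interp (structs \<Gamma>\<^sub>2) (structs (\<Sigma>\<^sub>1 \<oplus> \<Sigma>\<^sub>2)) (\<lambda>A. inr_struct (f\<^sub>2 A))"
    unfolding interp_inr by (rule interp_subset[OF sum_functor.IH(2)]) auto
  ultimately show ?case
    unfolding interp_structs_sum
    by (intro conjI iffD2[OF interp_cong[OF refl refl sum_functor.hyps(3)]]
        iffD2[OF interp_cong[OF refl refl sum_functor.hyps(4)]])
next
  case (list_functor \<Gamma> \<Sigma> f g)
  note f = interpD[OF list_functor.IH] and g = list_functor.hyps(2)
  \<comment> \<open>Universes only shrink under \<open>f\<close>, so images of disjoint items are
    disjoint; they may be empty, hence \<open>wf_list\<close> rather than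
    \<open>items\<close>.\<close>
  have wf: "wf_list (map f As)" if "items (structs \<Gamma>) As" for As
  proof -
    have As: "A \<in> structs \<Gamma>" if "A \<in> set As" for A
      using \<open>items (structs \<Gamma>) As\<close> that by (auto simp: items_def)
    have "sorted_wrt (\<lambda>A B. disj (f A) (f B)) As"
    proof (rule sorted_wrt_mono_rel)
      show "sorted_wrt disj As"
        using that by (simp add: items_def)
      show "disj (f A) (f B)" if "A \<in> set As" "B \<in> set As" "disj A B" for A B
        using f(2)[OF As[OF that(1)]] f(2)[OF As[OF that(2)]] that(3) by blast
    qed
    then show ?thesis
      using f(1)[OF As] by (auto simp: wf_list_def sorted_wrt_map intro: wf_structs)
  qed
  show ?case
  proof (rule interp_structs_listI, goal_cases)
    case (1 As)
    have "list_struct (map f As) \<in> structs (Lists \<Sigma>)"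
      using 1 wf[OF 1(1)] f(1) by (intro list_struct_in_structs) (auto simp: items_def wf_list_def)
    moreover have "universe (list_struct (map f As)) \<subseteq> universe (list_struct As)"
      using f(2) 1(1) by (force simp: items_def)
    ultimately show ?case
      using g[OF 1(1)] by simp
  next
    case (2 As Bs X h)
    have "local_emb (list_struct (map f As)) (list_struct (map f Bs)) (X \<inter> universe (list_struct (map f As))) h"
    proof (rule local_emb_map[where g = "\<lambda>A. A"])
      fix C C' Z assume *: "C \<in> set As" "C' \<in> set Bs" "Z \<subseteq> universe (f C)" "local_emb C C' Z h"
      then have "C \<in> structs \<Gamma>" "C' \<in> structs \<Gamma>"
        using 2 by (auto simp: items_def)
      from f(3)[OF this *(4)] *(3) show "local_emb (f C) (f C') Z h"
        by (simp add: inf.absorb1)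
    qed (use 2 wf f(2) in \<open>auto simp: items_def\<close>)
    then show ?case
      using g 2 by simp
  qed
qed

section \<open>Derived combinators\<close>

text \<open>This and the next definitions invert the constructors by total functions, so that
  derived functions can be written as explicit terms instead of being specified by their values on
  the input class.\<close>

definition fst_part :: "'a rel_struct \<Rightarrow> 'a rel_struct" where
  "fst_part X = \<lparr>universe = {x \<in> universe X. [x] \<in> rel X InFirst}, rel = (\<lambda>R. rel X (ProdL R))\<rparr>"

definition snd_part :: "'a rel_struct \<Rightarrow> 'a rel_struct" where
  "snd_part X = \<lparr>universe = {x \<in> universe X. [x] \<notin> rel X InFirst}, rel = (\<lambda>R. rel X (ProdR R))\<rparr>"

definition un_inl :: "'a rel_struct \<Rightarrow> 'a rel_struct" where
  "un_inl X = \<lparr>universe = universe X, rel = (\<lambda>R. rel X (SumL R))\<rparr>"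

definition un_inr :: "'a rel_struct \<Rightarrow> 'a rel_struct" where
  "un_inr X = \<lparr>universe = universe X, rel = (\<lambda>R. rel X (SumR R))\<rparr>"

text \<open>The decomposition is unique by \<open>list_struct_inject\<close>; the type argument
  fixes what counts as an item.\<close>

definition un_list :: "list_type \<Rightarrow> 'a rel_struct \<Rightarrow> 'a rel_struct list" where
  "un_list \<Sigma> X = (SOME As. items (structs \<Sigma>) As \<and> X = list_struct As)"

lemma fst_part_prod [simp]: "fst_part (prod_struct A B) = A"
  by (rule rel_struct.equality) (auto simp: fst_part_def)

lemma snd_part_prod [simp]: "disj A B \<Longrightarrow> snd_part (prod_struct A B) = B"
  by (rule rel_struct.equality) (auto simp: snd_part_def)

lemma un_inl_inl [simp]: "un_inl (inl_struct A) = A"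
  by (rule rel_struct.equality) (auto simp: un_inl_def)

lemma un_inr_inr [simp]: "un_inr (inr_struct A) = A"
  by (rule rel_struct.equality) (auto simp: un_inr_def)

lemma un_list_list [simp]: "items (structs \<Sigma>) As \<Longrightarrow> un_list \<Sigma> (list_struct As) = As"
  unfolding un_list_def by (rule some_equality) (auto intro: list_struct_inject)

definition prod_map :: "('a rel_struct \<Rightarrow> 'a rel_struct) \<Rightarrow> ('a rel_struct \<Rightarrow> 'a rel_struct) \<Rightarrow>
    'a rel_struct \<Rightarrow> 'a rel_struct" where
  "prod_map f g X = prod_struct (f (fst_part X)) (g (snd_part X))"

definition sum_case :: "('a rel_struct \<Rightarrow> 'a rel_struct) \<Rightarrow> ('a rel_struct \<Rightarrow> 'a rel_struct) \<Rightarrow>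
    'a rel_struct \<Rightarrow> 'a rel_struct" where
  "sum_case f g X = (if [] \<in> rel X IsLeft then f (un_inl X) else g (un_inr X))"

definition list_map :: "list_type \<Rightarrow> ('a rel_struct \<Rightarrow> 'a rel_struct) \<Rightarrow> 'a rel_struct \<Rightarrow> 'a rel_struct" where
  "list_map \<Sigma> f X = list_struct (map f (un_list \<Sigma> X))"

lemma prod_map_prod [simp]: "disj A B \<Longrightarrow> prod_map f g (prod_struct A B) = prod_struct (f A) (g B)"
  by (simp add: prod_map_def)

lemma sum_case_simps [simp]: "sum_case f g (inl_struct A) = f A" "sum_case f g (inr_struct A) = g A"
  by (simp_all add: sum_case_def)

lemma derivable_cong:
  assumes f: "derivable \<Sigma> \<Gamma> f" and eq: "\<And>A. A \<in> structs \<Sigma> \<Longrightarrow> f A = f' A"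
  shows "derivable \<Sigma> \<Gamma> f'"
proof -
  text \<open>
    The derivation rules leave values outside the class of input structures open, but composition
    does not. The values of \<open>f'\<close> outside the class are therefore passed through the intermediate
    type \<open>\<Gamma> \<oplus> \<Gamma>\<close>, encoded as objects \<open>junk B\<close> that are not structures of this type.
  \<close>
  define junk :: "'a rel_struct \<Rightarrow> 'a rel_struct" where
    "junk = (\<lambda>B. \<lparr>universe = universe B, rel = (\<lambda>R. case R of SumL R' \<Rightarrow> rel B R' | IsLeft \<Rightarrow> {[undefined]} | _ \<Rightarrow> {})\<rparr>)"
  define g where
    "g = (\<lambda>X. if \<exists>A. X = inl_struct A \<and> A \<notin> structs \<Sigma> then junk (f' (un_inl X))
       else sum_case (\<lambda>A. inl_struct (f A)) (\<lambda>A. inr_struct (f A)) X)"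
  define c where
    "c = (\<lambda>X. if X \<in> structs (\<Gamma> \<oplus> \<Gamma>) then sum_case (\<lambda>A. A) (\<lambda>A. A) X else un_inl X :: 'a rel_struct)"
  have "g (inl_struct A) = inl_struct (f A)" if "A \<in> structs \<Sigma>" for A
    using that by (auto simp: g_def dest: inl_struct_inject)
  moreover have "g (inr_struct A) = inr_struct (f A)" for A
    by (simp add: g_def inl_struct_neq_inr_struct[symmetric])
  ultimately have "derivable (\<Sigma> \<oplus> \<Sigma>) (\<Gamma> \<oplus> \<Gamma>) g"
    using f by (intro sum_functor) auto
  moreover have "derivable \<Sigma> (\<Sigma> \<oplus> \<Sigma>) inl_struct"
    by (intro derivable.prime coproject_first) simp
  moreover have "derivable (\<Gamma> \<oplus> \<Gamma>) \<Gamma> c"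
    by (intro derivable.prime codiagonal) (auto simp: c_def)
  ultimately have "derivable \<Sigma> \<Gamma> (c \<circ> (g \<circ> inl_struct))"
    by (intro derivable.compose)
  moreover have "(c \<circ> (g \<circ> inl_struct)) A = f' A" for A
  proof (cases "A \<in> structs \<Sigma>")
    case True
    then have "g (inl_struct A) = inl_struct (f A)" "f A \<in> structs \<Gamma>"
      using interpD(1)[OF derivable_interp[OF f]] by (auto simp: g_def dest: inl_struct_inject)
    with True show ?thesis by (simp add: c_def eq)
  next
    case False
    then have "g (inl_struct A) = junk (f' A)"
      by (auto simp: g_def)
    \<comment> \<open>\<open>IsLeft\<close> has arity 0, whereas \<open>junk\<close> puts a tuple of
      length one into it.\<close>
    moreover have "junk (f' A) \<notin> structs (\<Gamma> \<oplus> \<Gamma>)"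
      using rel_of_structs[of "junk (f' A)" "\<Gamma> \<oplus> \<Gamma>" "[undefined]" IsLeft] by (auto simp: junk_def)
    moreover have "un_inl (junk B) = B" for B
      by (rule rel_struct.equality) (auto simp: un_inl_def junk_def)
    ultimately show ?thesis by (simp add: c_def del: structs.simps)
  qed
  ultimately show ?thesis
    by (metis ext)
qed

section \<open>Basic derivable functions\<close>

lemma derivable_comp:
  assumes "derivable \<Gamma> \<Sigma> f" "derivable \<Sigma> \<Delta> g"
  shows "derivable \<Gamma> \<Delta> (\<lambda>A. g (f A))"
  using derivable.compose[OF assms] by (simp add: comp_def)

lemma derivable_in: "derivable \<Sigma> \<Gamma> f \<Longrightarrow> A \<in> structs \<Sigma> \<Longrightarrow> f A \<in> structs \<Gamma>"
  and derivable_sub: "derivable \<Sigma> \<Gamma> f \<Longrightarrow> A \<in> structs \<Sigma> \<Longrightarrow> universe (f A) \<subseteq> universe A"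
  using derivable_interp interpD(1,2) by blast+

lemma derivable_fst: "derivable (\<Gamma> \<otimes> \<Sigma>) \<Gamma> fst_part"
  by (intro derivable.prime project_first) simp

lemma derivable_snd: "derivable (\<Gamma> \<otimes> \<Sigma>) \<Sigma> snd_part"
  by (intro derivable.prime project_second) simp

lemma derivable_nil: "derivable \<Sigma> (\<Sigma> \<otimes> Lists \<Gamma>) (\<lambda>A. prod_struct A (list_struct []))"
  by (intro derivable.prime create_empty) simp

text \<open>The identity is not among the prime functions: an empty list is created and projected
  away again. The other projection yields the constantly empty list.\<close>

lemma derivable_id: "derivable \<Sigma> \<Sigma> (\<lambda>A. A)"
  using derivable_comp[OF derivable_nil derivable_fst] by simp

lemma derivable_const_nil: "derivable \<Sigma> (Lists \<Gamma>) (\<lambda>_. list_struct [])"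
  using derivable_comp[OF derivable_nil derivable_snd] by simp

lemma derivable_prod_map:
  "derivable \<Gamma>\<^sub>1 \<Sigma>\<^sub>1 f \<Longrightarrow> derivable \<Gamma>\<^sub>2 \<Sigma>\<^sub>2 g \<Longrightarrow> derivable (\<Gamma>\<^sub>1 \<otimes> \<Gamma>\<^sub>2) (\<Sigma>\<^sub>1 \<otimes> \<Sigma>\<^sub>2) (prod_map f g)"
  by (rule derivable.prod_functor) auto

lemma derivable_inl: "derivable \<Sigma> (\<Sigma> \<oplus> \<Gamma>) inl_struct"
  and derivable_inr: "derivable \<Sigma> (\<Gamma> \<oplus> \<Sigma>) inr_struct"
  by (intro derivable.prime coproject_first coproject_second; simp)+

lemma derivable_sum_case:
  assumes "derivable \<Gamma>\<^sub>1 \<Sigma> f" "derivable \<Gamma>\<^sub>2 \<Sigma> g"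
  shows "derivable (\<Gamma>\<^sub>1 \<oplus> \<Gamma>\<^sub>2) \<Sigma> (sum_case f g)"
proof -
  have "derivable (\<Gamma>\<^sub>1 \<oplus> \<Gamma>\<^sub>2) (\<Sigma> \<oplus> \<Sigma>) (sum_case (\<lambda>A. inl_struct (f A)) (\<lambda>A. inr_struct (g A)))"
    using assms by (rule derivable.sum_functor) auto
  moreover have "derivable (\<Sigma> \<oplus> \<Sigma>) \<Sigma> (sum_case (\<lambda>A. A) (\<lambda>A. A))"
    by (intro derivable.prime codiagonal) auto
  ultimately show ?thesis
    by (rule derivable_comp[THEN derivable_cong]) auto
qed

lemma derivable_list_map: "derivable \<Gamma> \<Sigma> f \<Longrightarrow> derivable (Lists \<Gamma>) (Lists \<Sigma>) (list_map \<Gamma> f)"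
  by (rule derivable.list_functor) (auto simp: list_map_def)

text \<open>Lists in which items with empty universe are allowed; as structures they are equal to lists without.\<close>

definition weak_items :: "'a rel_struct set \<Rightarrow> 'a rel_struct list \<Rightarrow> bool" where
  "weak_items \<C> As \<longleftrightarrow> set As \<subseteq> \<C> \<and> sorted_wrt disj As"

abbreviation drop_empty :: "'a rel_struct list \<Rightarrow> 'a rel_struct list" where
  "drop_empty As \<equiv> filter (\<lambda>A. universe A \<noteq> {}) As"

lemma items_drop_empty: "weak_items \<C> As \<Longrightarrow> items \<C> (drop_empty As)"
  by (auto simp: weak_items_def items_def sorted_wrt_filter)

lemma list_struct_drop_empty: "weak_items (structs \<Sigma>) As \<Longrightarrow> list_struct (drop_empty As) = list_struct As"
  by (rule list_struct_nonempty[symmetric]) (auto simp: weak_items_def)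

lemma weak_items_wf: "weak_items (structs \<Sigma>) As \<Longrightarrow> wf_list As"
  by (auto simp: weak_items_def wf_list_def intro: wf_structs)

lemma items_weak: "items \<C> As \<Longrightarrow> weak_items \<C> As"
  by (auto simp: weak_items_def items_def)

lemma weak_items_in_structs: "weak_items (structs \<Sigma>) As \<Longrightarrow> list_struct As \<in> structs (Lists \<Sigma>)"
  by (rule list_struct_in_structs) (auto simp: weak_items_def)

lemma weak_items_append:
  "weak_items \<C> (As @ Bs) \<longleftrightarrow> weak_items \<C> As \<and> weak_items \<C> Bs \<and> disj (list_struct As) (list_struct Bs)"
  by (auto simp: weak_items_def sorted_wrt_append) blast

lemma weak_items_Nil [simp]: "weak_items \<C> []"
  and weak_items_singleton [simp]: "weak_items \<C> [A] \<longleftrightarrow> A \<in> \<C>"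
  by (auto simp: weak_items_def)

lemma weak_items_map:
  assumes As: "weak_items \<C> As" and f: "\<And>A. A \<in> \<C> \<Longrightarrow> f A \<in> \<D> \<and> universe (f A) \<subseteq> universe A"
  shows "weak_items \<D> (map f As)"
proof -
  have mem: "A \<in> \<C>" if "A \<in> set As" for A
    using As that by (auto simp: weak_items_def)
  have "sorted_wrt (\<lambda>A B. disj (f A) (f B)) As"
  proof (rule sorted_wrt_mono_rel)
    show "sorted_wrt disj As"
      using As by (simp add: weak_items_def)
    show "disj (f A) (f B)" if "A \<in> set As" "B \<in> set As" "disj A B" for A B
      using f[OF mem[OF that(1)]] f[OF mem[OF that(2)]] that(3) by blast
  qed
  then show ?thesis
    using f mem by (auto simp: weak_items_def sorted_wrt_map)
qed

lemma un_list_weak: "weak_items (structs \<Sigma>) As \<Longrightarrow> un_list \<Sigma> (list_struct As) = drop_empty As"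
  by (metis items_drop_empty list_struct_drop_empty un_list_list)

text \<open>An interpretation adds no elements, so empty items stay empty and are invisible both
  before and after \<open>f\<close>.\<close>

lemma map_drop_empty:
  assumes "weak_items (structs \<Sigma>) As" "interp (structs \<Sigma>) (structs \<Gamma>) f"
  shows "list_struct (map f (drop_empty As)) = list_struct (map f As)"
proof -
  have w: "weak_items (structs \<Gamma>) (map f As)" "weak_items (structs \<Gamma>) (map f (drop_empty As))"
    using assms items_drop_empty[OF assms(1), THEN items_weak] interpD[OF assms(2)]
    by (auto intro!: weak_items_map)
  have "universe (f A) = {}" if "A \<in> set As" "universe A = {}" for A
    using that interpD(2)[OF assms(2), of A] assms(1) by (auto simp: weak_items_def)
  then have "drop_empty (map f (drop_empty As)) = drop_empty (map f As)"
    by (induction As) auto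
  then show ?thesis
    using list_struct_drop_empty[OF w(1)] list_struct_drop_empty[OF w(2)] by metis
qed

lemma list_map_list [simp]:
  assumes "weak_items (structs \<Sigma>) As" "interp (structs \<Sigma>) (structs \<Gamma>) f"
  shows "list_map \<Sigma> f (list_struct As) = list_struct (map f As)"
  using assms by (simp add: list_map_def un_list_weak map_drop_empty)

definition append_fun :: "list_type \<Rightarrow> 'a rel_struct \<Rightarrow> 'a rel_struct" where
  "append_fun \<Sigma> X = list_struct (un_list \<Sigma> (fst_part X) @ [snd_part X])"

lemma append_fun_list:
  assumes "weak_items (structs \<Sigma>) (As @ [B])"
  shows "append_fun \<Sigma> (prod_struct (list_struct As) B) = list_struct (As @ [B])"
proof -
  have As: "weak_items (structs \<Sigma>) As" and d: "disj (list_struct As) B"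
    using assms by (auto simp: weak_items_append)
  have "weak_items (structs \<Sigma>) (drop_empty As @ [B])"
    using assms by (auto simp: weak_items_def sorted_wrt_append sorted_wrt_filter)
  then have "list_struct (drop_empty As @ [B]) = list_struct (drop_empty (drop_empty As @ [B]))"
    using list_struct_drop_empty by metis
  also have "\<dots> = list_struct (As @ [B])"
    using list_struct_drop_empty[OF assms] by simp
  finally show ?thesis
    using As d by (simp add: append_fun_def un_list_weak)
qed

lemma derivable_append_fun: "derivable (Lists \<Sigma> \<otimes> \<Sigma>) (Lists \<Sigma>) (append_fun \<Sigma>)"
  by (intro derivable.prime prime.append append_fun_list)
    (auto simp: weak_items_append items_weak)

lemma derivable_comm: "derivable (\<Gamma> \<otimes> \<Sigma>) (\<Sigma> \<otimes> \<Gamma>) (\<lambda>X. prod_struct (snd_part X) (fst_part X))"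
  by (intro derivable.prime prod_comm) auto

text \<open>The structure is appended to a newly created empty list.\<close>

lemma derivable_singleton: "derivable \<Sigma> (Lists \<Sigma>) (\<lambda>A. list_struct [A])"
proof (rule derivable_cong)
  show "derivable \<Sigma> (Lists \<Sigma>) (\<lambda>A. append_fun \<Sigma> ((\<lambda>X. prod_struct (snd_part X) (fst_part X))
      (prod_struct A (list_struct []))))"
    by (rule derivable_comp[OF derivable_comp[OF derivable_nil derivable_comm] derivable_append_fun])
  show "append_fun \<Sigma> ((\<lambda>X. prod_struct (snd_part X) (fst_part X)) (prod_struct A (list_struct []))) = list_struct [A]"
    if "A \<in> structs \<Sigma>" for A :: "'a rel_struct"
    using append_fun_list[of \<Sigma> "[]" A] that by simp
qed

definition concat_fun :: "list_type \<Rightarrow> 'a rel_struct \<Rightarrow> 'a rel_struct" where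
  "concat_fun \<Sigma> X = list_struct (List.concat (map (un_list \<Sigma>) (un_list (Lists \<Sigma>) X)))"

text \<open>Dropping empty items inside the inner lists and dropping empty inner lists amounts,
  after flattening, to dropping the empty items of the flattened list, and these leave no
  trace.\<close>

lemma concat_fun_list:
  assumes "\<forall>As\<in>set Ass. weak_items (structs \<Sigma>) As" "weak_items (structs (Lists \<Sigma>)) (map list_struct Ass)"
  shows "concat_fun \<Sigma> (list_struct (map list_struct Ass)) = list_struct (List.concat Ass)"
proof -
  let ?Bss = "filter (\<lambda>As. universe (list_struct As) \<noteq> {}) Ass"
  have un: "un_list (Lists \<Sigma>) (list_struct (map list_struct Ass)) = map list_struct ?Bss"
    using un_list_weak[OF assms(2)] by (simp add: filter_map comp_def)
  have "map (un_list \<Sigma>) (map list_struct ?Bss) = map drop_empty ?Bss"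
    using assms(1) un_list_weak by auto
  then have 1: "concat_fun \<Sigma> (list_struct (map list_struct Ass)) = list_struct (List.concat (map drop_empty ?Bss))"
    unfolding concat_fun_def un by (rule arg_cong)
  have "drop_empty As = []" if "universe (list_struct As) = {}" for As :: "'a rel_struct list"
    using that by (auto simp: filter_empty_conv)
  then have 2: "List.concat (map drop_empty ?Bss) = drop_empty (List.concat Ass)"
    by (induction Ass) auto
  have "weak_items (structs \<Sigma>) (List.concat Ass)"
    using assms
  proof (induction Ass)
    case (Cons As Ass)
    have "disj (list_struct As) (list_struct Bs)" if "Bs \<in> set Ass" for Bs
      using Cons.prems(2) that by (auto simp: weak_items_def simp del: universe_list_struct)
    moreover have "universe (list_struct (List.concat Ass)) = (\<Union>Bs\<in>set Ass. universe (list_struct Bs))"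
      by auto
    ultimately have "disj (list_struct As) (list_struct (List.concat Ass))"
      by blast
    moreover have "weak_items (structs (Lists \<Sigma>)) (map list_struct Ass)"
      using Cons.prems(2) by (auto simp: weak_items_def)
    ultimately show ?case
      using Cons by (simp add: weak_items_append)
  qed simp
  then show ?thesis
    unfolding 1 2 by (rule list_struct_drop_empty)
qed

lemma derivable_concat_fun: "derivable (Lists (Lists \<Sigma>)) (Lists \<Sigma>) (concat_fun \<Sigma>)"
  by (intro derivable.prime prime.concat concat_fun_list) (auto intro: items_weak simp del: structs.simps)

text \<open>Joining two lists reduces to flattening: the first is wrapped into a list with one item,
  the second is appended to this as a further item.\<close>

lemma derivable_append2:
  obtains f where "derivable (Lists \<Sigma> \<otimes> Lists \<Sigma>) (Lists \<Sigma>) f"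
    and "\<And>As Bs. weak_items (structs \<Sigma>) (As @ Bs) \<Longrightarrow>
      f (prod_struct (list_struct As) (list_struct Bs) :: 'a rel_struct) = list_struct (As @ Bs)"
proof
  let ?f = "\<lambda>X. concat_fun \<Sigma> (append_fun (Lists \<Sigma>) (prod_map (\<lambda>A. list_struct [A]) (\<lambda>A. A) (X :: 'a rel_struct)))"
  show "derivable (Lists \<Sigma> \<otimes> Lists \<Sigma>) (Lists \<Sigma>) ?f"
    by (intro derivable_comp[OF derivable_prod_map[OF derivable_singleton derivable_id]]
        derivable_comp[OF derivable_append_fun] derivable_concat_fun)
  fix As Bs :: "'a rel_struct list"
  assume w: "weak_items (structs \<Sigma>) (As @ Bs)"
  then have d: "disj (list_struct As) (list_struct Bs)" "weak_items (structs \<Sigma>) As" "weak_items (structs \<Sigma>) Bs"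
    by (auto simp: weak_items_append)
  have "weak_items (structs (Lists \<Sigma>)) [list_struct As, list_struct Bs]"
    using d weak_items_in_structs unfolding weak_items_def[of _ "[_, _]"] by auto
  then show "?f (prod_struct (list_struct As) (list_struct Bs)) = list_struct (As @ Bs)"
    using d append_fun_list[of "Lists \<Sigma>" "[list_struct As]" "list_struct Bs"]
      concat_fun_list[of "[As, Bs]" \<Sigma>]
    by (simp del: structs.simps universe_list_struct)
qed

lemma derivable_assoc_rl:
  obtains f where "derivable (\<Gamma> \<otimes> (\<Sigma> \<otimes> \<Delta>)) ((\<Gamma> \<otimes> \<Sigma>) \<otimes> \<Delta>) f"
    and "\<And>A B C. disj A B \<Longrightarrow> disj A C \<Longrightarrow> disj B C \<Longrightarrow>
      f (prod_struct A (prod_struct B C) :: 'a rel_struct) = prod_struct (prod_struct A B) C"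
proof
  let ?f = "\<lambda>X :: 'a rel_struct. prod_struct (prod_struct (fst_part X) (fst_part (snd_part X))) (snd_part (snd_part X))"
  show *: "\<And>A B C. disj A B \<Longrightarrow> disj A C \<Longrightarrow> disj B C \<Longrightarrow>
      ?f (prod_struct A (prod_struct B C)) = prod_struct (prod_struct A B) C"
    by (simp add: Int_Un_distrib)
  show "derivable (\<Gamma> \<otimes> (\<Sigma> \<otimes> \<Delta>)) ((\<Gamma> \<otimes> \<Sigma>) \<otimes> \<Delta>) ?f"
    by (intro derivable.prime prod_assoc_right_to_left *)
qed

lemma derivable_assoc_lr:
  obtains f where "derivable ((\<Gamma> \<otimes> \<Sigma>) \<otimes> \<Delta>) (\<Gamma> \<otimes> (\<Sigma> \<otimes> \<Delta>)) f"
    and "\<And>A B C. disj A B \<Longrightarrow> disj A C \<Longrightarrow> disj B C \<Longrightarrow>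
      f (prod_struct (prod_struct A B) C :: 'a rel_struct) = prod_struct A (prod_struct B C)"
proof
  let ?f = "\<lambda>X :: 'a rel_struct. prod_struct (fst_part (fst_part X)) (prod_struct (snd_part (fst_part X)) (snd_part X))"
  show *: "\<And>A B C. disj A B \<Longrightarrow> disj A C \<Longrightarrow> disj B C \<Longrightarrow>
      ?f (prod_struct (prod_struct A B) C) = prod_struct A (prod_struct B C)"
    by (simp add: Int_Un_distrib2)
  show "derivable ((\<Gamma> \<otimes> \<Sigma>) \<otimes> \<Delta>) (\<Gamma> \<otimes> (\<Sigma> \<otimes> \<Delta>)) ?f"
    by (intro derivable.prime prod_assoc_left_to_right *)
qed

text \<open>Interchange of the two middle factors by associativity and commutativity; it regroups a
  product both of whose factors have been split.\<close>

lemma derivable_exchange: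
  obtains f where "derivable ((\<Gamma>\<^sub>1 \<otimes> \<Gamma>\<^sub>2) \<otimes> (\<Sigma>\<^sub>1 \<otimes> \<Sigma>\<^sub>2)) ((\<Gamma>\<^sub>1 \<otimes> \<Sigma>\<^sub>1) \<otimes> (\<Gamma>\<^sub>2 \<otimes> \<Sigma>\<^sub>2)) f"
    and "\<And>A B C D. disj A B \<Longrightarrow> disj A C \<Longrightarrow> disj A D \<Longrightarrow> disj B C \<Longrightarrow> disj B D \<Longrightarrow> disj C D \<Longrightarrow>
      f (prod_struct (prod_struct A B) (prod_struct C D) :: 'a rel_struct) =
      prod_struct (prod_struct A C) (prod_struct B D)"
proof -
  obtain f1 :: "'a rel_struct \<Rightarrow> 'a rel_struct" where f1:
    "derivable ((\<Gamma>\<^sub>1 \<otimes> \<Gamma>\<^sub>2) \<otimes> (\<Sigma>\<^sub>1 \<otimes> \<Sigma>\<^sub>2)) (\<Gamma>\<^sub>1 \<otimes> (\<Gamma>\<^sub>2 \<otimes> (\<Sigma>\<^sub>1 \<otimes> \<Sigma>\<^sub>2))) f1"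
    "\<And>A B C. disj A B \<Longrightarrow> disj A C \<Longrightarrow> disj B C \<Longrightarrow>
      f1 (prod_struct (prod_struct A B) C) = prod_struct A (prod_struct B C)"
    by (rule derivable_assoc_lr[where \<Gamma> = \<Gamma>\<^sub>1 and \<Sigma> = \<Gamma>\<^sub>2 and \<Delta> = "\<Sigma>\<^sub>1 \<otimes> \<Sigma>\<^sub>2"]) blast
  obtain f2 :: "'a rel_struct \<Rightarrow> 'a rel_struct" where f2:
    "derivable (\<Gamma>\<^sub>2 \<otimes> (\<Sigma>\<^sub>1 \<otimes> \<Sigma>\<^sub>2)) ((\<Gamma>\<^sub>2 \<otimes> \<Sigma>\<^sub>1) \<otimes> \<Sigma>\<^sub>2) f2"
    "\<And>A B C. disj A B \<Longrightarrow> disj A C \<Longrightarrow> disj B C \<Longrightarrow>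
      f2 (prod_struct A (prod_struct B C)) = prod_struct (prod_struct A B) C"
    by (rule derivable_assoc_rl[where \<Gamma> = \<Gamma>\<^sub>2 and \<Sigma> = \<Sigma>\<^sub>1 and \<Delta> = \<Sigma>\<^sub>2]) blast
  obtain f3 :: "'a rel_struct \<Rightarrow> 'a rel_struct" where f3:
    "derivable ((\<Sigma>\<^sub>1 \<otimes> \<Gamma>\<^sub>2) \<otimes> \<Sigma>\<^sub>2) (\<Sigma>\<^sub>1 \<otimes> (\<Gamma>\<^sub>2 \<otimes> \<Sigma>\<^sub>2)) f3"
    "\<And>A B C. disj A B \<Longrightarrow> disj A C \<Longrightarrow> disj B C \<Longrightarrow>
      f3 (prod_struct (prod_struct A B) C) = prod_struct A (prod_struct B C)"
    by (rule derivable_assoc_lr[where \<Gamma> = \<Sigma>\<^sub>1 and \<Sigma> = \<Gamma>\<^sub>2 and \<Delta> = \<Sigma>\<^sub>2]) blast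
  obtain f4 :: "'a rel_struct \<Rightarrow> 'a rel_struct" where f4:
    "derivable (\<Gamma>\<^sub>1 \<otimes> (\<Sigma>\<^sub>1 \<otimes> (\<Gamma>\<^sub>2 \<otimes> \<Sigma>\<^sub>2))) ((\<Gamma>\<^sub>1 \<otimes> \<Sigma>\<^sub>1) \<otimes> (\<Gamma>\<^sub>2 \<otimes> \<Sigma>\<^sub>2)) f4"
    "\<And>A B C. disj A B \<Longrightarrow> disj A C \<Longrightarrow> disj B C \<Longrightarrow>
      f4 (prod_struct A (prod_struct B C)) = prod_struct (prod_struct A B) C"
    by (rule derivable_assoc_rl[where \<Gamma> = \<Gamma>\<^sub>1 and \<Sigma> = \<Sigma>\<^sub>1 and \<Delta> = "\<Gamma>\<^sub>2 \<otimes> \<Sigma>\<^sub>2"]) blast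
  let ?c = "\<lambda>X :: 'a rel_struct. prod_struct (snd_part X) (fst_part X)"
  let ?g = "\<lambda>X. f3 (prod_map ?c (\<lambda>A. A) (f2 X))"
  have "derivable (\<Gamma>\<^sub>2 \<otimes> (\<Sigma>\<^sub>1 \<otimes> \<Sigma>\<^sub>2)) (\<Sigma>\<^sub>1 \<otimes> (\<Gamma>\<^sub>2 \<otimes> \<Sigma>\<^sub>2)) ?g"
    by (intro derivable_comp[OF f2(1)] derivable_comp[OF _ f3(1)] derivable_prod_map derivable_comm derivable_id)
  then have "derivable ((\<Gamma>\<^sub>1 \<otimes> \<Gamma>\<^sub>2) \<otimes> (\<Sigma>\<^sub>1 \<otimes> \<Sigma>\<^sub>2)) ((\<Gamma>\<^sub>1 \<otimes> \<Sigma>\<^sub>1) \<otimes> (\<Gamma>\<^sub>2 \<otimes> \<Sigma>\<^sub>2))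
      (\<lambda>X. f4 (prod_map (\<lambda>A. A) ?g (f1 X)))"
    by (intro derivable_comp[OF f1(1)] derivable_comp[OF _ f4(1)] derivable_prod_map derivable_id)
  then show ?thesis
    by (rule that) (simp add: f1(2) f2(2) f3(2) f4(2) Int_Un_distrib Int_Un_distrib2 Int_commute)
qed

section \<open>Quantifier-free formulas define exactly the properties preserved by local embeddings\<close>

lemma finite_vocabulary: "finite (vocabulary \<Sigma>)"
  by (induction \<Sigma>) auto

lemma sat_local_emb:
  assumes e: "local_emb A B X h" and xs: "set xs \<subseteq> X" and \<phi>: "qf_over V (length xs) \<phi>"
  shows "sat A xs \<phi> \<longleftrightarrow> sat B (map h xs) \<phi>"
  using \<phi>
proof (induction \<phi>)
  case (Equal i j)
  then have "xs ! i \<in> X" "xs ! j \<in> X"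
    using xs by auto
  then show ?case
    using Equal local_embD(3)[OF e] by (auto dest: inj_onD)
next
  case (Atom R ks)
  then have "set (map ((!) xs) ks) \<subseteq> X"
    using xs by auto
  moreover have "map h (map ((!) xs) ks) = map ((!) (map h xs)) ks"
    using Atom by auto
  ultimately show ?case
    using local_embD(6)[OF e, of "map ((!) xs) ks" R] by (simp only: sat.simps)
qed auto

definition atoms :: "list_type \<Rightarrow> nat \<Rightarrow> qf_formula set" where
  "atoms \<Sigma> m = (\<lambda>(i, j). Equal i j) ` ({..<m} \<times> {..<m}) \<union>
     (\<Union>R\<in>vocabulary \<Sigma>. Atom R ` {ks. set ks \<subseteq> {..<m} \<and> length ks = arity R})"

lemma finite_atoms: "finite (atoms \<Sigma> m)"
  unfolding atoms_def using finite_vocabulary finite_lists_length_eq[of "{..<m}"] by auto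

fun Conjs :: "qf_formula list \<Rightarrow> qf_formula" where
  "Conjs [] = Truth"
| "Conjs (\<phi> # \<phi>s) = Conj \<phi> (Conjs \<phi>s)"

lemma sat_Conjs [simp]: "sat A xs (Conjs \<phi>s) \<longleftrightarrow> (\<forall>\<phi>\<in>set \<phi>s. sat A xs \<phi>)"
  by (induction \<phi>s) auto

lemma qf_over_Conjs [simp]: "qf_over V m (Conjs \<phi>s) \<longleftrightarrow> (\<forall>\<phi>\<in>set \<phi>s. qf_over V m \<phi>)"
  by (induction \<phi>s) auto

lemma qf_over_atoms: "\<phi> \<in> atoms \<Sigma> m \<Longrightarrow> qf_over (vocabulary \<Sigma>) m \<phi>"
  by (auto simp: atoms_def)

text \<open>Agreement on the atoms \<open>Equal i j\<close> makes sending \<open>xs ! i\<close> to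
  \<open>ys ! i\<close> a well-defined injection; agreement on the relational atoms makes it an
  embedding.\<close>

lemma same_atoms_local_emb:
  assumes A: "A \<in> structs \<Sigma>" "B \<in> structs \<Sigma>"
    and xs: "length xs = m" "length ys = m" "set xs \<subseteq> universe A" "set ys \<subseteq> universe B"
    and eq: "\<And>\<phi>. \<phi> \<in> atoms \<Sigma> m \<Longrightarrow> sat A xs \<phi> \<longleftrightarrow> sat B ys \<phi>"
  obtains h where "local_emb A B (set xs) h" "map h xs = ys"
proof -
  \<comment> \<open>Some index at which \<open>x\<close> occurs; the choice is irrelevant, since
    equal entries of \<open>xs\<close> have equal counterparts in \<open>ys\<close>.\<close>
  define idx where "idx = (\<lambda>x. SOME i. i < m \<and> xs ! i = x)"
  define h where "h = (\<lambda>x. ys ! idx x)"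
  have idx: "idx x < m \<and> xs ! idx x = x" if "x \<in> set xs" for x
    unfolding idx_def by (rule someI_ex) (use that xs(1) in \<open>auto simp: in_set_conv_nth\<close>)
  have same: "xs ! i = xs ! j \<longleftrightarrow> ys ! i = ys ! j" if "i < m" "j < m" for i j
    using eq[of "Equal i j"] that by (auto simp: atoms_def)
  have h: "h (xs ! i) = ys ! i" if "i < m" for i
    using same[of i "idx (xs ! i)"] idx[of "xs ! i"] that xs(1) by (auto simp: h_def)
  have map: "map h xs = ys"
    using h xs by (intro nth_equalityI) auto
  have "local_emb A B (set xs) h"
  proof (rule local_embI)
    show "inj_on h (set xs)"
    proof (rule inj_onI)
      fix x y assume "x \<in> set xs" "y \<in> set xs" "h x = h y"
      then show "x = y"
        using idx[of x] idx[of y] same[of "idx x" "idx y"] by (simp add: h_def)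
    qed
    show "h x \<in> universe B" if "x \<in> set xs" for x
      using that map xs(4) by auto
    fix zs R assume zs: "set zs \<subseteq> set xs"
    show "zs \<in> rel A R \<longleftrightarrow> map h zs \<in> rel B R"
    proof (cases "R \<in> vocabulary \<Sigma> \<and> length zs = arity R")
      case True
      then have "Atom R (map idx zs) \<in> atoms \<Sigma> m"
        using zs idx by (force simp: atoms_def image_iff subset_iff)
      from eq[OF this] have "map (\<lambda>z. xs ! idx z) zs \<in> rel A R \<longleftrightarrow> map h zs \<in> rel B R"
        by (simp add: h_def comp_def)
      moreover have "map (\<lambda>z. xs ! idx z) zs = zs"
        using zs idx by (intro map_idI) auto
      ultimately show ?thesis by simp
    next
      case False
      then show ?thesis
        using rel_of_structs[OF A(1), of zs R] rel_of_structs[OF A(2), of "map h zs" R] by auto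
    qed
  qed (use xs in simp)
  with map that show thesis by blast
qed

text \<open>There are finitely many atoms, hence finitely many atomic types of
  \<open>m\<close>-tuples. Tuples of the same atomic type are linked by a local embedding, so
  \<open>P\<close> is a union of types and a formula can list them.\<close>

lemma invariant_definable:
  fixes P :: "'a rel_struct \<Rightarrow> 'a list \<Rightarrow> bool"
  assumes inv: "\<And>A B xs h. A \<in> structs \<Sigma> \<Longrightarrow> B \<in> structs \<Sigma> \<Longrightarrow> length xs = m \<Longrightarrow>
    local_emb A B (set xs) h \<Longrightarrow> P A xs \<Longrightarrow> P B (map h xs)"
  obtains \<phi> where "qf_over (vocabulary \<Sigma>) m \<phi>"
    "\<And>A xs. A \<in> structs \<Sigma> \<Longrightarrow> length xs = m \<Longrightarrow> set xs \<subseteq> universe A \<Longrightarrow> sat A xs \<phi> \<longleftrightarrow> P A xs"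
proof -
  define tp where "tp = (\<lambda>A (xs :: 'a list). {\<phi> \<in> atoms \<Sigma> m. sat A xs \<phi>})"
  define T where "T = {tp A xs | A xs. A \<in> structs \<Sigma> \<and> length xs = m \<and> set xs \<subseteq> universe A \<and> P A xs}"
  have "T \<subseteq> Pow (atoms \<Sigma> m)"
    by (auto simp: T_def tp_def)
  then have "finite T"
    using finite_atoms finite_subset by blast
  then obtain ts where ts: "set ts = T"
    using finite_list by blast
  define lst where "lst = (\<lambda>S :: qf_formula set. SOME \<phi>s. set \<phi>s = S)"
  have lst: "set (lst S) = S" if "S \<subseteq> atoms \<Sigma> m" for S
    unfolding lst_def using finite_list[OF finite_subset[OF that finite_atoms]] by (rule someI_ex)
  \<comment> \<open>The complete description of the type \<open>S\<close>: its atoms hold and all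
    others fail. \<open>\<phi>\<close> is the disjunction of these descriptions over
    \<open>T\<close>, written with negation and conjunction.\<close>
  define F where "F = (\<lambda>S. Conj (Conjs (lst S)) (Conjs (map Neg (lst (atoms \<Sigma> m - S)))))"
  define \<phi> where "\<phi> = Neg (Conjs (map (\<lambda>S. Neg (F S)) ts))"
  have F: "sat A xs (F S) \<longleftrightarrow> tp A xs = S" if "S \<in> T" for A and xs :: "'a list" and S
    using lst[of S] lst[of "atoms \<Sigma> m - S"] that \<open>T \<subseteq> Pow _\<close> by (auto simp: F_def tp_def)
  have "qf_over (vocabulary \<Sigma>) m (F S)" if "S \<in> T" for S
    using lst[of S] lst[of "atoms \<Sigma> m - S"] that \<open>T \<subseteq> Pow _\<close> qf_over_atoms
    by (auto simp: F_def subset_iff Pow_iff)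
  then have "qf_over (vocabulary \<Sigma>) m \<phi>"
    by (auto simp: \<phi>_def ts)
  moreover have "sat A xs \<phi> \<longleftrightarrow> P A xs"
    if A: "A \<in> structs \<Sigma>" and xs: "length xs = m" "set xs \<subseteq> universe A" for A xs
  proof -
    have "sat A xs \<phi> \<longleftrightarrow> tp A xs \<in> T"
      using F by (auto simp: \<phi>_def ts)
    also have "\<dots> \<longleftrightarrow> P A xs"
    proof
      assume "tp A xs \<in> T"
      then obtain B ys where B: "B \<in> structs \<Sigma>" "length ys = m" "set ys \<subseteq> universe B" "P B ys"
        and eq: "tp B ys = tp A xs"
        by (auto simp: T_def)
      have "sat B ys \<phi> \<longleftrightarrow> sat A xs \<phi>" if "\<phi> \<in> atoms \<Sigma> m" for \<phi>
        using eq that by (auto simp: tp_def)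
      then obtain h where "local_emb B A (set ys) h" "map h ys = xs"
        using same_atoms_local_emb[OF B(1) A B(2) xs(1) B(3) xs(2)] by blast
      then show "P A xs"
        using inv[OF B(1) A B(2)] B(4) by blast
    qed (use A xs in \<open>auto simp: T_def\<close>)
    finally show ?thesis .
  qed
  ultimately show thesis by (rule that)
qed

lemma qf_interpretation_imp_interp:
  fixes f :: "'a rel_struct \<Rightarrow> 'a rel_struct"
  assumes f: "\<And>A. A \<in> structs \<Sigma> \<Longrightarrow> f A \<in> structs \<Gamma>" and qf: "qf_interpretation \<Sigma> \<Gamma> f"
  shows "interp (structs \<Sigma>) (structs \<Gamma>) f"
proof -
  obtain \<phi> \<psi> where \<phi>: "qf_over (vocabulary \<Sigma>) 1 \<phi>"
    and \<psi>: "\<And>R. R \<in> vocabulary \<Gamma> \<Longrightarrow> qf_over (vocabulary \<Sigma>) (arity R) (\<psi> R)"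
    and eq: "\<And>A. A \<in> structs \<Sigma> \<Longrightarrow> f A = qf_apply \<Gamma> \<phi> \<psi> A"
    using qf by (auto simp: qf_interpretation_def)
  have U: "x \<in> universe (f A) \<longleftrightarrow> x \<in> universe A \<and> sat A [x] \<phi>" if "A \<in> structs \<Sigma>" for A x
    by (simp add: eq[OF that] qf_apply_def Let_def)
  show ?thesis
  proof (rule interpI)
    fix A :: "'a rel_struct" assume "A \<in> structs \<Sigma>"
    then show "f A \<in> structs \<Gamma> \<and> universe (f A) \<subseteq> universe A"
      using f U by blast
  next
    fix A B :: "'a rel_struct" and X h assume A: "A \<in> structs \<Sigma>" and B: "B \<in> structs \<Sigma>" and e: "local_emb A B X h"
    have U_iff: "x \<in> universe (f A) \<longleftrightarrow> h x \<in> universe (f B)" if "x \<in> X" for x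
      using sat_local_emb[OF e, of "[x]" _ \<phi>] \<phi> that U[OF A] U[OF B] local_embD(4,5)[OF e that] by simp
    show "local_emb (f A) (f B) (X \<inter> universe (f A)) h"
    proof (rule local_embI)
      fix xs R assume xs: "set xs \<subseteq> X \<inter> universe (f A)"
      then have "set (map h xs) \<subseteq> universe (f B)"
        using U_iff by auto
      moreover have "sat A xs (\<psi> R) \<longleftrightarrow> sat B (map h xs) (\<psi> R)" if "R \<in> vocabulary \<Gamma>" "length xs = arity R"
        using sat_local_emb[OF e] \<psi>[OF that(1)] that(2) xs by auto
      moreover have "xs \<in> rel (f A) R \<longleftrightarrow>
          R \<in> vocabulary \<Gamma> \<and> length xs = arity R \<and> set xs \<subseteq> universe (f A) \<and> sat A xs (\<psi> R)"
        if "A \<in> structs \<Sigma>" for A :: "'a rel_struct" and xs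
        using that by (simp add: eq qf_apply_def Let_def)
      ultimately show "xs \<in> rel (f A) R \<longleftrightarrow> map h xs \<in> rel (f B) R"
        using A B xs by auto
    qed (use U_iff local_embD(3)[OF e] in \<open>auto simp: inj_on_def\<close>)
  qed
qed

text \<open>Membership in the output universe and in each output relation is preserved by local
  embeddings, and is therefore definable.\<close>

lemma interp_imp_qf_interpretation:
  assumes f: "interp (structs \<Sigma>) (structs \<Gamma>) f"
  shows "qf_interpretation \<Sigma> \<Gamma> f"
proof -
  obtain \<phi> where \<phi>: "qf_over (vocabulary \<Sigma>) 1 \<phi>"
    "\<And>A xs. A \<in> structs \<Sigma> \<Longrightarrow> length xs = 1 \<Longrightarrow> set xs \<subseteq> universe A \<Longrightarrow>
      sat A xs \<phi> \<longleftrightarrow> set xs \<subseteq> universe (f A)"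
  proof (rule invariant_definable[where m = 1 and \<Sigma> = \<Sigma> and P = "\<lambda>A xs. set xs \<subseteq> universe (f A)"])
    fix A B xs h
    assume "A \<in> structs \<Sigma>" "B \<in> structs \<Sigma>" "local_emb A B (set xs) h" "set xs \<subseteq> universe (f A)"
    then show "set (map h xs) \<subseteq> universe (f B)"
      using interp_iff[OF f] by auto
  qed blast
  have "\<exists>\<psi>. qf_over (vocabulary \<Sigma>) (arity R) \<psi> \<and> (\<forall>A xs. A \<in> structs \<Sigma> \<longrightarrow> length xs = arity R \<longrightarrow>
      set xs \<subseteq> universe A \<longrightarrow> (sat A xs \<psi> \<longleftrightarrow> xs \<in> rel (f A) R))" for R
  proof -
    obtain \<psi> where "qf_over (vocabulary \<Sigma>) (arity R) \<psi>"
      "\<And>A xs. A \<in> structs \<Sigma> \<Longrightarrow> length xs = arity R \<Longrightarrow> set xs \<subseteq> universe A \<Longrightarrow>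
        sat A xs \<psi> \<longleftrightarrow> xs \<in> rel (f A) R"
    proof (rule invariant_definable[where m = "arity R" and \<Sigma> = \<Sigma> and P = "\<lambda>A xs. xs \<in> rel (f A) R"])
      fix A B xs h
      assume A: "A \<in> structs \<Sigma>" "B \<in> structs \<Sigma>" "local_emb A B (set xs) h" and xs: "xs \<in> rel (f A) R"
      have "set xs \<subseteq> universe (f A)"
        using wf_structD[OF wf_structs[OF interpD(1)[OF f A(1)]] xs] by blast
      then show "map h xs \<in> rel (f B) R"
        using local_embD(6)[OF interpD(3)[OF f A], of xs R] xs by simp
    qed blast
    then show ?thesis by blast
  qed
  then obtain \<psi> where \<psi>: "\<And>R. qf_over (vocabulary \<Sigma>) (arity R) (\<psi> R)"
    "\<And>R A xs. A \<in> structs \<Sigma> \<Longrightarrow> length xs = arity R \<Longrightarrow> set xs \<subseteq> universe A \<Longrightarrow>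
      sat A xs (\<psi> R) \<longleftrightarrow> xs \<in> rel (f A) R"
    by metis
  have "f A = qf_apply \<Gamma> \<phi> \<psi> A" if A: "A \<in> structs \<Sigma>" for A
  proof (rule rel_struct.equality)
    have U: "{a \<in> universe A. sat A [a] \<phi>} = universe (f A)"
      using \<phi>(2)[OF A, of "[_]"] interpD(2)[OF f A] by auto
    then show "universe (f A) = universe (qf_apply \<Gamma> \<phi> \<psi> A)"
      by (simp add: qf_apply_def Let_def)
    show "rel (f A) = rel (qf_apply \<Gamma> \<phi> \<psi> A)"
    proof
      fix R
      have "xs \<in> rel (f A) R \<longleftrightarrow>
          R \<in> vocabulary \<Gamma> \<and> length xs = arity R \<and> set xs \<subseteq> universe (f A) \<and> sat A xs (\<psi> R)" for xs
        using rel_of_structs[OF interpD(1)[OF f A], of xs R] \<psi>(2)[OF A, of xs R] interpD(2)[OF f A] by blast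
      then show "rel (f A) R = rel (qf_apply \<Gamma> \<phi> \<psi> A) R"
        unfolding qf_apply_def Let_def U by auto
    qed
  qed simp
  then show ?thesis
    unfolding qf_interpretation_def using \<phi>(1) \<psi>(1) by blast
qed

section \<open>Normal forms of input types\<close>

text \<open>
  \<open>NZero\<close> stands for a type whose only structure is empty. There is no such list type; it is
  represented by the empty list over \<open>Unit\<close>, so \<open>models n\<close> can be smaller than
  \<open>structs (type_of n)\<close>.
\<close>

datatype nf = NZero | NOne | NTimes nf nf | NPlus nf nf | NList nf

primrec type_of :: "nf \<Rightarrow> list_type" where
  "type_of NZero = Lists Unit"
| "type_of NOne = Unit"
| "type_of (NTimes m n) = type_of m \<otimes> type_of n"
| "type_of (NPlus m n) = type_of m \<oplus> type_of n"
| "type_of (NList n) = Lists (type_of n)"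

primrec models :: "nf \<Rightarrow> 'a rel_struct set" where
  "models NZero = {list_struct []}"
| "models NOne = range unit_struct"
| "models (NTimes m n) = {prod_struct A B | A B. A \<in> models m \<and> B \<in> models n \<and> disj A B}"
| "models (NPlus m n) = inl_struct ` models m \<union> inr_struct ` models n"
| "models (NList n) = {list_struct As | As. items (models n) As}"

text \<open>Stands for the absence of nullary relations (\<open>no_nullary\<close>). Everything
  below a list counts as sum-free, since a list turns nullary names into unary ones.\<close>

primrec sum_free :: "nf \<Rightarrow> bool" where
  "sum_free NZero = True"
| "sum_free NOne = True"
| "sum_free (NTimes m n) = (sum_free m \<and> sum_free n)"
| "sum_free (NPlus m n) = False"
| "sum_free (NList n) = True"

text \<open>Sums may occur on top and directly below lists; a sum inside a product is separated from
  it by a list.\<close>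

primrec normal :: "nf \<Rightarrow> bool" where
  "normal NZero = True"
| "normal NOne = True"
| "normal (NTimes m n) = (normal m \<and> normal n \<and> sum_free m \<and> sum_free n)"
| "normal (NPlus m n) = (normal m \<and> normal n)"
| "normal (NList n) = normal n"

primrec depth :: "nf \<Rightarrow> nat" where
  "depth NZero = 0"
| "depth NOne = 0"
| "depth (NTimes m n) = max (depth m) (depth n)"
| "depth (NPlus m n) = max (depth m) (depth n)"
| "depth (NList n) = Suc (depth n)"

lemma items_mono: "\<C> \<subseteq> \<D> \<Longrightarrow> items \<C> As \<Longrightarrow> items \<D> As"
  by (auto simp: items_def)

lemma list_struct_Nil_in_structs: "list_struct [] \<in> structs (Lists \<Gamma>)"
  by (rule weak_items_in_structs) simp

lemma prod_in_models [intro]: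
  "A \<in> models m \<Longrightarrow> B \<in> models n \<Longrightarrow> disj A B \<Longrightarrow> prod_struct A B \<in> models (NTimes m n)"
  by auto

lemma models_structs:
  fixes A :: "'a rel_struct"
  shows "A \<in> models n \<Longrightarrow> A \<in> structs (type_of n)"
proof (induction n arbitrary: A)
  case NZero
  then show ?case
    using list_struct_Nil_in_structs by (simp del: structs.simps)
next
  case (NList n)
  then obtain As where As: "A = list_struct As" "items (models n) As"
    by auto
  have "items (structs (type_of n)) As"
    by (rule items_mono[OF _ As(2)]) (use NList.IH in blast)
  then show ?case
    using As(1) by auto
next
  case (NTimes m n)
  then obtain B C where "A = prod_struct B C" "B \<in> models m" "C \<in> models n" "disj B C"
    by auto
  with NTimes.IH show ?case
    using prod_in_structs[of B "type_of m" C "type_of n"] by simp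
qed auto

lemma wf_models: "A \<in> models n \<Longrightarrow> wf_struct A"
  using models_structs wf_structs by blast

lemma items_models: "items (models n) As \<Longrightarrow> items (structs (type_of n)) As"
  using items_mono models_structs by blast

lemma items_models_wf: "items (models n) As \<Longrightarrow> wf_list As"
  using items_models items_wf_list by blast

lemma finite_models: "A \<in> models n \<Longrightarrow> finite (universe A)"
proof (induction n arbitrary: A)
  case (NList n)
  then show ?case by (auto simp: items_def)
qed auto

lemma no_nullary: "sum_free n \<Longrightarrow> A \<in> models n \<Longrightarrow> [] \<notin> rel A R"
proof (induction n arbitrary: A R)
  case NZero
  then show ?case by (auto simp: rel_list_struct_Nil)
next
  case (NTimes m n)
  then show ?case by (cases R) auto
next
  case (NList n)
  then obtain As where "A = list_struct As" "items (models n) As"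
    by auto
  then have As: "A = list_struct As" "wf_list As"
    using items_models_wf by blast+
  show ?case
  proof
    assume n: "[] \<in> rel A R"
    show False
    proof (cases R)
      case (Item R')
      with n As show False
        by (cases "arity R' = 0") (auto simp: rel_list_Item_nullary rel_list_Item)
    qed (use n As in \<open>auto simp: rel_list_Leq\<close>)
  qed
qed auto

text \<open>Over the empty set only the empty tuple is tested, and no relation contains it.\<close>

lemma local_emb_empty: "sum_free n \<Longrightarrow> A \<in> models n \<Longrightarrow> B \<in> models n \<Longrightarrow> local_emb A B {} h"
  by (rule local_embI) (auto simp: no_nullary)

lemma local_emb_models_prod:
  assumes "A \<in> models m" "B \<in> models n" "disj A B" "A' \<in> models m'" "B' \<in> models n'" "disj A' B'"
  shows "local_emb (prod_struct A B) (prod_struct A' B') X h \<longleftrightarrow>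
    X \<subseteq> universe A \<union> universe B \<and>
    local_emb A A' (X \<inter> universe A) h \<and> local_emb B B' (X \<inter> universe B) h"
  using assms wf_models by (intro local_emb_prod) auto


subsection \<open>Renaming of elements\<close>

definition rename :: "('a \<Rightarrow> 'a) \<Rightarrow> 'a rel_struct \<Rightarrow> 'a rel_struct" where
  "rename h A = \<lparr>universe = h ` universe A, rel = (\<lambda>R. map h ` rel A R)\<rparr>"

lemma universe_rename [simp]: "universe (rename h A) = h ` universe A"
  by (simp add: rename_def)

lemma rename_unit: "rename h (unit_struct a) = unit_struct (h a)"
  by (rule rel_struct.equality) (auto simp: rename_def)

lemma rename_prod: "rename h (prod_struct A B) = prod_struct (rename h A) (rename h B)"
proof (rule rel_struct.equality)
  show "rel (rename h (prod_struct A B)) = rel (prod_struct (rename h A) (rename h B))"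
  proof
    fix R show "rel (rename h (prod_struct A B)) R = rel (prod_struct (rename h A) (rename h B)) R"
      by (cases R) (force simp: rename_def image_iff)+
  qed
qed (auto simp: rename_def)

lemma rename_inl: "rename h (inl_struct A) = inl_struct (rename h A)"
proof (rule rel_struct.equality)
  show "rel (rename h (inl_struct A)) = rel (inl_struct (rename h A))"
  proof
    fix R show "rel (rename h (inl_struct A)) R = rel (inl_struct (rename h A)) R"
      by (cases R) (auto simp: rename_def)
  qed
qed (auto simp: rename_def)

lemma rename_inr: "rename h (inr_struct A) = inr_struct (rename h A)"
proof (rule rel_struct.equality)
  show "rel (rename h (inr_struct A)) = rel (inr_struct (rename h A))"
  proof
    fix R show "rel (rename h (inr_struct A)) R = rel (inr_struct (rename h A)) R"
      by (cases R) (auto simp: rename_def)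
  qed
qed (auto simp: rename_def)

lemma rename_list: "rename h (list_struct As) = list_struct (map (rename h) As)"
proof (rule rel_struct.equality)
  show "rel (rename h (list_struct As)) = rel (list_struct (map (rename h) As))"
  proof
    fix R show "rel (rename h (list_struct As)) R = rel (list_struct (map (rename h) As)) R"
    proof (cases R)
      case (Item R')
      then show ?thesis
        by (cases "arity R' = 0") (fastforce simp: rename_def list_struct_def image_iff)+
    next
      case Leq
      have "rel (list_struct (map (rename h) As)) Leq = {[x, y] | x y i j. i \<le> j \<and> j < length As \<and>
          x \<in> h ` universe (As ! i) \<and> y \<in> h ` universe (As ! j)}"
        by (force simp: list_struct_def)
      then show ?thesis
        unfolding Leq by (fastforce simp: rename_def list_struct_def image_iff)
    qed (auto simp: rename_def)
  qed
qed (auto simp: rename_def)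

lemma rename_models: "A \<in> models n \<Longrightarrow> inj_on h (universe A) \<Longrightarrow> rename h A \<in> models n"
proof (induction n arbitrary: A)
  case NZero
  then show ?case by (simp add: rename_list)
next
  case NOne
  then show ?case by (auto simp: rename_unit)
next
  case (NTimes m n)
  then obtain B C where A: "A = prod_struct B C" "B \<in> models m" "C \<in> models n" "disj B C"
    by auto
  then have "rename h B \<in> models m" "rename h C \<in> models n"
    using NTimes by (auto intro: inj_on_subset)
  moreover have "disj (rename h B) (rename h C)"
    using A NTimes.prems(2) by (auto simp: inj_on_def)
  ultimately show ?case
    unfolding A(1) rename_prod by (rule prod_in_models)
next
  case (NPlus m n)
  then show ?case by (auto simp: rename_inl rename_inr)
next
  case (NList n)
  then obtain As where A: "A = list_struct As" "items (models n) As"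
    by auto
  have inj: "inj_on h (\<Union> (universe ` set As))"
    using NList.prems(2) A by simp
  have "rename h B \<in> models n" if "B \<in> set As" for B
    using that A(2) inj by (intro NList.IH) (auto simp: items_def intro: inj_on_subset)
  moreover have "sorted_wrt (\<lambda>A B. disj (rename h A) (rename h B)) As"
  proof (rule sorted_wrt_mono_rel)
    show "sorted_wrt disj As"
      using A(2) by (simp add: items_def)
    show "disj (rename h B) (rename h C)" if "B \<in> set As" "C \<in> set As" "disj B C" for B C
      using inj_on_image_Int[OF inj, of "universe B" "universe C"] that by auto
  qed
  ultimately have "items (models n) (map (rename h) As)"
    using A(2) by (auto simp: items_def sorted_wrt_map)
  then show ?case
    unfolding A(1) rename_list by auto
qed

lemma local_emb_rename:
  assumes "wf_struct A" "inj_on h (universe A)"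
  shows "local_emb A (rename h A) (universe A) h"
proof (rule local_embI)
  fix xs R assume xs: "set xs \<subseteq> universe A"
  have "xs = ys" if "map h xs = map h ys" "ys \<in> rel A R" for ys
    using that xs wf_structD[OF assms(1) that(2)] assms(2)
    by (intro map_inj_on[OF that(1)]) (auto intro: inj_on_subset)
  then show "xs \<in> rel A R \<longleftrightarrow> map h xs \<in> rel (rename h A) R"
    by (auto simp: rename_def)
qed (use assms in auto)

lemma ex_fresh_inj:
  fixes S F :: "'a::infinite set"
  assumes "finite S" "finite F"
  obtains h where "inj_on h S" "h ` S \<inter> F = {}"
proof -
  have "infinite (UNIV - F)"
    using assms(2) infinite_UNIV by (metis Diff_infinite_finite)
  then obtain T where T: "finite T" "card T = card S" "T \<subseteq> UNIV - F"
    using infinite_arbitrarily_large by metis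
  then obtain h where "bij_betw h S T"
    using finite_same_card_bij[OF assms(1) T(1)] by auto
  with T that show thesis
    by (metis Diff_disjoint bij_betw_def disjoint_iff_not_equal subset_iff)
qed

text \<open>Disjoint unions are plain unions within one element type, so structures have to be moved
  apart before they are combined; this uses that the element type is infinite.\<close>

lemma fresh_copy:
  fixes A :: "'a::infinite rel_struct"
  assumes "A \<in> models n" "finite F"
  obtains h where "rename h A \<in> models n" "local_emb A (rename h A) (universe A) h"
    "universe (rename h A) \<inter> F = {}"
proof -
  obtain h where h: "inj_on h (universe A)" "h ` universe A \<inter> F = {}"
    using ex_fresh_inj[OF finite_models[OF assms(1)] assms(2)] .
  with that show thesis
    using rename_models[OF assms(1) h(1)] local_emb_rename[OF wf_models[OF assms(1)] h(1)] by auto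
qed

text \<open>Used to complete a structure to a product, with the new factor kept away from given
  elements.\<close>

lemma ex_fresh_model:
  fixes F :: "'a::infinite set"
  assumes "finite F"
  obtains A where "A \<in> models n" "universe A \<inter> F = {}"
proof -
  have "\<exists>A \<in> models n. universe A \<inter> F = {}"
    using assms
  proof (induction n arbitrary: F)
    case NOne
    then obtain a where "a \<notin> F"
      using ex_new_if_finite infinite_UNIV by blast
    then show ?case by (intro bexI[of _ "unit_struct a"]) auto
  next
    case (NTimes m n)
    then obtain A where A: "A \<in> models m" "universe A \<inter> F = {}" by blast
    with NTimes obtain B where "B \<in> models n" "universe B \<inter> (F \<union> universe A) = {}"
      using finite_models by (metis finite_UnI)
    with A show ?case
      by (intro bexI[of _ "prod_struct A B"]) auto
  next
    case (NPlus m n)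
    then obtain A where "A \<in> models m" "universe A \<inter> F = {}" by blast
    then show ?case by (intro bexI[of _ "inl_struct A"]) auto
  next
    case (NList n)
    have "items (models n) []" by (simp add: items_def)
    then show ?case by (intro bexI[of _ "list_struct []"]) auto
  qed auto
  with that show thesis by blast
qed


subsection \<open>Amalgamation\<close>

lemma universe_list_append:
  "universe (list_struct (As @ Bs)) = universe (list_struct As) \<union> universe (list_struct Bs)"
  and universe_list_singleton: "universe (list_struct [A]) = universe A"
  by auto

lemma wf_list_Cons: "wf_list (A # As) \<longleftrightarrow> wf_struct A \<and> disj A (list_struct As) \<and> wf_list As"
  using wf_list_append[of "[A]" As] by auto

lemma local_emb_append_left:
  assumes "wf_list (As @ Bs)"
  shows "local_emb (list_struct As) (list_struct (As @ Bs)) (universe (list_struct As)) (\<lambda>x. x)"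
proof -
  have wf: "wf_list As" "wf_list Bs" "wf_list ([] :: 'a rel_struct list)"
    using assms by (auto simp: wf_list_append) (simp add: wf_list_def)
  have "local_emb (list_struct (As @ [])) (list_struct (As @ Bs)) (universe (list_struct As)) (\<lambda>x. x)"
    using assms wf by (intro local_emb_append local_emb_mono[OF local_emb_id[OF order_refl]])
      (auto simp: local_emb_list)
  then show ?thesis by simp
qed

lemma local_emb_append_right:
  assumes "wf_list (As @ Bs)"
  shows "local_emb (list_struct Bs) (list_struct (As @ Bs)) (universe (list_struct Bs)) (\<lambda>x. x)"
proof -
  have wf: "wf_list As" "wf_list Bs" "wf_list ([] :: 'a rel_struct list)"
    using assms by (auto simp: wf_list_append) (simp add: wf_list_def)
  have "local_emb (list_struct ([] @ Bs)) (list_struct (As @ Bs)) (universe (list_struct Bs)) (\<lambda>x. x)"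
    using assms wf by (intro local_emb_append local_emb_mono[OF local_emb_id[OF order_refl]])
      (auto simp: local_emb_list)
  then show ?thesis by simp
qed

text \<open>The lists are merged around the items \<open>A\<close> and \<open>B\<close>, which are
  replaced by a common item \<open>C\<close>: whatever precedes either of them goes before
  \<open>C\<close>, whatever follows either of them goes after \<open>C\<close>.\<close>

lemma items_amalgam:
  assumes As: "items \<C> (As1 @ [A] @ As2)" and Bs: "items \<C> (Bs1 @ [B] @ Bs2)"
    and dis: "disj (list_struct (As1 @ [A] @ As2)) (list_struct (Bs1 @ [B] @ Bs2))"
    and C: "C \<in> \<C>" "universe C \<noteq> {}" "universe C \<inter> (universe (list_struct (As1 @ [A] @ As2)) \<union>
       universe (list_struct (Bs1 @ [B] @ Bs2))) = {}"
  shows "items \<C> ((As1 @ Bs1) @ [C] @ (As2 @ Bs2))"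
proof -
  have "items \<C> [A] \<longleftrightarrow> A \<in> \<C> \<and> universe A \<noteq> {}" for A
    by (simp add: items_def)
  then have simps: "\<And>As Bs. items \<C> (As @ Bs) \<longleftrightarrow> items \<C> As \<and> items \<C> Bs \<and>
      universe (list_struct As) \<inter> universe (list_struct Bs) = {}"
    "\<And>A. items \<C> [A] \<longleftrightarrow> A \<in> \<C> \<and> universe A \<noteq> {}"
    by (simp_all add: items_append)
  show ?thesis
    using As Bs dis C unfolding simps universe_list_append universe_list_singleton
      Int_Un_distrib Int_Un_distrib2 Un_empty
    by (simp add: Int_commute del: universe_list_struct)
qed

text \<open>Three consecutive segments are glued: the identity on the outer two and \<open>h\<close>
  on the replaced item.\<close>

lemma local_emb_replace:
  assumes wf: "wf_list (As1 @ [A] @ As2)" "wf_list (Bs1 @ [B] @ Bs2)"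
    and e1: "local_emb (list_struct As1) (list_struct Bs1) (universe (list_struct As1)) (\<lambda>x. x)"
    and e2: "local_emb (list_struct As2) (list_struct Bs2) (universe (list_struct As2)) (\<lambda>x. x)"
    and e: "local_emb A B (universe A) h"
  shows "local_emb (list_struct (As1 @ [A] @ As2)) (list_struct (Bs1 @ [B] @ Bs2))
    (universe (list_struct (As1 @ [A] @ As2))) (\<lambda>x. if x \<in> universe A then h x else x)"
    (is "local_emb _ _ _ ?h")
proof -
  have dA: "universe A \<inter> universe (list_struct As1) = {}" "universe A \<inter> universe (list_struct As2) = {}"
    using wf(1) by (simp_all add: wf_list_append wf_list_Cons Int_Un_distrib Int_commute)
  have wfp: "wf_list ([A] @ As2)" "wf_list ([B] @ Bs2)" "wf_struct A" "wf_struct B"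
    using wf by (simp_all add: wf_list_append wf_list_Cons)
  have 1: "local_emb (list_struct As1) (list_struct Bs1) (universe (list_struct As1)) ?h"
    using e1 dA(1) by (subst local_emb_cong[where h' = "\<lambda>x. x"]) auto
  have 2: "local_emb (list_struct As2) (list_struct Bs2) (universe (list_struct As2)) ?h"
    using e2 dA(2) by (subst local_emb_cong[where h' = "\<lambda>x. x"]) auto
  have "local_emb A B (universe A) ?h"
    using e by (subst local_emb_cong[where h' = h]) auto
  then have 3: "local_emb (list_struct [A]) (list_struct [B]) (universe A) ?h"
    using wfp by (intro local_emb_singleton)
  have 4: "local_emb (list_struct ([A] @ As2)) (list_struct ([B] @ Bs2)) (universe (list_struct ([A] @ As2))) ?h"
    by (rule local_emb_append[OF wfp(1,2) order_refl]; rule local_emb_mono[OF 3] local_emb_mono[OF 2]) auto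
  show ?thesis
    by (rule local_emb_append[OF wf order_refl]; rule local_emb_mono[OF 1] local_emb_mono[OF 4]) auto
qed

text \<open>One shared point is all that comparing unary types requires. In a product the point lies
  in one factor, and the other factor is amalgamated over the empty set. Lists without a shared
  point are concatenated; otherwise the two items of the shared point are amalgamated and the lists
  are merged around the result.\<close>

lemma amalgamation:
  fixes A B :: "'a::infinite rel_struct"
  assumes "normal n" "A \<in> models n" "B \<in> models n" "X \<subseteq> {x}" "local_emb A B X p"
  shows "\<exists>C\<in>models n. \<exists>h g. local_emb A C (universe A) h \<and> local_emb B C (universe B) g \<and>
    (\<forall>x\<in>X. g (p x) = h x)"
  using assms
proof (induction n arbitrary: A B X p)
  case NZero
  then show ?case
    using local_emb_id[of "{}" A] local_embD(1)[OF NZero.prems(5)]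
    by (intro bexI[of _ A] exI[of _ "\<lambda>x. x"] conjI) auto
next
  case NOne
  then obtain a b where "A = unit_struct a" "B = unit_struct b" by auto
  then show ?case
    using NOne.prems by (intro bexI[of _ A] exI[of _ "\<lambda>x. x"] exI[of _ "\<lambda>_. a"] conjI) auto
next
  case (NTimes m n)
  then obtain A1 A2 B1 B2 where A: "A = prod_struct A1 A2" "A1 \<in> models m" "A2 \<in> models n" "disj A1 A2"
    and B: "B = prod_struct B1 B2" "B1 \<in> models m" "B2 \<in> models n" "disj B1 B2"
    by auto
  note AB = A(2-4) B(2-4)
  have X: "X \<subseteq> universe A1 \<union> universe A2"
    and e1: "local_emb A1 B1 (X \<inter> universe A1) p" and e2: "local_emb A2 B2 (X \<inter> universe A2) p"
    using NTimes.prems(5) local_emb_models_prod[OF AB] unfolding A B by blast+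
  from NTimes.IH(1)[OF _ A(2) B(2) _ e1] NTimes.prems obtain C1 h1 g1 where
    1: "C1 \<in> models m" "local_emb A1 C1 (universe A1) h1" "local_emb B1 C1 (universe B1) g1"
      "\<forall>x\<in>X \<inter> universe A1. g1 (p x) = h1 x"
    by auto
  from NTimes.IH(2)[OF _ A(3) B(3) _ e2] NTimes.prems obtain C h2 g2 where
    2: "C \<in> models n" "local_emb A2 C (universe A2) h2" "local_emb B2 C (universe B2) g2"
      "\<forall>x\<in>X \<inter> universe A2. g2 (p x) = h2 x"
    by auto
  \<comment> \<open>\<open>C1\<close> and \<open>C\<close> come from independent amalgamations and
    may overlap.\<close>
  obtain r where r: "rename r C \<in> models n" "local_emb C (rename r C) (universe C) r"
    "universe (rename r C) \<inter> universe C1 = {}"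
    using fresh_copy[OF 2(1) finite_models[OF 1(1)]] .
  have C: "disj C1 (rename r C)"
    using r(3) by blast
  have e: "local_emb A2 (rename r C) (universe A2) (\<lambda>x. r (h2 x))"
    "local_emb B2 (rename r C) (universe B2) (\<lambda>x. r (g2 x))"
    by (rule local_emb_comp[OF 2(2)] local_emb_comp[OF 2(3)];
      rule local_emb_mono[OF r(2) local_embD(2)[OF 2(2)]] local_emb_mono[OF r(2) local_embD(2)[OF 2(3)]])+
  let ?h = "\<lambda>x. if x \<in> universe A1 then h1 x else r (h2 x)"
  let ?g = "\<lambda>x. if x \<in> universe B1 then g1 x else r (g2 x)"
  have eh: "local_emb A1 C1 (universe A1) ?h" "local_emb A2 (rename r C) (universe A2) ?h"
    using 1(2) e(1) A(4) by (subst local_emb_cong[where h' = h1], auto,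
      subst local_emb_cong[where h' = "\<lambda>x. r (h2 x)"], auto)
  have eg: "local_emb B1 C1 (universe B1) ?g" "local_emb B2 (rename r C) (universe B2) ?g"
    using 1(3) e(2) B(4) by (subst local_emb_cong[where h' = g1], auto,
      subst local_emb_cong[where h' = "\<lambda>x. r (g2 x)"], auto)
  have pX: "p x \<in> universe B1 \<longleftrightarrow> x \<in> universe A1" if "x \<in> X" for x
    using that X local_embD(5)[OF e1, of x] local_embD(5)[OF e2, of x] A(4) B(4) by blast
  show ?case
  proof (intro bexI[of _ "prod_struct C1 (rename r C)"] exI conjI)
    show "local_emb A (prod_struct C1 (rename r C)) (universe A) ?h"
      unfolding A(1) using eh local_emb_models_prod[OF AB(1-3) 1(1) r(1) C]
      by (auto elim!: local_emb_mono simp del: universe_rename)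
    show "local_emb B (prod_struct C1 (rename r C)) (universe B) ?g"
      unfolding B(1) using eg local_emb_models_prod[OF AB(4-6) 1(1) r(1) C]
      by (auto elim!: local_emb_mono simp del: universe_rename)
    show "\<forall>x\<in>X. ?g (p x) = ?h x"
      using pX 1(4) 2(4) X by auto
    show "prod_struct C1 (rename r C) \<in> models (NTimes m n)"
      using 1(1) r(1) C by (rule prod_in_models)
  qed
next
  case (NPlus m n)
  consider A1 B1 where "A = inl_struct A1" "B = inl_struct B1" "A1 \<in> models m" "B1 \<in> models m"
    | A1 B1 where "A = inr_struct A1" "B = inr_struct B1" "A1 \<in> models n" "B1 \<in> models n"
    using NPlus.prems by auto
  then show ?case
  proof cases
    case 1
    then obtain C h g where "C \<in> models m" "local_emb A1 C (universe A1) h" "local_emb B1 C (universe B1) g"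
      "\<forall>x\<in>X. g (p x) = h x"
      using NPlus.IH(1)[of A1 B1 X p] NPlus.prems by auto
    then show ?thesis
      using 1 by (intro bexI[of _ "inl_struct C"] exI[of _ h] exI[of _ g]) auto
  next
    case 2
    then obtain C h g where "C \<in> models n" "local_emb A1 C (universe A1) h" "local_emb B1 C (universe B1) g"
      "\<forall>x\<in>X. g (p x) = h x"
      using NPlus.IH(2)[of A1 B1 X p] NPlus.prems by auto
    then show ?thesis
      using 2 by (intro bexI[of _ "inr_struct C"] exI[of _ h] exI[of _ g]) auto
  qed
next
  case (NList n)
  obtain r where r: "rename r B \<in> models (NList n)" "local_emb B (rename r B) (universe B) r"
    "universe (rename r B) \<inter> universe A = {}"
    using fresh_copy[OF NList.prems(3) finite_models[OF NList.prems(2)]] .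
  obtain As where As: "A = list_struct As" "items (models n) As"
    using NList.prems(2) by auto
  obtain Bs where Bs: "rename r B = list_struct Bs" "items (models n) Bs"
    using r(1) by auto
  let ?p = "\<lambda>x. r (p x)"
  have e: "local_emb (list_struct As) (list_struct Bs) X ?p"
    using local_emb_comp[OF NList.prems(5) local_emb_mono[OF r(2)]] local_embD(2)[OF NList.prems(5)]
    by (simp add: As Bs del: universe_list_struct)
  have dis: "disj (list_struct As) (list_struct Bs)"
    using r(3) unfolding Bs(1) As(1) by blast
  have "\<exists>Ds. items (models n) Ds \<and> (\<exists>h g. local_emb (list_struct As) (list_struct Ds) (universe (list_struct As)) h \<and>
      local_emb (list_struct Bs) (list_struct Ds) (universe (list_struct Bs)) g \<and> (\<forall>x\<in>X. g (?p x) = h x))"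
  proof (cases "X = {}")
    case True
    have "items (models n) (As @ Bs)"
      using As Bs dis by (simp add: items_append)
    then show ?thesis
      using True local_emb_append_left[of As Bs] local_emb_append_right[of As Bs] items_models_wf[of n "As @ Bs"]
      by (intro exI[of _ "As @ Bs"] conjI exI[of _ "\<lambda>x. x"]) (simp_all del: universe_list_struct)
  next
    case False
    then have X: "X = {x}"
      using NList.prems(4) by blast
    have wf: "wf_list As" "wf_list Bs"
      using As Bs items_models_wf by blast+
    have x: "x \<in> universe (list_struct As)" "?p x \<in> universe (list_struct Bs)"
      using local_embD(4,5)[OF e, of x] X by blast+
    define A0 B0 where "A0 = item As x" and "B0 = item Bs (?p x)"
    have A0: "A0 \<in> set As" "x \<in> universe A0" and B0: "B0 \<in> set Bs" "?p x \<in> universe B0"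
      using pos_less(2,3)[OF wf(1) x(1)] pos_less(2,3)[OF wf(2) x(2)] by (auto simp: A0_def B0_def)
    have mod: "A0 \<in> models n" "B0 \<in> models n"
      using A0 B0 As Bs by (auto simp: items_def)
    have "local_emb A0 B0 (X \<inter> universe A0) ?p"
      using e[unfolded local_emb_list[OF wf]] X by (simp add: A0_def B0_def del: universe_list_struct)
    then have "local_emb A0 B0 {x} ?p"
      using X A0 by simp
    then obtain C0 h0 g0 where C0: "C0 \<in> models n" "local_emb A0 C0 (universe A0) h0"
      "local_emb B0 C0 (universe B0) g0" "g0 (?p x) = h0 x"
      using NList.IH[of A0 B0 "{x}" ?p] mod NList.prems(1) by auto
    have fin: "finite (universe (list_struct As) \<union> universe (list_struct Bs))"
      using finite_models[OF NList.prems(2)] finite_models[OF r(1)] unfolding As(1) Bs(1) by blast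
    obtain q where q: "rename q C0 \<in> models n" "local_emb C0 (rename q C0) (universe C0) q"
      "universe (rename q C0) \<inter> (universe (list_struct As) \<union> universe (list_struct Bs)) = {}"
      using fresh_copy[OF C0(1) fin] .
    have hg: "local_emb A0 (rename q C0) (universe A0) (\<lambda>x. q (h0 x))"
      "local_emb B0 (rename q C0) (universe B0) (\<lambda>x. q (g0 x))"
      by (rule local_emb_comp[OF C0(2) local_emb_mono[OF q(2) local_embD(2)[OF C0(2)]]],
        rule local_emb_comp[OF C0(3) local_emb_mono[OF q(2) local_embD(2)[OF C0(3)]]])
    obtain As1 As2 where As': "As = As1 @ [A0] @ As2"
      using split_list[OF A0(1)] by auto
    obtain Bs1 Bs2 where Bs': "Bs = Bs1 @ [B0] @ Bs2"
      using split_list[OF B0(1)] by auto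
    let ?Ds = "(As1 @ Bs1) @ [rename q C0] @ (As2 @ Bs2)"
    let ?h = "\<lambda>x. if x \<in> universe A0 then q (h0 x) else x"
    let ?g = "\<lambda>x. if x \<in> universe B0 then q (g0 x) else x"
    have "universe (rename q C0) \<noteq> {}"
      using local_embD(2)[OF hg(1)] A0(2) by blast
    then have Ds: "items (models n) ?Ds"
      using As(2) Bs(2) dis q(1,3) unfolding As' Bs' by (intro items_amalgam)
    have wfD: "wf_list ?Ds"
      using items_models_wf[OF Ds] .
    then have "wf_list (As1 @ Bs1)" "wf_list (As2 @ Bs2)"
      by (simp_all add: wf_list_append wf_list_Cons Int_Un_distrib)
    note emb = this[THEN local_emb_append_left] this[THEN local_emb_append_right]
    have "local_emb (list_struct As) (list_struct ?Ds) (universe (list_struct As)) ?h"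
      unfolding As' by (rule local_emb_replace[OF wf(1)[unfolded As'] wfD emb(1,2) hg(1)])
    moreover have "local_emb (list_struct Bs) (list_struct ?Ds) (universe (list_struct Bs)) ?g"
      unfolding Bs' by (rule local_emb_replace[OF wf(2)[unfolded Bs'] wfD emb(3,4) hg(2)])
    moreover have "\<forall>x\<in>X. ?g (?p x) = ?h x"
      using X A0 B0 C0(4) by simp
    ultimately show ?thesis
      using Ds by blast
  qed
  then obtain Ds h g where Ds: "items (models n) Ds"
    "local_emb (list_struct As) (list_struct Ds) (universe (list_struct As)) h"
    "local_emb (list_struct Bs) (list_struct Ds) (universe (list_struct Bs)) g" "\<forall>x\<in>X. g (?p x) = h x"
    by blast
  have "local_emb B (list_struct Ds) (universe B) (\<lambda>x. g (r x))"
    using local_emb_comp[OF r(2) local_emb_mono[OF Ds(3)[folded Bs(1)] local_embD(2)[OF r(2)]]] .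
  moreover have "list_struct Ds \<in> models (NList n)"
    using Ds(1) by auto
  ultimately show ?case
    using Ds(2,4) unfolding As(1) by blast
qed

text \<open>Amalgamation over the empty set. It needs sum-freeness, because structures from
  different sides of a sum disagree on a nullary relation.\<close>

lemma joint_embedding:
  fixes A B :: "'a::infinite rel_struct"
  assumes "normal n" "sum_free n" "A \<in> models n" "B \<in> models n"
  obtains C h g where "C \<in> models n" "local_emb A C (universe A) h" "local_emb B C (universe B) g"
  using amalgamation[OF assms(1,3,4), of "{}" undefined undefined] local_emb_empty[OF assms(2-4)] by blast

text \<open>Equality of the quantifier-free types of two elements, nullary facts included, phrased
  as an embedding of one point.\<close>

abbreviation same_type :: "'a rel_struct \<Rightarrow> 'a \<Rightarrow> 'a rel_struct \<Rightarrow> 'a \<Rightarrow> bool" where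
  "same_type A x B y \<equiv> local_emb A B {x} (\<lambda>_. y)"

lemma same_typeI: "local_emb A B X h \<Longrightarrow> x \<in> X \<Longrightarrow> same_type A x B (h x)"
  by (subst local_emb_cong[where h' = h]) (auto elim: local_emb_mono)

lemma same_type_trans: "same_type A x B y \<Longrightarrow> same_type B y C z \<Longrightarrow> same_type A x C z"
  using local_emb_comp[of A B "{x}" "\<lambda>_. y" C "\<lambda>_. z"] by simp

lemma same_type_sym: "same_type A x B y \<Longrightarrow> same_type B y A x"
  using local_emb_inv[of A B "{x}" "\<lambda>_. y"]
  by (subst local_emb_cong[where h' = "inv_into {x} (\<lambda>_. y)"]) (auto simp: inv_into_def)

lemma same_type_refl: "x \<in> universe A \<Longrightarrow> same_type A x A x"
  using same_typeI[OF local_emb_id[of "{x}" A], of x] by simp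

text \<open>A single element sees nothing of the list but its own item, because
  \<open>[x, x]\<close> always lies in \<open>Leq\<close>.\<close>

lemma same_type_list:
  assumes wf: "wf_list As" "wf_list Bs" and x: "x \<in> universe A" "A \<in> set As" and y: "B \<in> set Bs"
    and e: "same_type A x B y"
  shows "same_type (list_struct As) x (list_struct Bs) y"
proof -
  have "y \<in> universe B"
    using local_embD(5)[OF e] by simp
  moreover from this have "item As x = A" "item Bs y = B"
    using item_eq[OF wf(1) x(2,1)] item_eq[OF wf(2) y] by auto
  ultimately show ?thesis
    unfolding local_emb_list[OF wf] using x y e by auto
qed

lemma same_type_listD:
  assumes wf: "wf_list As" "wf_list Bs" and e: "same_type (list_struct As) x (list_struct Bs) y"
  shows "same_type (item As x) x (item Bs y) y"
  using e pos_less(2)[OF wf(1), of x] unfolding local_emb_list[OF wf] by simp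

text \<open>The path from the root of the type to \<open>x\<close> either crosses products only, and
  then an element of this type exists in every structure, or it crosses a list, and then the item
  containing \<open>x\<close> can be duplicated.\<close>

lemma twins:
  fixes A :: "'a::infinite rel_struct"
  assumes "normal n" "sum_free n" "A \<in> models n" "x \<in> universe A"
  shows "(\<forall>B\<in>models n. \<exists>y. same_type A x B y) \<or>
    (\<exists>C\<in>models n. \<exists>y z. y \<noteq> z \<and> same_type A x C y \<and> same_type A x C z)"
  using assms
proof (induction n arbitrary: A)
  case NOne
  then show ?case by auto
next
  case (NTimes m n)
  then obtain A1 A2 where A: "A = prod_struct A1 A2" "A1 \<in> models m" "A2 \<in> models n" "disj A1 A2"
    by auto
  have sf: "sum_free m" "sum_free n" "normal m" "normal n"
    using NTimes.prems by auto
  consider "x \<in> universe A1" "x \<notin> universe A2" | "x \<in> universe A2" "x \<notin> universe A1"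
    using A NTimes.prems(4) by auto
  then show ?case
  proof cases
    case 1
    \<comment> \<open>The other factor contributes nothing to the type of \<open>x\<close>, since it
      has no nullary relations.\<close>
    have lift: "same_type A x (prod_struct C D) y"
      if "same_type A1 x C y" "C \<in> models m" "D \<in> models n" "disj C D" for C D y
      unfolding A(1) local_emb_models_prod[OF A(2-4) that(2-4)]
      using 1 that(1) local_emb_empty[OF sf(2) A(3) that(3)] by auto
    from NTimes.IH(1)[OF sf(3,1) A(2) 1(1)] show ?thesis
    proof (elim disjE bexE exE conjE)
      fix C y z assume C: "C \<in> models m" "y \<noteq> z" "same_type A1 x C y" "same_type A1 x C z"
      obtain D :: "'a rel_struct" where D: "D \<in> models n" "universe D \<inter> universe C = {}"
        using ex_fresh_model[OF finite_models[OF C(1)]] .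
      then show ?thesis
        using lift[OF C(3) C(1) D(1)] lift[OF C(4) C(1) D(1)] C(1,2) by blast
    qed (use lift in fastforce)
  next
    case 2
    have lift: "same_type A x (prod_struct C D) y"
      if "same_type A2 x D y" "C \<in> models m" "D \<in> models n" "disj C D" for C D y
      unfolding A(1) local_emb_models_prod[OF A(2-4) that(2-4)]
      using 2 that(1) local_emb_empty[OF sf(1) A(2) that(2)] by auto
    from NTimes.IH(2)[OF sf(4,2) A(3) 2(1)] show ?thesis
    proof (elim disjE bexE exE conjE)
      fix C y z assume C: "C \<in> models n" "y \<noteq> z" "same_type A2 x C y" "same_type A2 x C z"
      obtain D :: "'a rel_struct" where D: "D \<in> models m" "universe D \<inter> universe C = {}"
        using ex_fresh_model[OF finite_models[OF C(1)]] .
      then show ?thesis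
        using lift[OF C(3) D(1) C(1)] lift[OF C(4) D(1) C(1)] C(1,2) by blast
    qed (use lift in fastforce)
  qed
next
  case (NList n)
  then obtain As where As: "A = list_struct As" "items (models n) As" by auto
  then obtain A0 where A0: "A0 \<in> set As" "x \<in> universe A0"
    using NList.prems(4) by auto
  then have m: "A0 \<in> models n"
    using As by (auto simp: items_def)
  obtain r where r: "rename r A0 \<in> models n" "local_emb A0 (rename r A0) (universe A0) r"
    "universe (rename r A0) \<inter> universe A0 = {}"
    using fresh_copy[OF m finite_models[OF m]] .
  have C: "items (models n) [A0, rename r A0]"
    using A0 m r by (auto simp: items_def)
  have "same_type A x (list_struct [A0, rename r A0]) x"
    unfolding As(1) using A0
    by (intro same_type_list[of _ _ _ A0 A0] items_models_wf[OF As(2)] items_models_wf[OF C] same_type_refl) auto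
  moreover have "same_type A x (list_struct [A0, rename r A0]) (r x)"
    unfolding As(1) using A0 same_typeI[OF r(2)]
    by (intro same_type_list[of _ _ _ A0 "rename r A0"] items_models_wf[OF As(2)] items_models_wf[OF C]) auto
  moreover have "x \<noteq> r x"
    using r(3) A0 by auto
  ultimately show ?case
    using C by (intro disjI2 bexI[of _ "list_struct [A0, rename r A0]"]) auto
qed (auto simp: rel_list_struct_Nil)

section \<open>Splitting a structure along a property of its elements\<close>

text \<open>\<open>r\<close> may forget elements but loses no information about those that stay:
  what holds between them in \<open>A\<close> can be read off in \<open>r A\<close>.\<close>

definition reflects :: "nf \<Rightarrow> ('a rel_struct \<Rightarrow> 'a rel_struct) \<Rightarrow> bool" where
  "reflects n r \<longleftrightarrow> (\<forall>A\<in>models n. \<forall>B\<in>models n. \<forall>X h. local_emb (r A) (r B) X h \<longrightarrow> local_emb A B X h)"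

text \<open>The additional elements of the preimage can be kept out of a finite set; otherwise
  preimages chosen for two factors or two items could collide.\<close>

definition onto :: "nf \<Rightarrow> nf \<Rightarrow> ('a rel_struct \<Rightarrow> 'a rel_struct) \<Rightarrow> bool" where
  "onto n m r \<longleftrightarrow> (\<forall>B\<in>models m. \<forall>F. finite F \<longrightarrow>
     (\<exists>A\<in>models n. r A = B \<and> (universe A - universe B) \<inter> F = {}))"

definition restriction :: "nf \<Rightarrow> nf \<Rightarrow> ('a rel_struct \<Rightarrow> 'a rel_struct) \<Rightarrow> bool" where
  "restriction n m r \<longleftrightarrow> interp (models n) (models m) r \<and> reflects n r \<and> onto n m r"

lemma reflectsD: "reflects n r \<Longrightarrow> A \<in> models n \<Longrightarrow> B \<in> models n \<Longrightarrow> local_emb (r A) (r B) X h \<Longrightarrow> local_emb A B X h"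
  unfolding reflects_def by blast

lemma ontoD:
  assumes "onto n m r" "B \<in> models m" "finite F"
  obtains A where "A \<in> models n" "r A = B" "(universe A - universe B) \<inter> F = {}"
  using assms unfolding onto_def by blast

lemma struct_eqI:
  assumes wf: "wf_struct A" "wf_struct B"
    and e: "local_emb A B (universe A) (\<lambda>x. x)" "local_emb B A (universe B) (\<lambda>x. x)"
  shows "A = B"
proof (rule rel_struct.equality)
  show "universe A = universe B"
    using local_embD(2)[OF e(1)] local_embD(2)[OF e(2)] by auto
  have "xs \<in> rel A R \<longleftrightarrow> xs \<in> rel B R" for xs R
    using local_embD(6)[OF e(1), of xs R] local_embD(6)[OF e(2), of xs R]
      wf_structD[OF wf(1), of xs R] wf_structD[OF wf(2), of xs R] by auto
  then show "rel A = rel B" by blast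
qed simp

text \<open>The value at \<open>B\<close> is computed from an arbitrary preimage. For two preimages
  the identity on \<open>B\<close> is an embedding both ways by \<open>reflects\<close>; as
  \<open>f\<close> stays within the part, its two values embed identically into each other and
  therefore coincide.\<close>

lemma restriction_factor:
  assumes r: "restriction n m r" and f: "interp (models n) (structs \<Gamma>) f"
    and sub: "\<And>A. A \<in> models n \<Longrightarrow> universe (f A) \<subseteq> universe (r A)"
  obtains g where "interp (models m) (structs \<Gamma>) g" "\<And>A. A \<in> models n \<Longrightarrow> f A = g (r A)"
proof -
  have r': "interp (models n) (models m) r" "reflects n r" "onto n m r"
    using r by (auto simp: restriction_def)
  define pre where "pre = (\<lambda>B. SOME A. A \<in> models n \<and> r A = B)"
  have pre: "pre B \<in> models n \<and> r (pre B) = B" if "B \<in> models m" for B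
    unfolding pre_def by (rule someI_ex) (use ontoD[OF r'(3) that finite.emptyI] in blast)
  have emb: "local_emb (f A) (f B) (X \<inter> universe (f A)) h"
    if "A \<in> models n" "B \<in> models n" "local_emb (r A) (r B) X h" for A B X h
    using interpD(3)[OF f that(1,2) reflectsD[OF r'(2) that]] .
  have half: "local_emb (f A) (f B) (universe (f A)) (\<lambda>x. x)"
    if "A \<in> models n" "B \<in> models n" "r A = r B" for A B
    using emb[OF that(1,2), of "universe (r A)" "\<lambda>x. x"] local_emb_id[of "universe (r A)" "r A"] that(3) sub[OF that(1)]
    by (simp add: inf.absorb2)
  have eq: "f A = f B" if "A \<in> models n" "B \<in> models n" "r A = r B" for A B
    using half[OF that] half[OF that(2,1) that(3)[symmetric]]
      interpD(1)[OF f that(1)] interpD(1)[OF f that(2)] by (intro struct_eqI wf_structs)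
  show thesis
  proof
    show "interp (models m) (structs \<Gamma>) (\<lambda>B. f (pre B))"
    proof (rule interpI)
      fix B :: "'a rel_struct" assume "B \<in> models m"
      then show "f (pre B) \<in> structs \<Gamma> \<and> universe (f (pre B)) \<subseteq> universe B"
        using pre interpD(1)[OF f] sub by metis
    next
      fix B B' :: "'a rel_struct" and X h assume "B \<in> models m" "B' \<in> models m" "local_emb B B' X h"
      then show "local_emb (f (pre B)) (f (pre B')) (X \<inter> universe (f (pre B))) h"
        using pre emb by metis
    qed
    show "f A = f (pre (r A))" if "A \<in> models n" for A
      using pre[OF interpD(1)[OF r'(1) that]] eq[OF that] by metis
  qed
qed

text \<open>\<open>s\<close> derives both parts at once; \<open>reflects\<close> and
  \<open>onto\<close> are what allows a function on \<open>n\<close> to be passed through one of the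
  parts.\<close>

definition splits :: "nf \<Rightarrow> ('a rel_struct \<Rightarrow> 'a \<Rightarrow> bool) \<Rightarrow> nf \<Rightarrow> nf \<Rightarrow> ('a rel_struct \<Rightarrow> 'a rel_struct) \<Rightarrow>
    ('a rel_struct \<Rightarrow> 'a rel_struct) \<Rightarrow> ('a rel_struct \<Rightarrow> 'a rel_struct) \<Rightarrow> bool" where
  "splits n \<phi> m1 m2 r1 r2 s \<longleftrightarrow> derivable (type_of n) (type_of m1 \<otimes> type_of m2) s \<and>
     (\<forall>A\<in>models n. s A = prod_struct (r1 A) (r2 A) \<and> r1 A \<in> models m1 \<and> r2 A \<in> models m2 \<and>
        universe (r1 A) = {x \<in> universe A. \<phi> A x} \<and> universe (r2 A) = {x \<in> universe A. \<not> \<phi> A x}) \<and>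
     reflects n r1 \<and> reflects n r2 \<and> onto n m1 r1 \<and> onto n m2 r2"

lemma splitsD:
  assumes "splits n \<phi> m1 m2 r1 r2 s"
  shows "derivable (type_of n) (type_of m1 \<otimes> type_of m2) s"
    and "\<And>A. A \<in> models n \<Longrightarrow> s A = prod_struct (r1 A) (r2 A)"
    and "\<And>A. A \<in> models n \<Longrightarrow> r1 A \<in> models m1" "\<And>A. A \<in> models n \<Longrightarrow> r2 A \<in> models m2"
    and "\<And>A. A \<in> models n \<Longrightarrow> universe (r1 A) = {x \<in> universe A. \<phi> A x}"
    and "\<And>A. A \<in> models n \<Longrightarrow> universe (r2 A) = {x \<in> universe A. \<not> \<phi> A x}"
    and "reflects n r1" "reflects n r2" "onto n m1 r1" "onto n m2 r2"
    and "\<And>A. A \<in> models n \<Longrightarrow> disj (r1 A) (r2 A)"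
  using assms unfolding splits_def by auto

text \<open>That the parts are interpretations comes from \<open>s\<close>: it is derivable, hence
  compatible with embeddings, and an embedding of products is an embedding of each factor.\<close>

lemma splits_restriction:
  assumes s: "splits n \<phi> m1 m2 r1 r2 s"
  shows "restriction n m1 r1" "restriction n m2 r2"
proof -
  note D = splitsD[OF s]
  have e: "local_emb (r1 A) (r1 B) (X \<inter> universe (r1 A)) h \<and> local_emb (r2 A) (r2 B) (X \<inter> universe (r2 A)) h"
    if "A \<in> models n" "B \<in> models n" "local_emb A B X h" for A B X h
  proof -
    have "local_emb (s A) (s B) (X \<inter> universe (s A)) h"
      using interpD(3)[OF derivable_interp[OF D(1)] models_structs[OF that(1)] models_structs[OF that(2)] that(3)] .
    then have "local_emb (r1 A) (r1 B) (X \<inter> universe (s A) \<inter> universe (r1 A)) h \<and>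
        local_emb (r2 A) (r2 B) (X \<inter> universe (s A) \<inter> universe (r2 A)) h"
      unfolding D(2)[OF that(1)] D(2)[OF that(2)]
      by (subst (asm) local_emb_models_prod[OF D(3,4,11)[OF that(1)] D(3,4,11)[OF that(2)]]) simp
    then show ?thesis
      unfolding D(2)[OF that(1)] by (auto elim!: local_emb_mono)
  qed
  show "restriction n m1 r1" "restriction n m2 r2"
    unfolding restriction_def using D e by (auto intro!: interpI)
qed

definition type_invariant :: "nf \<Rightarrow> ('a rel_struct \<Rightarrow> 'a \<Rightarrow> bool) \<Rightarrow> bool" where
  "type_invariant n \<phi> \<longleftrightarrow> (\<forall>A\<in>models n. \<forall>B\<in>models n. \<forall>x y. same_type A x B y \<longrightarrow> \<phi> A x = \<phi> B y)"

lemma type_invariantD: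
  "type_invariant n \<phi> \<Longrightarrow> A \<in> models n \<Longrightarrow> B \<in> models n \<Longrightarrow> same_type A x B y \<Longrightarrow> \<phi> A x = \<phi> B y"
  unfolding type_invariant_def by blast

lemma weak_items_models:
  assumes "weak_items (models n) As"
  shows "list_struct As \<in> models (NList n)"
proof -
  have "weak_items (structs (type_of n)) As"
    using assms models_structs by (auto simp: weak_items_def)
  then have "list_struct As = list_struct (drop_empty As)"
    using list_struct_drop_empty by metis
  then show ?thesis
    using items_drop_empty[OF assms] by auto
qed

definition list_unzip :: "list_type \<Rightarrow> 'a rel_struct \<Rightarrow> 'a rel_struct" where
  "list_unzip \<Sigma> X = prod_struct (list_struct (map fst_part (un_list \<Sigma> X))) (list_struct (map snd_part (un_list \<Sigma> X)))"

lemma derivable_list_unzip: "derivable (Lists (\<Sigma> \<otimes> \<Gamma>)) (Lists \<Sigma> \<otimes> Lists \<Gamma>) (list_unzip (\<Sigma> \<otimes> \<Gamma>))"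
proof (intro derivable.prime list_distribute)
  fix ABs :: "('a rel_struct \<times> 'a rel_struct) list"
  assume ABs: "\<forall>(A, B)\<in>set ABs. A \<in> structs \<Sigma> \<and> B \<in> structs \<Gamma> \<and> disj A B"
    and it: "items (structs (\<Sigma> \<otimes> \<Gamma>)) (map (\<lambda>(A, B). prod_struct A B) ABs)"
  have "map fst_part (map (\<lambda>(A, B). prod_struct A B) ABs) = map fst ABs"
    "map snd_part (map (\<lambda>(A, B). prod_struct A B) ABs) = map snd ABs"
    using ABs by auto
  then show "list_unzip (\<Sigma> \<otimes> \<Gamma>) (list_struct (map (\<lambda>(A, B). prod_struct A B) ABs)) =
      prod_struct (list_struct (map fst ABs)) (list_struct (map snd ABs))"
    unfolding list_unzip_def un_list_list[OF it] by (simp only:)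
qed

text \<open>Both factors are split, and the four resulting parts are regrouped by exchanging the
  middle two.\<close>

lemma splits_NTimes:
  fixes \<phi> :: "'a::infinite rel_struct \<Rightarrow> 'a \<Rightarrow> bool"
  assumes s: "splits m \<phi>1 m1 m2 r1 r2 s" and t: "splits n \<phi>2 n1 n2 t1 t2 t"
    and \<phi>1: "\<And>A B x. A \<in> models m \<Longrightarrow> B \<in> models n \<Longrightarrow> disj A B \<Longrightarrow> x \<in> universe A \<Longrightarrow> \<phi> (prod_struct A B) x = \<phi>1 A x"
    and \<phi>2: "\<And>A B x. A \<in> models m \<Longrightarrow> B \<in> models n \<Longrightarrow> disj A B \<Longrightarrow> x \<in> universe B \<Longrightarrow> \<phi> (prod_struct A B) x = \<phi>2 B x"
  shows "\<exists>S. splits (NTimes m n) \<phi> (NTimes m1 n1) (NTimes m2 n2) (prod_map r1 t1) (prod_map r2 t2) S"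
proof -
  note D = splitsD[OF s] and E = splitsD[OF t]
  obtain e :: "'a rel_struct \<Rightarrow> 'a rel_struct" where e:
    "derivable ((type_of m1 \<otimes> type_of m2) \<otimes> (type_of n1 \<otimes> type_of n2))
      ((type_of m1 \<otimes> type_of n1) \<otimes> (type_of m2 \<otimes> type_of n2)) e"
    "\<And>A B C D. disj A B \<Longrightarrow> disj A C \<Longrightarrow> disj A D \<Longrightarrow> disj B C \<Longrightarrow> disj B D \<Longrightarrow> disj C D \<Longrightarrow>
      e (prod_struct (prod_struct A B) (prod_struct C D)) = prod_struct (prod_struct A C) (prod_struct B D)"
    by (rule derivable_exchange[where \<Gamma>\<^sub>1 = "type_of m1" and \<Gamma>\<^sub>2 = "type_of m2"
        and \<Sigma>\<^sub>1 = "type_of n1" and \<Sigma>\<^sub>2 = "type_of n2"]) blast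
  have dis: "disj (r1 A) (r2 A)" "disj (r1 A) (t1 B)" "disj (r1 A) (t2 B)" "disj (r2 A) (t1 B)"
      "disj (r2 A) (t2 B)" "disj (t1 B) (t2 B)"
    if "A \<in> models m" "B \<in> models n" "disj A B" for A B
    using D(5,6)[OF that(1)] E(5,6)[OF that(2)] that(3) by blast+
  have refl: "reflects (NTimes m n) (prod_map r t)"
    if r: "reflects m (r :: 'a rel_struct \<Rightarrow> 'a rel_struct)" "\<And>A. A \<in> models m \<Longrightarrow> universe (r A) \<subseteq> universe A \<and> r A \<in> models m'"
      and t: "reflects n t" "\<And>A. A \<in> models n \<Longrightarrow> universe (t A) \<subseteq> universe A \<and> t A \<in> models n'" for r t m' n'
    unfolding reflects_def
  proof (intro ballI allI impI)
    fix P Q :: "'a rel_struct" and X h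
    assume "P \<in> models (NTimes m n)" "Q \<in> models (NTimes m n)"
      and emb: "local_emb (prod_map r t P) (prod_map r t Q) X h"
    then obtain A B A' B' where P: "P = prod_struct A B" "A \<in> models m" "B \<in> models n" "disj A B"
      and Q: "Q = prod_struct A' B'" "A' \<in> models m" "B' \<in> models n" "disj A' B'"
      by auto
    have d: "disj (r A) (t B)" "disj (r A') (t B')"
      using r(2)[OF P(2)] t(2)[OF P(3)] P(4) r(2)[OF Q(2)] t(2)[OF Q(3)] Q(4) by blast+
    have mods: "r A \<in> models m'" "t B \<in> models n'" "r A' \<in> models m'" "t B' \<in> models n'"
      using r(2) t(2) P Q by blast+
    have emb': "X \<subseteq> universe (r A) \<union> universe (t B)" "local_emb (r A) (r A') (X \<inter> universe (r A)) h"
      "local_emb (t B) (t B') (X \<inter> universe (t B)) h"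
      using emb local_emb_models_prod[OF mods(1,2) d(1) mods(3,4) d(2)] P Q by simp_all
    have "X \<inter> universe A = X \<inter> universe (r A)" "X \<inter> universe B = X \<inter> universe (t B)"
      using emb'(1) r(2)[OF P(2)] t(2)[OF P(3)] P(4) by blast+
    then show "local_emb P Q X h"
      unfolding P(1) Q(1) local_emb_models_prod[OF P(2-4) Q(2-4)]
      using reflectsD[OF r(1) P(2) Q(2) emb'(2)] reflectsD[OF t(1) P(3) Q(3) emb'(3)] emb'(1)
        r(2)[OF P(2)] t(2)[OF P(3)] by auto
  qed
  have on: "onto (NTimes m n) (NTimes m' n') (prod_map r t)"
    if r: "onto m m' (r :: 'a rel_struct \<Rightarrow> 'a rel_struct)" and t: "onto n n' t" for r t m' n'
    unfolding onto_def
  proof (intro ballI allI impI)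
    fix P :: "'a rel_struct" and F :: "'a set"
    assume "P \<in> models (NTimes m' n')" and F: "finite F"
    then obtain A B where P: "P = prod_struct A B" "A \<in> models m'" "B \<in> models n'" "disj A B"
      by auto
    \<comment> \<open>The preimage of \<open>A\<close> is kept away from \<open>B\<close>, and the
      preimage of \<open>B\<close> away from that of \<open>A\<close>, so that the two form a
      product.\<close>
    obtain A' where A': "A' \<in> models m" "r A' = A" "(universe A' - universe A) \<inter> (F \<union> universe B) = {}"
      using ontoD[OF r P(2)] F finite_models[OF P(3)] by (metis finite_UnI)
    obtain B' where B': "B' \<in> models n" "t B' = B" "(universe B' - universe B) \<inter> (F \<union> universe A') = {}"
      using ontoD[OF t P(3)] F finite_models[OF A'(1)] by (metis finite_UnI)
    have d: "disj A' B'"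
      using A'(3) B'(3) P(4) by blast
    show "\<exists>Q\<in>models (NTimes m n). prod_map r t Q = P \<and> (universe Q - universe P) \<inter> F = {}"
    proof (intro bexI conjI)
      show "prod_struct A' B' \<in> models (NTimes m n)"
        using A'(1) B'(1) d by (rule prod_in_models)
      show "prod_map r t (prod_struct A' B') = P"
        using d A'(2) B'(2) P(1) by simp
      show "(universe (prod_struct A' B') - universe P) \<inter> F = {}"
        using A'(3) B'(3) P(1) by auto
    qed
  qed
  have "splits (NTimes m n) \<phi> (NTimes m1 n1) (NTimes m2 n2) (prod_map r1 t1) (prod_map r2 t2)
      (\<lambda>X. e (prod_map s t X))"
    unfolding splits_def
  proof (intro conjI ballI)
    show "derivable (type_of (NTimes m n)) (type_of (NTimes m1 n1) \<otimes> type_of (NTimes m2 n2)) (\<lambda>X. e (prod_map s t X))"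
      using derivable_comp[OF derivable_prod_map[OF D(1) E(1)] e(1)] by simp
    fix P :: "'a rel_struct" assume "P \<in> models (NTimes m n)"
    then obtain A B where P: "P = prod_struct A B" "A \<in> models m" "B \<in> models n" "disj A B"
      by auto
    note d = dis[OF P(2-4)]
    show "e (prod_map s t P) = prod_struct (prod_map r1 t1 P) (prod_map r2 t2 P)"
      using P(4) D(2)[OF P(2)] E(2)[OF P(3)] e(2)[OF d] by (simp add: P(1))
    show "prod_map r1 t1 P \<in> models (NTimes m1 n1)"
      unfolding P(1) prod_map_prod[OF P(4)] using D(3)[OF P(2)] E(3)[OF P(3)] d(2) by (rule prod_in_models)
    show "prod_map r2 t2 P \<in> models (NTimes m2 n2)"
      unfolding P(1) prod_map_prod[OF P(4)] using D(4)[OF P(2)] E(4)[OF P(3)] d(5) by (rule prod_in_models)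
    show "universe (prod_map r1 t1 P) = {x \<in> universe P. \<phi> P x}"
      using P \<phi>1[OF P(2-4)] \<phi>2[OF P(2-4)] D(5)[OF P(2)] E(5)[OF P(3)] by auto
    show "universe (prod_map r2 t2 P) = {x \<in> universe P. \<not> \<phi> P x}"
      using P \<phi>1[OF P(2-4)] \<phi>2[OF P(2-4)] D(6)[OF P(2)] E(6)[OF P(3)] by auto
  next
    show "reflects (NTimes m n) (prod_map r1 t1)"
      by (rule refl[OF D(7) _ E(7)]) (use D(3,5) E(3,5) in auto)
    show "reflects (NTimes m n) (prod_map r2 t2)"
      by (rule refl[OF D(8) _ E(8)]) (use D(4,6) E(4,6) in auto)
  qed (intro on D E)+
  then show ?thesis by blast
qed

text \<open>Both parts keep the tag of the sum, as otherwise an embedding of a part would not lift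
  to the whole structure.\<close>

lemma splits_NPlus:
  fixes \<phi> :: "'a rel_struct \<Rightarrow> 'a \<Rightarrow> bool"
  assumes s: "splits m (\<lambda>A. \<phi> (inl_struct A)) m1 m2 r1 r2 s" and t: "splits n (\<lambda>A. \<phi> (inr_struct A)) n1 n2 t1 t2 t"
  defines "R1 \<equiv> sum_case (\<lambda>A. inl_struct (r1 A)) (\<lambda>A. inr_struct (t1 A))"
    and "R2 \<equiv> sum_case (\<lambda>A. inl_struct (r2 A)) (\<lambda>A. inr_struct (t2 A))"
  shows "\<exists>S. splits (NPlus m n) \<phi> (NPlus m1 n1) (NPlus m2 n2) R1 R2 S"
proof -
  note D = splitsD[OF s] and E = splitsD[OF t]
  let ?S = "sum_case (\<lambda>A. prod_map inl_struct inl_struct (s A)) (\<lambda>A. prod_map inr_struct inr_struct (t A))"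
  have "splits (NPlus m n) \<phi> (NPlus m1 n1) (NPlus m2 n2) R1 R2 ?S"
    unfolding splits_def
  proof (intro conjI ballI)
    show "derivable (type_of (NPlus m n)) (type_of (NPlus m1 n1) \<otimes> type_of (NPlus m2 n2)) ?S"
      unfolding type_of.simps
      by (intro derivable_sum_case derivable_comp[OF D(1)] derivable_comp[OF E(1)] derivable_prod_map
          derivable_inl derivable_inr)
  next
    show "reflects (NPlus m n) R1"
      using D(7) E(7) unfolding reflects_def R1_def by auto
    show "reflects (NPlus m n) R2"
      using D(8) E(8) unfolding reflects_def R2_def by auto
    show "onto (NPlus m n) (NPlus m1 n1) R1"
      using D(9) E(9) unfolding onto_def R1_def by (auto simp: bex_Un) metis+
    show "onto (NPlus m n) (NPlus m2 n2) R2"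
      using D(10) E(10) unfolding onto_def R2_def by (auto simp: bex_Un) metis+
  qed (use D(2-6,11) E(2-6,11) in \<open>auto simp: R1_def R2_def\<close>)
  then show ?thesis by blast
qed

text \<open>Induction on the list with a growing forbidden set: the preimages for the tail avoid the
  next item, and the preimage of that item avoids those for the tail.\<close>

lemma onto_list:
  fixes r :: "'a::infinite rel_struct \<Rightarrow> 'a rel_struct"
  assumes r: "onto n m r" and sub: "\<And>A. A \<in> models n \<Longrightarrow> universe (r A) \<subseteq> universe A"
    and Bs: "items (models m) Bs" and F: "finite F"
  shows "\<exists>As. items (models n) As \<and> map r As = Bs \<and>
    (universe (list_struct As) - universe (list_struct Bs)) \<inter> F = {}"
  using Bs F
proof (induction Bs arbitrary: F)
  case Nil
  then show ?case by (auto simp: items_def)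
next
  case (Cons B Bs)
  have B: "B \<in> models m" "universe B \<noteq> {}" "disj B (list_struct Bs)" "items (models m) Bs"
    using Cons.prems(1) by (auto simp: items_Cons)
  have "finite (F \<union> universe B)"
    using Cons.prems(2) finite_models[OF B(1)] by simp
  from Cons.IH[OF B(4) this] obtain As where As: "items (models n) As" "map r As = Bs"
    "(universe (list_struct As) - universe (list_struct Bs)) \<inter> (F \<union> universe B) = {}"
    by blast
  have "list_struct As \<in> models (NList n)" using As(1) by auto
  then have fin: "finite (F \<union> universe (list_struct As))"
    using Cons.prems(2) finite_models by (simp del: universe_list_struct models.simps)
  obtain A where A: "A \<in> models n" "r A = B" "(universe A - universe B) \<inter> (F \<union> universe (list_struct As)) = {}"
    using ontoD[OF r B(1) fin] .
  have "disj A (list_struct As)"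
    using A(3) As(3) B(3) by blast
  moreover have "universe A \<noteq> {}"
    using sub[OF A(1)] A(2) B(2) by blast
  ultimately have "items (models n) (A # As)"
    using A(1) As(1) by (simp add: items_Cons)
  moreover have "(universe (list_struct (A # As)) - universe (list_struct (B # Bs))) \<inter> F = {}"
    using A(3) As(3) by auto
  ultimately show ?case
    using A(2) As(2) by (intro exI[of _ "A # As"]) simp
qed

text \<open>Each item is split and the list of pairs is unzipped. Parts that become empty leave no
  trace in the unzipped lists, yet comparisons of the remaining elements are unaffected, so
  embeddings still lift.\<close>

lemma splits_NList:
  fixes \<phi> :: "'a::infinite rel_struct \<Rightarrow> 'a \<Rightarrow> bool"
  assumes s: "splits n \<psi> m1 m2 r1 r2 s"
    and \<psi>: "\<And>As A x. items (models n) As \<Longrightarrow> A \<in> set As \<Longrightarrow> x \<in> universe A \<Longrightarrow> \<phi> (list_struct As) x = \<psi> A x"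
  defines "lift \<equiv> \<lambda>r X. list_struct (map r (un_list (type_of n) X))"
  shows "\<exists>S. splits (NList n) \<phi> (NList m1) (NList m2) (lift r1) (lift r2) S"
proof -
  note D = splitsD[OF s]
  have lift: "lift r (list_struct As) = list_struct (map r As)" if "items (models n) As" for r As
    using items_models[OF that] by (simp add: lift_def)
  have weak: "weak_items (models m) (map r As)"
    if "items (models n) As" "\<And>A. A \<in> models n \<Longrightarrow> r A \<in> models m" "\<And>A. A \<in> models n \<Longrightarrow> universe (r A) \<subseteq> universe A"
    for m r As
    by (rule weak_items_map[OF items_weak[OF that(1)]]) (use that in blast)
  have refl: "reflects (NList n) (lift r)"
    if r: "reflects n r" "\<And>A. A \<in> models n \<Longrightarrow> r A \<in> models m" "\<And>A. A \<in> models n \<Longrightarrow> universe (r A) \<subseteq> universe A"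
    for r m
    unfolding reflects_def
  proof (intro ballI allI impI)
    fix P Q :: "'a rel_struct" and X h
    assume "P \<in> models (NList n)" "Q \<in> models (NList n)" and e: "local_emb (lift r P) (lift r Q) X h"
    then obtain As Bs where P: "P = list_struct As" "items (models n) As" and Q: "Q = list_struct Bs" "items (models n) Bs"
      by auto
    have wf: "wf_list (map r Cs)" if "items (models n) Cs" for Cs
      using weak_items_models[OF weak[OF that r(2,3)]] weak[OF that r(2,3)] wf_models
      by (auto simp: weak_items_def wf_list_def)
    have "local_emb (list_struct (map (\<lambda>A. A) As)) (list_struct (map (\<lambda>A. A) Bs)) X h"
    proof (rule local_emb_map_transfer[where g = r])
      show "local_emb (list_struct (map r As)) (list_struct (map r Bs)) X h"
        using e lift P Q by simp
      fix C assume "C \<in> set As"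
      then show "X \<inter> universe (r C) \<subseteq> universe C"
        using r(3) P(2) by (auto simp: items_def)
    next
      fix C C' Z assume "C \<in> set As" "C' \<in> set Bs" "local_emb (r C) (r C') Z h"
      then show "local_emb C C' Z h"
        using reflectsD[OF r(1)] P(2) Q(2) by (auto simp: items_def)
    qed (use wf P Q items_models_wf in auto)
    then show "local_emb P Q X h"
      using P Q by simp
  qed
  have on: "onto (NList n) (NList m) (lift r)"
    if r: "onto n m r" "\<And>A. A \<in> models n \<Longrightarrow> universe (r A) \<subseteq> universe A" for r m
    unfolding onto_def
  proof (intro ballI allI impI)
    fix P :: "'a rel_struct" and F :: "'a set" assume "P \<in> models (NList m)" and F: "finite F"
    then obtain Bs where P: "P = list_struct Bs" "items (models m) Bs" by auto
    obtain As where "items (models n) As" "map r As = Bs"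
      "(universe (list_struct As) - universe (list_struct Bs)) \<inter> F = {}"
      using onto_list[OF r P(2) F] by blast
    then show "\<exists>A\<in>models (NList n). lift r A = P \<and> (universe A - universe P) \<inter> F = {}"
      using P lift by (intro bexI[of _ "list_struct As"]) auto
  qed
  let ?S = "\<lambda>X. list_unzip (type_of m1 \<otimes> type_of m2) (list_map (type_of n) s X)"
  have "splits (NList n) \<phi> (NList m1) (NList m2) (lift r1) (lift r2) ?S"
    unfolding splits_def
  proof (intro conjI ballI)
    show "derivable (type_of (NList n)) (type_of (NList m1) \<otimes> type_of (NList m2)) ?S"
      using derivable_comp[OF derivable_list_map[OF D(1)] derivable_list_unzip] by simp
    fix P :: "'a rel_struct" assume "P \<in> models (NList n)"
    then obtain As where P: "P = list_struct As" "items (models n) As" by auto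
    have As: "A \<in> models n" if "A \<in> set As" for A
      using that P(2) by (simp add: items_def)
    have U: "universe (s A) = universe A" if "A \<in> models n" for A
      using D(2,5,6)[OF that] by auto
    have "weak_items (structs (type_of m1 \<otimes> type_of m2)) (map s As)"
      using items_weak[OF P(2)] U derivable_in[OF D(1) models_structs] by (intro weak_items_map[of "models n"]) auto
    moreover have "\<forall>A\<in>set As. universe (s A) \<noteq> {}"
      using P(2) U by (auto simp: items_def)
    ultimately have it: "items (structs (type_of m1 \<otimes> type_of m2)) (map s As)"
      by (auto simp: items_def weak_items_def)
    have lm: "list_map (type_of n) s (list_struct As) = list_struct (map s As)"
      using list_map_list[OF items_weak[OF items_models[OF P(2)]] derivable_interp[OF D(1)]] .
    have mp: "map fst_part (map s As) = map r1 As" "map snd_part (map s As) = map r2 As"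
      using As D(2,11) by auto
    show "?S P = prod_struct (lift r1 P) (lift r2 P)"
      by (simp only: P(1) lm list_unzip_def un_list_list[OF it] mp lift[OF P(2)])
    show "lift r1 P \<in> models (NList m1)" "lift r2 P \<in> models (NList m2)"
      unfolding P(1) lift[OF P(2)] using D(3-6)
      by (intro weak_items_models weak P(2); auto)+
    show "universe (lift r1 P) = {x \<in> universe P. \<phi> P x}" "universe (lift r2 P) = {x \<in> universe P. \<not> \<phi> P x}"
      unfolding P(1) lift[OF P(2)] using D(5,6) As \<psi>[OF P(2)] by auto
  next
    show "reflects (NList n) (lift r1)" "reflects (NList n) (lift r2)"
      by (rule refl[OF D(7,3)] refl[OF D(8,4)]; use D(5,6) in auto)+
    show "onto (NList n) (NList m1) (lift r1)" "onto (NList n) (NList m2) (lift r2)"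
      by (rule on[OF D(9)] on[OF D(10)]; use D(5,6) in auto)+
  qed
  then show ?thesis by blast
qed

lemma derivable_nil_left: "derivable \<Sigma> (Lists \<Gamma> \<otimes> \<Sigma>) (\<lambda>A. prod_struct (list_struct []) A)"
  by (rule derivable_cong[OF derivable_comp[OF derivable_nil derivable_comm]]) simp

text \<open>Invariance lets \<open>\<phi>\<close> descend to the components, because the type of an
  element depends neither on the other factor nor on the other items. On \<open>NOne\<close> the
  property is constant: one part is everything and the other is \<open>NZero\<close>, which is how
  zeros enter.\<close>

lemma ex_splits:
  fixes \<phi> :: "'a::infinite rel_struct \<Rightarrow> 'a \<Rightarrow> bool"
  assumes "normal n" "type_invariant n \<phi>"
  shows "\<exists>m1 m2 r1 r2 s. splits n \<phi> m1 m2 r1 r2 s \<and> normal m1 \<and> normal m2 \<and>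
    (sum_free n \<longrightarrow> sum_free m1 \<and> sum_free m2) \<and> depth m1 \<le> depth n \<and> depth m2 \<le> depth n"
  using assms
proof (induction n arbitrary: \<phi>)
  case NZero
  have "splits NZero \<phi> NZero NZero (\<lambda>A. A) (\<lambda>_. list_struct []) (\<lambda>A. prod_struct A (list_struct []))"
    unfolding splits_def reflects_def onto_def using derivable_nil by auto
  then show ?case by (intro exI[of _ NZero] exI) auto
next
  case NOne
  let ?nil = "\<lambda>_ :: 'a rel_struct. list_struct [] :: 'a rel_struct"
  have id: "reflects NOne (\<lambda>A :: 'a rel_struct. A)" "onto NOne NOne (\<lambda>A :: 'a rel_struct. A)"
    by (auto simp: reflects_def onto_def)
  \<comment> \<open>An embedding between empty lists has domain \<open>{}\<close>, and
    \<open>NOne\<close> has no nullary relations to compare.\<close>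
  have "reflects NOne ?nil"
    unfolding reflects_def using local_emb_empty[of NOne] by (auto dest: local_embD(1))
  moreover have "onto NOne NZero ?nil"
    unfolding onto_def
  proof (intro ballI allI impI)
    fix B :: "'a rel_struct" and F :: "'a set" assume "B \<in> models NZero" "finite F"
    moreover obtain A :: "'a rel_struct" where "A \<in> models NOne" "universe A \<inter> F = {}"
      using ex_fresh_model[OF \<open>finite F\<close>] .
    ultimately show "\<exists>A\<in>models NOne. list_struct [] = B \<and> (universe A - universe B) \<inter> F = {}"
      by (intro bexI[of _ A]) auto
  qed
  moreover have const: "\<phi> (unit_struct a) a = \<phi> (unit_struct b) b" for a b
    by (rule type_invariantD[OF NOne.prems(2)]) auto
  moreover have "splits NOne \<phi> NOne NZero (\<lambda>A. A) (\<lambda>_. list_struct []) (\<lambda>A. prod_struct A (list_struct []))"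
    if "\<phi> (unit_struct undefined) undefined"
    unfolding splits_def using derivable_nil that const id calculation(1,2) by fastforce
  moreover have "splits NOne \<phi> NZero NOne (\<lambda>_. list_struct []) (\<lambda>A. A) (\<lambda>A. prod_struct (list_struct []) A)"
    if "\<not> \<phi> (unit_struct undefined) undefined"
    unfolding splits_def using derivable_nil_left that const id calculation(1,2) by fastforce
  ultimately show ?case
    by (cases "\<phi> (unit_struct undefined) undefined")
      ((rule exI[of _ NOne], rule exI[of _ NZero], auto)[], (rule exI[of _ NZero], rule exI[of _ NOne], auto)[])
next
  case (NTimes m n)
  have sf: "sum_free m" "sum_free n" "normal m" "normal n"
    using NTimes.prems by auto
  \<comment> \<open>The witness \<open>B\<close> merely completes \<open>A\<close> to a product; by
    \<open>inv1\<close> its choice is irrelevant.\<close>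
  define \<phi>1 where "\<phi>1 = (\<lambda>A x. \<exists>B\<in>models n. disj A B \<and> \<phi> (prod_struct A B) x)"
  define \<phi>2 where "\<phi>2 = (\<lambda>B x. \<exists>A\<in>models m. disj A B \<and> \<phi> (prod_struct A B) x)"
  have inv1: "\<phi> (prod_struct A B) x = \<phi> (prod_struct A' B') y"
    if "A \<in> models m" "B \<in> models n" "disj A B" "A' \<in> models m" "B' \<in> models n" "disj A' B'" "same_type A x A' y"
    for A B A' B' x y
  proof (rule type_invariantD[OF NTimes.prems(2)])
    have "x \<in> universe A" using local_embD(4)[OF that(7)] by blast
    then have "{x} \<inter> universe A = {x}" "{x} \<inter> universe B = {}"
      using that(3) by blast+
    then show "same_type (prod_struct A B) x (prod_struct A' B') y"
      unfolding local_emb_models_prod[OF that(1-6)]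
      using that(7) local_emb_empty[OF sf(2) that(2,5)] by auto
  qed (intro prod_in_models that)+
  have inv2: "\<phi> (prod_struct A B) x = \<phi> (prod_struct A' B') y"
    if "A \<in> models m" "B \<in> models n" "disj A B" "A' \<in> models m" "B' \<in> models n" "disj A' B'" "same_type B x B' y"
    for A B A' B' x y
  proof (rule type_invariantD[OF NTimes.prems(2)])
    have "x \<in> universe B" using local_embD(4)[OF that(7)] by blast
    then have "{x} \<inter> universe B = {x}" "{x} \<inter> universe A = {}"
      using that(3) by blast+
    then show "same_type (prod_struct A B) x (prod_struct A' B') y"
      unfolding local_emb_models_prod[OF that(1-6)]
      using that(7) local_emb_empty[OF sf(1) that(1,4)] by auto
  qed (intro prod_in_models that)+
  have \<phi>1: "\<phi> (prod_struct A B) x = \<phi>1 A x"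
    if "A \<in> models m" "B \<in> models n" "disj A B" "x \<in> universe A" for A B x
    using inv1[OF that(1-3) that(1) _ _ same_type_refl[OF that(4)]] that unfolding \<phi>1_def by blast
  have \<phi>2: "\<phi> (prod_struct A B) x = \<phi>2 B x"
    if "A \<in> models m" "B \<in> models n" "disj A B" "x \<in> universe B" for A B x
    using inv2[OF that(1-3) _ that(2) _ same_type_refl[OF that(4)]] that unfolding \<phi>2_def by blast
  have "type_invariant m \<phi>1"
    unfolding type_invariant_def
  proof (intro ballI allI impI)
    fix A A' :: "'a rel_struct" and x y assume A: "A \<in> models m" "A' \<in> models m" "same_type A x A' y"
    obtain B :: "'a rel_struct" where B: "B \<in> models n" "universe B \<inter> universe A = {}"
      using ex_fresh_model[OF finite_models[OF A(1)]] .
    obtain B' :: "'a rel_struct" where B': "B' \<in> models n" "universe B' \<inter> universe A' = {}"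
      using ex_fresh_model[OF finite_models[OF A(2)]] .
    have d: "disj A B" "disj A' B'" using B B' by blast+
    have "x \<in> universe A" "y \<in> universe A'" using local_embD(4,5)[OF A(3)] by blast+
    then show "\<phi>1 A x = \<phi>1 A' y"
      using \<phi>1[OF A(1) B(1) d(1)] \<phi>1[OF A(2) B'(1) d(2)] inv1[OF A(1) B(1) d(1) A(2) B'(1) d(2) A(3)] by simp
  qed
  moreover have "type_invariant n \<phi>2"
    unfolding type_invariant_def
  proof (intro ballI allI impI)
    fix A A' :: "'a rel_struct" and x y assume A: "A \<in> models n" "A' \<in> models n" "same_type A x A' y"
    obtain B :: "'a rel_struct" where B: "B \<in> models m" "universe B \<inter> universe A = {}"
      using ex_fresh_model[OF finite_models[OF A(1)]] .
    obtain B' :: "'a rel_struct" where B': "B' \<in> models m" "universe B' \<inter> universe A' = {}"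
      using ex_fresh_model[OF finite_models[OF A(2)]] .
    have "x \<in> universe A" "y \<in> universe A'" using local_embD(4,5)[OF A(3)] by blast+
    then show "\<phi>2 A x = \<phi>2 A' y"
      using \<phi>2[OF B(1) A(1) B(2)] \<phi>2[OF B'(1) A(2) B'(2)] inv2[OF B(1) A(1) B(2) B'(1) A(2) B'(2) A(3)] by simp
  qed
  ultimately obtain m1 m2 r1 r2 s n1 n2 t1 t2 t where
    s: "splits m \<phi>1 m1 m2 r1 r2 s" "normal m1" "normal m2" "sum_free m1" "sum_free m2"
      "depth m1 \<le> depth m" "depth m2 \<le> depth m" and
    t: "splits n \<phi>2 n1 n2 t1 t2 t" "normal n1" "normal n2" "sum_free n1" "sum_free n2"
      "depth n1 \<le> depth n" "depth n2 \<le> depth n"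
    using NTimes.IH(1)[OF sf(3)] NTimes.IH(2)[OF sf(4)] sf(1,2) by meson
  obtain S where "splits (NTimes m n) \<phi> (NTimes m1 n1) (NTimes m2 n2) (prod_map r1 t1) (prod_map r2 t2) S"
    using splits_NTimes[OF s(1) t(1) \<phi>1 \<phi>2] by blast
  then show ?case
    using s t by (intro exI[of _ "NTimes m1 n1"] exI[of _ "NTimes m2 n2"] exI conjI) auto
next
  case (NPlus m n)
  have "type_invariant m (\<lambda>A. \<phi> (inl_struct A))" "type_invariant n (\<lambda>A. \<phi> (inr_struct A))"
    using NPlus.prems(2) unfolding type_invariant_def by auto
  then obtain m1 m2 r1 r2 s n1 n2 t1 t2 t where
    s: "splits m (\<lambda>A. \<phi> (inl_struct A)) m1 m2 r1 r2 s" "normal m1" "normal m2"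
      "depth m1 \<le> depth m" "depth m2 \<le> depth m" and
    t: "splits n (\<lambda>A. \<phi> (inr_struct A)) n1 n2 t1 t2 t" "normal n1" "normal n2"
      "depth n1 \<le> depth n" "depth n2 \<le> depth n"
    using NPlus.IH NPlus.prems(1) by (meson normal.simps(4))
  from splits_NPlus[OF s(1) t(1)] s t show ?case
    by (elim exE, intro exI[of _ "NPlus m1 n1"] exI[of _ "NPlus m2 n2"] exI conjI) auto
next
  case (NList n)
  \<comment> \<open>Evaluated in the list with the single item \<open>A\<close>: an element has the
    same type there as in any list containing that item.\<close>
  define \<psi> where "\<psi> = (\<lambda>A. \<phi> (list_struct [A]))"
  have \<psi>: "\<phi> (list_struct As) x = \<psi> B y"
    if "items (models n) As" "A \<in> set As" "B \<in> models n" "same_type A x B y" for As A B x y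
    unfolding \<psi>_def
  proof (rule type_invariantD[OF NList.prems(2)])
    have xy: "x \<in> universe A" "y \<in> universe B"
      using local_embD(4,5)[OF that(4)] by blast+
    then have it: "items (models n) [B]"
      using that(3) by (auto simp: items_def)
    then show "list_struct [B] \<in> models (NList n)" by auto
    show "same_type (list_struct As) x (list_struct [B]) y"
      using same_type_list[OF items_models_wf[OF that(1)] items_models_wf[OF it] xy(1) that(2) _ that(4)] by simp
  qed (use that in auto)
  have "type_invariant n \<psi>"
    unfolding type_invariant_def
  proof (intro ballI allI impI)
    fix A B :: "'a rel_struct" and x y assume AB: "A \<in> models n" "B \<in> models n" "same_type A x B y"
    then have "items (models n) [A]"
      using local_embD(4)[OF AB(3)] by (auto simp: items_def)
    from \<psi>[OF this _ AB(2,3)] show "\<psi> A x = \<psi> B y"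
      by (simp add: \<psi>_def)
  qed
  then obtain m1 m2 r1 r2 s where s: "splits n \<psi> m1 m2 r1 r2 s" "normal m1" "normal m2"
      "depth m1 \<le> depth n" "depth m2 \<le> depth n"
    using NList.IH NList.prems(1) by (meson normal.simps(5))
  have eq: "\<phi> (list_struct As) x = \<psi> A x" if "items (models n) As" "A \<in> set As" "x \<in> universe A" for As A x
    using \<psi>[OF that(1,2) _ same_type_refl[OF that(3)]] that(1,2) by (auto simp: items_def)
  have "\<exists>R1 R2 S. splits (NList n) \<phi> (NList m1) (NList m2) R1 R2 S"
    by (rule exI, rule exI, rule splits_NList[OF s(1)], rule eq)
  then show ?case
    using s by (elim exE, intro exI[of _ "NList m1"] exI[of _ "NList m2"] exI conjI) auto
qed

text \<open>Discarding a factor loses no information about the other one because the discarded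
  factor has no nullary relations and its empty embedding always exists.\<close>

lemma restriction_fst:
  assumes "sum_free n"
  shows "restriction (NTimes m n) m (fst_part :: 'a::infinite rel_struct \<Rightarrow> _)"
  unfolding restriction_def
proof (intro conjI)
  show "interp (models (NTimes m n)) (models m) (fst_part :: 'a rel_struct \<Rightarrow> _)"
    unfolding models.simps(3) by (rule interp_prodI) (auto intro: wf_models)
  show "reflects (NTimes m n) (fst_part :: 'a rel_struct \<Rightarrow> _)"
    unfolding reflects_def
  proof (intro ballI allI impI)
    fix P Q :: "'a rel_struct" and X h
    assume "P \<in> models (NTimes m n)" "Q \<in> models (NTimes m n)" and e: "local_emb (fst_part P) (fst_part Q) X h"
    then obtain A B A' B' where P: "P = prod_struct A B" "A \<in> models m" "B \<in> models n" "disj A B"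
      and Q: "Q = prod_struct A' B'" "A' \<in> models m" "B' \<in> models n" "disj A' B'"
      by auto
    have "X \<subseteq> universe A" "local_emb A A' X h"
      using e local_embD(1)[OF e] P Q by simp_all
    moreover from this have "X \<inter> universe B = {}"
      using P(4) by blast
    ultimately show "local_emb P Q X h"
      unfolding P(1) Q(1) local_emb_models_prod[OF P(2-4) Q(2-4)]
      using local_emb_empty[OF assms P(3) Q(3)] by (auto simp: inf.absorb1)
  qed
  show "onto (NTimes m n) m (fst_part :: 'a rel_struct \<Rightarrow> _)"
    unfolding onto_def
  proof (intro ballI allI impI)
    fix A :: "'a rel_struct" and F :: "'a set" assume A: "A \<in> models m" "finite F"
    obtain B :: "'a rel_struct" where "B \<in> models n" "universe B \<inter> (F \<union> universe A) = {}"
      using ex_fresh_model[of "F \<union> universe A"] A(2) finite_models[OF A(1)] by (metis finite_UnI)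
    with A show "\<exists>P\<in>models (NTimes m n). fst_part P = A \<and> (universe P - universe A) \<inter> F = {}"
      by (intro bexI[of _ "prod_struct A B"]) auto
  qed
qed

lemma restriction_snd:
  assumes "sum_free m"
  shows "restriction (NTimes m n) n (snd_part :: 'a::infinite rel_struct \<Rightarrow> _)"
  unfolding restriction_def
proof (intro conjI)
  show "interp (models (NTimes m n)) (models n) (snd_part :: 'a rel_struct \<Rightarrow> _)"
    unfolding models.simps(3) by (rule interp_prodI) (auto intro: wf_models)
  show "reflects (NTimes m n) (snd_part :: 'a rel_struct \<Rightarrow> _)"
    unfolding reflects_def
  proof (intro ballI allI impI)
    fix P Q :: "'a rel_struct" and X h
    assume "P \<in> models (NTimes m n)" "Q \<in> models (NTimes m n)" and e: "local_emb (snd_part P) (snd_part Q) X h"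
    then obtain A B A' B' where P: "P = prod_struct A B" "A \<in> models m" "B \<in> models n" "disj A B"
      and Q: "Q = prod_struct A' B'" "A' \<in> models m" "B' \<in> models n" "disj A' B'"
      by auto
    have "X \<subseteq> universe B" "local_emb B B' X h"
      using e local_embD(1)[OF e] P Q by simp_all
    moreover from this have "X \<inter> universe A = {}"
      using P(4) by blast
    ultimately show "local_emb P Q X h"
      unfolding P(1) Q(1) local_emb_models_prod[OF P(2-4) Q(2-4)]
      using local_emb_empty[OF assms P(2) Q(2)] by (auto simp: inf.absorb1)
  qed
  show "onto (NTimes m n) n (snd_part :: 'a rel_struct \<Rightarrow> _)"
    unfolding onto_def
  proof (intro ballI allI impI)
    fix A :: "'a rel_struct" and F :: "'a set" assume A: "A \<in> models n" "finite F"
    obtain B :: "'a rel_struct" where B: "B \<in> models m" "universe B \<inter> (F \<union> universe A) = {}"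
      using ex_fresh_model[of "F \<union> universe A"] A(2) finite_models[OF A(1)] by (metis finite_UnI)
    then have "disj B A" by blast
    with A B show "\<exists>P\<in>models (NTimes m n). snd_part P = A \<and> (universe P - universe A) \<inter> F = {}"
      by (intro bexI[of _ "prod_struct B A"]) auto
  qed
qed

section \<open>Deriving interpretations on normal forms\<close>

text \<open>The derivable \<open>g\<close> is compared with \<open>f\<close> on
  \<open>models n\<close> only. Further structures of \<open>type_of n\<close>, which may exist when
  \<open>NZero\<close> occurs in \<open>n\<close>, leave it unconstrained.\<close>

definition solvable :: "nf \<Rightarrow> list_type \<Rightarrow> ('a rel_struct \<Rightarrow> 'a rel_struct) \<Rightarrow> bool" where
  "solvable n \<Gamma> f \<longleftrightarrow> (\<exists>g. derivable (type_of n) \<Gamma> g \<and> (\<forall>A\<in>models n. g A = f A))"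

lemma solvableI: "derivable (type_of n) \<Gamma> g \<Longrightarrow> (\<And>A. A \<in> models n \<Longrightarrow> g A = f A) \<Longrightarrow> solvable n \<Gamma> f"
  unfolding solvable_def by blast

lemma solvable_comp:
  assumes "solvable m \<Gamma> g" "derivable (type_of n) (type_of m) r" "\<And>A. A \<in> models n \<Longrightarrow> r A \<in> models m"
    "\<And>A. A \<in> models n \<Longrightarrow> f A = g (r A)" "derivable \<Gamma> \<Delta> k"
  shows "solvable n \<Delta> (\<lambda>A. k (f A))"
proof -
  obtain g' where "derivable (type_of m) \<Gamma> g'" "\<And>A. A \<in> models m \<Longrightarrow> g' A = g A"
    using assms(1) by (auto simp: solvable_def)
  note g' = this
  show ?thesis
    using assms(3,4) g'(2)
    by (intro solvableI[OF derivable_comp[OF derivable_comp[OF assms(2) g'(1)] assms(5)]]) auto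
qed

lemma structs_Unit_universe: "A \<in> structs Unit \<Longrightarrow> \<exists>a. universe A = {a}"
  by auto

lemma interp_local_emb:
  assumes "interp \<C> \<D> f" "A \<in> \<C>" "B \<in> \<C>" "local_emb A B X h" "X \<subseteq> universe (f A)"
  shows "local_emb (f A) (f B) X h"
  using interpD(3)[OF assms(1-4)] assms(5) by (simp add: inf.absorb1)

lemma interp_mem:
  assumes "interp \<C> \<D> f" "A \<in> \<C>" "B \<in> \<C>" "same_type A x B y"
  shows "x \<in> universe (f A) \<longleftrightarrow> y \<in> universe (f B)"
  using interp_iff[OF assms] by simp

text \<open>If two inputs used different sides, a joint extension of them would use both sides at
  once.\<close>

lemma one_component:
  fixes f :: "'a::infinite rel_struct \<Rightarrow> 'a rel_struct"
  assumes n: "normal (NTimes m n)" and f: "interp (models (NTimes m n)) \<D> f"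
    and single: "\<And>A x y. A \<in> models (NTimes m n) \<Longrightarrow> x \<in> universe (f A) \<Longrightarrow> y \<in> universe (f A) \<Longrightarrow>
      x \<in> universe (fst_part A) \<Longrightarrow> y \<in> universe (snd_part A) \<Longrightarrow> False"
  shows "(\<forall>A\<in>models (NTimes m n). universe (f A) \<subseteq> universe (fst_part A)) \<or>
    (\<forall>A\<in>models (NTimes m n). universe (f A) \<subseteq> universe (snd_part A))"
proof (rule ccontr)
  have sides: "universe A = universe (fst_part A) \<union> universe (snd_part A)"
    "universe (fst_part A) \<inter> universe (snd_part A) = {}" if "A \<in> models (NTimes m n)" for A :: "'a rel_struct"
    using that by auto
  assume "\<not> ?thesis"
  then obtain A B x y where A: "A \<in> models (NTimes m n)" "x \<in> universe (f A)" "x \<notin> universe (snd_part A)"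
    and B: "B \<in> models (NTimes m n)" "y \<in> universe (f B)" "y \<notin> universe (fst_part B)"
    by blast
  then have x: "x \<in> universe (fst_part A)" and y: "y \<in> universe (snd_part B)"
    using interpD(2)[OF f] sides by blast+
  have "sum_free (NTimes m n)" using n by simp
  then obtain C h g where C: "C \<in> models (NTimes m n)" "local_emb A C (universe A) h" "local_emb B C (universe B) g"
    using joint_embedding[OF n _ A(1) B(1)] by metis
  have sf: "sum_free m" "sum_free n" using n by auto
  have "h x \<in> universe (f C)" "g y \<in> universe (f C)"
    using interp_iff[OF f A(1) C(1,2), of x] interp_iff[OF f B(1) C(1,3), of y] A B x y sides by blast+
  moreover have "h x \<in> universe (fst_part C)"
    using interp_iff[OF _ A(1) C(1,2), of "models m" fst_part x] restriction_fst[OF sf(2), of m] x sides(1)[OF A(1)]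
    by (auto simp: restriction_def)
  moreover have "g y \<in> universe (snd_part C)"
    using interp_iff[OF _ B(1) C(1,3), of "models n" snd_part y] restriction_snd[OF sf(1), of n] y sides(1)[OF B(1)]
    by (auto simp: restriction_def)
  ultimately show False
    using single[OF C(1)] by blast
qed

lemma solvable_fst:
  fixes f :: "'a::infinite rel_struct \<Rightarrow> 'a rel_struct"
  assumes n: "normal (NTimes m n)" and f: "interp (models (NTimes m n)) (structs \<Gamma>) f"
    and sub: "\<forall>A\<in>models (NTimes m n). universe (f A) \<subseteq> universe (fst_part A)"
    and g: "\<And>g. interp (models m) (structs \<Gamma>) g \<Longrightarrow> (\<And>A. A \<in> models (NTimes m n) \<Longrightarrow> f A = g (fst_part A)) \<Longrightarrow> solvable m \<Gamma> g"
  shows "solvable (NTimes m n) \<Gamma> f"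
proof -
  have r: "restriction (NTimes m n) m (fst_part :: 'a rel_struct \<Rightarrow> _)"
    using restriction_fst n by auto
  obtain g where g': "interp (models m) (structs \<Gamma>) g" "\<And>A. A \<in> models (NTimes m n) \<Longrightarrow> f A = g (fst_part A)"
    using restriction_factor[OF r f] sub by blast
  have "solvable (NTimes m n) \<Gamma> (\<lambda>A. (\<lambda>A. A) (f A))"
    by (rule solvable_comp[OF g[OF g'] _ _ g'(2) derivable_id])
      (use r derivable_fst in \<open>auto simp: restriction_def interp_def\<close>)
  then show ?thesis by simp
qed

lemma solvable_snd:
  fixes f :: "'a::infinite rel_struct \<Rightarrow> 'a rel_struct"
  assumes n: "normal (NTimes m n)" and f: "interp (models (NTimes m n)) (structs \<Gamma>) f"
    and sub: "\<forall>A\<in>models (NTimes m n). universe (f A) \<subseteq> universe (snd_part A)"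
    and g: "\<And>g. interp (models n) (structs \<Gamma>) g \<Longrightarrow> (\<And>A. A \<in> models (NTimes m n) \<Longrightarrow> f A = g (snd_part A)) \<Longrightarrow> solvable n \<Gamma> g"
  shows "solvable (NTimes m n) \<Gamma> f"
proof -
  have r: "restriction (NTimes m n) n (snd_part :: 'a rel_struct \<Rightarrow> _)"
    using restriction_snd n by auto
  obtain g where g': "interp (models n) (structs \<Gamma>) g" "\<And>A. A \<in> models (NTimes m n) \<Longrightarrow> f A = g (snd_part A)"
    using restriction_factor[OF r f] sub by blast
  have "solvable (NTimes m n) \<Gamma> (\<lambda>A. (\<lambda>A. A) (f A))"
    by (rule solvable_comp[OF g[OF g'] _ _ g'(2) derivable_id])
      (use r derivable_snd in \<open>auto simp: restriction_def interp_def\<close>)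
  then show ?thesis by simp
qed

text \<open>The output always has exactly one element. The zero and the lists have an empty
  structure, which leaves no possible output; in a product the one element always comes from the
  same factor.\<close>

lemma solvable_Unit:
  fixes f :: "'a::infinite rel_struct \<Rightarrow> 'a rel_struct"
  assumes "normal n" "sum_free n" "interp (models n) (structs Unit) f"
  shows "solvable n Unit f"
  using assms
proof (induction n arbitrary: f)
  case NZero
  have "list_struct [] \<in> (models NZero :: 'a rel_struct set)" by simp
  from interpD(1,2)[OF NZero.prems(3) this] show ?case by auto
next
  case NOne
  have "f A = A" if "A \<in> models NOne" for A
    using interpD(1,2)[OF NOne.prems(3) that] that by auto
  then show ?case
    using derivable_id by (intro solvableI) auto
next
  case (NTimes m n)
  have "universe (fst_part A) \<inter> universe (snd_part A) = {}" if "A \<in> models (NTimes m n)" for A :: "'a rel_struct"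
    using that by auto
  then have "(\<forall>A\<in>models (NTimes m n). universe (f A) \<subseteq> universe (fst_part A)) \<or>
    (\<forall>A\<in>models (NTimes m n). universe (f A) \<subseteq> universe (snd_part A))"
    using one_component[OF NTimes.prems(1,3)] structs_Unit_universe[OF interpD(1)[OF NTimes.prems(3)]]
    by (metis disjoint_iff singletonD)
  moreover have "normal m" "normal n" "sum_free m" "sum_free n"
    using NTimes.prems by auto
  ultimately show ?case
    using solvable_fst[OF NTimes.prems(1,3)] solvable_snd[OF NTimes.prems(1,3)] NTimes.IH by blast
next
  case (NList n)
  have "items (models n) ([] :: 'a rel_struct list)" by (simp add: items_def)
  then have "list_struct [] \<in> (models (NList n) :: 'a rel_struct set)" by force
  from interpD(1,2)[OF NList.prems(3) this] show ?case by auto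
qed simp

text \<open>Any two inputs are related by the empty embedding, so their outputs agree on
  \<open>IsLeft\<close>: one side of the sum serves all inputs.\<close>

lemma solvable_Sum:
  fixes f :: "'a::infinite rel_struct \<Rightarrow> 'a rel_struct"
  assumes n: "sum_free n" and f: "interp (models n) (structs (\<Gamma> \<oplus> \<Delta>)) f"
    and g1: "\<And>g :: 'a rel_struct \<Rightarrow> 'a rel_struct. interp (models n) (structs \<Gamma>) g \<Longrightarrow> solvable n \<Gamma> g"
    and g2: "\<And>g :: 'a rel_struct \<Rightarrow> 'a rel_struct. interp (models n) (structs \<Delta>) g \<Longrightarrow> solvable n \<Delta> g"
  shows "solvable n (\<Gamma> \<oplus> \<Delta>) f"
proof -
  have emb: "local_emb (f A) (f B) {} id" if "A \<in> models n" "B \<in> models n" for A B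
    using interpD(3)[OF f that local_emb_empty[OF n that]] by simp
  have sides: "f A \<in> inl_struct ` structs \<Gamma> \<or> f A \<in> inr_struct ` structs \<Delta>" if "A \<in> models n" for A
    using interpD(1)[OF f that] by simp
  show ?thesis
  proof (cases "\<exists>A\<in>models n. f A \<in> inl_struct ` structs \<Gamma>")
    case True
    then have l: "f A \<in> inl_struct ` structs \<Gamma>" if "A \<in> models n" for A
      using sides[OF that] emb[OF _ that] local_emb_inl_inr(1) by fastforce
    then have eq: "inl_struct (un_inl (f A)) = f A" if "A \<in> models n" for A
      using that by force
    have "interp (models n) (structs (\<Gamma> \<oplus> \<Delta>)) (\<lambda>A. inl_struct (un_inl (f A)))"
      using f by (simp add: eq cong: interp_cong)
    then have "interp (models n) (structs \<Gamma>) (\<lambda>A. un_inl (f A))"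
      unfolding interp_inl
      by (rule interp_subset) (auto dest: inl_struct_inject simp: inl_struct_neq_inr_struct)
    from g1[OF this] obtain g where g: "derivable (type_of n) \<Gamma> g" "\<And>A. A \<in> models n \<Longrightarrow> g A = un_inl (f A)"
      by (auto simp: solvable_def)
    show ?thesis
      by (rule solvableI[OF derivable_comp[OF g(1) derivable_inl]]) (simp add: g(2) eq)
  next
    case False
    then have r: "f A \<in> inr_struct ` structs \<Delta>" if "A \<in> models n" for A
      using sides[OF that] that by blast
    then have eq: "inr_struct (un_inr (f A)) = f A" if "A \<in> models n" for A
      using that by force
    have "interp (models n) (structs (\<Gamma> \<oplus> \<Delta>)) (\<lambda>A. inr_struct (un_inr (f A)))"
      using f by (simp add: eq cong: interp_cong)
    then have "interp (models n) (structs \<Delta>) (\<lambda>A. un_inr (f A))"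
      unfolding interp_inr
      by (rule interp_subset) (auto dest: inr_struct_inject simp: inl_struct_neq_inr_struct[symmetric])
    from g2[OF this] obtain g where g: "derivable (type_of n) \<Delta> g" "\<And>A. A \<in> models n \<Longrightarrow> g A = un_inr (f A)"
      by (auto simp: solvable_def)
    show ?thesis
      by (rule solvableI[OF derivable_comp[OF g(1) derivable_inr]]) (simp add: g(2) eq)
  qed
qed

text \<open>
  Membership in the universe of \<open>f1\<close> depends only on the unary type of an element, so the input splits
  along it, and \<open>f1\<close>, \<open>f2\<close> factor through the two parts.
\<close>

lemma solvable_pair:
  fixes f1 f2 :: "'a::infinite rel_struct \<Rightarrow> 'a rel_struct"
  assumes n: "normal n" "sum_free n"
    and f1: "interp (models n) (structs \<Gamma>) f1" and f2: "interp (models n) (structs \<Delta>) f2"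
    and dis: "\<And>A. A \<in> models n \<Longrightarrow> disj (f1 A) (f2 A)"
    and s1: "\<And>m r g. normal m \<Longrightarrow> sum_free m \<Longrightarrow> depth m \<le> depth n \<Longrightarrow> restriction n m r \<Longrightarrow>
      interp (models m) (structs \<Gamma>) g \<Longrightarrow> (\<And>A. A \<in> models n \<Longrightarrow> f1 A = g (r A)) \<Longrightarrow> solvable m \<Gamma> g"
    and s2: "\<And>m r g. normal m \<Longrightarrow> sum_free m \<Longrightarrow> depth m \<le> depth n \<Longrightarrow> restriction n m r \<Longrightarrow>
      interp (models m) (structs \<Delta>) g \<Longrightarrow> (\<And>A. A \<in> models n \<Longrightarrow> f2 A = g (r A)) \<Longrightarrow> solvable m \<Delta> g"
    and k: "derivable (\<Gamma> \<otimes> \<Delta>) \<Theta> k"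
  shows "solvable n \<Theta> (\<lambda>A. k (prod_struct (f1 A) (f2 A)))"
proof -
  have "type_invariant n (\<lambda>A x. x \<in> universe (f1 A))"
    unfolding type_invariant_def using interp_mem[OF f1] by blast
  then obtain m1 m2 r1 r2 s where s: "splits n (\<lambda>A x. x \<in> universe (f1 A)) m1 m2 r1 r2 s"
    and m: "normal m1" "normal m2" "sum_free m1" "sum_free m2" "depth m1 \<le> depth n" "depth m2 \<le> depth n"
    using ex_splits[OF n(1)] n(2) by blast
  note D = splitsD[OF s] and r = splits_restriction[OF s]
  have "universe (f1 A) \<subseteq> universe (r1 A)" "universe (f2 A) \<subseteq> universe (r2 A)" if "A \<in> models n" for A
    using D(5,6)[OF that] interpD(2)[OF f1 that] interpD(2)[OF f2 that] dis[OF that] by blast+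
  then obtain g1 g2 where
    g1: "interp (models m1) (structs \<Gamma>) g1" "\<And>A. A \<in> models n \<Longrightarrow> f1 A = g1 (r1 A)" and
    g2: "interp (models m2) (structs \<Delta>) g2" "\<And>A. A \<in> models n \<Longrightarrow> f2 A = g2 (r2 A)"
    using restriction_factor[OF r(1) f1] restriction_factor[OF r(2) f2] by metis
  from s1[OF m(1,3,5) r(1) g1] s2[OF m(2,4,6) r(2) g2] obtain h1 h2 where
    h: "derivable (type_of m1) \<Gamma> h1" "\<And>A. A \<in> models m1 \<Longrightarrow> h1 A = g1 A"
      "derivable (type_of m2) \<Delta> h2" "\<And>A. A \<in> models m2 \<Longrightarrow> h2 A = g2 A"
    by (auto simp: solvable_def)
  show ?thesis
  proof (rule solvableI)
    show "derivable (type_of n) \<Theta> (\<lambda>A. k (prod_map h1 h2 (s A)))"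
      by (intro derivable_comp[OF D(1)] derivable_comp[OF _ k] derivable_prod_map h)
    show "k (prod_map h1 h2 (s A)) = k (prod_struct (f1 A) (f2 A))" if "A \<in> models n" for A
      using D(2-4,11)[OF that] h g1(2)[OF that] g2(2)[OF that] by simp
  qed
qed

lemma solvable_Prod:
  fixes f :: "'a::infinite rel_struct \<Rightarrow> 'a rel_struct"
  assumes n: "normal n" "sum_free n" and f: "interp (models n) (structs (\<Gamma> \<otimes> \<Delta>)) f"
    and s: "\<And>m (g :: 'a rel_struct \<Rightarrow> 'a rel_struct). normal m \<Longrightarrow> sum_free m \<Longrightarrow> depth m \<le> depth n \<Longrightarrow>
      interp (models m) (structs \<Gamma>) g \<Longrightarrow> solvable m \<Gamma> g"
      "\<And>m (g :: 'a rel_struct \<Rightarrow> 'a rel_struct). normal m \<Longrightarrow> sum_free m \<Longrightarrow> depth m \<le> depth n \<Longrightarrow>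
      interp (models m) (structs \<Delta>) g \<Longrightarrow> solvable m \<Delta> g"
  shows "solvable n (\<Gamma> \<otimes> \<Delta>) f"
proof -
  have fA: "f A = prod_struct (fst_part (f A)) (snd_part (f A)) \<and> disj (fst_part (f A)) (snd_part (f A))"
    if "A \<in> models n" for A
    using interpD(1)[OF f that] by auto
  have "solvable n (\<Gamma> \<otimes> \<Delta>) (\<lambda>A. (\<lambda>X. X) (prod_struct ((fst_part \<circ> f) A) ((snd_part \<circ> f) A)))"
  proof (rule solvable_pair[OF n])
    show "interp (models n) (structs \<Gamma>) (fst_part \<circ> f)" "interp (models n) (structs \<Delta>) (snd_part \<circ> f)"
      using interp_comp[OF f derivable_interp[OF derivable_fst]]
        interp_comp[OF f derivable_interp[OF derivable_snd]] by blast+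
  qed (use s fA derivable_id in auto)
  then show ?thesis
    using fA unfolding solvable_def by auto
qed


subsection \<open>Outputs with at most one list item\<close>

text \<open>In the application \<open>K\<close> consists of the inputs with nonempty output and
  \<open>g\<close> returns the only item. As no type used by \<open>g\<close> occurs in
  \<open>A0\<close>, by \<open>twins\<close> every used type can occur twice in one input, and an
  output of type \<open>Unit\<close> would then have two elements. So the recursion through the item
  type meets only lists, which can be empty, and sums, whose side is fixed by the nullary
  relations.\<close>

lemma ex_empty_struct:
  fixes g :: "'a::infinite rel_struct \<Rightarrow> 'a rel_struct"
  assumes n: "normal n" "sum_free n" and K: "K \<subseteq> models n" "A1 \<in> K" and A0: "A0 \<in> models n"
    and g: "\<And>A. A \<in> K \<Longrightarrow> g A \<in> structs \<Gamma>" "\<And>A. A \<in> K \<Longrightarrow> universe (g A) \<subseteq> universe A"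
    and inv: "\<And>A B x y. A \<in> K \<Longrightarrow> B \<in> models n \<Longrightarrow> x \<in> universe (g A) \<Longrightarrow> same_type A x B y \<Longrightarrow>
      B \<in> K \<and> same_type (g A) x (g B) y"
    and nullary: "\<And>A B R. A \<in> K \<Longrightarrow> B \<in> K \<Longrightarrow> [] \<in> rel (g A) R \<Longrightarrow> [] \<in> rel (g B) R"
    and missing: "\<And>A x y. A \<in> K \<Longrightarrow> x \<in> universe (g A) \<Longrightarrow> \<not> same_type A x A0 y"
  shows "\<exists>B\<in>(structs \<Gamma> :: 'a rel_struct set). universe B = {} \<and> (\<forall>R. [] \<in> rel B R \<longleftrightarrow> [] \<in> rel (g A1) R)"
  using g inv nullary missing
proof (induction \<Gamma> arbitrary: g)
  case Unit
  obtain x where x: "universe (g A1) = {x}"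
    using structs_Unit_universe[OF Unit(1)[OF K(2)]] by blast
  then have "x \<in> universe A1"
    using Unit(2)[OF K(2)] by blast
  with twins[OF n, of A1 x] K obtain C y z where C: "C \<in> models n" "y \<noteq> z" "same_type A1 x C y" "same_type A1 x C z"
    using A0 Unit(5)[OF K(2), of x] x by blast
  then have "C \<in> K" "same_type (g A1) x (g C) y" "same_type (g A1) x (g C) z"
    using Unit(3)[OF K(2) C(1), of x] x by auto
  then have "y \<in> universe (g C)" "z \<in> universe (g C)"
    using local_embD(5)[of "g A1" "g C" "{x}" "\<lambda>_. y" x] local_embD(5)[of "g A1" "g C" "{x}" "\<lambda>_. z" x]
    by simp_all
  with structs_Unit_universe[OF Unit(1)[OF \<open>C \<in> K\<close>]] C(2) show ?case by auto
next
  case (Prod \<Gamma> \<Delta>)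
  have gA: "g A = prod_struct (fst_part (g A)) (snd_part (g A))" "fst_part (g A) \<in> structs \<Gamma>"
    "snd_part (g A) \<in> structs \<Delta>" "disj (fst_part (g A)) (snd_part (g A))" if "A \<in> K" for A
    using Prod(3)[OF that] by auto
  then have U: "universe (g A) = universe (fst_part (g A)) \<union> universe (snd_part (g A))" if "A \<in> K" for A
    using that by (metis universe_simps(2))
  have emb: "local_emb (fst_part (g A)) (fst_part (g B)) (X \<inter> universe (fst_part (g A))) h \<and>
      local_emb (snd_part (g A)) (snd_part (g B)) (X \<inter> universe (snd_part (g A))) h"
    if AB: "A \<in> K" "B \<in> K" and "local_emb (g A) (g B) X h" for A B X h
  proof -
    note wfs = gA(2,3)[OF AB(1), THEN wf_structs] gA(2,3)[OF AB(2), THEN wf_structs]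
    show ?thesis
      using that(3) local_emb_prod[OF wfs gA(4)[OF AB(1)] gA(4)[OF AB(2)], of X h]
      unfolding gA(1)[OF AB(1), symmetric] gA(1)[OF AB(2), symmetric] by blast
  qed
  have emb1: "local_emb (fst_part (g A)) (fst_part (g B)) {x} h"
    if "A \<in> K" "B \<in> K" "local_emb (g A) (g B) {x} h" "x \<in> universe (fst_part (g A))" for A B x h
    using emb[OF that(1-3)] that(4) by simp
  have emb2: "local_emb (snd_part (g A)) (snd_part (g B)) {x} h"
    if "A \<in> K" "B \<in> K" "local_emb (g A) (g B) {x} h" "x \<in> universe (snd_part (g A))" for A B x h
    using emb[OF that(1-3)] that(4) by simp
  have "\<exists>B\<in>(structs \<Gamma> :: 'a rel_struct set). universe B = {} \<and> (\<forall>R. [] \<in> rel B R \<longleftrightarrow> [] \<in> rel (fst_part (g A1)) R)"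
  proof (rule Prod.IH(1)[of "\<lambda>A. fst_part (g A)"])
    fix A B x y assume *: "A \<in> K" "B \<in> models n" "x \<in> universe (fst_part (g A))" "same_type A x B y"
    then have "B \<in> K \<and> same_type (g A) x (g B) y"
      using Prod(5) U by blast
    then show "B \<in> K \<and> same_type (fst_part (g A)) x (fst_part (g B)) y"
      using emb1 * by blast
  next
    fix A B R assume "A \<in> K" "B \<in> K" "[] \<in> rel (fst_part (g A)) R"
    then show "[] \<in> rel (fst_part (g B)) R"
      using Prod(6)[of A B "ProdL R"] by (simp add: fst_part_def)
  qed (use gA U Prod(4,7) in blast)+
  then obtain B1 :: "'a rel_struct" where B1: "B1 \<in> structs \<Gamma>" "universe B1 = {}" "\<And>R. [] \<in> rel B1 R \<longleftrightarrow> [] \<in> rel (fst_part (g A1)) R"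
    by blast
  have "\<exists>B\<in>(structs \<Delta> :: 'a rel_struct set). universe B = {} \<and> (\<forall>R. [] \<in> rel B R \<longleftrightarrow> [] \<in> rel (snd_part (g A1)) R)"
  proof (rule Prod.IH(2)[of "\<lambda>A. snd_part (g A)"])
    fix A B x y assume *: "A \<in> K" "B \<in> models n" "x \<in> universe (snd_part (g A))" "same_type A x B y"
    then have "B \<in> K \<and> same_type (g A) x (g B) y"
      using Prod(5) U by blast
    then show "B \<in> K \<and> same_type (snd_part (g A)) x (snd_part (g B)) y"
      using emb2 * by blast
  next
    fix A B R assume "A \<in> K" "B \<in> K" "[] \<in> rel (snd_part (g A)) R"
    then show "[] \<in> rel (snd_part (g B)) R"
      using Prod(6)[of A B "ProdR R"] by (simp add: snd_part_def)
  qed (use gA U Prod(4,7) in blast)+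
  then obtain B2 :: "'a rel_struct" where B2: "B2 \<in> structs \<Delta>" "universe B2 = {}" "\<And>R. [] \<in> rel B2 R \<longleftrightarrow> [] \<in> rel (snd_part (g A1)) R"
    by blast
  have "[] \<in> rel (prod_struct B1 B2) R \<longleftrightarrow> [] \<in> rel (prod_struct (fst_part (g A1)) (snd_part (g A1))) R" for R
    using B1(3) B2(3) by (cases R) simp_all
  then have "[] \<in> rel (prod_struct B1 B2) R \<longleftrightarrow> [] \<in> rel (g A1) R" for R
    by (simp only: gA(1)[OF K(2), symmetric])
  then show ?case
    using B1 B2 prod_in_structs[of B1 \<Gamma> B2 \<Delta>] by (intro bexI[of _ "prod_struct B1 B2"]) auto
next
  case (Sum \<Gamma> \<Delta>)
  have side: "g A \<in> inl_struct ` structs \<Gamma> \<or> g A \<in> inr_struct ` structs \<Delta>" if "A \<in> K" for A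
    using Sum(3)[OF that] by simp
  show ?case
  proof (cases "[] \<in> rel (g A1) IsLeft")
    case True
    then have left: "[] \<in> rel (g A) IsLeft" if "A \<in> K" for A
      using Sum(6)[OF K(2) that] by blast
    have gA: "g A = inl_struct (un_inl (g A))" "un_inl (g A) \<in> structs \<Gamma>" "universe (un_inl (g A)) = universe (g A)"
      if A: "A \<in> K" for A
    proof -
      obtain x where "g A = inl_struct x" "x \<in> structs \<Gamma>"
        using side[OF A] left[OF A] by auto
      then show "g A = inl_struct (un_inl (g A))" "un_inl (g A) \<in> structs \<Gamma>" "universe (un_inl (g A)) = universe (g A)"
        by simp_all
    qed
    have "\<exists>B\<in>(structs \<Gamma> :: 'a rel_struct set). universe B = {} \<and> (\<forall>R. [] \<in> rel B R \<longleftrightarrow> [] \<in> rel (un_inl (g A1)) R)"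
    proof (rule Sum.IH(1)[of "\<lambda>A. un_inl (g A)"])
      fix A B x y assume *: "A \<in> K" "B \<in> models n" "x \<in> universe (un_inl (g A))" "same_type A x B y"
      then have B: "B \<in> K" "same_type (g A) x (g B) y"
        using Sum(5)[OF *(1,2) _ *(4)] gA(3)[OF *(1)] by auto
      then show "B \<in> K \<and> same_type (un_inl (g A)) x (un_inl (g B)) y"
        using gA(1)[OF *(1)] gA(1)[OF B(1)] by (metis local_emb_inl)
    next
      fix A B R assume "A \<in> K" "B \<in> K" "[] \<in> rel (un_inl (g A)) R"
      then show "[] \<in> rel (un_inl (g B)) R"
        using Sum(6)[of A B "SumL R"] by (simp add: un_inl_def)
    qed (use gA Sum(4,7) in auto)
    then obtain B :: "'a rel_struct" where B: "B \<in> structs \<Gamma>" "universe B = {}" "\<And>R. [] \<in> rel B R \<longleftrightarrow> [] \<in> rel (un_inl (g A1)) R"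
      by blast
    have "[] \<in> rel (inl_struct B) R \<longleftrightarrow> [] \<in> rel (inl_struct (un_inl (g A1))) R" for R
      using B(3) by (cases R) simp_all
    then show ?thesis
      using B(1,2) gA(1)[OF K(2)] by (intro bexI[of _ "inl_struct B"]) auto
  next
    case False
    then have no_left: "[] \<notin> rel (g A) IsLeft" if "A \<in> K" for A
      using Sum(6)[OF that K(2)] by blast
    have gA: "g A = inr_struct (un_inr (g A))" "un_inr (g A) \<in> structs \<Delta>" "universe (un_inr (g A)) = universe (g A)"
      if A: "A \<in> K" for A
    proof -
      obtain x where "g A = inr_struct x" "x \<in> structs \<Delta>"
        using side[OF A] no_left[OF A] by auto
      then show "g A = inr_struct (un_inr (g A))" "un_inr (g A) \<in> structs \<Delta>" "universe (un_inr (g A)) = universe (g A)"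
        by simp_all
    qed
    have "\<exists>B\<in>(structs \<Delta> :: 'a rel_struct set). universe B = {} \<and> (\<forall>R. [] \<in> rel B R \<longleftrightarrow> [] \<in> rel (un_inr (g A1)) R)"
    proof (rule Sum.IH(2)[of "\<lambda>A. un_inr (g A)"])
      fix A B x y assume *: "A \<in> K" "B \<in> models n" "x \<in> universe (un_inr (g A))" "same_type A x B y"
      then have B: "B \<in> K" "same_type (g A) x (g B) y"
        using Sum(5)[OF *(1,2) _ *(4)] gA(3)[OF *(1)] by auto
      then show "B \<in> K \<and> same_type (un_inr (g A)) x (un_inr (g B)) y"
        using gA(1)[OF *(1)] gA(1)[OF B(1)] by (metis local_emb_inr)
    next
      fix A B R assume "A \<in> K" "B \<in> K" "[] \<in> rel (un_inr (g A)) R"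
      then show "[] \<in> rel (un_inr (g B)) R"
        using Sum(6)[of A B "SumR R"] by (simp add: un_inr_def)
    qed (use gA Sum(4,7) in auto)
    then obtain B :: "'a rel_struct" where B: "B \<in> structs \<Delta>" "universe B = {}" "\<And>R. [] \<in> rel B R \<longleftrightarrow> [] \<in> rel (un_inr (g A1)) R"
      by blast
    have "[] \<in> rel (inr_struct B) R \<longleftrightarrow> [] \<in> rel (inr_struct (un_inr (g A1))) R" for R
      using B(3) by (cases R) simp_all
    then show ?thesis
      using B(1,2) gA(1)[OF K(2)] by (intro bexI[of _ "inr_struct B"]) auto
  qed
next
  case (Lists \<Gamma>)
  have "[] \<notin> rel (g A1) R" for R
    using rel_of_structs[OF Lists(2)[OF K(2)], of "[]" R] by (auto split: if_splits)
  then show ?case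
    using list_struct_Nil_in_structs by (intro bexI[of _ "list_struct []"]) (auto simp: rel_list_struct_Nil)
qed

text \<open>The only item, read off by \<open>hd\<close>, makes sense only where the output is
  nonempty. Elsewhere it is extended by an empty structure \<open>E\<close> with the same nullary
  relations: embeddings cannot tell the difference, and the list with the item \<open>E\<close> is
  the empty list.\<close>

lemma solvable_single_item:
  fixes F :: "'a::infinite rel_struct \<Rightarrow> 'a rel_struct"
  assumes n: "normal n" "sum_free n" and F: "interp (models n) (structs (Lists \<Gamma>)) F"
    and grp: "\<And>A x y. A \<in> models n \<Longrightarrow> x \<in> universe (F A) \<Longrightarrow> y \<in> universe (F A) \<Longrightarrow> [x, y] \<in> rel (F A) Leq"
    and s: "\<And>g :: 'a rel_struct \<Rightarrow> 'a rel_struct. interp (models n) (structs \<Gamma>) g \<Longrightarrow> solvable n \<Gamma> g"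
  shows "solvable n (Lists \<Gamma>) F"
proof (cases "\<forall>A\<in>models n. universe (F A) = {}")
  case True
  have "F A = list_struct []" if A: "A \<in> models n" for A
  proof -
    obtain As where As: "F A = list_struct As" "items (structs \<Gamma>) As"
      using interpD(1)[OF F A] by auto
    moreover have "universe (list_struct As) = {}"
      using True A As(1) by metis
    ultimately show ?thesis
      by (cases As) (auto simp: items_def)
  qed
  then show ?thesis
    by (intro solvableI[OF derivable_const_nil]) simp
next
  case False
  define K where "K = {A \<in> models n. universe (F A) \<noteq> {}}"
  define h where "h = (\<lambda>A. hd (un_list \<Gamma> (F A)))"
  have h: "F A = list_struct [h A]" "h A \<in> structs \<Gamma>" "universe (F A) = universe (h A)" if A: "A \<in> K" for A
  proof -
    obtain As where As: "F A = list_struct As" "items (structs \<Gamma>) As"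
      using interpD(1)[OF F, of A] A by (auto simp: K_def)
    have wf: "wf_list As" using As(2) items_wf_list by blast
    obtain B Bs where B: "As = B # Bs"
      using A As(1) by (cases As) (auto simp: K_def)
    have "Bs = []"
    proof (rule ccontr)
      assume "Bs \<noteq> []"
      then obtain C Cs where C: "Bs = C # Cs" by (cases Bs) auto
      then obtain x y where xy: "x \<in> universe B" "y \<in> universe C"
        using As(2) B by (fastforce simp: items_def)
      have "pos As x = 0" "pos As y = 1"
        using xy B C by (intro pos_eq[OF wf]; simp)+
      moreover have "[y, x] \<in> rel (list_struct As) Leq"
        using grp[of A y x] A xy B C As(1) by (auto simp: K_def)
      ultimately show False
        by (auto simp: rel_list_Leq[OF wf])
    qed
    then show "F A = list_struct [h A]" "h A \<in> structs \<Gamma>" "universe (F A) = universe (h A)"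
      using As B by (auto simp: h_def items_def)
  qed
  have K: "A \<in> models n" if "A \<in> K" for A
    using that by (simp add: K_def)
  have hemb: "B \<in> K \<and> local_emb (h A) (h B) X p"
    if AB: "A \<in> K" "B \<in> models n" and e: "local_emb A B X p" and X: "X \<noteq> {}" "X \<subseteq> universe (F A)" for A B X p
  proof -
    have FAB: "local_emb (F A) (F B) X p"
      using interp_local_emb[OF F K[OF AB(1)] AB(2) e X(2)] .
    then have B: "B \<in> K"
      using AB(2) X local_embD(5)[OF FAB] by (auto simp: K_def)
    have "local_emb (list_struct [h A]) (list_struct [h B]) X p"
      using FAB h(1)[OF AB(1)] h(1)[OF B] by simp
    then show ?thesis
      using local_emb_singletonD[OF wf_structs[OF h(2)[OF AB(1)]] wf_structs[OF h(2)[OF B]] _ X(1)] B by blast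
  qed
  \<comment> \<open>Both inputs embed into a common one, whose item has the same nullary relations
    as either of theirs.\<close>
  have nullary: "[] \<in> rel (h A) R \<longleftrightarrow> [] \<in> rel (h B) R" if AB: "A \<in> K" "B \<in> K" for A B R
  proof -
    obtain C p q where C: "C \<in> models n" "local_emb A C (universe A) p" "local_emb B C (universe B) q"
      using joint_embedding[OF n K[OF AB(1)] K[OF AB(2)]] .
    have "local_emb (h A) (h C) (universe (F A)) p" "local_emb (h B) (h C) (universe (F B)) q"
      using hemb[OF AB(1) C(1) local_emb_mono[OF C(2) interpD(2)[OF F K[OF AB(1)]]]]
        hemb[OF AB(2) C(1) local_emb_mono[OF C(3) interpD(2)[OF F K[OF AB(2)]]]] AB by (auto simp: K_def)
    then show ?thesis
      using local_embD(6)[of "h A" "h C" _ p "[]" R] local_embD(6)[of "h B" "h C" _ q "[]" R] by simp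
  qed
  obtain A1 where A1: "A1 \<in> K" using False by (auto simp: K_def)
  \<comment> \<open>If no output is empty, the item type may fail to have an empty structure; hence
    the implication.\<close>
  have "\<exists>E :: 'a rel_struct. (\<exists>A\<in>models n. A \<notin> K) \<longrightarrow> E \<in> structs \<Gamma> \<and> universe E = {} \<and> (\<forall>R. [] \<in> rel E R \<longleftrightarrow> [] \<in> rel (h A1) R)"
  proof (cases "\<exists>A\<in>models n. A \<notin> K")
    case True
    then obtain A0 where A0: "A0 \<in> models n" "universe (F A0) = {}"
      by (auto simp: K_def)
    have "\<exists>B\<in>(structs \<Gamma> :: 'a rel_struct set). universe B = {} \<and> (\<forall>R. [] \<in> rel B R \<longleftrightarrow> [] \<in> rel (h A1) R)"
    proof (rule ex_empty_struct[OF n _ A1 A0(1)])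
      fix A B x y assume *: "A \<in> K" "B \<in> models n" "x \<in> universe (h A)" "same_type A x B y"
      show "B \<in> K \<and> same_type (h A) x (h B) y"
        using hemb[OF *(1,2,4)] *(3) h(3)[OF *(1)] by simp
    next
      fix A x y assume *: "A \<in> K" "x \<in> universe (h A)"
      show "\<not> same_type A x A0 y"
        using interp_mem[OF F K[OF *(1)] A0(1), of x y] h(3)[OF *(1)] *(2) A0(2) by blast
    next
      fix A assume "A \<in> K"
      then show "universe (h A) \<subseteq> universe A"
        using h(3)[of A] interpD(2)[OF F K[of A]] by simp
    next
      show "K \<subseteq> models n" using K by blast
      show "h A \<in> structs \<Gamma>" if "A \<in> K" for A
        by (rule h(2)[OF that])
      show "[] \<in> rel (h B) R" if "A \<in> K" "B \<in> K" "[] \<in> rel (h A) R" for A B R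
        using nullary[OF that(1,2)] that(3) by blast
    qed
    then obtain E :: "'a rel_struct" where "E \<in> structs \<Gamma> \<and> universe E = {} \<and> (\<forall>R. [] \<in> rel E R \<longleftrightarrow> [] \<in> rel (h A1) R)"
      by (elim bexE) auto
    then show ?thesis by (intro exI[of _ E] impI)
  next
    case False
    then show ?thesis by simp
  qed
  then obtain E :: "'a rel_struct" where E0: "(\<exists>A\<in>models n. A \<notin> K) \<longrightarrow>
      E \<in> structs \<Gamma> \<and> universe E = {} \<and> (\<forall>R. [] \<in> rel E R \<longleftrightarrow> [] \<in> rel (h A1) R)"
    by (rule exE)
  have E: "E \<in> structs \<Gamma> \<and> universe E = {} \<and> (\<forall>R. [] \<in> rel E R \<longleftrightarrow> [] \<in> rel (h A1) R)"
    if "A \<in> models n" "A \<notin> K" for A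
    by (rule E0[THEN mp]) (use that in blast)
  define g where "g = (\<lambda>A. if A \<in> K then h A else E)"
  have g_null: "[] \<in> rel (g A) R \<longleftrightarrow> [] \<in> rel (h A1) R" if "A \<in> models n" for A R
    using E[OF that] nullary[OF _ A1] by (auto simp: g_def)
  have g_U: "universe (g A) = universe (F A)" "g A \<in> structs \<Gamma>" if "A \<in> models n" for A
    using E[OF that] h(2,3)[of A] that by (auto simp: g_def K_def)
  have "interp (models n) (structs \<Gamma>) g"
  proof (rule interpI)
    fix A :: "'a rel_struct" assume "A \<in> models n"
    then show "g A \<in> structs \<Gamma> \<and> universe (g A) \<subseteq> universe A"
      using g_U interpD(2)[OF F] by auto
  next
    fix A B :: "'a rel_struct" and X p assume AB: "A \<in> models n" "B \<in> models n" and e: "local_emb A B X p"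
    \<comment> \<open>If \<open>X\<close> misses the output, only nullary relations are compared,
      and these are constant; otherwise both inputs lie in \<open>K\<close>.\<close>
    show "local_emb (g A) (g B) (X \<inter> universe (g A)) p"
    proof (cases "X \<inter> universe (F A) = {}")
      case True
      then show ?thesis
        unfolding g_U[OF AB(1)] True using g_null[OF AB(1)] g_null[OF AB(2)]
        by (intro local_embI) auto
    next
      case False
      then have "A \<in> K" using AB(1) by (auto simp: K_def)
      then show ?thesis
        using hemb[OF _ AB(2) local_emb_mono[OF e] False] g_U(1)[OF AB(1)] by (simp add: g_def)
    qed
  qed
  from s[OF this] obtain g' where g': "derivable (type_of n) \<Gamma> g'" "\<And>A. A \<in> models n \<Longrightarrow> g' A = g A"
    by (auto simp: solvable_def)
  show ?thesis
  proof (rule solvableI[OF derivable_comp[OF g'(1) derivable_singleton]])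
    fix A :: "'a rel_struct" assume A: "A \<in> models n"
    show "list_struct [g' A] = F A"
    proof (cases "A \<in> K")
      case True
      then show ?thesis using g'(2)[OF A] h(1) by (simp add: g_def)
    next
      case False
      obtain As where As: "F A = list_struct As" "items (structs \<Gamma>) As"
        using interpD(1)[OF F A] by auto
      then have "As = []"
        using False A by (cases As) (auto simp: K_def items_def)
      moreover have "list_struct [g A] = list_struct []"
        using list_struct_nonempty[of "[g A]" \<Gamma>] g_U[OF A] False A by (auto simp: K_def)
      ultimately show ?thesis
        using As(1) g'(2)[OF A] by simp
    qed
  qed
qed

subsection \<open>The order on the output list\<close>

lemma Leq_mem: "L \<in> structs (Lists \<Gamma>) \<Longrightarrow> [x, y] \<in> rel L Leq \<Longrightarrow> x \<in> universe L \<and> y \<in> universe L"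
  using rel_of_structs[of L "Lists \<Gamma>" "[x, y]" Leq] by simp

lemma Leq_total:
  assumes "L \<in> structs (Lists \<Gamma>)" "x \<in> universe L" "y \<in> universe L"
  shows "[x, y] \<in> rel L Leq \<or> [y, x] \<in> rel L Leq"
proof -
  obtain As where As: "L = list_struct As" "wf_list As"
    using assms(1) items_wf_list by auto
  then show ?thesis
    using assms(2,3) unfolding As(1) rel_list_Leq[OF As(2)] by auto
qed

lemma Leq_trans:
  assumes "L \<in> structs (Lists \<Gamma>)" "[x, y] \<in> rel L Leq" "[y, z] \<in> rel L Leq"
  shows "[x, z] \<in> rel L Leq"
proof -
  obtain As where As: "L = list_struct As" "wf_list As"
    using assms(1) items_wf_list by auto
  then show ?thesis
    using assms(2,3) unfolding As(1) rel_list_Leq[OF As(2)] by auto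
qed

text \<open>A tuple of an \<open>Item\<close> relation stays within one item.\<close>

lemma Item_tuple_Leq:
  assumes "L \<in> structs (Lists \<Gamma>)" "xs \<in> rel L (Item R)" "x \<in> set xs" "y \<in> set xs"
  shows "[x, y] \<in> rel L Leq"
proof -
  obtain As where As: "L = list_struct As" "wf_list As"
    using assms(1) items_wf_list by auto
  have mem: "x \<in> universe L" "y \<in> universe L"
    using rel_of_structs[OF assms(1,2)] assms(3,4) by blast+
  show ?thesis
  proof (cases "arity R = 0")
    case True
    then have "x = y"
      using assms(2-4) rel_list_Item_nullary[OF As(2) True] unfolding As(1) by auto
    then show ?thesis using Leq_total[OF assms(1) mem] by blast
  next
    case False
    then obtain w where w: "w \<in> universe (list_struct As)" "xs \<in> rel (item As w) R"
      using assms(2) rel_list_Item[OF As(2) False] unfolding As(1) by blast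
    have "wf_struct (item As w)"
      using pos_less(3)[OF As(2) w(1)] As(2) by (simp add: wf_list_def)
    then have "pos As x = pos As w" "pos As y = pos As w"
      using wf_structD[OF _ w(2)] assms(3,4) mem_item[OF As(2) w(1)] by blast+
    then show ?thesis
      using mem unfolding As(1) rel_list_Leq[OF As(2)] by auto
  qed
qed

text \<open>A tuple spanning two blocks is either a comparison, settled by \<open>less\<close>, or a
  tuple of an item relation, which would make its elements equivalent and is thus impossible in both
  lists.\<close>

lemma list_eq_blocks:
  assumes L: "L \<in> structs (Lists \<Gamma>)" "L' \<in> structs (Lists \<Gamma>)" "universe L = universe L'"
    and less: "\<And>x y. x \<in> universe L \<Longrightarrow> y \<in> universe L \<Longrightarrow> blk x < (blk y :: nat) \<Longrightarrow>
      [x, y] \<in> rel L Leq \<and> [y, x] \<notin> rel L Leq \<and> [x, y] \<in> rel L' Leq \<and> [y, x] \<notin> rel L' Leq"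
    and same: "\<And>xs R x. set xs \<subseteq> universe L \<Longrightarrow> x \<in> set xs \<Longrightarrow> (\<And>y. y \<in> set xs \<Longrightarrow> blk y = blk x) \<Longrightarrow>
      xs \<in> rel L R \<longleftrightarrow> xs \<in> rel L' R"
  shows "L = L'"
proof (rule rel_struct.equality)
  have "xs \<in> rel L R \<longleftrightarrow> xs \<in> rel L' R" for xs R
  proof (cases "R \<in> vocabulary (Lists \<Gamma>) \<and> length xs = arity R \<and> set xs \<subseteq> universe L")
    case True
    then have "xs \<noteq> []" by (auto split: if_splits)
    then obtain w where w: "w \<in> set xs" by (cases xs) auto
    show ?thesis
    proof (cases "\<forall>y\<in>set xs. blk y = blk w")
      case True
      then show ?thesis
        using same[of xs w R] w \<open>R \<in> vocabulary (Lists \<Gamma>) \<and> length xs = arity R \<and> set xs \<subseteq> universe L\<close> by blast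
    next
      case False
      then obtain x y where xy: "x \<in> set xs" "y \<in> set xs" "blk x < blk y"
        using w by (metis linorder_neqE_nat)
      then have U: "x \<in> universe L" "y \<in> universe L"
        using True by blast+
      note less = less[OF U xy(3)]
      from True consider "R = Leq" | R' where "R = Item R'" by auto
      then show ?thesis
      proof cases
        case 1
        then have "length xs = 2" using True by simp
        then have "xs = [x, y] \<or> xs = [y, x]"
          using xy by (auto simp: length_Suc_conv numeral_2_eq_2)
        then show ?thesis using less 1 by auto
      next
        case (2 R')
        then show ?thesis
          using Item_tuple_Leq[OF L(1) _ xy(2,1)] Item_tuple_Leq[OF L(2) _ xy(2,1)] less by blast
      qed
    qed
  next
    case False
    then show ?thesis
      using rel_of_structs[OF L(1)] rel_of_structs[OF L(2)] L(3) by blast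
  qed
  then show "rel L = rel L'" by blast
qed (use L in auto)

lemma wf_list_middle:
  assumes "wf_list (As @ Bs @ Cs)"
  shows "local_emb (list_struct Bs) (list_struct (As @ Bs @ Cs)) (universe (list_struct Bs)) (\<lambda>x. x)"
proof -
  have "wf_list (Bs @ Cs)"
    using assms by (simp add: wf_list_append)
  note 1 = local_emb_append_left[OF this]
  have "local_emb (list_struct (Bs @ Cs)) (list_struct (As @ Bs @ Cs)) ((\<lambda>x. x) ` universe (list_struct Bs)) (\<lambda>x. x)"
    by (rule local_emb_mono[OF local_emb_append_right[OF assms]]) auto
  from local_emb_comp[OF 1 this] show ?thesis .
qed

lemma local_emb_item:
  assumes "wf_list As" "A \<in> set As"
  shows "local_emb (list_struct [A]) (list_struct As) (universe A) (\<lambda>x. x)"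
proof -
  obtain As1 As2 where "As = As1 @ [A] @ As2"
    using split_list[OF assms(2)] by auto
  then show ?thesis
    using wf_list_middle[of As1 "[A]" As2] assms(1) by simp
qed

text \<open>\<open>h\<close> is \<open>F\<close> on lists with one item. As each item embeds into
  the whole list, the output within an item is its \<open>h\<close>-value; \<open>asc\<close>
  prescribes the order across items. Hence flattening the list of \<open>h\<close>-values reproduces
  the output.\<close>

lemma solvable_ascending:
  fixes F :: "'a::infinite rel_struct \<Rightarrow> 'a rel_struct"
  assumes F: "interp (models (NList m)) (structs (Lists \<Gamma>)) F"
    and asc: "\<And>As i j x y. items (models m) As \<Longrightarrow> i < j \<Longrightarrow> j < length As \<Longrightarrow>
      x \<in> universe (As ! i) \<Longrightarrow> y \<in> universe (As ! j) \<Longrightarrow>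
      x \<in> universe (F (list_struct As)) \<Longrightarrow> y \<in> universe (F (list_struct As)) \<Longrightarrow>
      [x, y] \<in> rel (F (list_struct As)) Leq \<and> [y, x] \<notin> rel (F (list_struct As)) Leq"
    and deep: "\<And>g :: 'a rel_struct \<Rightarrow> 'a rel_struct. interp (models m) (structs (Lists \<Gamma>)) g \<Longrightarrow> solvable m (Lists \<Gamma>) g"
  shows "solvable (NList m) (Lists \<Gamma>) F"
proof -
  define h where "h = (\<lambda>A. F (list_struct [A]))"
  have single: "list_struct [A] \<in> models (NList m)" if "A \<in> models m" for A :: "'a rel_struct"
    using that by (intro weak_items_models) simp
  have h: "interp (models m) (structs (Lists \<Gamma>)) h"
  proof (rule interpI)
    fix A :: "'a rel_struct" assume "A \<in> models m"
    from interpD(1,2)[OF F single[OF this]] show "h A \<in> structs (Lists \<Gamma>) \<and> universe (h A) \<subseteq> universe A"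
      by (simp add: h_def)
  next
    fix A B :: "'a rel_struct" and X p assume "A \<in> models m" "B \<in> models m" "local_emb A B X p"
    then show "local_emb (h A) (h B) (X \<inter> universe (h A)) p"
      unfolding h_def by (intro interpD(3)[OF F] single local_emb_singleton) (auto intro: wf_models)
  qed
  from deep[OF h] obtain g where g: "derivable (type_of m) (Lists \<Gamma>) g" "\<And>A. A \<in> models m \<Longrightarrow> g A = h A"
    by (auto simp: solvable_def)
  show ?thesis
  proof (rule solvableI)
    show "derivable (type_of (NList m)) (Lists \<Gamma>) (\<lambda>X. concat_fun \<Gamma> (list_map (type_of m) g X))"
      using derivable_comp[OF derivable_list_map[OF g(1)] derivable_concat_fun] by simp
    fix X :: "'a rel_struct" assume X: "X \<in> models (NList m)"
    then obtain As where As: "X = list_struct As" "items (models m) As" by auto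
    have wf: "wf_list As" using items_models_wf[OF As(2)] .
    have mem: "A \<in> models m" if "A \<in> set As" for A
      using that As(2) by (simp add: items_def)
    define Gs where "Gs = (\<lambda>A. un_list \<Gamma> (h A))"
    have Gs: "h A = list_struct (Gs A)" "items (structs \<Gamma>) (Gs A)" if "A \<in> set As" for A
      using interpD(1)[OF h mem[OF that]] by (auto simp: Gs_def)
    have w: "weak_items (structs (Lists \<Gamma>)) (map h As)"
      using items_weak[OF As(2)] by (rule weak_items_map) (use interpD[OF h] in blast)
    have mapeq: "map h As = map list_struct (map Gs As)"
      using Gs by simp
    define Ds where "Ds = List.concat (map Gs As)"
    have "list_map (type_of m) g (list_struct As) = list_struct (map h As)"
      using list_map_list[OF items_weak[OF items_models[OF As(2)]] derivable_interp[OF g(1)]]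
        g(2) mem by (simp cong: map_cong)
    moreover have "concat_fun \<Gamma> (list_struct (map h As)) = list_struct Ds"
      unfolding mapeq Ds_def
      by (rule concat_fun_list) (use Gs items_weak w[unfolded mapeq] in auto)
    moreover have "list_struct Ds = F (list_struct As)"
    proof -
      let ?L = "F (list_struct As)" and ?L' = "list_struct Ds"
      have L: "?L \<in> structs (Lists \<Gamma>)"
        using interpD(1)[OF F X] As(1) by simp
      have wfG: "wf_list (map list_struct (map Gs As))" "\<forall>As\<in>set (map Gs As). wf_list As"
        using weak_items_wf[OF w] Gs items_wf_list unfolding mapeq by auto
      have "?L' \<in> structs (Lists \<Gamma>)"
        using derivable_in[OF derivable_concat_fun weak_items_in_structs[OF w]] calculation(2) by simp
      note L = L this
      have UL': "universe ?L' = (\<Union>A\<in>set As. universe (h A))"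
        using Gs by (auto simp: Ds_def)
      have emb1: "local_emb (h A) ?L (universe (h A)) (\<lambda>x. x)" if A: "A \<in> set As" for A
        using interp_local_emb[OF F single[OF mem[OF A]] X[unfolded As(1)] local_emb_mono[OF local_emb_item[OF wf A]]]
          interpD(2)[OF h mem[OF A]] unfolding h_def by blast
      have iff: "x \<in> universe (h A) \<longleftrightarrow> x \<in> universe ?L" if "A \<in> set As" "x \<in> universe A" for A x
        using interp_iff[OF F single[OF mem[OF that(1)]] X[unfolded As(1)] local_emb_item[OF wf that(1)] that(2)]
        by (simp add: h_def)
      have UL: "universe ?L = (\<Union>A\<in>set As. universe (h A))"
        using iff interpD(2)[OF F X[unfolded As(1)]] interpD(2)[OF h mem] by fastforce
      have emb2: "local_emb (h A) ?L' (universe (h A)) (\<lambda>x. x)" if A: "A \<in> set As" for A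
      proof -
        obtain As1 As2 where "As = As1 @ A # As2"
          using split_list[OF A] by auto
        then have "Ds = List.concat (map Gs As1) @ Gs A @ List.concat (map Gs As2)"
          by (simp add: Ds_def)
        then show ?thesis
          using wf_list_middle[of "List.concat (map Gs As1)" "Gs A" "List.concat (map Gs As2)"]
            wf_list_concat[OF wfG] Gs(1)[OF A] by (simp add: Ds_def)
      qed
      have U: "x \<in> universe (list_struct As)" if "x \<in> universe ?L" for x
        using that interpD(2)[OF F X[unfolded As(1)]] by blast
      have posG: "x \<in> universe (list_struct (map list_struct (map Gs As)))"
        "pos (map list_struct (map Gs As)) x = pos As x" if "x \<in> universe ?L" for x
      proof -
        note p = pos_less[OF wf U[OF that]]
        have "x \<in> universe (h (item As x))"
          using iff[OF p(3,2)] that by blast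
        then have "x \<in> universe (map list_struct (map Gs As) ! pos As x)"
          using Gs(1)[OF p(3)] p(1) by (simp add: item_def)
        then show "x \<in> universe (list_struct (map list_struct (map Gs As)))"
          "pos (map list_struct (map Gs As)) x = pos As x"
          using p(1) pos_eq[OF wfG(1)] nth_mem[of "pos As x" "map list_struct (map Gs As)"]
          unfolding universe_list_struct by (metis UN_I length_map)+
      qed
      \<comment> \<open>Blocks are the items of the input: across them \<open>asc\<close> decides,
        within one of them both lists agree with \<open>h\<close>.\<close>
      have "?L = ?L'"
      proof (rule list_eq_blocks[OF L, where blk = "pos As"])
        show "universe ?L = universe ?L'"
          unfolding UL UL' ..
        fix x y assume xy: "x \<in> universe ?L" "y \<in> universe ?L" "pos As x < pos As y"
        have a: "[x, y] \<in> rel ?L Leq \<and> [y, x] \<notin> rel ?L Leq"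
          using asc[OF As(2) xy(3) pos_less(1)[OF wf U[OF xy(2)]]] pos_less(2)[OF wf U[OF xy(1)]]
            pos_less(2)[OF wf U[OF xy(2)]] xy(1,2) by (simp add: item_def)
        have mem': "x \<in> universe ?L'" "y \<in> universe ?L'"
          using xy(1,2) UL UL' by simp_all
        have "pos Ds x \<le> pos Ds y" "\<not> pos Ds y \<le> pos Ds x"
          using pos_concat_le[OF wfG posG(1)[OF xy(1)] posG(1)[OF xy(2)]]
            pos_concat_le[OF wfG posG(1)[OF xy(2)] posG(1)[OF xy(1)]] posG(2)[OF xy(1)] posG(2)[OF xy(2)] xy(3)
          unfolding Ds_def by simp_all
        then show "[x, y] \<in> rel ?L Leq \<and> [y, x] \<notin> rel ?L Leq \<and> [x, y] \<in> rel ?L' Leq \<and> [y, x] \<notin> rel ?L' Leq"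
          using a mem' wf_list_concat[OF wfG] unfolding Ds_def[symmetric]
          by (simp add: rel_list_Leq del: universe_list_struct)
      next
        fix xs R x assume xs: "set xs \<subseteq> universe ?L" "x \<in> set xs" "\<And>y. y \<in> set xs \<Longrightarrow> pos As y = pos As x"
        have x: "x \<in> universe (list_struct As)" using U xs(1,2) by blast
        have it: "item As x \<in> set As" using pos_less(3)[OF wf x] .
        have "set xs \<subseteq> universe (h (item As x))"
        proof
          fix y assume y: "y \<in> set xs"
          then have "y \<in> universe (item As x)"
            using mem_item[OF wf x] xs(1,3) U by blast
          then show "y \<in> universe (h (item As x))"
            using iff[OF it] y xs(1) by blast
        qed
        then show "xs \<in> rel ?L R \<longleftrightarrow> xs \<in> rel ?L' R"
          using local_embD(6)[OF emb1[OF it], of xs R] local_embD(6)[OF emb2[OF it], of xs R] by simp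
      qed
      then show ?thesis ..
    qed
    ultimately show "concat_fun \<Gamma> (list_map (type_of m) g X) = F X"
      using As(1) by simp
  qed
qed

text \<open>The variables range over element types. \<open>up p q\<close> says that \<open>p\<close>
  precedes or equals \<open>q\<close> in the output when \<open>q\<close> sits in a later input
  item, \<open>dn p q\<close> that the later \<open>q\<close> precedes or equals \<open>p\<close>,
  and \<open>same p q\<close> that \<open>p\<close> precedes or equals \<open>q\<close> within some
  common item. One type whose copies strictly ascend forces every other type to ascend, both by
  itself and against the first.\<close>

lemma asc_propagates:
  assumes mem: "s \<in> T" "u \<in> T"
    and total: "\<And>p q. p \<in> T \<Longrightarrow> q \<in> T \<Longrightarrow> up p q \<or> dn p q"
    and t: "\<And>p q r. p \<in> T \<Longrightarrow> q \<in> T \<Longrightarrow> r \<in> T \<Longrightarrow> up q r \<Longrightarrow> dn p r \<Longrightarrow> dn p q"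
      "\<And>p q r. p \<in> T \<Longrightarrow> q \<in> T \<Longrightarrow> r \<in> T \<Longrightarrow> dn p r \<Longrightarrow> up p q \<Longrightarrow> dn q r"
      "\<And>p q r. p \<in> T \<Longrightarrow> q \<in> T \<Longrightarrow> r \<in> T \<Longrightarrow> dn q r \<Longrightarrow> dn p q \<Longrightarrow> dn p r"
    and same: "\<And>p q r. p \<in> T \<Longrightarrow> q \<in> T \<Longrightarrow> r \<in> T \<Longrightarrow> same p q \<Longrightarrow> dn p r \<Longrightarrow> dn q r"
      "\<And>p q r. p \<in> T \<Longrightarrow> q \<in> T \<Longrightarrow> r \<in> T \<Longrightarrow> same p q \<Longrightarrow> dn r q \<Longrightarrow> dn r p"
    and le: "\<And>p q. p \<in> T \<Longrightarrow> q \<in> T \<Longrightarrow> up p q \<or> dn q p \<or> same p q"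
    and asc: "\<not> dn s s"
  shows "up s u \<and> \<not> dn s u \<and> up u s \<and> \<not> dn u s \<and> \<not> dn u u"
proof -
  have 1: "\<not> dn s u"
  proof
    assume d: "dn s u"
    from le[OF mem] consider "up s u" | "dn u s" | "same s u" by blast
    then show False
    proof cases
      case 1 then show False using t(1)[OF mem(1,1,2) _ d] asc by blast
    next
      case 2 then show False using t(3)[OF mem(1,2,1) _ d] asc by blast
    next
      case 3 then show False using same(2)[OF mem(1,2,1) _ d] asc by blast
    qed
  qed
  have 2: "\<not> dn u s"
  proof
    assume d: "dn u s"
    from le[OF mem(2,1)] consider "up u s" | "dn s u" | "same u s" by blast
    then show False
    proof cases
      case 1 then show False using t(2)[OF mem(2,1,1) d] asc by blast
    next
      case 2 then show False using 1 by blast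
    next
      case 3 then show False using same(1)[OF mem(2,1,1) _ d] asc by blast
    qed
  qed
  have 3: "up s u" "up u s"
    using 1 2 total mem by blast+
  have "\<not> dn u u"
    using t(2)[OF mem(2,1,2) _ 3(2)] 1 by blast
  with 1 2 3 show ?thesis by blast
qed

text \<open>The six laws \<open>t\<close> are transitivity for elements of three successive items.
  If one type strictly ascends, all do; if one strictly descends, all do; otherwise the copies of
  each type are equivalent to each other, and then so are all types.\<close>

lemma order_types:
  assumes total: "\<And>p q. p \<in> T \<Longrightarrow> q \<in> T \<Longrightarrow> up p q \<or> dn p q"
    and t: "\<And>p q r. p \<in> T \<Longrightarrow> q \<in> T \<Longrightarrow> r \<in> T \<Longrightarrow> up p q \<Longrightarrow> up q r \<Longrightarrow> up p r"
      "\<And>p q r. p \<in> T \<Longrightarrow> q \<in> T \<Longrightarrow> r \<in> T \<Longrightarrow> up p r \<Longrightarrow> dn q r \<Longrightarrow> up p q"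
      "\<And>p q r. p \<in> T \<Longrightarrow> q \<in> T \<Longrightarrow> r \<in> T \<Longrightarrow> dn p q \<Longrightarrow> up p r \<Longrightarrow> up q r"
      "\<And>p q r. p \<in> T \<Longrightarrow> q \<in> T \<Longrightarrow> r \<in> T \<Longrightarrow> up q r \<Longrightarrow> dn p r \<Longrightarrow> dn p q"
      "\<And>p q r. p \<in> T \<Longrightarrow> q \<in> T \<Longrightarrow> r \<in> T \<Longrightarrow> dn p r \<Longrightarrow> up p q \<Longrightarrow> dn q r"
      "\<And>p q r. p \<in> T \<Longrightarrow> q \<in> T \<Longrightarrow> r \<in> T \<Longrightarrow> dn q r \<Longrightarrow> dn p q \<Longrightarrow> dn p r"
    and same: "\<And>p q r. p \<in> T \<Longrightarrow> q \<in> T \<Longrightarrow> r \<in> T \<Longrightarrow> same p q \<Longrightarrow> up q r \<Longrightarrow> up p r"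
      "\<And>p q r. p \<in> T \<Longrightarrow> q \<in> T \<Longrightarrow> r \<in> T \<Longrightarrow> same p q \<Longrightarrow> dn p r \<Longrightarrow> dn q r"
      "\<And>p q r. p \<in> T \<Longrightarrow> q \<in> T \<Longrightarrow> r \<in> T \<Longrightarrow> same p q \<Longrightarrow> dn r q \<Longrightarrow> dn r p"
      "\<And>p q r. p \<in> T \<Longrightarrow> q \<in> T \<Longrightarrow> r \<in> T \<Longrightarrow> same p q \<Longrightarrow> up r p \<Longrightarrow> up r q"
    and le: "\<And>p q. p \<in> T \<Longrightarrow> q \<in> T \<Longrightarrow> up p q \<or> dn q p \<or> same p q"
  shows "(\<forall>p\<in>T. \<forall>q\<in>T. up p q \<and> \<not> dn p q) \<or> (\<forall>p\<in>T. \<forall>q\<in>T. dn p q \<and> \<not> up p q) \<or>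
    (\<forall>p\<in>T. \<forall>q\<in>T. up p q \<and> dn p q)"
proof -
  have asc: "up s u \<and> \<not> dn s u \<and> up u s \<and> \<not> dn u s \<and> \<not> dn u u" if "s \<in> T" "u \<in> T" "\<not> dn s s" for s u
    by (rule asc_propagates[where T = T and same = same]) (fact that total t(4-6) same(2,3) le)+
  \<comment> \<open>The ascending case with \<open>up\<close> and \<open>dn\<close> exchanged and
    \<open>same\<close> reversed.\<close>
  have desc: "dn s u \<and> \<not> up s u \<and> dn u s \<and> \<not> up u s \<and> \<not> up u u" if "s \<in> T" "u \<in> T" "\<not> up s s" for s u
  proof (rule asc_propagates[where T = T and same = "\<lambda>p q. same q p"])
    show "dn p q \<or> up p q" if "p \<in> T" "q \<in> T" for p q
      using total[OF that] by blast
    show "up p q" if "p \<in> T" "q \<in> T" "r \<in> T" "dn q r" "up p r" for p q r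
      using t(2)[OF that(1-3,5,4)] .
    show "up q r" if "p \<in> T" "q \<in> T" "r \<in> T" "up p r" "dn p q" for p q r
      using t(3)[OF that(1-3,5,4)] .
    show "up p r" if "p \<in> T" "q \<in> T" "r \<in> T" "up q r" "up p q" for p q r
      using t(1)[OF that(1-3,5,4)] .
    show "up q r" if "p \<in> T" "q \<in> T" "r \<in> T" "same q p" "up p r" for p q r
      using same(1)[OF that(2,1,3-5)] .
    show "up r p" if "p \<in> T" "q \<in> T" "r \<in> T" "same q p" "up r q" for p q r
      using same(4)[OF that(2,1,3-5)] .
    show "dn p q \<or> up q p \<or> same q p" if "p \<in> T" "q \<in> T" for p q
      using le[OF that(2,1)] by blast
  qed (fact that)+
  consider s where "s \<in> T" "\<not> dn s s" | s where "s \<in> T" "\<not> up s s" | "\<forall>s\<in>T. up s s \<and> dn s s"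
    by blast
  then show ?thesis
  proof cases
    case 1
    then have "up p q \<and> \<not> dn p q" if "p \<in> T" "q \<in> T" for p q
      using asc[OF that] asc[of s p] that by blast
    then show ?thesis by blast
  next
    case 2
    then have "dn p q \<and> \<not> up p q" if "p \<in> T" "q \<in> T" for p q
      using desc[OF that] desc[of s p] that by blast
    then show ?thesis by blast
  next
    case 3
    have "dn s u" if su: "s \<in> T" "u \<in> T" for s u
    proof (rule ccontr)
      assume n: "\<not> dn s u"
      from le[OF su(2,1)] consider "up u s" | "same u s" using n by blast
      then show False
      proof cases
        case 1 then show False using t(4)[OF su(1,2,1)] 3 su n by blast
      next
        case 2 then show False using same(3)[OF su(2,1,1)] 3 su n by blast
      qed
    qed
    moreover have "up s u" if su: "s \<in> T" "u \<in> T" for s u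
    proof (rule ccontr)
      assume n: "\<not> up s u"
      from le[OF su] consider "dn u s" | "same s u" using n by blast
      then show False
      proof cases
        case 1 then show False using t(2)[OF su(1,2,1)] 3 su n by blast
      next
        case 2 then show False using same(4)[OF su(1,2,1)] 3 su n by blast
      qed
    qed
    ultimately show ?thesis by blast
  qed
qed

text \<open>Really a relation between unary types, stated for representing elements: some input
  realizes both types and shows them in this order in its output.\<close>

definition before :: "nf \<Rightarrow> ('a rel_struct \<Rightarrow> 'a rel_struct) \<Rightarrow> 'a rel_struct \<Rightarrow> 'a \<Rightarrow> 'a rel_struct \<Rightarrow> 'a \<Rightarrow> bool" where
  "before n F A x B y \<longleftrightarrow> (\<exists>C\<in>models n. \<exists>x' y'. same_type A x C x' \<and> same_type B y C y' \<and> [x', y'] \<in> rel (F C) Leq)"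

lemma beforeI:
  "C \<in> models n \<Longrightarrow> same_type A x C x' \<Longrightarrow> same_type B y C y' \<Longrightarrow> [x', y'] \<in> rel (F C) Leq \<Longrightarrow> before n F A x B y"
  unfolding before_def by blast

lemma Leq_emb:
  assumes F: "interp \<C> (structs (Lists \<Gamma>)) F" and "A \<in> \<C>" "B \<in> \<C>" "local_emb A B X h" "x \<in> X" "y \<in> X"
  shows "[x, y] \<in> rel (F A) Leq \<longleftrightarrow> [h x, h y] \<in> rel (F B) Leq"
proof (cases "x \<in> universe (F A) \<and> y \<in> universe (F A)")
  case True
  then show ?thesis
    using local_embD(6)[OF interpD(3)[OF assms(1-4)], of "[x, y]" Leq] assms(5,6) by simp
next
  case False
  then show ?thesis
    using interp_iff[OF assms(1-4)] assms(5,6) Leq_mem[OF interpD(1)[OF F assms(2)]]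
      Leq_mem[OF interpD(1)[OF F assms(3)]] by blast
qed

text \<open>The two witnessing inputs share the type of the middle element and are amalgamated over
  it; in the amalgam the two comparisons compose.\<close>

lemma before_trans:
  fixes F :: "'a::infinite rel_struct \<Rightarrow> 'a rel_struct"
  assumes n: "normal n" and F: "interp (models n) (structs (Lists \<Gamma>)) F"
    and 1: "before n F A x B y" and 2: "before n F B y C z"
  shows "before n F A x C z"
proof -
  obtain D x1 y1 where D: "D \<in> models n" "same_type A x D x1" "same_type B y D y1" "[x1, y1] \<in> rel (F D) Leq"
    using 1 unfolding before_def by blast
  obtain E y2 z2 where E: "E \<in> models n" "same_type B y E y2" "same_type C z E z2" "[y2, z2] \<in> rel (F E) Leq"
    using 2 unfolding before_def by blast
  have "same_type D y1 E y2"
    using same_type_trans[OF same_type_sym[OF D(3)] E(2)] .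
  then obtain G h g where G: "G \<in> models n" "local_emb D G (universe D) h" "local_emb E G (universe E) g"
    "g y2 = h y1"
    using amalgamation[OF n D(1) E(1), of "{y1}" y1 "\<lambda>_. y2"] by auto
  have mem: "x1 \<in> universe D" "y1 \<in> universe D" "y2 \<in> universe E" "z2 \<in> universe E"
    using local_embD(5)[OF D(2)] local_embD(5)[OF D(3)] local_embD(5)[OF E(2)] local_embD(5)[OF E(3)] by blast+
  have "[h x1, h y1] \<in> rel (F G) Leq" "[g y2, g z2] \<in> rel (F G) Leq"
    using Leq_emb[OF F D(1) G(1,2) mem(1,2)] Leq_emb[OF F E(1) G(1,3) mem(3,4)] D(4) E(4) by blast+
  then have "[h x1, g z2] \<in> rel (F G) Leq"
    using Leq_trans[OF interpD(1)[OF F G(1)]] G(4) by metis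
  then show ?thesis
    using G(1) same_type_trans[OF D(2) same_typeI[OF G(2) mem(1)]]
      same_type_trans[OF E(3) same_typeI[OF G(3) mem(4)]] by (intro beforeI)
qed

text \<open>Every tuple over one element is constant, so the names whose constant tuple is present
  determine the unary type. The codes are subsets of a finite vocabulary.\<close>

definition elem_type :: "'a rel_struct \<Rightarrow> 'a \<Rightarrow> rel_name set" where
  "elem_type A x = {R. replicate (arity R) x \<in> rel A R}"

text \<open>The unary types that reach the output; their number is the measure for cutting list
  outputs.\<close>

definition leaf_types :: "nf \<Rightarrow> ('a rel_struct \<Rightarrow> 'a rel_struct) \<Rightarrow> rel_name set set" where
  "leaf_types n F = {elem_type A x | A x. A \<in> models n \<and> x \<in> universe (F A)}"

lemma finite_leaf_types: "finite (leaf_types n F)"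
proof -
  have "leaf_types n F \<subseteq> Pow (vocabulary (type_of n))"
    using rel_of_structs[OF models_structs] by (fastforce simp: leaf_types_def elem_type_def)
  then show ?thesis
    using finite_vocabulary by (meson finite_Pow_iff finite_subset)
qed

lemma elem_type_eq:
  assumes A: "A \<in> models n" "B \<in> models n" and x: "x \<in> universe A" "y \<in> universe B"
  shows "elem_type A x = elem_type B y \<longleftrightarrow> same_type A x B y"
proof
  assume eq: "elem_type A x = elem_type B y"
  show "same_type A x B y"
  proof (rule local_embI)
    fix xs R assume "set xs \<subseteq> {x}"
    then have xs: "xs = replicate (length xs) x"
      by (induction xs) auto
    then have map: "map (\<lambda>_. y) xs = replicate (length xs) y"
      by (simp add: map_replicate_const)
    show "xs \<in> rel A R \<longleftrightarrow> map (\<lambda>_. y) xs \<in> rel B R"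
    proof (cases "length xs = arity R")
      case True
      then have "xs \<in> rel A R \<longleftrightarrow> R \<in> elem_type A x" "map (\<lambda>_. y) xs \<in> rel B R \<longleftrightarrow> R \<in> elem_type B y"
        using xs unfolding map elem_type_def by simp_all
      then show ?thesis using eq by simp
    next
      case False
      then show ?thesis
        using wf_structD[OF wf_models[OF A(1)], of xs R] wf_structD[OF wf_models[OF A(2)], of "map (\<lambda>_. y) xs" R]
        by auto
    qed
  qed (use x in auto)
next
  assume e: "same_type A x B y"
  have "replicate (arity R) x \<in> rel A R \<longleftrightarrow> replicate (arity R) y \<in> rel B R" for R
    using local_embD(6)[OF e, of "replicate (arity R) x" R] set_replicate_conv_if[of "arity R" x]
    by (simp add: map_replicate_const split: if_splits)
  then show "elem_type A x = elem_type B y"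
    by (simp add: elem_type_def)
qed

text \<open>An element of the part has a type there and one in the whole structure, and the latter
  determines the former because \<open>r\<close> is compatible with embeddings.\<close>

lemma card_leaf_types_restriction:
  assumes r: "restriction n m r" and F: "\<And>A. A \<in> models n \<Longrightarrow> F A = G (r A)"
    and sub: "\<And>A. A \<in> models m \<Longrightarrow> universe (G A) \<subseteq> universe A"
  shows "card (leaf_types m G) \<le> card (leaf_types n F)"
proof -
  have r': "interp (models n) (models m) r" "reflects n r" "onto n m r"
    using r by (auto simp: restriction_def)
  show ?thesis
  proof (rule card_le_if_inj_on_rel[where r = "\<lambda>s t. \<exists>A\<in>models n. \<exists>x\<in>universe (F A). s = elem_type (r A) x \<and> t = elem_type A x"])
    show "finite (leaf_types n F)" by (rule finite_leaf_types)
    fix s assume "s \<in> leaf_types m G"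
    then obtain B x where B: "B \<in> models m" "x \<in> universe (G B)" "s = elem_type B x"
      by (auto simp: leaf_types_def)
    obtain A where A: "A \<in> models n" "r A = B"
      using ontoD[OF r'(3) B(1) finite.emptyI] .
    moreover have "x \<in> universe (F A)"
      using B(2) A F[OF A(1)] by simp
    ultimately show "\<exists>t. t \<in> leaf_types n F \<and> (\<exists>A\<in>models n. \<exists>x\<in>universe (F A). s = elem_type (r A) x \<and> t = elem_type A x)"
      using B(3) unfolding leaf_types_def by (intro exI[of _ "elem_type A x"]) blast
  next
    fix s s' t
    assume "\<exists>A\<in>models n. \<exists>x\<in>universe (F A). s = elem_type (r A) x \<and> t = elem_type A x"
      "\<exists>A\<in>models n. \<exists>x\<in>universe (F A). s' = elem_type (r A) x \<and> t = elem_type A x"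
    then obtain A x B y where A: "A \<in> models n" "x \<in> universe (F A)" "s = elem_type (r A) x" "t = elem_type A x"
      and B: "B \<in> models n" "y \<in> universe (F B)" "s' = elem_type (r B) y" "t = elem_type B y"
      by blast
    have x: "x \<in> universe (r A)" "y \<in> universe (r B)"
      using A(2) F[OF A(1)] sub[OF interpD(1)[OF r'(1) A(1)]]
        B(2) F[OF B(1)] sub[OF interpD(1)[OF r'(1) B(1)]] by auto
    moreover have "universe (r A) \<subseteq> universe A" "universe (r B) \<subseteq> universe B"
      using interpD(2)[OF r'(1)] A(1) B(1) by blast+
    ultimately have "same_type A x B y"
      using elem_type_eq[OF A(1) B(1)] A(4) B(4) by blast
    then have "same_type (r A) x (r B) y"
      using interp_local_emb[OF r'(1) A(1) B(1)] x by blast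
    then show "s = s'"
      using elem_type_eq[OF interpD(1)[OF r'(1) A(1)] interpD(1)[OF r'(1) B(1)] x] A(3) B(3) by simp
  qed
qed

lemma local_emb_id_sym: "local_emb A B X (\<lambda>x. x) \<Longrightarrow> local_emb B A X (\<lambda>x. x)"
  unfolding local_emb_def by simp

text \<open>Makes the two halves of a list output interpretations in their own right, each half
  being selected by a property of unary types.\<close>

lemma interp_substructure:
  assumes F: "interp \<C> \<D> F" and H: "\<And>A. A \<in> \<C> \<Longrightarrow> H A \<in> \<E>"
    and e: "\<And>A. A \<in> \<C> \<Longrightarrow> local_emb (H A) (F A) (universe (H A)) (\<lambda>x. x)"
    and U: "\<And>A. A \<in> \<C> \<Longrightarrow> universe (H A) = {x \<in> universe (F A). \<phi> A x}"
    and \<phi>: "\<And>A B x y. A \<in> \<C> \<Longrightarrow> B \<in> \<C> \<Longrightarrow> same_type A x B y \<Longrightarrow> \<phi> A x \<Longrightarrow> \<phi> B y"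
  shows "interp \<C> \<E> H"
proof (rule interpI)
  fix A assume A: "A \<in> \<C>"
  then show "H A \<in> \<E> \<and> universe (H A) \<subseteq> universe A"
    using H U interpD(2)[OF F A] by blast
next
  fix A B X h assume AB: "A \<in> \<C>" "B \<in> \<C>" and h: "local_emb A B X h"
  let ?Y = "X \<inter> universe (H A)"
  have FY: "local_emb (F A) (F B) ?Y h"
    using interpD(3)[OF F AB h] by (rule local_emb_mono) (use U[OF AB(1)] in blast)
  have "h ` ?Y \<subseteq> universe (H B)"
  proof
    fix y assume "y \<in> h ` ?Y"
    then obtain x where x: "x \<in> X" "x \<in> universe (H A)" "y = h x" by blast
    then have "\<phi> A x" using U[OF AB(1)] by blast
    then have "\<phi> B y" using \<phi>[OF AB same_typeI[OF h x(1)]] x(3) by simp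
    moreover have "y \<in> universe (F B)" using local_embD(5)[OF FY] x by blast
    ultimately show "y \<in> universe (H B)" using U[OF AB(2)] by blast
  qed
  then have "local_emb (F B) (H B) (h ` ?Y) (\<lambda>x. x)"
    by (rule local_emb_mono[OF local_emb_id_sym[OF e[OF AB(2)]]])
  from local_emb_comp[OF FY this] have FH: "local_emb (F A) (H B) ((\<lambda>x. x) ` ?Y) h"
    by simp
  have "local_emb (H A) (F A) ?Y (\<lambda>x. x)"
    by (rule local_emb_mono[OF e[OF AB(1)]]) blast
  from local_emb_comp[OF this FH] show "local_emb (H A) (H B) ?Y h" .
qed

lemma filter_split:
  assumes "sorted_wrt (\<lambda>a b. P b \<longrightarrow> P a) xs"
  shows "filter P xs @ filter (\<lambda>x. \<not> P x) xs = xs"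
  using assms
proof (induction xs)
  case (Cons a xs)
  show ?case
  proof (cases "P a")
    case False
    then have "filter P xs = []" "filter (\<lambda>x. \<not> P x) xs = xs"
      using Cons.prems by (auto simp: filter_empty_conv filter_id_conv)
    with False show ?thesis by simp
  qed (use Cons in auto)
qed simp

text \<open>
  If some element type never precedes-or-equals another one, the output list is the concatenation of
  two lists over fewer element types.
\<close>

lemma solvable_peel:
  fixes F :: "'a::infinite rel_struct \<Rightarrow> 'a rel_struct"
  assumes n: "normal n" "sum_free n" and F: "interp (models n) (structs (Lists \<Gamma>)) F"
    and A0: "A0 \<in> models n" "x0 \<in> universe (F A0)" and B0: "B0 \<in> models n" "y0 \<in> universe (F B0)"
    and nb: "\<not> before n F B0 y0 A0 x0"
    and IH: "\<And>m (G :: 'a rel_struct \<Rightarrow> 'a rel_struct). normal m \<Longrightarrow> sum_free m \<Longrightarrow> depth m \<le> depth n \<Longrightarrow>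
      interp (models m) (structs (Lists \<Gamma>)) G \<Longrightarrow> card (leaf_types m G) < card (leaf_types n F) \<Longrightarrow>
      solvable m (Lists \<Gamma>) G"
  shows "solvable n (Lists \<Gamma>) F"
proof -
  \<comment> \<open>Elements that the type of \<open>y0\<close> never precedes or equals. By
    transitivity they form an initial segment of every output list; \<open>x0\<close> has this
    property and \<open>y0\<close> does not.\<close>
  define \<phi> where "\<phi> = (\<lambda>A z. \<not> before n F B0 y0 A z)"
  have \<phi>: "\<phi> A x \<longleftrightarrow> \<phi> B y" if "same_type A x B y" for A B x y
    unfolding \<phi>_def before_def using that same_type_trans same_type_sym by metis
  define Cs where "Cs = (\<lambda>A. un_list \<Gamma> (F A))"
  define P where "P = (\<lambda>A (C :: 'a rel_struct). \<forall>z\<in>universe C. \<phi> A z)"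
  define F1 where "F1 = (\<lambda>A. list_struct (filter (P A) (Cs A)))"
  define F2 where "F2 = (\<lambda>A. list_struct (filter (\<lambda>C. \<not> P A C) (Cs A)))"
  have FA: "F A = list_struct (Cs A)" "items (structs \<Gamma>) (Cs A)" if "A \<in> models n" for A
    using interpD(1)[OF F that] by (auto simp: Cs_def)
  have sep: "[w, z] \<notin> rel (F A) Leq" if A: "A \<in> models n" and zw: "z \<in> universe (F A)" "w \<in> universe (F A)" "\<phi> A z" "\<not> \<phi> A w" for A z w
  proof
    assume l: "[w, z] \<in> rel (F A) Leq"
    have "w \<in> universe A" "z \<in> universe A"
      using zw interpD(2)[OF F A] by blast+
    then have "before n F A w A z"
      using l A same_type_refl by (intro beforeI)
    then show False
      using before_trans[OF n(1) F] zw(3,4) unfolding \<phi>_def by blast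
  qed
  \<comment> \<open>For \<open>i = j\<close> this says that an item lies entirely inside or entirely
    outside the segment, so filtering whole items cuts the list correctly.\<close>
  have order: "P A (Cs A ! i)"
    if A: "A \<in> models n" and ij: "i \<le> j" "j < length (Cs A)" and z: "z \<in> universe (Cs A ! j)" "\<phi> A z" for A i j z
    unfolding P_def
  proof
    fix w assume w: "w \<in> universe (Cs A ! i)"
    have wf: "wf_list (Cs A)" using FA(2)[OF A] items_wf_list by blast
    have U: "w \<in> universe (F A)" "z \<in> universe (F A)"
      using w z(1) ij FA(1)[OF A] nth_mem[of i "Cs A"] nth_mem[of j "Cs A"] by auto
    have "pos (Cs A) w = i" "pos (Cs A) z = j"
      using w z ij by (intro pos_eq[OF wf]; simp)+
    then have "[w, z] \<in> rel (F A) Leq"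
      using U ij(1) unfolding FA(1)[OF A] rel_list_Leq[OF wf] by blast
    then show "\<phi> A w"
      using sep[OF A U(2,1) z(2)] by blast
  qed
  have notP: "\<not> \<phi> A z" if A: "A \<in> models n" "C \<in> set (Cs A)" "\<not> P A C" "z \<in> universe C" for A C z
    using order[OF A(1) order_refl] A(2-4) by (metis in_set_conv_nth)
  have split: "filter (P A) (Cs A) @ filter (\<lambda>C. \<not> P A C) (Cs A) = Cs A" if A: "A \<in> models n" for A
  proof (rule filter_split, unfold sorted_wrt_iff_nth_less, intro allI impI)
    fix i j assume ij: "i < j" "j < length (Cs A)" "P A (Cs A ! j)"
    have "universe (Cs A ! j) \<noteq> {}"
      using FA(2)[OF A] nth_mem[OF ij(2)] by (simp add: items_def)
    then obtain z where z: "z \<in> universe (Cs A ! j)" by blast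
    then have "\<phi> A z" using ij(3) by (simp add: P_def)
    with z show "P A (Cs A ! i)"
      by (rule order[OF A less_imp_le[OF ij(1)] ij(2)])
  qed
  have U1: "universe (F1 A) = {z \<in> universe (F A). \<phi> A z}" and U2: "universe (F2 A) = {z \<in> universe (F A). \<not> \<phi> A z}"
    if A: "A \<in> models n" for A
  proof -
    have "\<phi> A z" if "P A C" "z \<in> universe C" for C z
      using that by (simp add: P_def)
    then show "universe (F1 A) = {z \<in> universe (F A). \<phi> A z}" "universe (F2 A) = {z \<in> universe (F A). \<not> \<phi> A z}"
      unfolding F1_def F2_def FA(1)[OF A] universe_list_struct set_filter using notP[OF A] by blast+
  qed
  have w: "weak_items (structs \<Gamma>) (filter (P A) (Cs A) @ filter (\<lambda>C. \<not> P A C) (Cs A))" if "A \<in> models n" for A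
    unfolding split[OF that] using items_weak[OF FA(2)[OF that]] .
  have mem: "F1 A \<in> structs (Lists \<Gamma>)" "F2 A \<in> structs (Lists \<Gamma>)" if "A \<in> models n" for A
    using w[OF that] weak_items_in_structs unfolding weak_items_append F1_def F2_def by blast+
  have e: "local_emb (F1 A) (F A) (universe (F1 A)) (\<lambda>x. x)" "local_emb (F2 A) (F A) (universe (F2 A)) (\<lambda>x. x)"
    if "A \<in> models n" for A
    using local_emb_append_left[OF weak_items_wf[OF w[OF that]]] local_emb_append_right[OF weak_items_wf[OF w[OF that]]]
    unfolding F1_def F2_def split[OF that] FA(1)[OF that, symmetric] by blast+
  have F1: "interp (models n) (structs (Lists \<Gamma>)) F1"
  proof (rule interp_substructure[OF F mem(1) e(1) U1])
    show "\<phi> B y" if "A \<in> models n" "B \<in> models n" "same_type A x B y" "\<phi> A x" for A B x y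
      using \<phi>[OF that(3)] that(4) by simp
  qed
  have F2: "interp (models n) (structs (Lists \<Gamma>)) F2"
  proof (rule interp_substructure[OF F mem(2) e(2) U2])
    show "\<not> \<phi> B y" if "A \<in> models n" "B \<in> models n" "same_type A x B y" "\<not> \<phi> A x" for A B x y
      using \<phi>[OF that(3)] that(4) by simp
  qed
  have refl: "before n F B0 y0 B0 y0"
    using B0 interpD(2)[OF F B0(1)] Leq_total[OF interpD(1)[OF F B0(1)] B0(2,2)]
    by (intro beforeI[OF B0(1)]) (auto intro: same_type_refl)
  \<comment> \<open>Each half lacks a type that \<open>F\<close> uses: the first that of
    \<open>y0\<close>, the second that of \<open>x0\<close>.\<close>
  have less: "card (leaf_types n H) < card (leaf_types n F)"
    if H: "\<And>A. A \<in> models n \<Longrightarrow> universe (H A) \<subseteq> universe (F A)"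
      and B: "B \<in> models n" "y \<in> universe (F B)" "\<And>A z. A \<in> models n \<Longrightarrow> z \<in> universe (H A) \<Longrightarrow> \<not> same_type A z B y"
    for H B y
  proof (rule psubset_card_mono[OF finite_leaf_types], rule psubsetI)
    show "leaf_types n H \<subseteq> leaf_types n F"
      using H unfolding leaf_types_def by blast
    have "elem_type B y \<in> leaf_types n F"
      using B unfolding leaf_types_def by blast
    moreover have "elem_type B y \<notin> leaf_types n H"
    proof
      assume "elem_type B y \<in> leaf_types n H"
      then obtain A z where A: "A \<in> models n" "z \<in> universe (H A)" "elem_type A z = elem_type B y"
        by (auto simp: leaf_types_def)
      then have "z \<in> universe A" "y \<in> universe B"
        using H[OF A(1)] interpD(2)[OF F A(1)] interpD(2)[OF F B(1)] B(2) by blast+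
      then show False
        using elem_type_eq[OF A(1) B(1)] A(3) B(3)[OF A(1,2)] by blast
    qed
    ultimately show "leaf_types n H \<noteq> leaf_types n F" by blast
  qed
  have less1: "card (leaf_types n F1) < card (leaf_types n F)"
  proof (rule less[OF _ B0])
    fix A z assume "A \<in> models n" "z \<in> universe (F1 A)"
    then show "\<not> same_type A z B0 y0"
      using U1 \<phi>[of A B0 z y0] refl unfolding \<phi>_def by blast
  qed (use U1 in blast)
  have less2: "card (leaf_types n F2) < card (leaf_types n F)"
  proof (rule less[OF _ A0])
    fix A z assume "A \<in> models n" "z \<in> universe (F2 A)"
    then show "\<not> same_type A z A0 x0"
      using U2 \<phi>[of A A0 z x0] nb unfolding \<phi>_def by blast
  qed (use U2 in blast)
  obtain k :: "'a rel_struct \<Rightarrow> 'a rel_struct" where k: "derivable (Lists \<Gamma> \<otimes> Lists \<Gamma>) (Lists \<Gamma>) k"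
    "\<And>As Bs. weak_items (structs \<Gamma>) (As @ Bs) \<Longrightarrow> k (prod_struct (list_struct As) (list_struct Bs)) = list_struct (As @ Bs)"
    by (rule derivable_append2[where \<Sigma> = \<Gamma>]) blast
  have "solvable n (Lists \<Gamma>) (\<lambda>A. k (prod_struct (F1 A) (F2 A)))"
  proof (rule solvable_pair[OF n F1 F2])
    show "disj (F1 A) (F2 A)" if "A \<in> models n" for A
      using U1[OF that] U2[OF that] by blast
    fix m and r G :: "'a rel_struct \<Rightarrow> 'a rel_struct"
    assume m: "normal m" "sum_free m" "depth m \<le> depth n" "restriction n m r" "interp (models m) (structs (Lists \<Gamma>)) G"
    show "solvable m (Lists \<Gamma>) G" if "\<And>A. A \<in> models n \<Longrightarrow> F1 A = G (r A)"
      using IH[OF m(1-3,5)] card_leaf_types_restriction[OF m(4) that interpD(2)[OF m(5)]] less1 by simp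
    show "solvable m (Lists \<Gamma>) G" if "\<And>A. A \<in> models n \<Longrightarrow> F2 A = G (r A)"
      using IH[OF m(1-3,5)] card_leaf_types_restriction[OF m(4) that interpD(2)[OF m(5)]] less2 by simp
  qed (rule k(1))
  moreover have "k (prod_struct (F1 A) (F2 A)) = F A" if "A \<in> models n" for A
    using k(2)[OF w[OF that]] unfolding F1_def F2_def split[OF that] FA(1)[OF that, symmetric] .
  ultimately show ?thesis
    unfolding solvable_def by auto
qed

subsection \<open>Outputs with a single class of element types\<close>

text \<open>A pair of elements from different items is described by their unary types and the order
  of the items alone.\<close>

lemma local_emb_two_items:
  assumes wf: "wf_list As" "wf_list Bs" and ij: "i < j" "j < length As" "k < l" "l < length Bs"
    and x: "same_type (As ! i) x (Bs ! k) x'" and y: "same_type (As ! j) y (Bs ! l) y'"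
  shows "\<exists>h. local_emb (list_struct As) (list_struct Bs) {x, y} h \<and> h x = x' \<and> h y = y'"
proof -
  let ?h = "\<lambda>z. if z = x then x' else y'"
  have mem: "x \<in> universe (As ! i)" "x' \<in> universe (Bs ! k)" "y \<in> universe (As ! j)" "y' \<in> universe (Bs ! l)"
    using local_embD(4,5)[OF x, of x] local_embD(4,5)[OF y, of y] by simp_all
  have pos: "pos As x = i" "pos As y = j" "pos Bs x' = k" "pos Bs y' = l"
    using mem ij by (auto intro!: pos_eq wf)
  have in_list: "z \<in> universe (list_struct Cs)" if "k < length Cs" "z \<in> universe (Cs ! k)" for k Cs z
    using nth_mem[OF that(1)] that(2) by auto
  have neq: "x \<noteq> y" using pos ij by auto
  have notin: "y \<notin> universe (As ! i)" "x \<notin> universe (As ! j)"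
    using pos pos_eq[OF wf(1), of i y] pos_eq[OF wf(1), of j x] ij by auto
  have "local_emb (list_struct As) (list_struct Bs) {x, y} ?h"
    unfolding local_emb_list[OF wf]
  proof (intro conjI ballI)
    fix z assume z: "z \<in> {x, y}"
    have 1: "local_emb (As ! i) (Bs ! k) {x} ?h"
      using x by (subst local_emb_cong[where h' = "\<lambda>_. x'"]) auto
    have 2: "local_emb (As ! j) (Bs ! l) {y} ?h"
      using y neq by (subst local_emb_cong[where h' = "\<lambda>_. y'"]) auto
    have I: "{x, y} \<inter> universe (As ! i) = {x}" "{x, y} \<inter> universe (As ! j) = {y}"
      using mem notin by blast+
    show "local_emb (item As z) (item Bs (?h z)) ({x, y} \<inter> universe (item As z)) ?h"
    proof (cases "z = x")
      case True
      then have "item As z = As ! i" "item Bs (?h z) = Bs ! k" using pos by (simp_all add: item_def)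
      with 1 I(1) show ?thesis by (simp only:)
    next
      case False
      then have "item As z = As ! j" "item Bs (?h z) = Bs ! l" using z pos by (auto simp: item_def)
      with 2 I(2) show ?thesis by (simp only:)
    qed
  next
    show "{x, y} \<subseteq> universe (list_struct As)" "?h ` {x, y} \<subseteq> universe (list_struct Bs)"
      using in_list[of i As x] in_list[of j As y] in_list[of k Bs x'] in_list[of l Bs y'] mem ij
      by (simp_all del: universe_list_struct) auto
    fix z w assume "z \<in> {x, y}" "w \<in> {x, y}"
    then show "pos As z \<le> pos As w \<longleftrightarrow> pos Bs (?h z) \<le> pos Bs (?h w)"
      using pos neq ij by auto
  qed
  then show ?thesis
    using neq by (intro exI[of _ ?h]) auto
qed

text \<open>Provides one input with prescribed unary types in consecutive items, in which the laws
  relating \<open>up\<close> and \<open>dn\<close> can be read off.\<close>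

lemma ex_fresh_items:
  fixes ps :: "('a::infinite rel_struct \<times> 'a) list"
  assumes "\<forall>p\<in>set ps. fst p \<in> models m \<and> snd p \<in> universe (fst p)" "finite S"
  shows "\<exists>As xs. items (models m) As \<and> length As = length ps \<and> length xs = length ps \<and>
    universe (list_struct As) \<inter> S = {} \<and>
    (\<forall>i<length ps. same_type (fst (ps ! i)) (snd (ps ! i)) (As ! i) (xs ! i))"
  using assms
proof (induction ps arbitrary: S)
  case Nil
  then show ?case by (auto simp: items_def)
next
  case (Cons p ps)
  obtain A u where p: "p = (A, u)" "A \<in> models m" "u \<in> universe A"
    using Cons.prems(1) by (cases p) auto
  obtain r where r: "rename r A \<in> models m" "local_emb A (rename r A) (universe A) r" "universe (rename r A) \<inter> S = {}"
    using fresh_copy[OF p(2) Cons.prems(2)] .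
  have "finite (S \<union> universe (rename r A))"
    using Cons.prems(2) finite_models[OF r(1)] by (rule finite_UnI)
  moreover have "\<forall>p\<in>set ps. fst p \<in> models m \<and> snd p \<in> universe (fst p)"
    using Cons.prems(1) by simp
  ultimately obtain As xs where As: "items (models m) As"
    "length As = length ps" "length xs = length ps" "universe (list_struct As) \<inter> (S \<union> universe (rename r A)) = {}"
    "\<forall>i<length ps. same_type (fst (ps ! i)) (snd (ps ! i)) (As ! i) (xs ! i)"
    using Cons.IH[of "S \<union> universe (rename r A)"] by blast
  have "r u \<in> universe (rename r A)" using p(3) by simp
  then have "items (models m) (rename r A # As)"
    using r(1) As(1,4) by (auto simp: items_Cons)
  moreover have "universe (list_struct (rename r A # As)) \<inter> S = {}"
    using r(3) As(4) by auto
  moreover have "\<forall>i<length (p # ps). same_type (fst ((p # ps) ! i)) (snd ((p # ps) ! i)) ((rename r A # As) ! i) ((r u # xs) ! i)"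
    using As(5) same_typeI[OF r(2) p(3)] p(1) by (auto simp: less_Suc_eq_0_disj)
  ultimately show ?case
    using As(2,3) by (intro exI[of _ "rename r A # As"] exI[of _ "r u # xs"]) simp
qed

text \<open>How the output orders elements of different items depends only on their unary types and
  on which item is earlier. \<open>order_types\<close> leaves three cases: ascending; descending,
  which is ascending after reversal; and all types equivalent, which contradicts the strict pair
  \<open>x0\<close>, \<open>y0\<close>.\<close>

lemma solvable_list_base:
  fixes F :: "'a::infinite rel_struct \<Rightarrow> 'a rel_struct"
  assumes F: "interp (models (NList m)) (structs (Lists \<Gamma>)) F"
    and all: "\<And>A B x y. A \<in> models (NList m) \<Longrightarrow> B \<in> models (NList m) \<Longrightarrow> x \<in> universe (F A) \<Longrightarrow> y \<in> universe (F B) \<Longrightarrow>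
      before (NList m) F A x B y"
    and strict: "A0 \<in> models (NList m)" "x0 \<in> universe (F A0)" "y0 \<in> universe (F A0)" "[y0, x0] \<notin> rel (F A0) Leq"
    and deep: "\<And>g :: 'a rel_struct \<Rightarrow> 'a rel_struct. interp (models m) (structs (Lists \<Gamma>)) g \<Longrightarrow> solvable m (Lists \<Gamma>) g"
  shows "solvable (NList m) (Lists \<Gamma>) F"
proof -
  let ?le = "\<lambda>As x y. [x, y] \<in> rel (F (list_struct As)) Leq"
  \<comment> \<open>The used types, each represented by an item and an element of it. As the type of
    an element depends only on its item, the list with that single item decides whether the type is
    used.\<close>
  define T where "T = {(A, u). A \<in> models m \<and> u \<in> universe (F (list_struct [A]))}"
  \<comment> \<open>Defined through some witness; \<open>iff\<close> shows that every witness gives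
    the same answer for \<open>up\<close> and \<open>dn\<close>, whereas \<open>same\<close> may
    depend on the witness.\<close>
  define up where "up = (\<lambda>p q. \<exists>As i j x y. items (models m) As \<and> i < j \<and> j < length As \<and>
    same_type (fst p) (snd p) (As ! i) x \<and> same_type (fst q) (snd q) (As ! j) y \<and> ?le As x y)"
  define dn where "dn = (\<lambda>p q. \<exists>As i j x y. items (models m) As \<and> i < j \<and> j < length As \<and>
    same_type (fst p) (snd p) (As ! i) x \<and> same_type (fst q) (snd q) (As ! j) y \<and> ?le As y x)"
  define same where "same = (\<lambda>p q. \<exists>A x y. items (models m) [A] \<and>
    same_type (fst p) (snd p) A x \<and> same_type (fst q) (snd q) A y \<and> ?le [A] x y)"
  have mod: "list_struct As \<in> models (NList m)" if "items (models m) As" for As :: "'a rel_struct list"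
    using that by auto
  have single: "list_struct [A] \<in> models (NList m)" if "A \<in> models m" for A :: "'a rel_struct"
    using that by (intro weak_items_models) simp
  have TD: "fst p \<in> models m" "snd p \<in> universe (fst p)" "items (models m) [fst p]" if "p \<in> T" for p
  proof -
    show A: "fst p \<in> models m" using that by (auto simp: T_def)
    show "snd p \<in> universe (fst p)"
      using that interpD(2)[OF F single[OF A]] by (auto simp: T_def)
    with A show "items (models m) [fst p]" by (auto simp: items_def)
  qed
  have L: "F (list_struct As) \<in> structs (Lists \<Gamma>)" if "items (models m) As" for As
    using interpD(1)[OF F mod[OF that]] .
  have iff: "?le As x y \<longleftrightarrow> up p q" "?le As y x \<longleftrightarrow> dn p q"
    if As: "items (models m) As" "i < j" "j < length As" "same_type (fst p) (snd p) (As ! i) x"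
      "same_type (fst q) (snd q) (As ! j) y" for As i j x y p q
  proof -
    have tr: "(?le As x y \<longleftrightarrow> ?le Bs x' y') \<and> (?le As y x \<longleftrightarrow> ?le Bs y' x')"
      if Bs: "items (models m) Bs" "k < l" "l < length Bs" "same_type (fst p) (snd p) (Bs ! k) x'"
      "same_type (fst q) (snd q) (Bs ! l) y'" for Bs k l x' y'
    proof -
      obtain h where h: "local_emb (list_struct As) (list_struct Bs) {x, y} h" "h x = x'" "h y = y'"
        using local_emb_two_items[OF items_models_wf[OF As(1)] items_models_wf[OF Bs(1)] As(2,3) Bs(2,3)
          same_type_trans[OF same_type_sym[OF As(4)] Bs(4)] same_type_trans[OF same_type_sym[OF As(5)] Bs(5)]]
        by blast
      then show ?thesis
        using Leq_emb[OF F mod[OF As(1)] mod[OF Bs(1)] h(1)] by auto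
    qed
    show "?le As x y \<longleftrightarrow> up p q"
    proof
      assume "up p q"
      then obtain Bs k l x' y' where "items (models m) Bs" "k < l" "l < length Bs"
        "same_type (fst p) (snd p) (Bs ! k) x'" "same_type (fst q) (snd q) (Bs ! l) y'" "?le Bs x' y'"
        unfolding up_def by (elim exE conjE)
      with tr[of Bs k l x' y'] show "?le As x y" by simp
    next
      assume l: "?le As x y"
      show "up p q"
        unfolding up_def by (rule exI[of _ As], rule exI[of _ i], rule exI[of _ j], rule exI[of _ x], rule exI[of _ y])
          (intro conjI As l)
    qed
    show "?le As y x \<longleftrightarrow> dn p q"
    proof
      assume "dn p q"
      then obtain Bs k l x' y' where "items (models m) Bs" "k < l" "l < length Bs"
        "same_type (fst p) (snd p) (Bs ! k) x'" "same_type (fst q) (snd q) (Bs ! l) y'" "?le Bs y' x'"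
        unfolding dn_def by (elim exE conjE)
      with tr[of Bs k l x' y'] show "?le As y x" by simp
    next
      assume l: "?le As y x"
      show "dn p q"
        unfolding dn_def by (rule exI[of _ As], rule exI[of _ i], rule exI[of _ j], rule exI[of _ x], rule exI[of _ y])
          (intro conjI As l)
    qed
  qed
  have used: "y \<in> universe (F (list_struct As)) \<longleftrightarrow> x \<in> universe (F (list_struct [A]))"
    if As: "items (models m) As" "B \<in> set As" and A: "A \<in> models m" "same_type A x B y" for As A B x y
  proof -
    have x: "x \<in> universe A" using local_embD(4)[OF A(2)] by simp
    then have it: "items (models m) [A]" using A(1) by (auto simp: items_def)
    have "same_type (list_struct [A]) x (list_struct As) y"
      by (rule same_type_list[OF items_models_wf[OF it] items_models_wf[OF As(1)] x _ As(2) A(2)]) simp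
    then show ?thesis
      using interp_mem[OF F mod[OF it] mod[OF As(1)]] by blast
  qed
  have in_T: "(As ! i, x) \<in> T" if "items (models m) As" "i < length As" "x \<in> universe (As ! i)" "x \<in> universe (F (list_struct As))" for As i x
  proof -
    have "As ! i \<in> models m" using that(1,2) by (simp add: items_def)
    then show ?thesis
      using used[OF that(1) nth_mem[OF that(2)] _ same_type_refl[OF that(3)]] that(4) by (simp add: T_def)
  qed
  \<comment> \<open>One input realizes the three types in consecutive items, so that the six
    relations are comparisons in a single output list.\<close>
  have triple: "\<exists>(L :: 'a rel_struct) x y z. L \<in> structs (Lists \<Gamma>) \<and> x \<in> universe L \<and> y \<in> universe L \<and> z \<in> universe L \<and>
      ([x, y] \<in> rel L Leq \<longleftrightarrow> up p q) \<and> ([y, x] \<in> rel L Leq \<longleftrightarrow> dn p q) \<and>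
      ([y, z] \<in> rel L Leq \<longleftrightarrow> up q r) \<and> ([z, y] \<in> rel L Leq \<longleftrightarrow> dn q r) \<and>
      ([x, z] \<in> rel L Leq \<longleftrightarrow> up p r) \<and> ([z, x] \<in> rel L Leq \<longleftrightarrow> dn p r)"
    if pqr: "p \<in> T" "q \<in> T" "r \<in> T" for p q r
  proof -
    obtain As xs where As: "items (models m) As" "length As = 3" "length xs = 3"
      "\<forall>i<3. same_type (fst ([p, q, r] ! i)) (snd ([p, q, r] ! i)) (As ! i) (xs ! i)"
    proof -
      have "\<forall>p\<in>set [p, q, r]. fst p \<in> models m \<and> snd p \<in> universe (fst p)"
        using TD(1,2)[OF pqr(1)] TD(1,2)[OF pqr(2)] TD(1,2)[OF pqr(3)] by auto
      from ex_fresh_items[OF this finite.emptyI] obtain As xs where "items (models m) As"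
        "length As = length [p, q, r]" "length xs = length [p, q, r]"
        "\<forall>i<length [p, q, r]. same_type (fst ([p, q, r] ! i)) (snd ([p, q, r] ! i)) (As ! i) (xs ! i)"
        by (elim exE conjE)
      then show thesis
        by (intro that[of As xs]) simp_all
    qed
    have st: "same_type (fst p) (snd p) (As ! 0) (xs ! 0)" "same_type (fst q) (snd q) (As ! 1) (xs ! 1)"
      "same_type (fst r) (snd r) (As ! 2) (xs ! 2)"
      using As(4)[rule_format, of 0] As(4)[rule_format, of 1] As(4)[rule_format, of 2] by simp_all
    have U: "xs ! 0 \<in> universe (F (list_struct As))" "xs ! 1 \<in> universe (F (list_struct As))"
      "xs ! 2 \<in> universe (F (list_struct As))"
      using used[OF As(1) _ TD(1)[OF pqr(1)] st(1)] used[OF As(1) _ TD(1)[OF pqr(2)] st(2)]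
        used[OF As(1) _ TD(1)[OF pqr(3)] st(3)] pqr As(2) by (auto simp: T_def)
    let ?L = "F (list_struct As)"
    have c: "([xs ! 0, xs ! 1] \<in> rel ?L Leq \<longleftrightarrow> up p q) \<and> ([xs ! 1, xs ! 0] \<in> rel ?L Leq \<longleftrightarrow> dn p q) \<and>
      ([xs ! 1, xs ! 2] \<in> rel ?L Leq \<longleftrightarrow> up q r) \<and> ([xs ! 2, xs ! 1] \<in> rel ?L Leq \<longleftrightarrow> dn q r) \<and>
      ([xs ! 0, xs ! 2] \<in> rel ?L Leq \<longleftrightarrow> up p r) \<and> ([xs ! 2, xs ! 0] \<in> rel ?L Leq \<longleftrightarrow> dn p r)"
      using iff[OF As(1) _ _ st(1,2)] iff[OF As(1) _ _ st(2,3)] iff[OF As(1) _ _ st(1,3)] As(2) by simp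
    show ?thesis
      apply (rule exI[where x = "F (list_struct As)"])
      apply (rule exI[where x = "xs ! 0"])
      apply (rule exI[where x = "xs ! 1"])
      apply (rule exI[where x = "xs ! 2"])
      apply (rule conjI[OF L[OF As(1)]])
      apply (rule conjI[OF U(1)])
      apply (rule conjI[OF U(2)])
      apply (rule conjI[OF U(3)])
      apply (rule c)
      done
  qed
  have emb: "local_emb (list_struct [A]) (list_struct As) (universe A) (\<lambda>x. x)" "A \<in> models m"
    if "items (models m) As" "A \<in> set As" for A As
    using local_emb_item[OF items_models_wf[OF that(1)] that(2)] that by (auto simp: items_def)
  have le_item: "?le [A] x y \<longleftrightarrow> ?le As x y"
    if As: "items (models m) As" "A \<in> set As" and xy: "x \<in> universe A" "y \<in> universe A" for A As x y
    using Leq_emb[OF F single[OF emb(2)[OF As]] mod[OF As(1)] emb(1)[OF As] xy] .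
  \<comment> \<open>A copy of \<open>r\<close> in a separate item after or before \<open>A\<close>,
    with which two elements of \<open>A\<close> can both be compared.\<close>
  have beside: "\<exists>B z. same_type (fst r) (snd r) B z \<and> items (models m) [A, B] \<and> items (models m) [B, A]"
    if A: "items (models m) [A]" and r: "r \<in> T" for A r
  proof -
    have "A \<in> models m" using A by (simp add: items_def)
    obtain h where h: "rename h (fst r) \<in> models m" "local_emb (fst r) (rename h (fst r)) (universe (fst r)) h"
      "universe (rename h (fst r)) \<inter> universe A = {}"
      using fresh_copy[OF TD(1)[OF r] finite_models[OF \<open>A \<in> models m\<close>]] .
    have "same_type (fst r) (snd r) (rename h (fst r)) (h (snd r))"
      using same_typeI[OF h(2) TD(2)[OF r]] .
    moreover have "items (models m) [A, rename h (fst r)]" "items (models m) [rename h (fst r), A]"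
      using A h(1,3) TD(2)[OF r] by (auto simp: items_def)
    ultimately show ?thesis by blast
  qed
  have same_rules: "(up q r \<longrightarrow> up p r) \<and> (dn p r \<longrightarrow> dn q r) \<and> (dn r q \<longrightarrow> dn r p) \<and> (up r p \<longrightarrow> up r q)"
    if pqr: "p \<in> T" "q \<in> T" "r \<in> T" and s: "same p q" for p q r
  proof -
    obtain A x y where A: "items (models m) [A]" "same_type (fst p) (snd p) A x" "same_type (fst q) (snd q) A y" "?le [A] x y"
      using s unfolding same_def by blast
    obtain B z where B: "same_type (fst r) (snd r) B z" "items (models m) [A, B]" "items (models m) [B, A]"
      using beside[OF A(1) pqr(3)] by blast
    have xy: "x \<in> universe A" "y \<in> universe A"
      using local_embD(5)[OF A(2)] local_embD(5)[OF A(3)] by simp_all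
    have 1: "?le [A, B] x y" "?le [B, A] x y"
      using le_item[OF B(2) _ xy] le_item[OF B(3) _ xy] A(4) by simp_all
    have "?le [A, B] x z \<longleftrightarrow> up p r" "?le [A, B] z x \<longleftrightarrow> dn p r" "?le [A, B] y z \<longleftrightarrow> up q r" "?le [A, B] z y \<longleftrightarrow> dn q r"
      using iff[OF B(2), of 0 1 p x r z] iff[OF B(2), of 0 1 q y r z] A B(1) by simp_all
    moreover have "?le [B, A] z x \<longleftrightarrow> up r p" "?le [B, A] x z \<longleftrightarrow> dn r p" "?le [B, A] z y \<longleftrightarrow> up r q" "?le [B, A] y z \<longleftrightarrow> dn r q"
      using iff[OF B(3), of 0 1 r z p x] iff[OF B(3), of 0 1 r z q y] A B(1) by simp_all
    ultimately show ?thesis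
      using 1 Leq_trans[OF L[OF B(2)]] Leq_trans[OF L[OF B(3)]] by blast
  qed
  \<comment> \<open>The input witnessing \<open>before\<close> has the two elements in different
    items, in one of two orders, or in a common item.\<close>
  have le: "up p q \<or> dn q p \<or> same p q" if pq: "p \<in> T" "q \<in> T" for p q
  proof -
    have "before (NList m) F (list_struct [fst p]) (snd p) (list_struct [fst q]) (snd q)"
      using pq by (intro all mod TD(3)) (auto simp: T_def)
    then obtain C x y where C: "C \<in> models (NList m)" "same_type (list_struct [fst p]) (snd p) C x"
      "same_type (list_struct [fst q]) (snd q) C y" "[x, y] \<in> rel (F C) Leq"
      unfolding before_def by blast
    then obtain As where As: "C = list_struct As" "items (models m) As" by auto
    have wf: "wf_list As" using items_models_wf[OF As(2)] .
    have xy: "x \<in> universe (list_struct As)" "y \<in> universe (list_struct As)"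
      using local_embD(5)[OF C(2), of "snd p"] local_embD(5)[OF C(3), of "snd q"] As(1) by simp_all
    have "item [fst p] (snd p) = fst p" "item [fst q] (snd q) = fst q"
      using TD(2)[OF pq(1)] TD(2)[OF pq(2)] by (simp_all add: item_def pos_singleton)
    then have st: "same_type (fst p) (snd p) (As ! pos As x) x" "same_type (fst q) (snd q) (As ! pos As y) y"
      using same_type_listD[OF items_models_wf[OF TD(3)[OF pq(1)]] wf C(2)[unfolded As(1)]]
        same_type_listD[OF items_models_wf[OF TD(3)[OF pq(2)]] wf C(3)[unfolded As(1)]] by (simp_all add: item_def)
    have len: "pos As x < length As" "pos As y < length As"
      using pos_less(1)[OF wf] xy by blast+
    have l: "?le As x y" using C(4) As(1) by simp
    consider "pos As x < pos As y" | "pos As y < pos As x" | "pos As x = pos As y"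
      by linarith
    then show ?thesis
    proof cases
      case 1 then show ?thesis using iff(1)[OF As(2) 1 len(2) st] l by blast
    next
      case 2 then show ?thesis using iff(2)[OF As(2) 2 len(1) st(2,1)] l by blast
    next
      case 3
      let ?A = "As ! pos As x"
      have A: "?A \<in> set As" using len(1) by simp
      have "x \<in> universe ?A" "y \<in> universe ?A"
        using local_embD(5)[OF st(1)] local_embD(5)[OF st(2)] 3 by simp_all
      then have "?le [?A] x y" "items (models m) [?A]"
        using le_item[OF As(2) A] l emb(2)[OF As(2) A] by (auto simp: items_def)
      then have "same p q"
        unfolding same_def using st 3 by metis
      then show ?thesis by blast
    qed
  qed
  have triple_rules: "(up p q \<or> dn p q) \<and> (up p q \<longrightarrow> up q r \<longrightarrow> up p r) \<and> (up p r \<longrightarrow> dn q r \<longrightarrow> up p q) \<and>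
      (dn p q \<longrightarrow> up p r \<longrightarrow> up q r) \<and> (up q r \<longrightarrow> dn p r \<longrightarrow> dn p q) \<and> (dn p r \<longrightarrow> up p q \<longrightarrow> dn q r) \<and>
      (dn q r \<longrightarrow> dn p q \<longrightarrow> dn p r)"
    if pqr: "p \<in> T" "q \<in> T" "r \<in> T" for p q r
  proof -
    obtain L x y z where L: "(L :: 'a rel_struct) \<in> structs (Lists \<Gamma>)" "x \<in> universe L" "y \<in> universe L" "z \<in> universe L"
      and eq: "([x, y] \<in> rel L Leq \<longleftrightarrow> up p q) \<and> ([y, x] \<in> rel L Leq \<longleftrightarrow> dn p q) \<and>
      ([y, z] \<in> rel L Leq \<longleftrightarrow> up q r) \<and> ([z, y] \<in> rel L Leq \<longleftrightarrow> dn q r) \<and>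
      ([x, z] \<in> rel L Leq \<longleftrightarrow> up p r) \<and> ([z, x] \<in> rel L Leq \<longleftrightarrow> dn p r)"
      using triple[OF pqr] by - ((erule exE conjE)+, rule that, assumption+, intro conjI, assumption+)
    show ?thesis
      using Leq_total[OF L(1,2,3)] Leq_trans[OF L(1), of x y z] Leq_trans[OF L(1), of x z y]
        Leq_trans[OF L(1), of y x z] Leq_trans[OF L(1), of y z x] Leq_trans[OF L(1), of z x y]
        Leq_trans[OF L(1), of z y x] eq by argo
  qed
  have "(\<forall>p\<in>T. \<forall>q\<in>T. up p q \<and> \<not> dn p q) \<or> (\<forall>p\<in>T. \<forall>q\<in>T. dn p q \<and> \<not> up p q) \<or>
    (\<forall>p\<in>T. \<forall>q\<in>T. up p q \<and> dn p q)"
  proof (rule order_types[where same = same])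
    show "up p q \<or> dn p q" if "p \<in> T" "q \<in> T" for p q
      using triple_rules[OF that that(2)] by (rule conjunct1)
    show "up p r" if "p \<in> T" "q \<in> T" "r \<in> T" "up p q" "up q r" for p q r
      using triple_rules[OF that(1-3)] that(4,5) by argo
    show "up p q" if "p \<in> T" "q \<in> T" "r \<in> T" "up p r" "dn q r" for p q r
      using triple_rules[OF that(1-3)] that(4,5) by argo
    show "up q r" if "p \<in> T" "q \<in> T" "r \<in> T" "dn p q" "up p r" for p q r
      using triple_rules[OF that(1-3)] that(4,5) by argo
    show "dn p q" if "p \<in> T" "q \<in> T" "r \<in> T" "up q r" "dn p r" for p q r
      using triple_rules[OF that(1-3)] that(4,5) by argo
    show "dn q r" if "p \<in> T" "q \<in> T" "r \<in> T" "dn p r" "up p q" for p q r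
      using triple_rules[OF that(1-3)] that(4,5) by argo
    show "dn p r" if "p \<in> T" "q \<in> T" "r \<in> T" "dn q r" "dn p q" for p q r
      using triple_rules[OF that(1-3)] that(4,5) by argo
  qed (use same_rules le in blast)+
  then consider "\<forall>p\<in>T. \<forall>q\<in>T. up p q \<and> \<not> dn p q" | "\<forall>p\<in>T. \<forall>q\<in>T. dn p q \<and> \<not> up p q"
    | "\<forall>p\<in>T. \<forall>q\<in>T. up p q \<and> dn p q"
    by blast
  then show ?thesis
  proof cases
    case 1
    show ?thesis
    proof (rule solvable_ascending[OF F _ deep])
      fix As i j x y
      assume As: "items (models m) As" "i < j" "j < length As" "x \<in> universe (As ! i)" "y \<in> universe (As ! j)"
        "x \<in> universe (F (list_struct As))" "y \<in> universe (F (list_struct As))"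
      have T: "(As ! i, x) \<in> T" "(As ! j, y) \<in> T"
        using in_T[OF As(1) _ As(4,6)] in_T[OF As(1,3,5,7)] As(2,3) by simp_all
      show "?le As x y \<and> \<not> ?le As y x"
        using iff[OF As(1-3), of "(As ! i, x)" x "(As ! j, y)" y] 1 T same_type_refl[OF As(4)] same_type_refl[OF As(5)] by simp
    qed
  next
    case 2
    \<comment> \<open>Descending on a list means ascending on its reversal, and reversal undoes
      itself.\<close>
    define rv :: "'a rel_struct \<Rightarrow> 'a rel_struct" where "rv = (\<lambda>X. list_struct (rev (un_list (type_of m) X)))"
    have rv: "rv (list_struct As) = list_struct (rev As)" if "items (models m) As" for As
      using items_models[OF that] by (simp add: rv_def)
    have drv: "derivable (Lists (type_of m)) (Lists (type_of m)) rv"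
      by (intro derivable.prime prime.reverse) (simp add: rv_def)
    have rv_in: "interp (models (NList m)) (models (NList m)) rv"
    proof (rule interpI)
      fix X :: "'a rel_struct" assume "X \<in> models (NList m)"
      then obtain As where As: "X = list_struct As" "items (models m) As" by auto
      then have "list_struct (rev As) \<in> models (NList m)" by (intro mod) simp
      then show "rv X \<in> models (NList m) \<and> universe (rv X) \<subseteq> universe X"
        using As by (simp add: rv del: models.simps)
    next
      fix X Y :: "'a rel_struct" and Z h assume "X \<in> models (NList m)" "Y \<in> models (NList m)" "local_emb X Y Z h"
      then show "local_emb (rv X) (rv Y) (Z \<inter> universe (rv X)) h"
        using interpD(3)[OF derivable_interp[OF drv]] models_structs by (metis type_of.simps(5))
    qed
    have "solvable (NList m) (Lists \<Gamma>) (F \<circ> rv)"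
    proof (rule solvable_ascending[OF interp_comp[OF rv_in F] _ deep])
      fix As i j x y
      assume As: "items (models m) As" "i < j" "j < length As" "x \<in> universe (As ! i)" "y \<in> universe (As ! j)"
        "x \<in> universe ((F \<circ> rv) (list_struct As))" "y \<in> universe ((F \<circ> rv) (list_struct As))"
      let ?Bs = "rev As" and ?k = "length As - Suc j" and ?l = "length As - Suc i"
      have Bs: "items (models m) ?Bs" "?k < ?l" "?l < length ?Bs" "?Bs ! ?k = As ! j" "?Bs ! ?l = As ! i"
        using As(1-3) by (auto simp: rev_nth)
      have U: "x \<in> universe (F (list_struct ?Bs))" "y \<in> universe (F (list_struct ?Bs))"
        using As(6,7) rv[OF As(1)] by simp_all
      have T: "(?Bs ! ?k, y) \<in> T" "(?Bs ! ?l, x) \<in> T"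
        using in_T[OF Bs(1), of ?k y] in_T[OF Bs(1,3), of x] U As(4,5) Bs(2-5) by simp_all
      have "?le ?Bs x y \<and> \<not> ?le ?Bs y x"
        using iff[OF Bs(1-3), of "(?Bs ! ?k, y)" y "(?Bs ! ?l, x)" x] 2 T same_type_refl[OF As(4)] same_type_refl[OF As(5)] Bs(4,5) by simp
      then show "[x, y] \<in> rel ((F \<circ> rv) (list_struct As)) Leq \<and> [y, x] \<notin> rel ((F \<circ> rv) (list_struct As)) Leq"
        using rv[OF As(1)] by simp
    qed
    then obtain g where g: "derivable (Lists (type_of m)) (Lists \<Gamma>) g" "\<And>A. A \<in> models (NList m) \<Longrightarrow> g A = F (rv A)"
      by (auto simp: solvable_def)
    show ?thesis
    proof (rule solvableI)
      show "derivable (type_of (NList m)) (Lists \<Gamma>) (\<lambda>X. g (rv X))"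
        using derivable_comp[OF drv g(1)] by simp
      fix X :: "'a rel_struct" assume X: "X \<in> models (NList m)"
      then obtain As where As: "X = list_struct As" "items (models m) As" by auto
      have "rv (rv X) = X"
        using As rv[of As] rv[of "rev As"] by simp
      then show "g (rv X) = F X"
        using g(2)[OF interpD(1)[OF rv_in X]] by simp
    qed
  next
    case 3
    obtain As where As: "A0 = list_struct As" "items (models m) As"
      using strict(1) by auto
    have wf: "wf_list As" using items_models_wf[OF As(2)] .
    have U: "x0 \<in> universe (list_struct As)" "y0 \<in> universe (list_struct As)"
      using strict(2,3) interpD(2)[OF F strict(1)] As(1) by blast+
    note px = pos_less[OF wf U(1)] and py = pos_less[OF wf U(2)]
    have T: "(As ! pos As x0, x0) \<in> T" "(As ! pos As y0, y0) \<in> T"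
      using in_T[OF As(2) px(1)] in_T[OF As(2) py(1)] px(2) py(2) strict(2,3) As(1) by (simp_all add: item_def)
    have n: "\<not> ?le As y0 x0" using strict(4) As(1) by simp
    have st: "same_type (As ! pos As x0) x0 (As ! pos As x0) x0" "same_type (As ! pos As y0) y0 (As ! pos As y0) y0"
      using px(2) py(2) by (simp_all add: item_def same_type_refl)
    consider "pos As x0 < pos As y0" | "pos As y0 < pos As x0" | "pos As x0 = pos As y0"
      by linarith
    then have False
    proof cases
      case 1
      then show False
        using iff(2)[OF As(2) 1 py(1), of "(As ! pos As x0, x0)" x0 "(As ! pos As y0, y0)" y0] st 3 T n by simp
    next
      case 2
      then show False
        using iff(1)[OF As(2) 2 px(1), of "(As ! pos As y0, y0)" y0 "(As ! pos As x0, x0)" x0] st 3 T n by simp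
    next
      \<comment> \<open>Within a common item \<open>up\<close> and \<open>dn\<close> say nothing
        directly. A copy \<open>z\<close> of \<open>x0\<close> in a further item mediates:
        \<open>y0\<close> precedes or equals \<open>z\<close>, which precedes or equals
        \<open>x0\<close>.\<close>
      case 3
      let ?A = "As ! pos As x0" and ?p = "(As ! pos As x0, x0)" and ?q = "(As ! pos As y0, y0)"
      have A: "?A \<in> set As" "x0 \<in> universe ?A" "y0 \<in> universe ?A"
        using px py 3 by (simp_all add: item_def)
      then have "items (models m) [?A]"
        using emb(2)[OF As(2)] by (auto simp: items_def)
      then obtain B z where B: "same_type (fst ?p) (snd ?p) B z" "items (models m) [?A, B]"
        using beside T(1) by blast
      have "up ?q ?p" "dn ?p ?p"
        using \<open>\<forall>p\<in>T. \<forall>q\<in>T. up p q \<and> dn p q\<close> T by blast+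
      then have "?le [?A, B] y0 z" "?le [?A, B] z x0"
        using iff(1)[OF B(2), of 0 1 ?q y0 ?p z] iff(2)[OF B(2), of 0 1 ?p x0 ?p z] st B(1) 3 by simp_all
      then have "?le [?A, B] y0 x0"
        using Leq_trans[OF L[OF B(2)]] by blast
      then show False
        using le_item[OF B(2) _ A(3,2)] le_item[OF As(2) A(1,3,2)] n by simp
    qed
    then show ?thesis ..
  qed
qed

text \<open>Carries comparability of all used types over to the factor that remains.\<close>

lemma before_restriction:
  assumes r: "restriction n m r" and F: "interp (models n) (structs (Lists \<Gamma>)) F" and G: "interp (models m) (structs (Lists \<Gamma>)) G"
    and FG: "\<And>A. A \<in> models n \<Longrightarrow> F A = G (r A)"
    and A: "A \<in> models n" "x \<in> universe (F A)" and B: "B \<in> models n" "y \<in> universe (F B)"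
    and b: "before n F A x B y"
  shows "before m G (r A) x (r B) y"
proof -
  have r': "interp (models n) (models m) r" using r by (simp add: restriction_def)
  obtain C x' y' where C: "C \<in> models n" "same_type A x C x'" "same_type B y C y'" "[x', y'] \<in> rel (F C) Leq"
    using b unfolding before_def by blast
  have "{x} \<subseteq> universe (r A)" "{y} \<subseteq> universe (r B)"
    using A B FG interpD(2)[OF G interpD(1)[OF r']] by auto
  then have "same_type (r A) x (r C) x'" "same_type (r B) y (r C) y'"
    using interp_local_emb[OF r' A(1) C(1,2)] interp_local_emb[OF r' B(1) C(1,3)] by blast+
  then show ?thesis
    using C(4) FG[OF C(1)] interpD(1)[OF r' C(1)] by (intro beforeI) auto
qed

text \<open>In a product, a pair with one element on each side is described by the two unary types,
  so \<open>all\<close> makes such elements equivalent in the output. A strict pair therefore lies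
  on one side, and a used element of the other side would mediate between its two elements; hence
  only one side is used.\<close>

lemma solvable_base:
  fixes F :: "'a::infinite rel_struct \<Rightarrow> 'a rel_struct"
  assumes n: "normal n" "sum_free n" and F: "interp (models n) (structs (Lists \<Gamma>)) F"
    and all: "\<And>A B x y. A \<in> models n \<Longrightarrow> B \<in> models n \<Longrightarrow> x \<in> universe (F A) \<Longrightarrow> y \<in> universe (F B) \<Longrightarrow>
      before n F A x B y"
    and strict: "A0 \<in> models n" "x0 \<in> universe (F A0)" "y0 \<in> universe (F A0)" "[y0, x0] \<notin> rel (F A0) Leq"
    and deep: "\<And>m (g :: 'a rel_struct \<Rightarrow> 'a rel_struct). normal m \<Longrightarrow> depth m < depth n \<Longrightarrow>
      interp (models m) (structs (Lists \<Gamma>)) g \<Longrightarrow> solvable m (Lists \<Gamma>) g"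
  shows "solvable n (Lists \<Gamma>) F"
  using assms
proof (induction n arbitrary: F A0)
  case NZero
  then show ?case using interpD(2)[OF NZero.prems(3,5)] by auto
next
  case NOne
  then obtain a where "universe A0 = {a}" by auto
  then have "x0 = a" "y0 = a"
    using interpD(2)[OF NOne.prems(3,5)] NOne.prems(6,7) by auto
  then show ?case
    using Leq_total[OF interpD(1)[OF NOne.prems(3,5)] NOne.prems(6,7)] NOne.prems(8) by simp
next
  case (NTimes m n)
  let ?n = "NTimes m n"
  note F = NTimes.prems(3) and all = NTimes.prems(4) and strict = NTimes.prems(5-8)
  have sf: "sum_free m" "sum_free n" "normal m" "normal n"
    using NTimes.prems(1) by auto
  have r1: "restriction ?n m (fst_part :: 'a rel_struct \<Rightarrow> _)" and r2: "restriction ?n n (snd_part :: 'a rel_struct \<Rightarrow> _)"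
    using restriction_fst[OF sf(2)] restriction_snd[OF sf(1)] by blast+
  have r1': "interp (models ?n) (models m) (fst_part :: 'a rel_struct \<Rightarrow> _)"
    and r2': "interp (models ?n) (models n) (snd_part :: 'a rel_struct \<Rightarrow> _)"
    using r1 r2 by (simp_all add: restriction_def)
  have sides: "universe A = universe (fst_part A) \<union> universe (snd_part A)"
    "universe (fst_part A) \<inter> universe (snd_part A) = {}" if "A \<in> models ?n" for A :: "'a rel_struct"
    using that by auto
  have pair: "\<exists>h. local_emb D C {u', v'} h \<and> h u' = u \<and> h v' = v"
    if C: "C \<in> models ?n" and D: "D \<in> models ?n"
      and u: "u' \<in> universe (fst_part D)" "same_type (fst_part D) u' (fst_part C) u"
      and v: "v' \<in> universe (snd_part D)" "same_type (snd_part D) v' (snd_part C) v" for C D :: "'a rel_struct" and u u' v v'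
  proof -
    obtain C1 C2 D1 D2 where C': "C = prod_struct C1 C2" "C1 \<in> models m" "C2 \<in> models n" "disj C1 C2"
      and D': "D = prod_struct D1 D2" "D1 \<in> models m" "D2 \<in> models n" "disj D1 D2"
      using C D by auto
    let ?h = "\<lambda>z. if z = u' then u else v"
    have neq: "u' \<noteq> v'" and I: "{u', v'} \<inter> universe D1 = {u'}" "{u', v'} \<inter> universe D2 = {v'}"
      using u(1) v(1) C' D' by auto
    have "local_emb D1 C1 {u'} ?h"
      using u(2) C' D' by (subst local_emb_cong[where h' = "\<lambda>_. u"]) auto
    moreover have "local_emb D2 C2 {v'} ?h"
      using v(2) C' D' neq by (subst local_emb_cong[where h' = "\<lambda>_. v"]) auto
    ultimately have "local_emb D C {u', v'} ?h"
      unfolding C'(1) D'(1) local_emb_models_prod[OF D'(2-4) C'(2-4)] I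
      using u(1) v(1) C' D' by simp
    then show ?thesis using neq by (intro exI[of _ ?h]) auto
  qed
  have cross: "[u, v] \<in> rel (F C) Leq \<and> [v, u] \<in> rel (F C) Leq"
    if C: "C \<in> models ?n" "u \<in> universe (F C)" "v \<in> universe (F C)" "u \<in> universe (fst_part C)" "v \<in> universe (snd_part C)" for C u v
  proof -
    have st: "same_type C u D u' \<Longrightarrow> u' \<in> universe (fst_part D) \<and> same_type (fst_part D) u' (fst_part C) u"
      "same_type C v D v' \<Longrightarrow> v' \<in> universe (snd_part D) \<and> same_type (snd_part D) v' (snd_part C) v"
      if "D \<in> models ?n" for D u' v'
      using interp_mem[OF r1' C(1) that] interp_mem[OF r2' C(1) that] C(4,5)
        interp_local_emb[OF r1' C(1) that, of "{u}" "\<lambda>_. u'"] interp_local_emb[OF r2' C(1) that, of "{v}" "\<lambda>_. v'"]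
        same_type_sym by auto
    have tr: "([u', v'] \<in> rel (F D) Leq \<longrightarrow> [u, v] \<in> rel (F C) Leq) \<and> ([v', u'] \<in> rel (F D) Leq \<longrightarrow> [v, u] \<in> rel (F C) Leq)"
      if D: "D \<in> models ?n" "same_type C u D u'" "same_type C v D v'" for D u' v'
    proof -
      obtain h where "local_emb D C {u', v'} h" "h u' = u" "h v' = v"
        using pair[OF C(1) D(1)] st(1)[OF D(1,2)] st(2)[OF D(1,3)] by blast
      then show ?thesis
        using Leq_emb[OF F D(1) C(1), of "{u', v'}" h] by auto
    qed
    show ?thesis
      using all[OF C(1,1,2,3)] all[OF C(1,1,3,2)] tr unfolding before_def by blast
  qed
  have not_cross: "x0 \<in> universe (fst_part A0) \<longleftrightarrow> y0 \<in> universe (fst_part A0)"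
    using cross[OF strict(1-3)] cross[OF strict(1,3,2)] strict(4) sides[OF strict(1)]
      interpD(2)[OF F strict(1)] strict(2,3) by blast
  \<comment> \<open>A joint embedding brings \<open>w\<close> into one input with the strict pair,
    where it is equivalent to both elements of the pair.\<close>
  have contra: False
    if B: "B \<in> models ?n" "w \<in> universe (F B)"
      and side: "x0 \<in> universe (fst_part A0) \<and> w \<in> universe (snd_part B) \<or> x0 \<notin> universe (fst_part A0) \<and> w \<in> universe (fst_part B)" for B w
  proof -
    obtain C h g where C: "C \<in> models ?n" "local_emb A0 C (universe A0) h" "local_emb B C (universe B) g"
      using joint_embedding[OF NTimes.prems(1,2) strict(1) B(1)] .
    have mem: "x0 \<in> universe A0" "y0 \<in> universe A0" "w \<in> universe B"
      using interpD(2)[OF F strict(1)] interpD(2)[OF F B(1)] strict B by blast+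
    have used: "h x0 \<in> universe (F C)" "h y0 \<in> universe (F C)" "g w \<in> universe (F C)"
      using interp_iff[OF F strict(1) C(1,2)] interp_iff[OF F B(1) C(1,3)] mem strict B by blast+
    have "h x0 \<in> universe (fst_part C) \<longleftrightarrow> x0 \<in> universe (fst_part A0)" "h y0 \<in> universe (fst_part C) \<longleftrightarrow> x0 \<in> universe (fst_part A0)"
      "g w \<in> universe (fst_part C) \<longleftrightarrow> w \<in> universe (fst_part B)"
      using interp_iff[OF r1' strict(1) C(1,2)] interp_iff[OF r1' B(1) C(1,3)] mem not_cross by blast+
    moreover have "h x0 \<in> universe C" "h y0 \<in> universe C" "g w \<in> universe C"
      using local_embD(5)[OF C(2)] local_embD(5)[OF C(3)] mem by blast+
    ultimately have "[h y0, g w] \<in> rel (F C) Leq" "[g w, h x0] \<in> rel (F C) Leq"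
      using cross[OF C(1) used(2,3)] cross[OF C(1) used(3,2)] cross[OF C(1) used(3,1)] cross[OF C(1) used(1,3)]
        side sides[OF C(1)] sides[OF B(1)] by blast+
    then have "[h y0, h x0] \<in> rel (F C) Leq"
      using Leq_trans[OF interpD(1)[OF F C(1)]] by blast
    then show False
      using Leq_emb[OF F strict(1) C(1,2) mem(2,1)] strict(4) by blast
  qed
  show ?case
  proof (cases "x0 \<in> universe (fst_part A0)")
    case True
    have "\<forall>A\<in>models ?n. universe (F A) \<subseteq> universe (fst_part A)"
      using contra True sides interpD(2)[OF F] by blast
    from NTimes.prems(1) F this show ?thesis
    proof (rule solvable_fst)
      fix G assume G: "interp (models m) (structs (Lists \<Gamma>)) G" "\<And>A. A \<in> models ?n \<Longrightarrow> F A = G (fst_part A)"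
      show "solvable m (Lists \<Gamma>) G"
      proof (rule NTimes.IH(1)[OF sf(3,1) G(1)])
        fix A B x y assume A: "A \<in> models m" "x \<in> universe (G A)" and B: "B \<in> models m" "y \<in> universe (G B)"
        obtain A' where A': "A' \<in> models ?n" "fst_part A' = A"
          using r1 A(1) ontoD[OF _ _ finite.emptyI] unfolding restriction_def by metis
        obtain B' where B': "B' \<in> models ?n" "fst_part B' = B"
          using r1 B(1) ontoD[OF _ _ finite.emptyI] unfolding restriction_def by metis
        have "x \<in> universe (F A')" "y \<in> universe (F B')"
          using A B A' B' G(2) by simp_all
        then show "before m G A x B y"
          using before_restriction[OF r1 F G A'(1) _ B'(1)] all[OF A'(1) B'(1)] A'(2) B'(2) by metis
      next
        show "fst_part A0 \<in> models m" using interpD(1)[OF r1' strict(1)] .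
      qed (use strict G(2)[OF strict(1)] NTimes.prems(9) in auto)
    qed
  next
    case False
    have "\<forall>A\<in>models ?n. universe (F A) \<subseteq> universe (snd_part A)"
      using contra False sides interpD(2)[OF F] by blast
    from NTimes.prems(1) F this show ?thesis
    proof (rule solvable_snd)
      fix G assume G: "interp (models n) (structs (Lists \<Gamma>)) G" "\<And>A. A \<in> models ?n \<Longrightarrow> F A = G (snd_part A)"
      show "solvable n (Lists \<Gamma>) G"
      proof (rule NTimes.IH(2)[OF sf(4,2) G(1)])
        fix A B x y assume A: "A \<in> models n" "x \<in> universe (G A)" and B: "B \<in> models n" "y \<in> universe (G B)"
        obtain A' where A': "A' \<in> models ?n" "snd_part A' = A"
          using r2 A(1) ontoD[OF _ _ finite.emptyI] unfolding restriction_def by metis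
        obtain B' where B': "B' \<in> models ?n" "snd_part B' = B"
          using r2 B(1) ontoD[OF _ _ finite.emptyI] unfolding restriction_def by metis
        have "x \<in> universe (F A')" "y \<in> universe (F B')"
          using A B A' B' G(2) by simp_all
        then show "before n G A x B y"
          using before_restriction[OF r2 F G A'(1) _ B'(1)] all[OF A'(1) B'(1)] A'(2) B'(2) by metis
      next
        show "snd_part A0 \<in> models n" using interpD(1)[OF r2' strict(1)] .
      qed (use strict G(2)[OF strict(1)] NTimes.prems(9) in auto)
    qed
  qed
next
  case (NList n)
  show ?case
    by (rule solvable_list_base[OF NList.prems(3,4,5-8)]) (use NList.prems(1,9) in auto)
qed simp

section \<open>Interpretations are derivable\<close>

text \<open>Induction on the output type and, for list outputs, on the number of used types, which
  cutting lowers. The bound \<open>d\<close> stays fixed throughout, so the hypothesis about smaller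
  depth is available for every output type.\<close>

lemma solvable_sum_free:
  fixes f :: "'a::infinite rel_struct \<Rightarrow> 'a rel_struct"
  assumes IH: "\<And>m \<Delta> (g :: 'a rel_struct \<Rightarrow> 'a rel_struct). normal m \<Longrightarrow> depth m < d \<Longrightarrow>
      interp (models m) (structs \<Delta>) g \<Longrightarrow> solvable m \<Delta> g"
  shows "normal n \<Longrightarrow> sum_free n \<Longrightarrow> depth n \<le> d \<Longrightarrow> interp (models n) (structs \<Gamma>) f \<Longrightarrow> solvable n \<Gamma> f"
proof (induction \<Gamma> arbitrary: n f)
  case Unit
  then show ?case by (intro solvable_Unit)
next
  case (Prod \<Gamma> \<Delta>)
  show ?case
  proof (rule solvable_Prod[OF Prod.prems(1,2,4)])
    fix m and g :: "'a rel_struct \<Rightarrow> 'a rel_struct"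
    assume m: "normal m" "sum_free m" "depth m \<le> depth n"
    then have "depth m \<le> d" using Prod.prems(3) by simp
    then show "interp (models m) (structs \<Gamma>) g \<Longrightarrow> solvable m \<Gamma> g"
      "interp (models m) (structs \<Delta>) g \<Longrightarrow> solvable m \<Delta> g"
      using Prod.IH(1)[OF m(1,2)] Prod.IH(2)[OF m(1,2)] by simp_all
  qed
next
  case (Sum \<Gamma> \<Delta>)
  show ?case
    by (rule solvable_Sum[OF Sum.prems(2,4)]) (erule Sum.IH(1)[OF Sum.prems(1-3)] Sum.IH(2)[OF Sum.prems(1-3)])+
next
  case (Lists \<Gamma>)
  from Lists.prems show ?case
  proof (induction "card (leaf_types n f)" arbitrary: n f rule: less_induct)
    case less
    note n = less.prems(1,2) and f = less.prems(4)
    show ?case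
    proof (cases "\<forall>A\<in>models n. \<forall>B\<in>models n. \<forall>x\<in>universe (f A). \<forall>y\<in>universe (f B). before n f A x B y")
      case False
      then obtain A B x y where *: "A \<in> models n" "x \<in> universe (f A)" "B \<in> models n" "y \<in> universe (f B)"
        "\<not> before n f A x B y" by blast
      show ?thesis
      proof (rule solvable_peel[OF n f *(3,4,1,2,5)])
        fix m and g :: "'a rel_struct \<Rightarrow> 'a rel_struct"
        assume "normal m" "sum_free m" "depth m \<le> depth n" "interp (models m) (structs (Lists \<Gamma>)) g"
          "card (leaf_types m g) < card (leaf_types n f)"
        then show "solvable m (Lists \<Gamma>) g" using less.hyps less.prems(3) by simp
      qed
    next
      case all: True
      show ?thesis
      proof (cases "\<forall>A\<in>models n. \<forall>x\<in>universe (f A). \<forall>y\<in>universe (f A). [x, y] \<in> rel (f A) Leq")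
        case True
        show ?thesis
        proof (rule solvable_single_item[OF n f])
          show "[x, y] \<in> rel (f A) Leq" if "A \<in> models n" "x \<in> universe (f A)" "y \<in> universe (f A)" for A x y
            using True that by blast
          show "interp (models n) (structs \<Gamma>) g \<Longrightarrow> solvable n \<Gamma> g" for g :: "'a rel_struct \<Rightarrow> 'a rel_struct"
            using Lists.IH[OF n less.prems(3)] .
        qed
      next
        case False
        then obtain A y x where *: "A \<in> models n" "x \<in> universe (f A)" "y \<in> universe (f A)" "[y, x] \<notin> rel (f A) Leq"
          by blast
        show ?thesis
        proof (rule solvable_base[OF n f _ *])
          show "before n f A x B y" if "A \<in> models n" "B \<in> models n" "x \<in> universe (f A)" "y \<in> universe (f B)" for A B x y
            using all that by blast
          show "solvable m (Lists \<Gamma>) g" if "normal m" "depth m < depth n" "interp (models m) (structs (Lists \<Gamma>)) g"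
            for m and g :: "'a rel_struct \<Rightarrow> 'a rel_struct"
            using IH[OF that(1) _ that(3)] that(2) less.prems(3) by simp
        qed
      qed
    qed
  qed
qed

text \<open>A sum on top is treated by cases. This need not lower the depth, so an induction on the
  normal form runs inside the one on depth.\<close>

lemma interp_solvable:
  fixes f :: "'a::infinite rel_struct \<Rightarrow> 'a rel_struct"
  shows "normal n \<Longrightarrow> interp (models n) (structs \<Gamma>) f \<Longrightarrow> solvable n \<Gamma> f"
proof (induction "depth n" arbitrary: n \<Gamma> f rule: less_induct)
  case less
  have "normal m \<Longrightarrow> depth m \<le> depth n \<Longrightarrow> interp (models m) (structs \<Gamma>) g \<Longrightarrow> solvable m \<Gamma> g"
    for m and g :: "'a rel_struct \<Rightarrow> 'a rel_struct"
  proof (induction m arbitrary: g)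
    case (NPlus m1 m2)
    have i: "interp (models m1) (structs \<Gamma>) (\<lambda>A. g (inl_struct A))"
      "interp (models m2) (structs \<Gamma>) (\<lambda>A. g (inr_struct A))"
      using NPlus.prems(3) by (simp_all add: interp_sum)
    have "solvable m1 \<Gamma> (\<lambda>A. g (inl_struct A))" "solvable m2 \<Gamma> (\<lambda>A. g (inr_struct A))"
      using NPlus.IH(1)[OF _ _ i(1)] NPlus.IH(2)[OF _ _ i(2)] NPlus.prems(1,2) by simp_all
    then obtain g1 g2 where g: "derivable (type_of m1) \<Gamma> g1" "\<And>A. A \<in> models m1 \<Longrightarrow> g1 A = g (inl_struct A)"
      "derivable (type_of m2) \<Gamma> g2" "\<And>A. A \<in> models m2 \<Longrightarrow> g2 A = g (inr_struct A)"
      unfolding solvable_def by blast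
    show ?case
    proof (rule solvableI)
      show "derivable (type_of (NPlus m1 m2)) \<Gamma> (sum_case g1 g2)"
        using derivable_sum_case[OF g(1,3)] by simp
      show "sum_case g1 g2 A = g A" if "A \<in> models (NPlus m1 m2)" for A
        using that g(2,4) by auto
    qed
  qed (rule solvable_sum_free[OF less.hyps]; simp)+
  then show ?case using less.prems by blast
qed

section \<open>Every list type is a retract of one in normal form\<close>

text \<open>A one-sided inverse is enough to transfer derivability: \<open>f\<close> is a derivation
  of \<open>f \<circ> v\<close> composed with \<open>u\<close>.\<close>

definition retract :: "list_type \<Rightarrow> list_type \<Rightarrow> ('a rel_struct \<Rightarrow> 'a rel_struct) \<Rightarrow> ('a rel_struct \<Rightarrow> 'a rel_struct) \<Rightarrow> bool" where
  "retract \<Sigma> \<Delta> u v \<longleftrightarrow> derivable \<Sigma> \<Delta> u \<and> derivable \<Delta> \<Sigma> v \<and> (\<forall>A\<in>structs \<Sigma>. v (u A) = A)"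

lemma retract_refl: "retract \<Sigma> \<Sigma> (\<lambda>A. A) (\<lambda>A. A)"
  by (simp add: retract_def derivable_id)

lemma retract_trans:
  "retract \<Sigma> \<Delta> u v \<Longrightarrow> retract \<Delta> \<Gamma> u' v' \<Longrightarrow> retract \<Sigma> \<Gamma> (\<lambda>A. u' (u A)) (\<lambda>A. v (v' A))"
  by (auto simp: retract_def derivable_in intro: derivable_comp)

lemma retract_prod:
  assumes "retract \<Sigma>\<^sub>1 \<Delta>\<^sub>1 u v" "retract \<Sigma>\<^sub>2 \<Delta>\<^sub>2 u' v'"
  shows "retract (\<Sigma>\<^sub>1 \<otimes> \<Sigma>\<^sub>2) (\<Delta>\<^sub>1 \<otimes> \<Delta>\<^sub>2) (prod_map u u') (prod_map v v')"
proof -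
  have "disj (u A) (u' B)" if "A \<in> structs \<Sigma>\<^sub>1" "B \<in> structs \<Sigma>\<^sub>2" "disj A B" for A B
    using that derivable_sub[of \<Sigma>\<^sub>1 \<Delta>\<^sub>1 u A] derivable_sub[of \<Sigma>\<^sub>2 \<Delta>\<^sub>2 u' B] assms by (auto simp: retract_def)
  then show ?thesis
    using assms by (auto simp: retract_def intro: derivable_prod_map)
qed

lemma retract_sum:
  assumes "retract \<Sigma>\<^sub>1 \<Delta>\<^sub>1 u v" "retract \<Sigma>\<^sub>2 \<Delta>\<^sub>2 u' v'"
  shows "retract (\<Sigma>\<^sub>1 \<oplus> \<Sigma>\<^sub>2) (\<Delta>\<^sub>1 \<oplus> \<Delta>\<^sub>2)
    (sum_case (\<lambda>A. inl_struct (u A)) (\<lambda>A. inr_struct (u' A))) (sum_case (\<lambda>A. inl_struct (v A)) (\<lambda>A. inr_struct (v' A)))"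
  using assms
  by (auto simp: retract_def intro!: derivable_sum_case derivable_comp[OF _ derivable_inl] derivable_comp[OF _ derivable_inr])

lemma retract_list:
  assumes "retract \<Sigma> \<Delta> u v"
  shows "retract (Lists \<Sigma>) (Lists \<Delta>) (list_map \<Sigma> u) (list_map \<Delta> v)"
proof -
  have uv: "derivable \<Sigma> \<Delta> u" "derivable \<Delta> \<Sigma> v" "\<And>A. A \<in> structs \<Sigma> \<Longrightarrow> v (u A) = A"
    using assms by (auto simp: retract_def)
  have "list_map \<Delta> v (list_map \<Sigma> u (list_struct As)) = list_struct As" if As: "items (structs \<Sigma>) As" for As
  proof -
    have "weak_items (structs \<Sigma>) As" using items_weak[OF As] .
    moreover have "map v (map u As) = As"
      using As uv(3) by (auto simp: items_def intro!: map_idI)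
    moreover have "weak_items (structs \<Delta>) (map u As)"
      by (rule weak_items_map[OF items_weak[OF As]]) (use derivable_in[OF uv(1)] derivable_sub[OF uv(1)] in blast)
    ultimately show ?thesis
      using derivable_interp[OF uv(1)] derivable_interp[OF uv(2)] by simp
  qed
  then show ?thesis
    using uv by (auto simp: retract_def intro: derivable_list_map)
qed

lemma retract_distribute:
  obtains u v :: "'a rel_struct \<Rightarrow> 'a rel_struct" where "retract (\<Gamma> \<otimes> (\<Sigma> \<oplus> \<Delta>)) ((\<Gamma> \<otimes> \<Sigma>) \<oplus> (\<Gamma> \<otimes> \<Delta>)) u v"
proof -
  let ?u = "\<lambda>X :: 'a rel_struct. sum_case (\<lambda>B. inl_struct (prod_struct (fst_part X) B))
    (\<lambda>B. inr_struct (prod_struct (fst_part X) B)) (snd_part X)"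
  let ?v = "sum_case (prod_map (\<lambda>A. A) inl_struct) (prod_map (\<lambda>A. A) inr_struct) :: 'a rel_struct \<Rightarrow> _"
  have "derivable (\<Gamma> \<otimes> (\<Sigma> \<oplus> \<Delta>)) ((\<Gamma> \<otimes> \<Sigma>) \<oplus> (\<Gamma> \<otimes> \<Delta>)) ?u"
    by (intro derivable.prime prime.distribute) simp_all
  moreover have "derivable ((\<Gamma> \<otimes> \<Sigma>) \<oplus> (\<Gamma> \<otimes> \<Delta>)) (\<Gamma> \<otimes> (\<Sigma> \<oplus> \<Delta>)) ?v"
    by (intro derivable.prime prime.undistribute) simp_all
  ultimately have "retract (\<Gamma> \<otimes> (\<Sigma> \<oplus> \<Delta>)) ((\<Gamma> \<otimes> \<Sigma>) \<oplus> (\<Gamma> \<otimes> \<Delta>)) ?u ?v"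
    by (auto simp: retract_def)
  then show ?thesis by (rule that)
qed

lemma retract_comm:
  obtains u :: "'a rel_struct \<Rightarrow> 'a rel_struct" where "retract (\<Gamma> \<otimes> \<Sigma>) (\<Sigma> \<otimes> \<Gamma>) u u"
proof -
  have "retract (\<Gamma> \<otimes> \<Sigma>) (\<Sigma> \<otimes> \<Gamma>) (\<lambda>X :: 'a rel_struct. prod_struct (snd_part X) (fst_part X))
      (\<lambda>X. prod_struct (snd_part X) (fst_part X))"
    using derivable_comm by (auto simp: retract_def Int_commute)
  then show ?thesis by (rule that)
qed

text \<open>Zeros arise when splitting, not when normalizing; on zero-free forms
  \<open>models\<close> and \<open>structs\<close> agree.\<close>

primrec zero_free :: "nf \<Rightarrow> bool" where
  "zero_free NZero = False"
| "zero_free NOne = True"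
| "zero_free (NTimes m n) = (zero_free m \<and> zero_free n)"
| "zero_free (NPlus m n) = (zero_free m \<and> zero_free n)"
| "zero_free (NList n) = zero_free n"

lemma models_zero_free: "zero_free n \<Longrightarrow> models n = structs (type_of n)"
  by (induction n) simp_all

text \<open>The argument \<open>t\<close> pins down the element type, which otherwise occurs only in
  bound variables.\<close>

definition normalizable :: "'a itself \<Rightarrow> list_type \<Rightarrow> bool" where
  "normalizable t \<Sigma> \<longleftrightarrow> (\<exists>k (u :: 'a rel_struct \<Rightarrow> 'a rel_struct) v. normal k \<and> zero_free k \<and> retract \<Sigma> (type_of k) u v)"

lemma normalizable_nf: "normal k \<Longrightarrow> zero_free k \<Longrightarrow> normalizable t (type_of k)"
  using retract_refl unfolding normalizable_def by blast

lemma normalizable_retract: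
  "retract \<Sigma> \<Delta> (u :: 'a rel_struct \<Rightarrow> 'a rel_struct) v \<Longrightarrow> normalizable (t :: 'a itself) \<Delta> \<Longrightarrow> normalizable t \<Sigma>"
  using retract_trans unfolding normalizable_def by blast

lemma normalizable_sum:
  assumes "normalizable (t :: 'a itself) \<Sigma>" "normalizable t \<Delta>"
  shows "normalizable t (\<Sigma> \<oplus> \<Delta>)"
proof -
  obtain k u v l u' v' where k: "normal k" "zero_free k" "retract \<Sigma> (type_of k) (u :: 'a rel_struct \<Rightarrow> _) v"
    and l: "normal l" "zero_free l" "retract \<Delta> (type_of l) (u' :: 'a rel_struct \<Rightarrow> _) v'"
    using assms unfolding normalizable_def by blast
  show ?thesis
    using normalizable_retract[OF retract_sum[OF k(3) l(3)], of t] normalizable_nf[of "NPlus k l" t] k l by simp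
qed

lemma normalizable_NTimes:
  "normal (NTimes m n) \<Longrightarrow> zero_free (NTimes m n) \<Longrightarrow> normalizable t (type_of m \<otimes> type_of n)"
  using normalizable_nf[of "NTimes m n" t] by simp

text \<open>The left factor is sum-free, so the sums on top of the right factor can be distributed
  outwards until none is left.\<close>

lemma normalizable_times_right:
  "sum_free m \<Longrightarrow> normal m \<Longrightarrow> zero_free m \<Longrightarrow> normal n \<Longrightarrow> zero_free n \<Longrightarrow> normalizable (t :: 'a itself) (type_of m \<otimes> type_of n)"
proof (induction n)
  case (NPlus n1 n2)
  obtain u v :: "'a rel_struct \<Rightarrow> 'a rel_struct"
    where "retract (type_of m \<otimes> (type_of n1 \<oplus> type_of n2)) ((type_of m \<otimes> type_of n1) \<oplus> (type_of m \<otimes> type_of n2)) u v"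
    by (rule retract_distribute)
  from normalizable_retract[OF this normalizable_sum] show ?case
    using NPlus by simp
qed (rule normalizable_NTimes; simp)+

text \<open>A sum in the left factor is brought to the right by commutativity and distributed
  there.\<close>

lemma normalizable_times:
  "normal m \<Longrightarrow> zero_free m \<Longrightarrow> normal n \<Longrightarrow> zero_free n \<Longrightarrow> normalizable (t :: 'a itself) (type_of m \<otimes> type_of n)"
proof (induction m)
  case (NPlus m1 m2)
  obtain u v :: "'a rel_struct \<Rightarrow> 'a rel_struct"
    where 1: "retract (type_of n \<otimes> (type_of m1 \<oplus> type_of m2)) ((type_of n \<otimes> type_of m1) \<oplus> (type_of n \<otimes> type_of m2)) u v"
    by (rule retract_distribute)
  have swap: "normalizable t (\<Sigma> \<otimes> \<Delta>)" if "normalizable t (\<Delta> \<otimes> \<Sigma>)" for \<Sigma> \<Delta>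
    using that retract_comm normalizable_retract by metis
  have "normalizable t (type_of n \<otimes> type_of m1)" "normalizable t (type_of n \<otimes> type_of m2)"
    using NPlus by (auto intro: swap)
  then show ?case
    using swap[OF normalizable_retract[OF 1 normalizable_sum]] by simp
qed (rule normalizable_times_right; simp)+

lemma normalizable: "normalizable (t :: 'a itself) \<Sigma>"
proof (induction \<Sigma>)
  case Unit
  show ?case using normalizable_nf[of NOne] by simp
next
  case (Prod \<Sigma> \<Delta>)
  then obtain k u v l u' v' where k: "normal k" "zero_free k" "retract \<Sigma> (type_of k) (u :: 'a rel_struct \<Rightarrow> _) v"
    and l: "normal l" "zero_free l" "retract \<Delta> (type_of l) (u' :: 'a rel_struct \<Rightarrow> _) v'"
    unfolding normalizable_def by blast
  show ?case
    by (rule normalizable_retract[OF retract_prod[OF k(3) l(3)] normalizable_times[OF k(1,2) l(1,2)]])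
next
  case (Sum \<Sigma> \<Delta>)
  then show ?case by (rule normalizable_sum)
next
  case (Lists \<Sigma>)
  then obtain k u v where k: "normal k" "zero_free k" "retract \<Sigma> (type_of k) (u :: 'a rel_struct \<Rightarrow> _) v"
    unfolding normalizable_def by blast
  show ?case
    using normalizable_retract[OF retract_list[OF k(3)], of t] normalizable_nf[of "NList k" t] k by simp
qed

theorem theorem2:
  fixes f :: "'a::infinite rel_struct \<Rightarrow> 'a rel_struct" and \<Sigma> \<Gamma> :: list_type
  assumes "\<And>A. A \<in> structs \<Sigma> \<Longrightarrow> f A \<in> structs \<Gamma>"
  shows "qf_interpretation \<Sigma> \<Gamma> f \<longleftrightarrow> derivable \<Sigma> \<Gamma> f"
proof
  assume "qf_interpretation \<Sigma> \<Gamma> f"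
  with assms have f: "interp (structs \<Sigma>) (structs \<Gamma>) f"
    by (rule qf_interpretation_imp_interp)
  obtain n and u v :: "'a rel_struct \<Rightarrow> 'a rel_struct" where n: "normal n" "zero_free n"
    and uv: "derivable \<Sigma> (type_of n) u" "derivable (type_of n) \<Sigma> v" "\<And>A. A \<in> structs \<Sigma> \<Longrightarrow> v (u A) = A"
    using normalizable[of "TYPE('a)" \<Sigma>] unfolding normalizable_def retract_def by blast
  \<comment> \<open>On the normal form it is \<open>f \<circ> v\<close> that gets derived; composing
    with \<open>u\<close> leads back to \<open>\<Sigma>\<close>, where \<open>v \<circ> u\<close> is
    the identity.\<close>
  have "interp (models n) (structs \<Gamma>) (f \<circ> v)"
    using interp_comp[OF derivable_interp[OF uv(2)] f] models_zero_free[OF n(2)] by metis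
  from interp_solvable[OF n(1) this] obtain g where g: "derivable (type_of n) \<Gamma> g"
    "\<And>A. A \<in> models n \<Longrightarrow> g A = f (v A)"
    by (auto simp: solvable_def)
  show "derivable \<Sigma> \<Gamma> f"
  proof (rule derivable_cong[OF derivable_comp[OF uv(1) g(1)]])
    fix A :: "'a rel_struct" assume A: "A \<in> structs \<Sigma>"
    then show "g (u A) = f A"
      using g(2)[of "u A"] derivable_in[OF uv(1) A] models_zero_free[OF n(2)] uv(3)[OF A] by metis
  qed
next
  assume "derivable \<Sigma> \<Gamma> f"
  then show "qf_interpretation \<Sigma> \<Gamma> f"
    by (intro interp_imp_qf_interpretation derivable_interp)
qed

end
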